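(* (a) Let $(K\to M,C,D)$ be a primitive Higgs bundle with a good connection; it induces an F-manifold structure $(M,\circ,e)$ on $M$. Let $\mathcal{I}_M\subset\mathcal{O}_{T^*M}$ be the ideal sheaf which defines the analytic spectrum of the multiplication $\circ$. Then $$\{\sqrt{\mathcal{I}_M},\sqrt{\mathcal{I}_M}\}\subset\sqrt{\mathcal{I}_M}.$$ (b) Let $(H\to\mathbb{C}\times M,\nabla)$ be a $(T)$-structure over an F-manifold $(M,\circ,e)$. Then also $\{\sqrt{\mathcal{I}_M},\sqrt{\mathcal{I}_M}\}\subset\sqrt{\mathcal{I}_M}$.
   Context: $M$ is a complex manifold of dimension $n$, $\mathcal{T}_M$ its sheaf of holomorphic vector fields. **F-manifold.** $(M,\circ,e)$ with a holomorphic commutative associative multiplication $\circ$ on $TM$, a global holomorphic unit field $e$ ($e\circ=\mathrm{id}$), and $\mathrm{Lie}_{X\circ Y}(\circ)=X\circ\mathrm{Lie}_Y(\circ)+Y\circ\mathrm{Lie}_X(\circ)$ for $X,Y\in\mathcal{T}_M$. **Higgs bundle.** $(K\to M,C)$: a holomorphic vector bundle $K\to M$ with an $\mathcal{O}_M$-linear map $C:\mathcal{O}(K)\to\Omega^1_M\otimes\mathcal{O}(K)$ such that $C_XC_Y=C_YC_X$ for $X,Y\in\mathcal{T}_M$. It is primitive if there is a section $\zeta\in\mathcal{O}(K)$ such that $\mathcal{T}_M\to\mathcal{O}(K)$, $X\mapsto C_X\zeta$, is an isomorphism. A primitive Higgs bundle induces a unique multiplication $\circ$ on $TM$ with $C_{X\circ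 Y}=C_XC_Y$, with unit field $e$ determined by $C_e\zeta=\zeta$. A good connection $D$ on $(K\to M,C)$ is a holomorphic connection on $K$ with $D_X(C_Y)-D_Y(C_X)=C_{[X,Y]}$ for $X,Y\in\mathcal{T}_M$. (It is known that for a primitive Higgs bundle with good connection the induced $(M,\circ,e)$ is an F-manifold.) **$(T)$-structure.** A holomorphic vector bundle $H\to\mathbb{C}\times M$ with a map $\nabla:\mathcal{O}(H)\to\frac1z\mathcal{O}_{\mathbb{C}\times M}\cdot\Omega^1_M\otimes\mathcal{O}(H)$ satisfying the Leibniz rule for $X\in\mathcal{T}_M$ and $\nabla_X\nabla_Y-\nabla_Y\nabla_X=\nabla_{[X,Y]}$ for $X,Y\in\mathcal{T}_M$ ($z$ the coordinate on $\mathbb{C}$). It induces the Higgs bundle $K:=H|_{\{0\}\times M}$, $C:=[z\nabla]$. It is a $(T)$-structure over the F-manifold $(M,\circ,e)$ if this Higgs bundle is primitive and induces $\circ$ and $e$. **Analytic spectrum and Poisson bracket.** Choose local coordinates $t_1,\dots,t_n$ on $M$ with $\partial_i=\partial/\partial t_i$ and $e=\partial_1$, let $y_1,\dots,y_n$ be the corresponding fiber coordinates on $T^*M$, and write $\partial_i\circ\partial_j=\sum_ka_{ij}^k\partial_k$. Then $\mathcal{I}_M=\big(y_1-1,\ y_iy_j-\sum_ka_{ij}^ky_k\ (1\le i,j\le n)\big)\subset\mathcal{O}_{T^*M}$, and $\sqrt{\mathcal{I}_M}$ is its radical. The Poisson bracket on $\mathcal{O}_{T^*M}$ is $\{f,g\}=H_f(g)$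 with $H_f=\sum_k\big(\frac{\partial f}{\partial t_k}\frac{\partial}{\partial y_k}-\frac{\partial f}{\partial y_k}\frac{\partial}{\partial t_k}\big)$. *)

theory Defs
  imports "HOL-Analysis.Analysis"
begin

section \<open>Holomorphic functions of several variables\<close>

text \<open>Holomorphic means Frechet differentiable with complex linear derivative. The set \<open>S\<close> is
  always open in the uses below.\<close>

definition holo_on :: "(complex^'n \<Rightarrow> complex) \<Rightarrow> (complex^'n) set \<Rightarrow> bool" where
  "holo_on f S \<longleftrightarrow> (\<forall>x\<in>S. \<exists>a::complex^'n. (f has_derivative (\<lambda>v. \<Sum>i\<in>UNIV. a $ i * v $ i)) (at x))"

definition pd :: "'n \<Rightarrow> (complex^'n \<Rightarrow> complex) \<Rightarrow> complex^'n \<Rightarrow> complex" where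
  "pd i f x = deriv (\<lambda>w. f (x + axis i w)) 0"

section \<open>Complex manifolds\<close>

text \<open>A chart is a pair of a domain and a coordinate map; the values of the map outside of the
  domain are irrelevant. The underlying set of the manifold is the whole type \<open>'m\<close>. (That the
  topology is Hausdorff and second countable is expressed by the sort of \<open>'m\<close> where a manifold
  is fixed.)\<close>

type_synonym ('m, 'n) chart = "'m set \<times> ('m \<Rightarrow> complex^'n)"

definition complex_atlas :: "('m::topological_space, 'n::finite) chart set \<Rightarrow> bool" where
  "complex_atlas A \<longleftrightarrow>
     (\<Union>(U,\<phi>)\<in>A. U) = UNIV \<and>
     (\<forall>(U,\<phi>)\<in>A. open U \<and> open (\<phi> ` U) \<and> homeomorphism U (\<phi> ` U) \<phi> (inv_into U \<phi>)) \<and>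
     (\<forall>(U,\<phi>)\<in>A. \<forall>(V,\<psi>)\<in>A. \<forall>i. holo_on (\<lambda>x. \<psi> (inv_into U \<phi> x) $ i) (\<phi> ` (U \<inter> V)))"

text \<open>Local coordinates are the charts of the maximal atlas.\<close>

definition local_coordinates :: "('m::topological_space, 'n::finite) chart set \<Rightarrow> ('m,'n) chart \<Rightarrow> bool" where
  "local_coordinates A c \<longleftrightarrow> complex_atlas (insert c A)"

text \<open>\<open>f \<in> \<O>(W)\<close> for an open set \<open>W\<close>.\<close>

definition holo_fun :: "('m::topological_space, 'n::finite) chart set \<Rightarrow> 'm set \<Rightarrow> ('m \<Rightarrow> complex) \<Rightarrow> bool" where
  "holo_fun A W f \<longleftrightarrow> (\<forall>(U,\<phi>)\<in>A. holo_on (\<lambda>x. f (inv_into U \<phi> x)) (\<phi> ` (U \<inter> W)))"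

text \<open>The atlas of the product of the complex line (coordinate index \<open>None\<close>) with a manifold.\<close>

definition line_atlas :: "('m::topological_space, 'n::finite) chart set \<Rightarrow> (complex \<times> 'm, 'n option) chart set" where
  "line_atlas A =
     (\<lambda>(U,\<phi>). (UNIV \<times> U, \<lambda>(z,p). \<chi> j. case j of None \<Rightarrow> z | Some i \<Rightarrow> \<phi> p $ i)) ` A"

section \<open>Holomorphic vector fields\<close>

text \<open>Vector fields are represented by their action on functions. Only the values on functions
  which are holomorphic near the point in question matter, see \<open>vf_eq\<close>.\<close>

type_synonym 'm vf = "('m \<Rightarrow> complex) \<Rightarrow> ('m \<Rightarrow> complex)"

definition coord_vf :: "('m, 'n::finite) chart \<Rightarrow> 'n \<Rightarrow> 'm vf" where
  "coord_vf c i = (case c of (U,\<phi>) \<Rightarrow> \<lambda>f p. pd i (\<lambda>x. f (inv_into U \<phi> x)) (\<phi> p))"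

definition holo_near :: "('m::topological_space, 'n::finite) chart set \<Rightarrow> 'm \<Rightarrow> ('m \<Rightarrow> complex) \<Rightarrow> bool" where
  "holo_near A p f \<longleftrightarrow> (\<exists>W. open W \<and> p \<in> W \<and> holo_fun A W f)"

text \<open>\<open>vfs A V\<close> is the set of sections over \<open>V\<close> of the tangent sheaf.\<close>

definition vfs :: "('m::topological_space, 'n::finite) chart set \<Rightarrow> 'm set \<Rightarrow> 'm vf set" where
  "vfs A V = {X. \<forall>(U,\<phi>)\<in>A. \<exists>a. (\<forall>i. holo_fun A (U \<inter> V) (a i)) \<and>
     (\<forall>p\<in>U \<inter> V. \<forall>f. holo_near A p f \<longrightarrow> X f p = (\<Sum>i\<in>UNIV. a i p * coord_vf (U,\<phi>) i f p))}"

definition vf_eq :: "('m::topological_space, 'n::finite) chart set \<Rightarrow> 'm set \<Rightarrow> 'm vf \<Rightarrow> 'm vf \<Rightarrow> bool" where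
  "vf_eq A V X Y \<longleftrightarrow> (\<forall>p\<in>V. \<forall>f. holo_near A p f \<longrightarrow> X f p = Y f p)"

definition vf_add :: "'m vf \<Rightarrow> 'm vf \<Rightarrow> 'm vf" where
  "vf_add X Y = (\<lambda>f p. X f p + Y f p)"

definition vf_diff :: "'m vf \<Rightarrow> 'm vf \<Rightarrow> 'm vf" where
  "vf_diff X Y = (\<lambda>f p. X f p - Y f p)"

definition vf_scale :: "('m \<Rightarrow> complex) \<Rightarrow> 'm vf \<Rightarrow> 'm vf" where
  "vf_scale g X = (\<lambda>f p. g p * X f p)"

definition lie_bracket :: "'m vf \<Rightarrow> 'm vf \<Rightarrow> 'm vf" where
  "lie_bracket X Y = (\<lambda>f p. X (Y f) p - Y (X f) p)"

text \<open>The lift to the product with the complex line acts on functions of \<open>(z,p)\<close> with \<open>z\<close> fixed.\<close>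

definition vf_lift :: "'m vf \<Rightarrow> (complex \<times> 'm) vf" where
  "vf_lift X = (\<lambda>f (z,p). X (\<lambda>q. f (z,q)) p)"

section \<open>Holomorphic multiplications on the tangent bundle and F-manifolds\<close>

text \<open>Sheaf morphisms are represented by functions on (total) representatives of local sections,
  which are required to depend only on the restriction of the arguments. They then commute with
  restrictions automatically.\<close>

definition tangent_mult :: "('m::topological_space, 'n::finite) chart set \<Rightarrow> ('m vf \<Rightarrow> 'm vf \<Rightarrow> 'm vf) \<Rightarrow> bool" where
  "tangent_mult A mul \<longleftrightarrow> (\<forall>V. open V \<longrightarrow>
     (\<forall>X\<in>vfs A V. \<forall>Y\<in>vfs A V.
        mul X Y \<in> vfs A V \<and>
        (\<forall>X'\<in>vfs A V. \<forall>Y'\<in>vfs A V. vf_eq A V X X' \<longrightarrow> vf_eq A V Y Y' \<longrightarrow>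
            vf_eq A V (mul X Y) (mul X' Y')) \<and>
        (\<forall>Z\<in>vfs A V. vf_eq A V (mul (vf_add X Z) Y) (vf_add (mul X Y) (mul Z Y)) \<and>
                      vf_eq A V (mul X (vf_add Y Z)) (vf_add (mul X Y) (mul X Z))) \<and>
        (\<forall>f. holo_fun A V f \<longrightarrow>
            vf_eq A V (mul (vf_scale f X) Y) (vf_scale f (mul X Y)) \<and>
            vf_eq A V (mul X (vf_scale f Y)) (vf_scale f (mul X Y)))))"

text \<open>The Lie derivative of the multiplication, evaluated on two vector fields.\<close>

definition lie_mult :: "('m vf \<Rightarrow> 'm vf \<Rightarrow> 'm vf) \<Rightarrow> 'm vf \<Rightarrow> 'm vf \<Rightarrow> 'm vf \<Rightarrow> 'm vf" where
  "lie_mult mul X Y Z =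
     vf_diff (vf_diff (lie_bracket X (mul Y Z)) (mul (lie_bracket X Y) Z)) (mul Y (lie_bracket X Z))"

definition F_manifold :: "('m::topological_space, 'n::finite) chart set \<Rightarrow> ('m vf \<Rightarrow> 'm vf \<Rightarrow> 'm vf) \<Rightarrow> 'm vf \<Rightarrow> bool" where
  "F_manifold A mul e \<longleftrightarrow>
     tangent_mult A mul \<and>
     (\<forall>V. open V \<longrightarrow> (\<forall>X\<in>vfs A V. \<forall>Y\<in>vfs A V. vf_eq A V (mul X Y) (mul Y X))) \<and>
     (\<forall>V. open V \<longrightarrow> (\<forall>X\<in>vfs A V. \<forall>Y\<in>vfs A V. \<forall>Z\<in>vfs A V.
        vf_eq A V (mul (mul X Y) Z) (mul X (mul Y Z)))) \<and>
     e \<in> vfs A UNIV \<and>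
     (\<forall>V. open V \<longrightarrow> (\<forall>X\<in>vfs A V. vf_eq A V (mul e X) X)) \<and>
     (\<forall>V. open V \<longrightarrow> (\<forall>X\<in>vfs A V. \<forall>Y\<in>vfs A V. \<forall>Z\<in>vfs A V. \<forall>Z'\<in>vfs A V.
        vf_eq A V (lie_mult mul (mul X Y) Z Z')
          (vf_add (mul X (lie_mult mul Y Z Z')) (mul Y (lie_mult mul X Z Z')))))"

section \<open>Holomorphic vector bundles\<close>

text \<open>A bundle of rank \<open>CARD('r)\<close> consists of the total space, the projection and trivializations;
  a trivialization is an open set \<open>V\<close> of the base and the fiber component of an isomorphism from
  the part of the total space over \<open>V\<close> to the product of \<open>V\<close> with the model fiber. The vector
  space structures on the fibers and the complex structure on the total space are those for which
  the trivializations are isomorphisms.\<close>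

record ('b, 'k, 'r) vbundle =
  Tot :: "'k set"
  Pr :: "'k \<Rightarrow> 'b"
  Trivs :: "('b set \<times> ('k \<Rightarrow> complex^'r)) set"

definition holo_vbundle :: "('b::topological_space, 'n::finite) chart set \<Rightarrow> ('b,'k,'r::finite) vbundle \<Rightarrow> bool" where
  "holo_vbundle A E \<longleftrightarrow>
     (\<Union>(V,h)\<in>Trivs E. V) = UNIV \<and>
     (\<forall>(V,h)\<in>Trivs E. open V \<and> (\<forall>p\<in>V. bij_betw h {v \<in> Tot E. Pr E v = p} UNIV)) \<and>
     (\<forall>(V,h)\<in>Trivs E. \<forall>(V',h')\<in>Trivs E. \<exists>g :: 'b \<Rightarrow> complex^'r^'r.
        (\<forall>i j. holo_fun A (V \<inter> V') (\<lambda>p. g p $ i $ j)) \<and>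
        (\<forall>v\<in>Tot E. Pr E v \<in> V \<inter> V' \<longrightarrow> h' v = g (Pr E v) *v h v))"

definition sects :: "('b::topological_space, 'n::finite) chart set \<Rightarrow> ('b,'k,'r::finite) vbundle \<Rightarrow> 'b set \<Rightarrow> ('b \<Rightarrow> 'k) set" where
  "sects A E W = {s. (\<forall>p\<in>W. s p \<in> Tot E \<and> Pr E (s p) = p) \<and>
     (\<forall>(V,h)\<in>Trivs E. \<forall>j. holo_fun A (V \<inter> W) (\<lambda>p. h (s p) $ j))}"

definition fib_add :: "('b,'k,'r::finite) vbundle \<Rightarrow> 'k \<Rightarrow> 'k \<Rightarrow> 'k" where
  "fib_add E u v = (THE w. w \<in> Tot E \<and> Pr E w = Pr E u \<and>
     (\<forall>(V,h)\<in>Trivs E. Pr E u \<in> V \<longrightarrow> h w = h u + h v))"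

definition fib_scale :: "('b,'k,'r::finite) vbundle \<Rightarrow> complex \<Rightarrow> 'k \<Rightarrow> 'k" where
  "fib_scale E c u = (THE w. w \<in> Tot E \<and> Pr E w = Pr E u \<and>
     (\<forall>(V,h)\<in>Trivs E. Pr E u \<in> V \<longrightarrow> h w = c *s h u))"

definition s_add :: "('b,'k,'r::finite) vbundle \<Rightarrow> ('b \<Rightarrow> 'k) \<Rightarrow> ('b \<Rightarrow> 'k) \<Rightarrow> 'b \<Rightarrow> 'k" where
  "s_add E s t = (\<lambda>p. fib_add E (s p) (t p))"

definition s_scale :: "('b,'k,'r::finite) vbundle \<Rightarrow> ('b \<Rightarrow> complex) \<Rightarrow> ('b \<Rightarrow> 'k) \<Rightarrow> 'b \<Rightarrow> 'k" where
  "s_scale E f s = (\<lambda>p. fib_scale E (f p) (s p))"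

definition s_diff :: "('b,'k,'r::finite) vbundle \<Rightarrow> ('b \<Rightarrow> 'k) \<Rightarrow> ('b \<Rightarrow> 'k) \<Rightarrow> 'b \<Rightarrow> 'k" where
  "s_diff E s t = s_add E s (s_scale E (\<lambda>_. -1) t)"

definition s_eq :: "'b set \<Rightarrow> ('b \<Rightarrow> 'k) \<Rightarrow> ('b \<Rightarrow> 'k) \<Rightarrow> bool" where
  "s_eq W s t \<longleftrightarrow> (\<forall>p\<in>W. s p = t p)"

section \<open>Higgs bundles and good connections\<close>

text \<open>A Higgs field and a connection are given by their contractions with vector fields,
  \<open>C X s\<close> is \<open>C\<^sub>X s\<close>.\<close>

type_synonym ('m, 'k) contraction = "'m vf \<Rightarrow> ('m \<Rightarrow> 'k) \<Rightarrow> 'm \<Rightarrow> 'k"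

text \<open>The properties which Higgs fields and connections have in common: \<open>P X s\<close> is a local
  operation, additive in \<open>s\<close> and linear over the holomorphic functions in \<open>X\<close>.\<close>

definition vf_linear :: "('m::topological_space, 'n::finite) chart set \<Rightarrow> ('m,'k,'r::finite) vbundle \<Rightarrow> ('m,'k) contraction \<Rightarrow> bool" where
  "vf_linear A K P \<longleftrightarrow> (\<forall>V. open V \<longrightarrow> (\<forall>X\<in>vfs A V. \<forall>s\<in>sects A K V.
     P X s \<in> sects A K V \<and>
     (\<forall>X'\<in>vfs A V. \<forall>s'\<in>sects A K V. vf_eq A V X X' \<longrightarrow> s_eq V s s' \<longrightarrow> s_eq V (P X s) (P X' s')) \<and>
     (\<forall>Y\<in>vfs A V. s_eq V (P (vf_add X Y) s) (s_add K (P X s) (P Y s))) \<and>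
     (\<forall>f. holo_fun A V f \<longrightarrow> s_eq V (P (vf_scale f X) s) (s_scale K f (P X s))) \<and>
     (\<forall>t\<in>sects A K V. s_eq V (P X (s_add K s t)) (s_add K (P X s) (P X t)))))"

definition higgs_bundle :: "('m::topological_space, 'n::finite) chart set \<Rightarrow> ('m,'k,'r::finite) vbundle \<Rightarrow> ('m,'k) contraction \<Rightarrow> bool" where
  "higgs_bundle A K C \<longleftrightarrow>
     holo_vbundle A K \<and> vf_linear A K C \<and>
     (\<forall>V. open V \<longrightarrow> (\<forall>X\<in>vfs A V. \<forall>s\<in>sects A K V.
        (\<forall>f. holo_fun A V f \<longrightarrow> s_eq V (C X (s_scale K f s)) (s_scale K f (C X s))) \<and>
        (\<forall>Y\<in>vfs A V. s_eq V (C X (C Y s)) (C Y (C X s)))))"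

text \<open>\<open>\<zeta>\<close> is a global section such that \<open>X \<mapsto> C\<^sub>X \<zeta>\<close> is an isomorphism of sheaves, i.e. bijective
  on sections over every open set.\<close>

definition primitive_section :: "('m::topological_space, 'n::finite) chart set \<Rightarrow> ('m,'k,'r::finite) vbundle \<Rightarrow> ('m,'k) contraction \<Rightarrow> ('m \<Rightarrow> 'k) \<Rightarrow> bool" where
  "primitive_section A K C \<zeta> \<longleftrightarrow>
     \<zeta> \<in> sects A K UNIV \<and>
     (\<forall>V. open V \<longrightarrow>
        (\<forall>X\<in>vfs A V. \<forall>Y\<in>vfs A V. s_eq V (C X \<zeta>) (C Y \<zeta>) \<longrightarrow> vf_eq A V X Y) \<and>
        (\<forall>s\<in>sects A K V. \<exists>X\<in>vfs A V. s_eq V (C X \<zeta>) s))"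

definition primitive_higgs_bundle :: "('m::topological_space, 'n::finite) chart set \<Rightarrow> ('m,'k,'r::finite) vbundle \<Rightarrow> ('m,'k) contraction \<Rightarrow> bool" where
  "primitive_higgs_bundle A K C \<longleftrightarrow> higgs_bundle A K C \<and> (\<exists>\<zeta>. primitive_section A K C \<zeta>)"

text \<open>The (up to \<open>vf_eq\<close> unique) multiplication and unit field induced by a primitive Higgs
  bundle.\<close>

definition higgs_induces :: "('m::topological_space, 'n::finite) chart set \<Rightarrow> ('m,'k,'r::finite) vbundle \<Rightarrow> ('m,'k) contraction
    \<Rightarrow> ('m vf \<Rightarrow> 'm vf \<Rightarrow> 'm vf) \<Rightarrow> 'm vf \<Rightarrow> bool" where
  "higgs_induces A K C mul e \<longleftrightarrow>
     tangent_mult A mul \<and>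
     (\<forall>V. open V \<longrightarrow> (\<forall>X\<in>vfs A V. \<forall>Y\<in>vfs A V. \<forall>s\<in>sects A K V. s_eq V (C (mul X Y) s) (C X (C Y s)))) \<and>
     e \<in> vfs A UNIV \<and>
     (\<exists>\<zeta>. primitive_section A K C \<zeta> \<and> s_eq UNIV (C e \<zeta>) \<zeta>)"

definition holo_connection :: "('m::topological_space, 'n::finite) chart set \<Rightarrow> ('m,'k,'r::finite) vbundle \<Rightarrow> ('m,'k) contraction \<Rightarrow> bool" where
  "holo_connection A K D \<longleftrightarrow> vf_linear A K D \<and>
     (\<forall>V. open V \<longrightarrow> (\<forall>X\<in>vfs A V. \<forall>s\<in>sects A K V. \<forall>f. holo_fun A V f \<longrightarrow>
        s_eq V (D X (s_scale K f s)) (s_add K (s_scale K (X f) s) (s_scale K f (D X s)))))"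

text \<open>\<open>D\<^sub>X(C\<^sub>Y)\<close> is the covariant derivative of the endomorphism \<open>C\<^sub>Y\<close>.\<close>

definition cov_deriv_end :: "('m,'k,'r::finite) vbundle \<Rightarrow> ('m,'k) contraction \<Rightarrow> ('m,'k) contraction
    \<Rightarrow> 'm vf \<Rightarrow> 'm vf \<Rightarrow> ('m \<Rightarrow> 'k) \<Rightarrow> 'm \<Rightarrow> 'k" where
  "cov_deriv_end K C D X Y s = s_diff K (D X (C Y s)) (C Y (D X s))"

definition good_connection :: "('m::topological_space, 'n::finite) chart set \<Rightarrow> ('m,'k,'r::finite) vbundle
    \<Rightarrow> ('m,'k) contraction \<Rightarrow> ('m,'k) contraction \<Rightarrow> bool" where
  "good_connection A K C D \<longleftrightarrow> holo_connection A K D \<and>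
     (\<forall>V. open V \<longrightarrow> (\<forall>X\<in>vfs A V. \<forall>Y\<in>vfs A V. \<forall>s\<in>sects A K V.
        s_eq V (s_diff K (cov_deriv_end K C D X Y s) (cov_deriv_end K C D Y X s))
               (C (lie_bracket X Y) s)))"

section \<open>(T)-structures\<close>

definition punct :: "(complex \<times> 'm) set \<Rightarrow> (complex \<times> 'm) set" where
  "punct W = {w \<in> W. fst w \<noteq> 0}"

text \<open>\<open>nab X s\<close> is the meromorphic section \<open>\<nabla>\<^sub>X s\<close>, whose values at \<open>z = 0\<close> are irrelevant.
  It has at most a simple pole along \<open>z = 0\<close>, i.e. it is equal to \<open>1/z\<close> times a holomorphic
  section \<open>u\<close>:\<close>

definition z_times :: "('m::topological_space, 'n::finite) chart set \<Rightarrow> (complex \<times> 'm,'h,'r::finite) vbundle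
    \<Rightarrow> (complex \<times> 'm) set \<Rightarrow> (complex \<times> 'm \<Rightarrow> 'h) \<Rightarrow> (complex \<times> 'm \<Rightarrow> 'h) \<Rightarrow> bool" where
  "z_times A H W v u \<longleftrightarrow> u \<in> sects (line_atlas A) H W \<and> s_eq (punct W) v (s_scale H (\<lambda>(z,p). 1 / z) u)"

definition T_structure :: "('m::topological_space, 'n::finite) chart set \<Rightarrow> (complex \<times> 'm,'h,'r::finite) vbundle
    \<Rightarrow> ('m vf \<Rightarrow> (complex \<times> 'm \<Rightarrow> 'h) \<Rightarrow> complex \<times> 'm \<Rightarrow> 'h) \<Rightarrow> bool" where
  "T_structure A H nab \<longleftrightarrow>
     holo_vbundle (line_atlas A) H \<and>
     (\<forall>V W. open V \<longrightarrow> open W \<longrightarrow> W \<subseteq> UNIV \<times> V \<longrightarrow>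
       (\<forall>X\<in>vfs A V. \<forall>s\<in>sects (line_atlas A) H W.
         (\<exists>u. z_times A H W (nab X s) u) \<and>
         (\<forall>X'\<in>vfs A V. \<forall>s'\<in>sects (line_atlas A) H W.
            vf_eq A V X X' \<longrightarrow> s_eq W s s' \<longrightarrow> s_eq (punct W) (nab X s) (nab X' s')) \<and>
         (\<forall>Y\<in>vfs A V. s_eq (punct W) (nab (vf_add X Y) s) (s_add H (nab X s) (nab Y s))) \<and>
         (\<forall>f. holo_fun A V f \<longrightarrow>
            s_eq (punct W) (nab (vf_scale f X) s) (s_scale H (\<lambda>(z,p). f p) (nab X s))) \<and>
         (\<forall>t\<in>sects (line_atlas A) H W.
            s_eq (punct W) (nab X (s_add H s t)) (s_add H (nab X s) (nab X t))) \<and>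
         (\<forall>f. holo_fun (line_atlas A) W f \<longrightarrow>
            s_eq (punct W) (nab X (s_scale H f s))
              (s_add H (s_scale H (vf_lift X f) s) (s_scale H f (nab X s)))) \<and>
         (\<forall>Y\<in>vfs A V. s_eq (punct W)
            (s_diff H (nab X (nab Y s)) (nab Y (nab X s))) (nab (lie_bracket X Y) s))))"

text \<open>The induced Higgs bundle \<open>K = H|\<^bsub>{0} \<times> M\<^esub>\<close>, \<open>C = [z\<nabla>]\<close>: to evaluate \<open>C\<^sub>X \<sigma>\<close> at \<open>p\<close>, extend
  \<open>\<sigma>\<close> near \<open>(0,p)\<close> to a section \<open>s\<close> of \<open>H\<close> and restrict \<open>z\<nabla>\<^sub>X s\<close> to \<open>z = 0\<close>.\<close>

definition zero_restrict :: "(complex \<times> 'm,'h,'r::finite) vbundle \<Rightarrow> ('m,'h,'r) vbundle" where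
  "zero_restrict H = \<lparr> Tot = {v \<in> Tot H. fst (Pr H v) = 0}, Pr = snd \<circ> Pr H,
     Trivs = (\<lambda>(V,h). ({p. (0,p) \<in> V}, h)) ` Trivs H \<rparr>"

definition zero_higgs :: "('m::topological_space, 'n::finite) chart set \<Rightarrow> (complex \<times> 'm,'h,'r::finite) vbundle
    \<Rightarrow> ('m vf \<Rightarrow> (complex \<times> 'm \<Rightarrow> 'h) \<Rightarrow> complex \<times> 'm \<Rightarrow> 'h) \<Rightarrow> ('m,'h) contraction" where
  "zero_higgs A H nab X \<sigma> p = (THE k. \<exists>V W s u.
     open V \<and> X \<in> vfs A V \<and> open W \<and> W \<subseteq> UNIV \<times> V \<and> (0,p) \<in> W \<and>
     s \<in> sects (line_atlas A) H W \<and> (\<forall>q. (0,q) \<in> W \<longrightarrow> s (0,q) = \<sigma> q) \<and>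
     z_times A H W (nab X s) u \<and> k = u (0,p))"

definition T_structure_over :: "('m::topological_space, 'n::finite) chart set \<Rightarrow> (complex \<times> 'm,'h,'r::finite) vbundle
    \<Rightarrow> ('m vf \<Rightarrow> (complex \<times> 'm \<Rightarrow> 'h) \<Rightarrow> complex \<times> 'm \<Rightarrow> 'h)
    \<Rightarrow> ('m vf \<Rightarrow> 'm vf \<Rightarrow> 'm vf) \<Rightarrow> 'm vf \<Rightarrow> bool" where
  "T_structure_over A H nab mul e \<longleftrightarrow>
     T_structure A H nab \<and>
     primitive_higgs_bundle A (zero_restrict H) (zero_higgs A H nab) \<and>
     higgs_induces A (zero_restrict H) (zero_higgs A H nab) mul e"

section \<open>The analytic spectrum\<close>

text \<open>Over the domain of local coordinates \<open>c = (U,\<phi>)\<close> the cotangent bundle is the product of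
  \<open>\<phi> ` U\<close> with the space of the fiber coordinates; the coordinate indices are \<open>Inl k\<close> for \<open>t\<^sub>k\<close>
  and \<open>Inr k\<close> for \<open>y\<^sub>k\<close>.\<close>

definition base_pt :: "complex^('n::finite + 'n) \<Rightarrow> complex^'n" where
  "base_pt x = (\<chi> k. x $ Inl k)"

definition cotangent :: "('m, 'n::finite) chart \<Rightarrow> (complex^('n + 'n)) set" where
  "cotangent c = (case c of (U,\<phi>) \<Rightarrow> {x. base_pt x \<in> \<phi> ` U})"

text \<open>The coefficient of \<open>\<partial>\<^sub>k\<close> in \<open>X\<close>, as a function of the coordinates \<open>t\<close>.\<close>

definition vf_coeff :: "('m, 'n::finite) chart \<Rightarrow> 'm vf \<Rightarrow> 'n \<Rightarrow> complex^'n \<Rightarrow> complex" where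
  "vf_coeff c X k t = (case c of (U,\<phi>) \<Rightarrow> X (\<lambda>p. \<phi> p $ k) (inv_into U \<phi> t))"

text \<open>The generator \<open>\<Sum>\<^sub>k e\<^sup>k y\<^sub>k - 1\<close> with \<open>e = \<Sum>\<^sub>k e\<^sup>k \<partial>\<^sub>k\<close> is the usual \<open>y\<^sub>1 - 1\<close> if the coordinates
  satisfy \<open>e = \<partial>\<^sub>1\<close> (lemma \<open>unit_gen_adapted\<close> below), but it makes sense in any coordinates.\<close>

definition unit_gen :: "('m, 'n::finite) chart \<Rightarrow> 'm vf \<Rightarrow> complex^('n + 'n) \<Rightarrow> complex" where
  "unit_gen c e x = (\<Sum>k\<in>UNIV. vf_coeff c e k (base_pt x) * x $ Inr k) - 1"

definition mult_gen :: "('m, 'n::finite) chart \<Rightarrow> ('m vf \<Rightarrow> 'm vf \<Rightarrow> 'm vf) \<Rightarrow> 'n \<Rightarrow> 'n \<Rightarrow> complex^('n + 'n) \<Rightarrow> complex" where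
  "mult_gen c mul i j x = x $ Inr i * x $ Inr j
     - (\<Sum>k\<in>UNIV. vf_coeff c (mul (coord_vf c i) (coord_vf c j)) k (base_pt x) * x $ Inr k)"

text \<open>Sections over an open set \<open>W\<close> of the ideal sheaf generated by a set \<open>G\<close> of functions, and of
  its radical.\<close>

definition ideal_sheaf :: "(complex^'a \<Rightarrow> complex) set \<Rightarrow> (complex^'a::finite) set \<Rightarrow> (complex^'a \<Rightarrow> complex) set" where
  "ideal_sheaf G W = {f. holo_on f W \<and> (\<forall>x\<in>W. \<exists>N. open N \<and> x \<in> N \<and> N \<subseteq> W \<and>
     (\<exists>F b. finite F \<and> F \<subseteq> G \<and> (\<forall>g\<in>F. holo_on (b g) N) \<and> (\<forall>y\<in>N. f y = (\<Sum>g\<in>F. b g y * g y))))}"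

definition radical_sheaf :: "((complex^'a::finite) set \<Rightarrow> (complex^'a \<Rightarrow> complex) set) \<Rightarrow> (complex^'a) set \<Rightarrow> (complex^'a \<Rightarrow> complex) set" where
  "radical_sheaf I W = {f. holo_on f W \<and> (\<forall>x\<in>W. \<exists>N. open N \<and> x \<in> N \<and> N \<subseteq> W \<and>
     (\<exists>k::nat. (\<lambda>y. f y ^ k) \<in> I N))}"

text \<open>The ideal sheaf of the analytic spectrum; only open sets \<open>W \<subseteq> cotangent c\<close> are meaningful.\<close>

definition spec_ideal :: "('m, 'n::finite) chart \<Rightarrow> ('m vf \<Rightarrow> 'm vf \<Rightarrow> 'm vf) \<Rightarrow> 'm vf
    \<Rightarrow> (complex^('n + 'n)) set \<Rightarrow> (complex^('n + 'n) \<Rightarrow> complex) set" where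
  "spec_ideal c mul e = ideal_sheaf (insert (unit_gen c e) {mult_gen c mul i j | i j. True})"

definition poisson :: "(complex^('n::finite + 'n) \<Rightarrow> complex) \<Rightarrow> (complex^('n + 'n) \<Rightarrow> complex) \<Rightarrow> complex^('n + 'n) \<Rightarrow> complex" where
  "poisson f g x = (\<Sum>k\<in>UNIV. pd (Inl k) f x * pd (Inr k) g x - pd (Inr k) f x * pd (Inl k) g x)"

text \<open>The inclusion of the Poisson bracket of the radical with itself in the radical, as an
  inclusion of sheaves on the cotangent bundle, in all local coordinates.\<close>

definition radical_poisson_closed :: "('m::topological_space, 'n::finite) chart set \<Rightarrow> ('m vf \<Rightarrow> 'm vf \<Rightarrow> 'm vf) \<Rightarrow> 'm vf \<Rightarrow> bool" where
  "radical_poisson_closed A mul e \<longleftrightarrow>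
     (\<forall>c W. local_coordinates A c \<longrightarrow> open W \<longrightarrow> W \<subseteq> cotangent c \<longrightarrow>
        (\<forall>f\<in>radical_sheaf (spec_ideal c mul e) W. \<forall>g\<in>radical_sheaf (spec_ideal c mul e) W.
           poisson f g \<in> radical_sheaf (spec_ideal c mul e) W))"

lemma unit_gen_adapted:
  fixes A :: "('m::topological_space, 'n::finite) chart set"
  assumes c: "local_coordinates A c" and e: "vf_eq A (fst c) e (coord_vf c i)"
    and x: "x \<in> cotangent c"
  shows "unit_gen c e x = x $ Inr i - 1"
proof -
  obtain U \<phi> where cU: "c = (U,\<phi>)" by fastforce
  have atl: "complex_atlas (insert (U,\<phi>) A)" using c unfolding local_coordinates_def cU .
  have U: "open U" "open (\<phi> ` U)" and hom: "homeomorphism U (\<phi> ` U) \<phi> (inv_into U \<phi>)"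
    using atl unfolding complex_atlas_def by auto
  let ?t = "base_pt x" let ?p = "inv_into U \<phi> ?t"
  have t: "?t \<in> \<phi> ` U" using x unfolding cotangent_def cU by simp
  have p: "?p \<in> U" and pt: "\<phi> ?p = ?t"
    using t by (auto intro: inv_into_into f_inv_into_f)
  have near: "holo_near A ?p (\<lambda>q. \<phi> q $ k)" for k
    unfolding holo_near_def holo_fun_def
  proof (intro exI[of _ U] conjI ballI U p)
    fix d assume d: "d \<in> A"
    obtain V \<psi> where dV: "d = (V,\<psi>)" by fastforce
    have "holo_on (\<lambda>y. \<phi> (inv_into V \<psi> y) $ k) (\<psi> ` (V \<inter> U))"
      using atl d unfolding complex_atlas_def dV by blast
    then show "case d of (V,\<psi>) \<Rightarrow> holo_on (\<lambda>y. \<phi> (inv_into V \<psi> y) $ k) (\<psi> ` (V \<inter> U))"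
      by (simp add: dV)
  qed
  have coeff: "vf_coeff c e k ?t = (if k = i then 1 else 0)" for k
  proof -
    have "vf_coeff c e k ?t = e (\<lambda>q. \<phi> q $ k) ?p" by (simp add: vf_coeff_def cU)
    also have "\<dots> = coord_vf c i (\<lambda>q. \<phi> q $ k) ?p"
      using e near p unfolding vf_eq_def cU by simp
    also have "\<dots> = deriv (\<lambda>w. \<phi> (inv_into U \<phi> (?t + axis i w)) $ k) 0"
      by (simp add: coord_vf_def cU pd_def pt)
    also have "\<dots> = deriv (\<lambda>w. (?t + axis i w) $ k) 0"
    proof (rule deriv_cong_ev)
      have cont: "continuous_on UNIV (\<lambda>w::complex. ?t + axis i w)"
      proof (intro continuous_on_add continuous_on_const)
        have "continuous_on UNIV (\<lambda>w::complex. if k = i then w else 0)" for k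
          by (cases "k = i") simp_all
        then show "continuous_on UNIV (axis i :: complex \<Rightarrow> complex^'n)"
          unfolding axis_def by (intro continuous_on_vec_lambda)
      qed
      have "open ((\<lambda>w. ?t + axis i w) -` (\<phi> ` U))"
        using U(2) cont by (simp add: open_vimage)
      moreover have "0 \<in> (\<lambda>w. ?t + axis i w) -` (\<phi> ` U)"
        using t by (simp add: axis_def vec_eq_iff zero_vec_def[symmetric])
      ultimately have "\<forall>\<^sub>F w in nhds 0. ?t + axis i w \<in> \<phi> ` U"
        unfolding eventually_nhds by blast
      then show "\<forall>\<^sub>F w in nhds 0. \<phi> (inv_into U \<phi> (?t + axis i w)) $ k = (?t + axis i w) $ k"
        by eventually_elim (simp add: f_inv_into_f)
    qed simp
    also have "\<dots> = (if k = i then 1 else 0)"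
      by (auto simp: axis_def)
    finally show ?thesis .
  qed
  have "(\<Sum>k\<in>UNIV. vf_coeff c e k ?t * x $ Inr k) = (\<Sum>k\<in>UNIV. if k = i then x $ Inr k else 0)"
    by (rule sum.cong) (auto simp: coeff)
  then show ?thesis by (simp add: unit_gen_def)
qed

end

theory Submission
  imports Defs "HOL-Complex_Analysis.Complex_Analysis"
begin

text \<open>Let \<open>a\<^sub>i(t)\<close> be the matrix of the multiplication by \<open>\<partial>\<^sub>i\<close> at \<open>t\<close>, so that the points of the analytic
  spectrum over \<open>t\<close> are the normalized joint left eigenvectors \<open>y\<close> of the \<open>a\<^sub>i(t)\<close>. Division modulo
  \<open>\<I>\<close>, one fiber variable at a time with the resolvents of the \<open>a\<^sub>i\<close> and Cauchy integrals, locally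
  replaces a function by one which is linear in \<open>y\<close>. It yields a Nullstellensatz: the radical
  consists of the functions vanishing on the spectrum. If \<open>u\<close> and \<open>v\<close> are such functions, linear in
  \<open>y\<close>, then the matrices \<open>u(t, a(t))\<close> and \<open>v(t, a(t))\<close> are nilpotent.

  Two facts about traces show that \<open>{u, v}(t, a(t))\<close> has trace zero against the commutant of the
  \<open>a\<^sub>i\<close>, hence is nilpotent, hence \<open>{u, v}\<close> vanishes on the spectrum. First, the derivative of a
  family of nilpotent matrices is trace-orthogonal to every commuting family. Second,
  \<open>\<partial>\<^sub>i a\<^sub>j - \<partial>\<^sub>j a\<^sub>i\<close> is trace-orthogonal to the commutant, because it is equal to
  \<open>[a\<^sub>j, D\<^sub>i] - [a\<^sub>i, D\<^sub>j]\<close> for some matrices \<open>D\<^sub>i\<close>. These are the connection matrices of a good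
  connection, and for a \<open>(T)\<close>-structure the \<open>z\<^sup>0\<close>-coefficients of \<open>\<nabla>\<close>, the identity being the
  \<open>z\<^sup>-\<^sup>1\<close>-coefficient of the flatness of \<open>\<nabla>\<close>.\<close>

text \<open>The joint eigenvalues may coincide, split and fail to be holomorphic in
  \<open>t\<close>, so they cannot be differentiated. Traces of holomorphic matrix families can, and
  traces against the commutant are enough: the Fitting projection of \<open>H\<close> is
  \<open>H * W\<close> with \<open>W\<close> in the commutant, so its trace is 0, and an idempotent
  of trace 0 in characteristic 0 is 0.

  A second obstacle is that a function is given near one point of the spectrum only, while
  nilpotency of its matrix concerns all points over \<open>t\<close>. The Cauchy integrals run over
  circles free of eigenvalues. They yield a linear form that agrees with the function at the nearby
  points of the spectrum and is 0 at all other points over \<open>t\<close>.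

  Finally, a function in the radical is such a linear form plus a combination of the generators. At
  a point of the spectrum the derivatives of the coefficients are multiplied by zeros, so the
  bracket of two such functions is a combination of brackets of linear forms and generators, all of
  which have nilpotent matrices.\<close>

no_notation fps_nth (infixl "$" 75)

section \<open>Square matrices\<close>

text \<open>Square matrices form a type of their own because the product on \<open>'a^'n^'n\<close> as an instance of
  the ring classes is componentwise.\<close>

typedef ('a, 'n) smat = "UNIV :: ('n \<Rightarrow> 'n \<Rightarrow> 'a) set"
  morphisms entry smat_of ..

setup_lifting type_definition_smat

lemma smat_eqI: "(\<And>i j. entry A i j = entry B i j) \<Longrightarrow> A = B"
  by (metis entry_inject ext)

instantiation smat :: (comm_ring_1, finite) ring_1
begin
lift_definition zero_smat :: "('a, 'b) smat" is "\<lambda>i j. 0" .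
lift_definition one_smat :: "('a, 'b) smat" is "\<lambda>i j. if i = j then 1 else 0" .
lift_definition plus_smat :: "('a, 'b) smat \<Rightarrow> ('a, 'b) smat \<Rightarrow> ('a, 'b) smat"
  is "\<lambda>A B i j. A i j + B i j" .
lift_definition minus_smat :: "('a, 'b) smat \<Rightarrow> ('a, 'b) smat \<Rightarrow> ('a, 'b) smat"
  is "\<lambda>A B i j. A i j - B i j" .
lift_definition uminus_smat :: "('a, 'b) smat \<Rightarrow> ('a, 'b) smat" is "\<lambda>A i j. - A i j" .
lift_definition times_smat :: "('a, 'b) smat \<Rightarrow> ('a, 'b) smat \<Rightarrow> ('a, 'b) smat"
  is "\<lambda>A B i j. \<Sum>k\<in>UNIV. A i k * B k j" .
instance
proof
  fix A B C :: "('a, 'b) smat"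
  show "A * B * C = A * (B * C)"
  proof transfer
    fix A B C :: "'b \<Rightarrow> 'b \<Rightarrow> 'a"
    have "(\<Sum>k\<in>UNIV. (\<Sum>l\<in>UNIV. A i l * B l k) * C k j) = (\<Sum>l\<in>UNIV. A i l * (\<Sum>k\<in>UNIV. B l k * C k j))"
      for i j
      by (simp add: sum_distrib_left sum_distrib_right mult.assoc) (rule sum.swap)
    then show "(\<lambda>i j. \<Sum>k\<in>UNIV. (\<Sum>l\<in>UNIV. A i l * B l k) * C k j) =
        (\<lambda>i j. \<Sum>l\<in>UNIV. A i l * (\<Sum>k\<in>UNIV. B l k * C k j))" by blast
  qed
  show "1 * A = A" "A * 1 = A"
    by (transfer; simp add: fun_eq_iff if_distrib if_distribR sum.delta sum.delta' cong: if_cong)+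
  show "(A + B) * C = A * C + B * C" "A * (B + C) = A * B + A * C"
    by (transfer; simp add: fun_eq_iff algebra_simps sum.distrib)+
  show "(0 :: ('a, 'b) smat) \<noteq> 1"
    by transfer (auto simp: fun_eq_iff)
qed (transfer; simp add: fun_eq_iff algebra_simps)+
end

lift_definition sc :: "'a::comm_ring_1 \<Rightarrow> ('a, 'n) smat \<Rightarrow> ('a, 'n::finite) smat"
  is "\<lambda>c A i j. c * A i j" .

lemma entry_simps [simp]:
  "entry 0 i j = 0" "entry 1 i j = (if i = j then 1 else 0)"
  "entry (A + B) i j = entry A i j + entry B i j" "entry (A - B) i j = entry A i j - entry B i j"
  "entry (- A) i j = - entry A i j" "entry (sc c A) i j = c * entry A i j"
  by (transfer; simp)+

lemma entry_mult: "entry (A * B) i j = (\<Sum>k\<in>UNIV. entry A i k * entry B k j)"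
  by transfer simp

lemma entry_sum [simp]: "entry (sum f S) i j = (\<Sum>x\<in>S. entry (f x) i j)"
  by (induction S rule: infinite_finite_induct) auto

lemma entry_smat_of [simp]: "entry (smat_of f) i j = f i j"
  by (simp add: smat_of_inverse)

lemma sc_simps [simp]: "sc c A * B = sc c (A * B)" "A * sc c B = sc c (A * B)" "sc 0 A = 0" "sc 1 A = A"
  by (auto intro!: smat_eqI simp: entry_mult sum_distrib_left algebra_simps)

section \<open>Traces of nilpotent matrices\<close>

definition tr :: "('a::comm_ring_1, 'n::finite) smat \<Rightarrow> 'a" where "tr A = (\<Sum>i\<in>UNIV. entry A i i)"

lemma tr_simps [simp]: "tr 0 = 0" "tr (A + B) = tr A + tr B" "tr (A - B) = tr A - tr B"
  "tr (- A) = - tr A" "tr (sc c A) = c * tr A"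
  by (auto simp: tr_def sum.distrib sum_subtractf sum_negf sum_distrib_left)

lemma tr_sum: "tr (sum f S) = (\<Sum>x\<in>S. tr (f x))"
  by (induction S rule: infinite_finite_induct) auto

lemma tr_mult: "tr (A * B) = (\<Sum>i\<in>UNIV. \<Sum>k\<in>UNIV. entry A i k * entry B k i)"
  by (simp add: tr_def entry_mult)

lemma tr_mult_commute: "tr (A * B) = tr (B * A)"
  unfolding tr_mult by (subst sum.swap) (simp add: mult.commute)

text \<open>\<open>G\<close> comes from a linear right inverse of the map on its range. The
  idempotent \<open>G * F\<close> has the same kernel as \<open>F\<close>, so multiplying by it
  models the quotient by this kernel without changing the basis or the size of the matrices.\<close>

lemma generalized_inverse:
  fixes F :: "('a::field, 'n::finite) smat"
  shows "\<exists>G. F * G * F = F"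
proof -
  define M :: "'a^'n^'n" where "M = (\<chi> i j. entry F i j)"
  obtain g where g: "Vector_Spaces.linear (*s) (*s) g" "\<And>v. v \<in> range ((*v) M) \<Longrightarrow> M *v g v = v"
    using vec.linear_exists_right_inverse_on[OF matrix_vector_mul_linear_gen vec.subspace_UNIV, of M] by metis
  define G where "G = smat_of (\<lambda>i j. matrix g $ i $ j)"
  have "M *v (matrix g *v (M *v x)) = M *v x" for x
    using g(2)[of "M *v x"] by (simp add: matrix_works[OF g(1)])
  then have "M ** matrix g ** M = M"
    by (simp add: matrix_eq flip: matrix_vector_mul_assoc)
  then have "entry (F * G * F) i j = entry F i j" for i j
    by (simp add: vec_eq_iff matrix_matrix_mult_def entry_mult M_def G_def)
  then show ?thesis
    by (blast intro: smat_eqI)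
qed

text \<open>\<open>F1\<close> acts on the image of the projection \<open>G * F\<close> as
  \<open>F\<close> acts on the quotient by its kernel. This lowers the nilpotency exponent by one,
  and cyclicity of the trace applied to \<open>F * (G * F)\<close> gives
  \<open>tr F = tr F1\<close>.\<close>

lemma nilpotent_trace:
  fixes F :: "('a::field, 'n::finite) smat"
  shows "F ^ N = 0 \<Longrightarrow> tr F = 0"
proof (induction N arbitrary: F)
  case (Suc N)
  obtain G where G: "F * G * F = F" using generalized_inverse by blast
  define F1 where "F1 = G * F * F"
  have FQ: "F * (G * F) = F" using G by (simp only: mult.assoc)
  have pw: "F1 ^ k * (G * F) = G * F ^ Suc k" for k
  proof (induction k)
    case (Suc k)
    have "F1 ^ Suc k * (G * F) = F1 ^ k * (G * F) * (F * (G * F))"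
      by (simp only: F1_def mult.assoc power_Suc2)
    also have "\<dots> = F1 ^ k * (G * F) * F" by (simp only: FQ)
    also have "\<dots> = G * F ^ Suc k * F" by (simp only: Suc)
    finally show ?case by (simp only: mult.assoc power_Suc2)
  qed simp
  \<comment> \<open>The exponent 0 is excluded because \<open>F1 ^ 0\<close> is 1. In that case the
    assumption says that \<open>F\<close> itself is 0.\<close>
  have "F1 ^ N = 0" if N: "N > 0"
  proof -
    obtain m where m: "N = Suc m" using N by (cases N) auto
    have "F1 ^ N = F1 ^ m * (G * F) * F" by (simp only: m F1_def mult.assoc power_Suc2)
    also have "\<dots> = G * F ^ Suc N" by (simp only: pw m) (simp only: mult.assoc power_Suc2)
    finally show ?thesis using Suc.prems by simp
  qed
  have "tr F = tr F1"
    unfolding F1_def by (subst FQ[symmetric]) (rule tr_mult_commute)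
  show ?case
  proof (cases "N = 0")
    case True then show ?thesis using Suc.prems by simp
  next
    case False
    then show ?thesis using Suc.IH[of F1] \<open>N > 0 \<Longrightarrow> F1 ^ N = 0\<close> \<open>tr F = tr F1\<close> by simp
  qed
qed simp

text \<open>Informally: in a basis adapted to the filtration by the kernels of the powers of \<open>F\<close>, the
  matrix \<open>F * d B\<close> is strictly triangular up to the trace of a commutator. Multiplying by the
  projection \<open>G * F\<close> passes to the quotient by the kernel of \<open>F\<close>.\<close>

lemma nilpotent_trace_derivation:
  fixes F B :: "('a::field, 'n::finite) smat"
  assumes d_add: "\<And>x y. d (x + y) = d x + d y" and d_mult: "\<And>x y. d (x * y) = d x * y + x * d y"
    and "F ^ N = 0" "F * B = B * F"
  shows "tr (F * smat_of (\<lambda>i j. d (entry B i j))) = 0"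
proof -
  define \<delta> where "\<delta> A = smat_of (\<lambda>i j. d (entry A i j))" for A :: "('a, 'n) smat"
  have d0: "d 0 = 0" 
  proof -
    have "d 0 + d 0 = d 0 + 0" using d_add[of 0 0] by (simp only: add_0_right)
    then show ?thesis by (rule add_left_imp_eq)
  qed
  have d_sum: "d (sum f S) = (\<Sum>x\<in>S. d (f x))" for f :: "'n \<Rightarrow> 'a" and S
    by (induction S rule: infinite_finite_induct) (auto simp: d0 d_add)
  have \<delta>: "\<delta> (A * C) = \<delta> A * C + A * \<delta> C" for A C
    by (rule smat_eqI) (simp add: \<delta>_def entry_mult d_sum d_mult sum.distrib)
  have "F ^ N = 0 \<Longrightarrow> F * B = B * F \<Longrightarrow> tr (F * \<delta> B) = 0"
  proof (induction N arbitrary: F B)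
    case (Suc N)
    obtain G where G: "F * G * F = F" using generalized_inverse by blast
    define Q where "Q = G * F"
    have FQ: "F * Q = F" using G by (simp only: Q_def mult.assoc)
    \<comment> \<open>\<open>B\<close> commutes with \<open>F\<close>, hence preserves the kernel of
      \<open>F\<close>. This kernel is the image of \<open>1 - Q\<close>, and \<open>Q\<close> kills
      it.\<close>
    have QB: "Q * B = Q * B * Q"
      by (metis FQ Q_def Suc.prems(2) mult.assoc)
    define F1 B1 where "F1 = Q * F" and "B1 = Q * B"
    have pw: "F1 ^ k * Q = G * F ^ Suc k" for k
    proof (induction k)
      case (Suc k)
      have "F1 ^ Suc k * Q = F1 ^ k * Q * (F * Q)" by (simp only: F1_def mult.assoc power_Suc2)
      also have "\<dots> = G * F ^ Suc k * F" by (simp only: FQ Suc)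
      finally show ?case by (simp only: mult.assoc power_Suc2)
    qed (simp add: Q_def)
    have nil: "F1 ^ N = 0" if N: "N > 0"
    proof -
      obtain m where m: "N = Suc m" using N by (cases N) auto
      have "F1 ^ N = F1 ^ m * Q * F" by (simp only: m F1_def mult.assoc power_Suc2)
      also have "\<dots> = G * F ^ Suc N" by (simp only: pw m) (simp only: mult.assoc power_Suc2)
      finally show ?thesis using Suc.prems by simp
    qed
    have comm: "F1 * B1 = B1 * F1"
      by (metis B1_def F1_def FQ QB Suc.prems(2) mult.assoc)
    have 1: "Q * \<delta> B = \<delta> B1 - \<delta> Q * B" by (simp add: B1_def \<delta>)
    have 2: "\<delta> B1 = \<delta> B1 * Q + B1 * \<delta> Q" using \<delta>[of B1 Q] QB by (simp add: B1_def)
    \<comment> \<open>The projection \<open>Q\<close> is not constant for the derivation, so two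
      terms with \<open>\<delta> Q\<close> appear. They cancel, because
      \<open>F * B1 = F * B\<close> and \<open>F\<close> commutes with \<open>B\<close>.\<close>
    have "tr (F * \<delta> B) = tr (F * (Q * \<delta> B))" by (simp only: FQ flip: mult.assoc)
    also have "\<dots> = tr (F * \<delta> B1) - tr (F * (\<delta> Q * B))" by (simp add: 1 right_diff_distrib)
    also have "tr (F * \<delta> B1) = tr (F * (\<delta> B1 * Q)) + tr (F * B1 * \<delta> Q)"
      by (subst 2) (simp add: distrib_left mult.assoc)
    also have "F * B1 = F * B" by (simp only: B1_def FQ flip: mult.assoc)
    also have "tr (F * (\<delta> Q * B)) = tr (F * B * \<delta> Q)"
      by (subst mult.assoc[symmetric], subst tr_mult_commute) (simp only: Suc.prems(2) flip: mult.assoc)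
    also have "tr (F * (\<delta> B1 * Q)) = tr (F1 * \<delta> B1)"
      unfolding F1_def by (subst mult.assoc[symmetric], subst tr_mult_commute) (simp only: mult.assoc)
    finally have eq: "tr (F * \<delta> B) = tr (F1 * \<delta> B1)" by simp
    show ?case
    proof (cases "N = 0")
      case False then show ?thesis using Suc.IH[OF nil comm] eq by simp
    qed (use Suc.prems in simp)
  qed simp
  with assms show ?thesis by (simp add: \<delta>_def)
qed

subsection \<open>Idempotents\<close>

text \<open>The trace is the rank, obtained by splitting off idempotents of rank one: if the entry
  \<open>(p, q)\<close> of \<open>E\<close> is nonzero, then column \<open>q\<close> times row
  \<open>p\<close>, divided by that entry, is an idempotent \<open>R\<close> of trace 1 with
  \<open>E * R = R * E = R\<close>. The induction is on the dimension of the space of fixed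
  vectors.\<close>

lemma idempotent_trace:
  fixes E :: "('a::field, 'n::finite) smat"
  shows "E * E = E \<Longrightarrow> \<exists>k. tr E = of_nat k \<and> (k = 0 \<longrightarrow> E = 0)"
proof (induction "vec.dim {x. \<forall>i. (\<Sum>j\<in>UNIV. entry E i j * x $ j) = x $ i}" arbitrary: E rule: less_induct)
  case less
  define S where "S E = {x::'a^'n. \<forall>i. (\<Sum>j\<in>UNIV. entry E i j * x $ j) = x $ i}" for E
  have sub: "vec.subspace (S E)" for E
    unfolding vec.subspace_def S_def
    by (auto simp: algebra_simps sum.distrib mult.left_commute simp flip: sum_distrib_left)
  show ?case
  proof (cases "E = 0")
    case False
    then obtain p q where pq: "entry E p q \<noteq> 0" by (metis smat_eqI entry_simps(1))
    define R where "R = smat_of (\<lambda>i j. entry E i q * entry E p j / entry E p q)"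
    have idem: "(\<Sum>k\<in>UNIV. entry E i k * entry E k j) = entry E i j" for i j
      using less.prems by (metis entry_mult)
    have ER: "E * R = R"
      by (rule smat_eqI) (simp add: R_def entry_mult idem flip: sum_divide_distrib sum_distrib_right mult.assoc)
    have RE: "R * E = R"
      by (rule smat_eqI) (simp add: R_def entry_mult idem mult.assoc
          flip: sum_divide_distrib sum_distrib_left)
    have RR: "R * R = R"
    proof (rule smat_eqI)
      fix i j
      have "entry (R * R) i j = (\<Sum>k\<in>UNIV. entry E i q * entry E p j / (entry E p q * entry E p q) * (entry E p k * entry E k q))"
        by (simp add: R_def entry_mult algebra_simps)
      also have "\<dots> = entry R i j" using pq by (simp only: idem R_def entry_smat_of flip: sum_distrib_left) simp
      finally show "entry (R * R) i j = entry R i j" .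
    qed
    have trR: "tr R = 1"
      using pq by (simp add: tr_def R_def idem mult.commute[of _ "entry E p _"] flip: sum_divide_distrib)
    let ?v = "(\<chi> i. entry E i q) :: 'a^'n"
    have v: "?v \<in> S E" by (simp add: S_def idem)
    \<comment> \<open>Column \<open>q\<close> of \<open>E\<close> is fixed by \<open>E\<close>, but
      \<open>E - R\<close> sends it to a vector whose coordinate \<open>p\<close> is 0. This makes
      the dimension drop strictly.\<close>
    have nv: "?v \<notin> S (E - R)"
    proof
      assume "?v \<in> S (E - R)"
      then have "(\<Sum>j\<in>UNIV. entry (E - R) p j * entry E j q) = entry E p q" by (simp add: S_def)
      moreover have "(\<Sum>j\<in>UNIV. entry (E - R) p j * entry E j q) = entry ((E - R) * E) p q"
        by (simp add: entry_mult)
      moreover have "entry ((E - R) * E) p q = 0"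
        using pq by (simp only: left_diff_distrib less.prems RE) (simp add: R_def)
      ultimately show False using pq by simp
    qed
    have idem': "(E - R) * (E - R) = E - R"
      by (simp add: algebra_simps less.prems ER RE RR)
    have "S (E - R) \<subseteq> S E"
    proof
      fix x assume x: "x \<in> S (E - R)"
      have E': "E * (E - R) = E - R" by (simp add: algebra_simps less.prems ER)
      have "(\<Sum>j\<in>UNIV. entry E i j * x $ j) = x $ i" for i
      proof -
        have "(\<Sum>j\<in>UNIV. entry E i j * x $ j) = (\<Sum>j\<in>UNIV. entry E i j * (\<Sum>k\<in>UNIV. entry (E - R) j k * x $ k))"
          using x unfolding S_def by simp
        also have "\<dots> = (\<Sum>k\<in>UNIV. entry (E * (E - R)) i k * x $ k)"
          by (simp only: entry_mult sum_distrib_left sum_distrib_right mult.assoc) (rule sum.swap)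
        finally show ?thesis using x unfolding E' by (simp add: S_def)
      qed
      then show "x \<in> S E" by (simp add: S_def)
    qed
    then have "S (E - R) \<subset> S E" using v nv by blast
    then have "vec.dim (S (E - R)) < vec.dim (S E)"
      by (intro vec.dim_psubset) (simp add: vec.span_eq_iff[THEN iffD2, OF sub])
    from less.hyps[OF this[unfolded S_def] idem'] obtain k where "tr (E - R) = of_nat k" by blast
    then have "tr E = of_nat (Suc k)" using trR by (simp add: algebra_simps)
    then show ?thesis by blast
  qed (auto intro: exI[of _ 0])
qed

lemma idempotent_trace_0:
  fixes E :: "('a::field_char_0, 'n::finite) smat"
  assumes "E * E = E" "tr E = 0" shows "E = 0"
  using idempotent_trace[OF assms(1)] assms(2) by auto

text \<open>The powers up to the real dimension of the matrix space are linearly dependent over the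
  reals. The lowest power in a relation is a polynomial multiple of the next one. Since
  \<open>Q\<close> is a polynomial in \<open>H\<close>, it commutes with whatever commutes with
  \<open>H\<close>. The bound on \<open>s\<close> depends on the size of the matrix only, so later
  exponents are uniform in \<open>t\<close>.\<close>

lemma power_eq_Suc_mult:
  fixes H :: "(complex, 'n::finite) smat"
  shows "\<exists>s\<le>DIM(complex^'n^'n). \<exists>Q. H ^ s = H ^ Suc s * Q \<and> (\<forall>X. X * H = H * X \<longrightarrow> X * Q = Q * X)"
proof -
  define v where "v i = (\<chi> p q. entry (H ^ i) p q)" for i :: nat
  define D where "D = DIM(complex^'n^'n)"
  have v_eq: "H ^ i = H ^ j" if "v i = v j" for i j
    using that by (intro smat_eqI) (simp add: v_def vec_eq_iff)
  have pow_commute: "X * H ^ i = H ^ i * X" if "X * H = H * X" for X i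
    using that by (metis power_commuting_commutes)
  show ?thesis
  \<comment> \<open>Linear dependence is stated for the set of powers, so a coincidence of two
    powers is treated separately. There \<open>Q\<close> is a single power of
    \<open>H\<close>.\<close>
  proof (cases "inj_on v {..D}")
    case False
    then obtain i j where ij: "i < j" "j \<le> D" "v i = v j"
      unfolding inj_on_def by (metis atMost_iff linorder_neqE_nat)
    have "H ^ i = H ^ Suc i * H ^ (j - Suc i)"
      using v_eq[OF ij(3)] ij(1) by (simp flip: power_add power_Suc)
    then have "H ^ i = H ^ Suc i * H ^ (j - Suc i) \<and> (\<forall>X. X * H = H * X \<longrightarrow> X * H ^ (j - Suc i) = H ^ (j - Suc i) * X)"
      using pow_commute by blast
    then show ?thesis using ij(1,2) unfolding D_def by (intro exI[of _ i]) auto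
  next
    case True
    have "dependent (v ` {..D})"
    proof (rule dependent_biggerset)
      show "card (v ` {..D}) > DIM(complex^'n^'n)" using card_image[OF True] by (simp add: D_def)
    qed
    then obtain u where u: "(\<Sum>x\<in>v ` {..D}. u x *\<^sub>R x) = 0" "\<exists>x\<in>v ` {..D}. u x \<noteq> 0"
      by (auto simp: dependent_finite)
    define c where "c i = u (v i)" for i
    have sum0: "(\<Sum>i\<le>D. c i *\<^sub>R v i) = 0" using u(1) by (simp add: sum.reindex[OF True] c_def)
    have ex: "\<exists>i. i \<le> D \<and> c i \<noteq> 0" using u(2) by (auto simp: c_def)
    define s where "s = (LEAST i. i \<le> D \<and> c i \<noteq> 0)"
    have s: "s \<le> D" "c s \<noteq> 0" using LeastI_ex[OF ex] by (auto simp: s_def)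
    have below: "c i = 0" if "i < s" for i
      using not_less_Least[of i "\<lambda>i. i \<le> D \<and> c i \<noteq> 0"] that s(1) by (auto simp: s_def)
    define Q where "Q = (\<Sum>i\<in>{Suc s..D}. sc (- of_real (c i) / of_real (c s)) (H ^ (i - Suc s)))"
    have "H ^ s = H ^ Suc s * Q"
    proof (rule smat_eqI)
      fix p q
      have "(\<Sum>i\<le>D. of_real (c i) * entry (H ^ i) p q) = (0::complex)"
        using arg_cong[OF sum0, of "\<lambda>x. x $ p $ q"] by (simp add: v_def scaleR_conv_of_real[symmetric])
      also have "(\<Sum>i\<le>D. of_real (c i) * entry (H ^ i) p q) =
         (\<Sum>i\<in>{s..D}. of_real (c i) * entry (H ^ i) p q)"
        by (rule sum.mono_neutral_right) (auto simp: below)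
      also have "\<dots> = of_real (c s) * entry (H ^ s) p q +
          (\<Sum>i\<in>{Suc s..D}. of_real (c i) * entry (H ^ i) p q)"
        using s(1) by (simp add: sum.atLeast_Suc_atMost)
      finally have "of_real (c s) * entry (H ^ s) p q =
          - (\<Sum>i\<in>{Suc s..D}. of_real (c i) * entry (H ^ i) p q)"
        by (simp add: eq_neg_iff_add_eq_0)
      then have "entry (H ^ s) p q = (\<Sum>i\<in>{Suc s..D}. (- of_real (c i) / of_real (c s)) * entry (H ^ i) p q)"
        using s(2) by (simp add: field_simps sum_negf flip: sum_divide_distrib)
      also have "\<dots> = (\<Sum>i\<in>{Suc s..D}. entry (H ^ Suc s * sc (- of_real (c i) / of_real (c s)) (H ^ (i - Suc s))) p q)"
        by (rule sum.cong) (auto simp flip: power_add power_Suc)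
      also have "\<dots> = entry (H ^ Suc s * Q) p q"
        by (simp add: Q_def sum_distrib_left del: power_Suc)
      finally show "entry (H ^ s) p q = entry (H ^ Suc s * Q) p q" .
    qed
    moreover have "X * Q = Q * X" if "X * H = H * X" for X
      unfolding Q_def using pow_commute[OF that] by (simp add: sum_distrib_left sum_distrib_right)
    ultimately show ?thesis using s(1) unfolding D_def by blast
  qed
qed

text \<open>The Fitting decomposition: \<open>E\<close> is the projection onto the part where \<open>H\<close> is invertible.\<close>

lemma fitting_idempotent:
  fixes H :: "(complex, 'n::finite) smat"
  obtains E W where "E * E = E" "E = H * W" "H ^ Suc (DIM(complex^'n^'n)) * E = H ^ Suc (DIM(complex^'n^'n))"
    "\<And>X. X * H = H * X \<Longrightarrow> X * E = E * X \<and> X * W = W * X"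
proof -
  obtain s Q where s: "s \<le> DIM(complex^'n^'n)" and Q: "H ^ s = H ^ Suc s * Q"
    and comm: "\<And>X. X * H = H * X \<Longrightarrow> X * Q = Q * X"
    using power_eq_Suc_mult by blast
  have HQ: "H * Q = Q * H" using comm by blast
  \<comment> \<open>\<open>r\<close> is at least 1, so that a factor \<open>H\<close> can be split
    off from \<open>E = T ^ r\<close>; the remaining factors make up \<open>W\<close>.\<close>
  define r T where "r = Suc s" and "T = H * Q"
  have Q': "H ^ r = H ^ r * T"
  proof -
    have "H ^ r = H * (H ^ Suc s * Q)" by (simp only: r_def power_Suc flip: Q[unfolded power_Suc])
    also have "\<dots> = H * H ^ r * Q" by (simp only: r_def mult.assoc)
    also have "\<dots> = H ^ r * H * Q" by (simp only: power_commutes)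
    finally show ?thesis by (simp only: T_def mult.assoc)
  qed
  have pw: "H ^ r * T ^ k = H ^ r" for k
    by (induction k) (simp_all add: mult.assoc[symmetric] flip: Q')
  have QHk: "Q * H ^ k = H ^ k * Q" for k
    using HQ by (metis power_commuting_commutes)
  have Tk: "T ^ k = Q ^ k * H ^ k" for k
  proof (induction k)
    case (Suc k)
    have "T ^ Suc k = Q ^ k * (H ^ Suc k * Q)" by (simp only: power_Suc2 Suc mult.assoc) (simp only: T_def)
    also have "\<dots> = Q ^ Suc k * H ^ Suc k" by (simp only: power_Suc2[of Q] mult.assoc flip: QHk)
    finally show ?case .
  qed simp
  \<comment> \<open>\<open>T ^ r\<close> equals \<open>Q ^ r * H ^ r\<close> and
    \<open>H ^ r\<close> absorbs powers of \<open>T\<close> on its right, which makes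
    \<open>E\<close> idempotent.\<close>
  define E W where "E = T ^ r" and "W = Q * T ^ s"
  have 1: "E * E = E"
  proof -
    have "E * E = Q ^ r * H ^ r * T ^ r" unfolding E_def by (rule arg_cong[OF Tk, of "\<lambda>x. x * T ^ r"])
    also have "\<dots> = Q ^ r * H ^ r" by (simp only: pw mult.assoc)
    finally show ?thesis by (simp only: E_def Tk)
  qed
  have 2: "E = H * W" by (simp add: E_def W_def r_def T_def mult.assoc)
  have 3: "H ^ Suc (DIM(complex^'n^'n)) * E = H ^ Suc (DIM(complex^'n^'n))"
  proof -
    have "H ^ Suc (DIM(complex^'n^'n)) = H ^ (Suc (DIM(complex^'n^'n)) - r) * H ^ r"
      using s by (simp add: r_def flip: power_add power_Suc)
    then show ?thesis unfolding E_def by (simp only: mult.assoc pw)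
  qed
  have 4: "X * E = E * X \<and> X * W = W * X" if X: "X * H = H * X" for X
  proof -
    have a: "X * T = T * X" unfolding T_def using X comm[OF X] by (metis mult.assoc)
    then have b: "X * T ^ k = T ^ k * X" for k by (metis power_commuting_commutes)
    then show ?thesis unfolding E_def W_def using comm[OF X] by (metis mult.assoc)
  qed
  show ?thesis using that 1 2 3 4 by blast
qed

subsection \<open>Joint eigenvectors\<close>

text \<open>Among all nonzero polynomials in \<open>T\<close> that kill some nonzero vector
  \<open>w\<close> of \<open>S\<close>, one of minimal degree is not constant. Splitting off a root
  \<open>z\<close> leaves a quotient that does not kill \<open>w\<close> by minimality, and it maps
  \<open>w\<close> to an eigenvector for \<open>z\<close>. Only vectors of \<open>S\<close> occur,
  so no restriction of \<open>T\<close> has to be formed.\<close>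

lemma eigenvector_exists:
  fixes T :: "complex^'n \<Rightarrow> complex^'n"
  assumes T: "Vector_Spaces.linear (*s) (*s) T" and S: "vec.subspace S" "S \<noteq> {0}" "\<And>x. x \<in> S \<Longrightarrow> T x \<in> S"
  obtains w c where "w \<in> S" "w \<noteq> 0" "T w = c *s w"
proof -
  interpret T: Vector_Spaces.linear "(*s)" "(*s)" T by (rule T)
  define ev where "ev p w = (\<Sum>i\<le>degree p. coeff p i *s (T ^^ i) w)" for p w
  have ev_le: "ev p w = (\<Sum>i\<le>N. coeff p i *s (T ^^ i) w)" if "degree p \<le> N" for p w N
    unfolding ev_def using that
    by (intro sum.mono_neutral_left) (auto simp: coeff_eq_0)
  have inv: "(T ^^ i) w \<in> S" if "w \<in> S" for i w by (induction i) (auto simp: that S)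
  have evS: "ev p w \<in> S" if "w \<in> S" for p w
    unfolding ev_def by (intro vec.subspace_sum vec.subspace_scale inv that S)
  have mult: "ev ([:- z, 1:] * q) w = T (ev q w) - z *s ev q w" for z q w
  proof -
    let ?N = "degree q"
    have "degree ([:- z, 1:] * q) \<le> Suc ?N"
      by (rule order_trans[OF degree_mult_le]) simp
    then have "ev ([:- z, 1:] * q) w = (\<Sum>i\<le>Suc ?N. coeff ([:- z, 1:] * q) i *s (T ^^ i) w)"
      by (rule ev_le)
    also have "\<dots> = (\<Sum>i\<le>Suc ?N. coeff (pCons 0 q) i *s (T ^^ i) w) - (\<Sum>i\<le>Suc ?N. (z * coeff q i) *s (T ^^ i) w)"
      by (simp add: sum_subtractf[symmetric] algebra_simps vector_sub_rdistrib del: sum.atMost_Suc)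
    also have "(\<Sum>i\<le>Suc ?N. coeff (pCons 0 q) i *s (T ^^ i) w) = T (ev q w)"
      unfolding ev_def by (subst sum.atMost_Suc_shift) (simp add: T.sum T.scale)
    also have "(\<Sum>i\<le>Suc ?N. (z * coeff q i) *s (T ^^ i) w) = z *s ev q w"
      by (simp add: ev_def coeff_eq_0 vec.scale_sum_right)
    finally show ?thesis .
  qed
  obtain w0 where w0: "w0 \<in> S" "w0 \<noteq> 0" using S vec.subspace_0[OF S(1)] by blast
  have "\<exists>p. p \<noteq> 0 \<and> (\<exists>w\<in>S. w \<noteq> 0 \<and> ev p w = 0)"
  proof (cases "inj_on (\<lambda>i. (T ^^ i) w0) {..CARD('n)}")
    case False
    then obtain i j where ij: "i < j" "(T ^^ i) w0 = (T ^^ j) w0"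
      unfolding inj_on_def by (metis linorder_neqE_nat)
    define p where "p = monom 1 j - (monom 1 i :: complex poly)"
    have deg: "degree p \<le> j" unfolding p_def using ij(1) by (intro degree_diff_le) (auto simp: degree_monom_eq)
    have "ev p w0 = (\<Sum>k\<le>j. (if k = j then (T ^^ j) w0 else 0) - (if k = i then (T ^^ i) w0 else 0))"
      unfolding ev_le[OF deg] by (intro sum.cong) (auto simp: p_def)
    also have "\<dots> = 0" using ij by (simp add: sum_subtractf)
    finally have "ev p w0 = 0" .
    moreover have "coeff p j \<noteq> 0" using ij(1) by (simp add: p_def)
    then have "p \<noteq> 0" by auto
    ultimately show ?thesis using w0 by blast
  next
    case True
    let ?B = "(\<lambda>i. (T ^^ i) w0) ` {..CARD('n)}"
    have "vec.dependent ?B"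
    proof (rule ccontr)
      assume "vec.independent ?B"
      then have "card ?B \<le> vec.dim (UNIV :: (complex^'n) set)"
        by (metis vec.independent_card_le_dim subset_UNIV)
      then show False using card_image[OF True] by (simp add: vec.dim_UNIV card_cart_basis)
    qed
    then obtain u where u: "(\<Sum>x\<in>?B. u x *s x) = 0" "\<exists>x\<in>?B. u x \<noteq> 0"
      by (auto simp: vec.dependent_finite)
    define p where "p = (\<Sum>i\<le>CARD('n). monom (u ((T ^^ i) w0)) i)"
    have cp: "coeff p k = (if k \<le> CARD('n) then u ((T ^^ k) w0) else 0)" for k
      by (simp add: p_def coeff_sum sum.delta if_distrib cong: if_cong)
    have deg: "degree p \<le> CARD('n)" by (rule degree_le) (simp add: cp)
    have "ev p w0 = 0" unfolding ev_le[OF deg] using u(1) by (simp add: cp sum.reindex[OF True])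
    moreover have "p \<noteq> 0" using u(2) cp by (metis (no_types, lifting) atMost_iff coeff_0 imageE)
    ultimately show ?thesis using w0 by blast
  qed
  then obtain p where p: "p \<noteq> 0 \<and> (\<exists>w\<in>S. w \<noteq> 0 \<and> ev p w = 0)"
    and min: "\<And>q. q \<noteq> 0 \<and> (\<exists>w\<in>S. w \<noteq> 0 \<and> ev q w = 0) \<Longrightarrow> degree p \<le> degree q"
    using arg_min_nat_lemma[of "\<lambda>p. p \<noteq> 0 \<and> (\<exists>w\<in>S. w \<noteq> 0 \<and> ev p w = 0)" _ degree] by (metis (no_types, lifting))
  obtain w where w: "w \<in> S" "w \<noteq> 0" "ev p w = 0" using p by blast
  have "degree p \<noteq> 0"
  proof
    assume "degree p = 0"
    then have "coeff p 0 \<noteq> 0" using p leading_coeff_neq_0 by metis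
    then show False using w \<open>degree p = 0\<close> by (simp add: ev_def)
  qed
  then have "\<exists>i\<in>{1..degree p}. coeff p i \<noteq> 0"
    using p by (intro bexI[of _ "degree p"]) (auto simp: Suc_le_eq)
  then obtain z where "(\<Sum>i\<le>degree p. coeff p i * z ^ i) = 0"
    using fundamental_theorem_of_algebra[of "coeff p" "degree p"] by blast
  then have "poly p z = 0" by (simp add: poly_altdef)
  then obtain q where q: "p = [:- z, 1:] * q" by (auto simp: poly_eq_0_iff_dvd)
  have "q \<noteq> 0" using p q by auto
  then have "degree q < degree p" unfolding q by (subst degree_mult_eq) auto
  then have "ev q w \<noteq> 0" using min[of q] \<open>q \<noteq> 0\<close> w by force
  moreover have "T (ev q w) = z *s ev q w" using w(3) unfolding q mult by simp
  ultimately show ?thesis using that evS[OF w(1)] by blast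
qed

text \<open>On a nonzero invariant subspace of minimal dimension every \<open>T i\<close> is a
  scalar: an eigenspace of \<open>T i\<close> inside it is invariant under the commuting operators
  and therefore is everything.\<close>

lemma joint_eigenvector_exists:
  fixes T :: "'i \<Rightarrow> complex^'n \<Rightarrow> complex^'n"
  assumes T: "\<And>i. Vector_Spaces.linear (*s) (*s) (T i)" and S: "vec.subspace S" "S \<noteq> {0}"
    and inv: "\<And>i x. x \<in> S \<Longrightarrow> T i x \<in> S" and comm: "\<And>i j x. T i (T j x) = T j (T i x)"
  obtains w c where "w \<in> S" "w \<noteq> 0" "\<And>i. T i w = c i *s w"
proof -
  define P where "P R \<longleftrightarrow> vec.subspace R \<and> R \<noteq> {0} \<and> R \<subseteq> S \<and> (\<forall>i. \<forall>x\<in>R. T i x \<in> R)" for R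
  have "P S" using S inv by (auto simp: P_def)
  then obtain R where R: "P R" and min: "\<And>R'. P R' \<Longrightarrow> vec.dim R \<le> vec.dim R'"
    using arg_min_nat_lemma[of P S vec.dim] by metis
  have "\<exists>c. \<forall>x\<in>R. T i x = c *s x" for i
  proof -
    interpret Ti: Vector_Spaces.linear "(*s)" "(*s)" "T i" by (rule T)
    obtain w c where w: "w \<in> R" "w \<noteq> 0" "T i w = c *s w"
      using eigenvector_exists[OF T, of R] R unfolding P_def by metis
    define R' where "R' = {x\<in>R. T i x = c *s x}"
    have "vec.subspace R'"
      using R unfolding P_def R'_def vec.subspace_def
      by (auto simp: Ti.add Ti.scale vector_add_ldistrib vector_smult_assoc mult.commute)
    moreover have "T j x \<in> R'" if "x \<in> R'" for j x
    proof -
      interpret Tj: Vector_Spaces.linear "(*s)" "(*s)" "T j" by (rule T)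
      show ?thesis using that R comm[of i j x] by (auto simp: R'_def P_def Tj.scale)
    qed
    ultimately have "P R'" using w R by (auto simp: P_def R'_def)
    then have "vec.dim R \<le> vec.dim R'" by (rule min)
    then have "R' = R"
      using R \<open>P R'\<close> vec.subspace_dim_equal[of R' R] by (auto simp: P_def R'_def)
    then show ?thesis unfolding R'_def by blast
  qed
  then obtain c where c: "\<And>i x. x \<in> R \<Longrightarrow> T i x = c i *s x" by metis
  have "R \<noteq> {0}" "0 \<in> R" using R vec.subspace_0[of R] by (auto simp: P_def)
  then obtain w where "w \<in> R" "w \<noteq> 0" by blast
  moreover have "R \<subseteq> S" using R by (simp add: P_def)
  ultimately show ?thesis using that[of w c] c by blast
qed

subsection \<open>Commutative algebras given by structure constants\<close>

text \<open>The right action of matrices on row vectors. It is the relevant one because a linear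
  form \<open>y\<close> on the algebra is multiplicative when it is an eigenvector of all
  multiplications from this side.\<close>

definition rowm :: "('n::finite \<Rightarrow> 'a::comm_ring_1) \<Rightarrow> ('a, 'n) smat \<Rightarrow> 'n \<Rightarrow> 'a" where
  "rowm y X j = (\<Sum>k\<in>UNIV. y k * entry X k j)"

lemma rowm_simps [simp]:
  "rowm y 0 = (\<lambda>_. 0)" "rowm (\<lambda>_. 0) A = (\<lambda>_. 0)" "rowm y 1 = y" "rowm y (A + B) = (\<lambda>j. rowm y A j + rowm y B j)"
  "rowm y (A - B) = (\<lambda>j. rowm y A j - rowm y B j)" "rowm y (sc c A) = (\<lambda>j. c * rowm y A j)"
  "rowm (\<lambda>j. c * y j) A = (\<lambda>j. c * rowm y A j)"
  by (auto simp: rowm_def fun_eq_iff sum.distrib sum_subtractf algebra_simps sum_distrib_left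
      if_distrib sum.delta sum.delta' cong: if_cong)

lemma rowm_sum: "rowm y (sum f S) j = (\<Sum>x\<in>S. rowm y (f x) j)"
  by (induction S rule: infinite_finite_induct) auto

lemma rowm_mult: "rowm y (A * B) = rowm (rowm y A) B"
proof
  fix j
  show "rowm y (A * B) j = rowm (rowm y A) B j"
    unfolding rowm_def entry_mult sum_distrib_left sum_distrib_right mult.assoc by (rule sum.swap)
qed

text \<open>The matrix of the multiplication with the \<open>i\<close>-th basis vector is \<open>a i\<close>, the unit is \<open>e\<close>.\<close>

locale comm_alg =
  fixes a :: "'n::finite \<Rightarrow> (complex, 'n) smat" and e :: "'n \<Rightarrow> complex"
  assumes comm: "a i * a j = a j * a i"
    and sym: "entry (a i) k j = entry (a j) k i"
    and unit: "(\<Sum>i\<in>UNIV. sc (e i) (a i)) = 1"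
begin

text \<open>These are the unital characters of the algebra, given by their values on the
  basis.\<close>

definition spec :: "('n \<Rightarrow> complex) set" where
  "spec = {y. (\<forall>i j. y i * y j = (\<Sum>k\<in>UNIV. entry (a i) k j * y k)) \<and> (\<Sum>i\<in>UNIV. e i * y i) = 1}"

text \<open>The commutant of the regular representation. By \<open>cm_expand\<close> it is the
  algebra itself.\<close>

definition cm :: "(complex, 'n) smat \<Rightarrow> bool" where
  "cm X \<longleftrightarrow> (\<forall>l. X * a l = a l * X)"

lemma cm_intros [simp, intro]: "cm 0" "cm 1" "cm (a i)" "cm A \<Longrightarrow> cm B \<Longrightarrow> cm (A + B)"
  "cm A \<Longrightarrow> cm B \<Longrightarrow> cm (A - B)" "cm A \<Longrightarrow> cm (sc c A)"
  by (auto simp: cm_def comm algebra_simps)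

lemma cm_mult [simp, intro]: "cm A \<Longrightarrow> cm B \<Longrightarrow> cm (A * B)"
  by (auto simp: cm_def) (metis mult.assoc)

lemma cm_sum [simp, intro]: "(\<And>x. x \<in> S \<Longrightarrow> cm (f x)) \<Longrightarrow> cm (sum f S)"
  by (induction S rule: infinite_finite_induct) auto

lemma a_e: "(\<Sum>j\<in>UNIV. entry (a i) k j * e j) = (if k = i then 1 else 0)"
proof -
  have "(\<Sum>j\<in>UNIV. entry (a i) k j * e j) = entry (\<Sum>j\<in>UNIV. sc (e j) (a j)) k i"
    by (simp add: sym[of i] mult.commute)
  then show ?thesis by (simp add: unit)
qed

lemma entry_mult_e: "(\<Sum>j\<in>UNIV. entry (X * Y) m j * e j) = (\<Sum>p\<in>UNIV. entry X m p * (\<Sum>j\<in>UNIV. entry Y p j * e j))"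
  unfolding entry_mult sum_distrib_left sum_distrib_right mult.assoc by (rule sum.swap)

text \<open>An operator that commutes with all multiplications is the multiplication by its value at
  the unit. Commuting \<open>X\<close> past \<open>a l\<close> and evaluating at the unit
  \<open>e\<close> gives the entries of column \<open>l\<close>.\<close>

lemma cm_expand:
  assumes "cm X" shows "X = (\<Sum>k\<in>UNIV. sc (\<Sum>j\<in>UNIV. entry X k j * e j) (a k))"
proof (rule smat_eqI)
  fix m l
  have "entry X m l = (\<Sum>j\<in>UNIV. entry (X * a l) m j * e j)"
    by (simp add: entry_mult_e a_e if_distrib sum.delta cong: if_cong)
  also have "\<dots> = (\<Sum>j\<in>UNIV. entry (a l * X) m j * e j)" using assms by (simp add: cm_def)
  also have "\<dots> = entry (\<Sum>k\<in>UNIV. sc (\<Sum>j\<in>UNIV. entry X k j * e j) (a k)) m l"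
    unfolding entry_mult_e by (simp add: sym[of l] mult.commute)
  finally show "entry X m l = entry (\<Sum>k\<in>UNIV. sc (\<Sum>j\<in>UNIV. entry X k j * e j) (a k)) m l" .
qed

lemma cm_commute:
  assumes "cm X" "cm Y" shows "X * Y = Y * X"
proof -
  have "cm X \<Longrightarrow> X * sc c (a k) = sc c (a k) * X" for c k by (simp add: cm_def)
  then show ?thesis
    by (subst (1 2) cm_expand[OF assms(2)]) (simp add: sum_distrib_left sum_distrib_right assms(1))
qed

text \<open>The product lies in the commutant and sends the unit to the product of the two basis
  vectors. In this way commuting matrices, symmetry and unit yield associativity.\<close>

lemma a_mult: "a i * a j = (\<Sum>k\<in>UNIV. sc (entry (a i) k j) (a k))"
proof -
  have "(\<Sum>l\<in>UNIV. entry (a i * a j) k l * e l) = entry (a i) k j" for k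
    by (simp add: entry_mult_e a_e if_distrib sum.delta cong: if_cong)
  then show ?thesis using cm_expand[of "a i * a j"] by simp
qed

lemma spec_rowm: "y \<in> spec \<Longrightarrow> rowm y (a i) = (\<lambda>j. y i * y j)"
  by (simp add: spec_def rowm_def fun_eq_iff mult.commute[of "y _" "entry _ _ _"])

lemma spec_nonzero: "y \<in> spec \<Longrightarrow> \<exists>j. y j \<noteq> 0"
  by (rule ccontr) (auto simp: spec_def)

lemma spec_power:
  assumes "rowm y X = (\<lambda>j. \<mu> * y j)" shows "rowm y (X ^ N) = (\<lambda>j. \<mu> ^ N * y j)"
  by (induction N) (simp_all add: rowm_mult assms mult.assoc)

text \<open>The row vectors fixed by \<open>E\<close> form a nonzero space that is invariant under
  the commuting \<open>a i\<close>, so it contains a joint eigenvector \<open>w\<close>. The tuple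
  \<open>y\<close> of eigenvalues is a character. The vector \<open>w\<close> is kept in the
  conclusion because it records that this character occurs in the part cut out by
  \<open>E\<close>.\<close>

lemma spec_exists:
  assumes E: "cm E" "E * E = E" "E \<noteq> 0"
  obtains y w where "y \<in> spec" "\<exists>j. w j \<noteq> 0" "rowm w E = w" "\<And>i. rowm w (a i) = (\<lambda>j. y i * w j)"
proof -
  define T where "T i x = (\<chi> j. rowm (($) x) (a i) j)" for i :: 'n and x :: "complex^'n"
  define S where "S = {x::complex^'n. rowm (($) x) E = ($) x}"
  have add: "rowm (\<lambda>i. x i + y i) X = (\<lambda>j. rowm x X j + rowm y X j)" for x y and X :: "(complex, 'n) smat"
    by (simp add: rowm_def fun_eq_iff algebra_simps sum.distrib)
  have lin: "Vector_Spaces.linear (*s) (*s) (T i)" for i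
    by unfold_locales (auto simp: T_def vec_eq_iff rowm_def algebra_simps sum.distrib sum_distrib_left)
  have TT: "T i (T j x) = (\<chi> k. rowm (($) x) (a j * a i) k)" for i j x
    by (simp add: T_def rowm_mult vec_eq_iff) (simp add: rowm_def)
  have sub: "vec.subspace S"
    unfolding vec.subspace_def S_def
    by (auto simp: rowm_def fun_eq_iff algebra_simps sum.distrib mult.left_commute simp flip: sum_distrib_left)
  obtain p q where pq: "entry E p q \<noteq> 0" using E(3) by (metis smat_eqI entry_simps(1))
  \<comment> \<open>A row of an idempotent is fixed by it.\<close>
  have "(\<chi> j. entry E p j) \<in> S"
    using E(2) by (auto simp: S_def rowm_def fun_eq_iff simp flip: entry_mult)
  moreover have "(\<chi> j. entry E p j) \<noteq> 0" using pq by (auto simp: vec_eq_iff)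
  ultimately have ne: "S \<noteq> {0}" by blast
  have inv: "T i x \<in> S" if "x \<in> S" for i x
  proof -
    have "rowm (rowm (($) x) (a i)) E = rowm (rowm (($) x) E) (a i)"
      using E(1) by (simp add: cm_def flip: rowm_mult)
    then show ?thesis using that by (simp add: S_def T_def) (metis (no_types, lifting) ext vec_lambda_beta)
  qed
  obtain w y where w: "w \<in> S" "w \<noteq> 0" "\<And>i. T i w = y i *s w"
    using joint_eigenvector_exists[of T S, OF lin sub ne inv] TT comm by metis
  have ev: "rowm (($) w) (a i) = (\<lambda>j. y i * w $ j)" for i
    using w(3)[of i] by (auto simp: T_def vec_eq_iff fun_eq_iff)
  obtain m where m: "w $ m \<noteq> 0" using w(2) by (auto simp: vec_eq_iff)
  \<comment> \<open>Both identities are tested on \<open>w\<close>: acting by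
    \<open>a i * a j\<close> and by the unit in two ways gives multiples of \<open>w\<close>, and a
    nonzero coordinate of \<open>w\<close> can be cancelled.\<close>
  have "y i * y j * w $ m = (\<Sum>k\<in>UNIV. entry (a i) k j * y k) * w $ m" for i j
  proof -
    have "y i * y j * w $ m = rowm (($) w) (a i * a j) m" by (simp add: rowm_mult ev)
    also have "\<dots> = (\<Sum>k\<in>UNIV. entry (a i) k j * (y k * w $ m))" by (simp add: a_mult rowm_sum ev)
    finally show ?thesis by (simp add: sum_distrib_right mult.assoc)
  qed
  moreover have "(\<Sum>i\<in>UNIV. e i * y i) * w $ m = w $ m"
  proof -
    have "w $ m = rowm (($) w) (\<Sum>i\<in>UNIV. sc (e i) (a i)) m" by (simp add: unit)
    then show ?thesis by (simp add: rowm_sum ev sum_distrib_right mult.assoc)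
  qed
  ultimately have "y \<in> spec" using m by (simp add: spec_def)
  then show ?thesis using that[of y "($) w"] m ev w(1) by (auto simp: S_def)
qed

text \<open>If the Fitting projection \<open>E = F * W\<close> were nonzero, some character would
  have an eigenvector \<open>w\<close> with \<open>w = w E\<close>. But \<open>F\<close> acts on
  \<open>w\<close> by the value of the linear form at that character, which is 0, so
  \<open>w E = 0\<close>.\<close>

lemma nilpotent_if_zero_on_spec:
  assumes "\<And>y. y \<in> spec \<Longrightarrow> (\<Sum>k\<in>UNIV. c k * y k) = 0"
  shows "(\<Sum>k\<in>UNIV. sc (c k) (a k)) ^ Suc (DIM(complex^'n^'n)) = 0"
proof -
  define F where "F = (\<Sum>k\<in>UNIV. sc (c k) (a k))"
  have cF: "cm F" by (auto simp: F_def)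
  obtain E W where E: "E * E = E" "E = F * W" "F ^ Suc (DIM(complex^'n^'n)) * E = F ^ Suc (DIM(complex^'n^'n))"
    and EW: "\<And>X. X * F = F * X \<Longrightarrow> X * E = E * X \<and> X * W = W * X"
    using fitting_idempotent[of F] by metis
  have "cm E" using EW cF by (simp add: cm_def)
  have "E = 0"
  proof (rule ccontr)
    assume "E \<noteq> 0"
    then obtain y w where w: "y \<in> spec" "\<exists>j. w j \<noteq> 0" "rowm w E = w" "\<And>i. rowm w (a i) = (\<lambda>j. y i * w j)"
      using spec_exists[OF \<open>cm E\<close> E(1)] by metis
    have "rowm w F j = (\<Sum>k\<in>UNIV. c k * y k) * w j" for j
      by (simp add: F_def rowm_sum w(4) sum_distrib_right mult.assoc)
    then have "rowm w F = (\<lambda>_. 0)" using assms[OF w(1)] by auto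
    then have "rowm w E = (\<lambda>_. 0)" unfolding E(2) rowm_mult by simp
    then show False using w by (metis)
  qed
  then show ?thesis using E(3) by (simp add: F_def)
qed

text \<open>The Fitting projection of \<open>H\<close> is \<open>H * W\<close> with \<open>W\<close>
  in the commutant, so its trace vanishes and it is 0. Then \<open>H\<close> is nilpotent and its
  eigenvalue \<open>\<mu>\<close> is 0.\<close>

lemma zero_on_spec_if_traces_zero:
  assumes H: "cm H" "\<And>B. cm B \<Longrightarrow> tr (H * B) = 0" and y: "y \<in> spec" "rowm y H = (\<lambda>j. \<mu> * y j)"
  shows "\<mu> = 0"
proof -
  obtain E W where E: "E * E = E" "E = H * W" "H ^ Suc (DIM(complex^'n^'n)) * E = H ^ Suc (DIM(complex^'n^'n))"
    and EW: "\<And>X. X * H = H * X \<Longrightarrow> X * E = E * X \<and> X * W = W * X"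
    using fitting_idempotent[of H] by metis
  have "cm W" using EW H(1) by (simp add: cm_def)
  then have "E = 0" using idempotent_trace_0[OF E(1)] H(2) E(2) by simp
  then have "H ^ Suc (DIM(complex^'n^'n)) = 0" using E(3) by simp
  then have "\<mu> ^ Suc (DIM(complex^'n^'n)) * y j = 0" for j
    using spec_power[OF y(2), of "Suc (DIM(complex^'n^'n))"] by (metis rowm_simps(1))
  moreover obtain j where "y j \<noteq> 0" using spec_nonzero[OF y(1)] by blast
  ultimately show ?thesis by (metis mult_eq_0_iff power_not_zero)
qed

end

section \<open>Holomorphic functions of several variables\<close>

lemma holo_onI:
  assumes "\<And>x. x \<in> S \<Longrightarrow> \<exists>D. (f has_derivative D) (at x) \<and> (\<forall>c v. D (c *s v) = c * D v)"
  shows "holo_on f S"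
  unfolding holo_on_def
proof
  fix x assume "x \<in> S"
  then obtain D where D: "(f has_derivative D) (at x)" "\<And>c v. D (c *s v) = c * D v" using assms by blast
  then interpret D: linear D by (simp add: has_derivative_linear)
  have "D v = (\<Sum>i\<in>UNIV. (\<chi> i. D (axis i 1)) $ i * v $ i)" for v
  proof -
    have "v = (\<Sum>i\<in>UNIV. v $ i *s axis i 1)" by (simp add: basis_expansion)
    then have "D v = (\<Sum>i\<in>UNIV. D (v $ i *s axis i 1))" by (metis D.sum)
    then show ?thesis by (simp add: D(2) mult.commute)
  qed
  then have "D = (\<lambda>v. \<Sum>i\<in>UNIV. (\<chi> i. D (axis i 1)) $ i * v $ i)" by (rule ext)
  with D(1) have "(f has_derivative (\<lambda>v. \<Sum>i\<in>UNIV. (\<chi> i. D (axis i 1)) $ i * v $ i)) (at x)" by (rule subst[rotated])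
  then show "\<exists>a. (f has_derivative (\<lambda>v. \<Sum>i\<in>UNIV. a $ i * v $ i)) (at x)" by (rule exI)
qed

lemma holo_onE:
  assumes "holo_on f S" "x \<in> S"
  obtains D where "(f has_derivative D) (at x)" "\<And>c v. D (c *s v) = c * D v"
proof -
  obtain a where "(f has_derivative (\<lambda>v. \<Sum>i\<in>UNIV. a $ i * v $ i)) (at x)" using assms unfolding holo_on_def by blast
  then show ?thesis using that by (metis (no_types, lifting) mult.left_commute sum.cong sum_distrib_left vector_smult_component)
qed

lemma holo_on_subset: "holo_on f S \<Longrightarrow> T \<subseteq> S \<Longrightarrow> holo_on f T"
  by (auto simp: holo_on_def)

lemma holo_on_const [simp, intro]: "holo_on (\<lambda>x. c) S"
  by (rule holo_onI) (auto intro!: derivative_eq_intros exI[of _ "\<lambda>_. 0"])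

lemma holo_on_component [simp, intro]: "holo_on (\<lambda>x. x $ i) S"
  by (rule holo_onI) (auto intro!: exI[of _ "\<lambda>x. x $ i"] bounded_linear_imp_has_derivative bounded_linear_vec_nth)

lemma holo_on_add [intro]: assumes "holo_on f S" "holo_on g S" shows "holo_on (\<lambda>x. f x + g x) S"
proof (rule holo_onI)
  fix x assume x: "x \<in> S"
  obtain D where D: "(f has_derivative D) (at x)" "\<And>c v. D (c *s v) = c * D v"
    using holo_onE[OF assms(1) x] by metis
  obtain D' where D': "(g has_derivative D') (at x)" "\<And>c v. D' (c *s v) = c * D' v"
    using holo_onE[OF assms(2) x] by metis
  show "\<exists>E. ((\<lambda>x. f x + g x) has_derivative E) (at x) \<and> (\<forall>c v. E (c *s v) = c * E v)"
    by (intro exI[of _ "\<lambda>v. D v + D' v"] conjI has_derivative_add D(1) D'(1)) (simp add: D(2) D'(2) distrib_left)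
qed

lemma holo_on_mult [intro]: assumes "holo_on f S" "holo_on g S" shows "holo_on (\<lambda>x. f x * g x) S"
proof (rule holo_onI)
  fix x assume x: "x \<in> S"
  obtain D where D: "(f has_derivative D) (at x)" "\<And>c v. D (c *s v) = c * D v"
    using holo_onE[OF assms(1) x] by metis
  obtain D' where D': "(g has_derivative D') (at x)" "\<And>c v. D' (c *s v) = c * D' v"
    using holo_onE[OF assms(2) x] by metis
  show "\<exists>E. ((\<lambda>x. f x * g x) has_derivative E) (at x) \<and> (\<forall>c v. E (c *s v) = c * E v)"
    by (intro exI[of _ "\<lambda>v. f x * D' v + D v * g x"] conjI has_derivative_mult D(1) D'(1))
      (simp add: D(2) D'(2) algebra_simps)
qed

lemma holo_on_uminus [intro]: "holo_on f S \<Longrightarrow> holo_on (\<lambda>x. - f x) S"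
  using holo_on_mult[OF holo_on_const[of "- 1"]] by simp

lemma holo_on_diff [intro]: "holo_on f S \<Longrightarrow> holo_on g S \<Longrightarrow> holo_on (\<lambda>x. f x - g x) S"
  using holo_on_add[of f S "\<lambda>x. - g x"] by auto

lemma holo_on_sum [intro]: "(\<And>i. i \<in> I \<Longrightarrow> holo_on (f i) S) \<Longrightarrow> holo_on (\<lambda>x. \<Sum>i\<in>I. f i x) S"
  by (induction I rule: infinite_finite_induct) auto

lemma holo_on_prod [intro]: "(\<And>i. i \<in> I \<Longrightarrow> holo_on (f i) S) \<Longrightarrow> holo_on (\<lambda>x. \<Prod>i\<in>I. f i x) S"
  by (induction I rule: infinite_finite_induct) auto

lemma holo_on_power [intro]: "holo_on f S \<Longrightarrow> holo_on (\<lambda>x. f x ^ k) S"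
  by (induction k) auto

lemma holo_on_inverse [intro]:
  assumes "holo_on f S" "\<And>x. x \<in> S \<Longrightarrow> f x \<noteq> 0" shows "holo_on (\<lambda>x. inverse (f x)) S"
proof (rule holo_onI)
  fix x assume x: "x \<in> S"
  obtain D where D: "(f has_derivative D) (at x)" "\<And>c v. D (c *s v) = c * D v"
    using holo_onE[OF assms(1) x] by metis
  show "\<exists>E. ((\<lambda>x. inverse (f x)) has_derivative E) (at x) \<and> (\<forall>c v. E (c *s v) = c * E v)"
    by (intro exI[of _ "\<lambda>v. - (inverse (f x) * D v * inverse (f x))"] conjI
        Deriv.has_derivative_inverse D(1) assms(2)[OF x]) (simp add: D(2))
qed

lemma has_derivative_vec_lambda:
  fixes g :: "complex^'n \<Rightarrow> complex^'m"
  assumes "\<And>i. ((\<lambda>x. g x $ i) has_derivative G i) (at x)"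
  shows "(g has_derivative (\<lambda>v. \<chi> i. G i v)) (at x)"
  unfolding has_derivative_def
proof
  have "linear (G i)" for i using assms has_derivative_linear by blast
  then have "linear (\<lambda>v. \<chi> i. G i v)"
    by (auto intro!: linearI simp: vec_eq_iff linear_add linear_scale)
  then show "bounded_linear (\<lambda>v. \<chi> i. G i v)" by (simp add: linear_conv_bounded_linear)
  show "((\<lambda>y. (g y - g (Lim (at x within UNIV) (\<lambda>x. x)) - (\<chi> i. G i (y - Lim (at x within UNIV) (\<lambda>x. x)))) /\<^sub>R
     norm (y - Lim (at x within UNIV) (\<lambda>x. x))) \<longlongrightarrow> 0) (at x)"
    using assms by (intro vec_tendstoI) (simp add: has_derivative_def)
qed

lemma holo_on_compose:
  fixes g :: "complex^'n \<Rightarrow> complex^'m"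
  assumes f: "holo_on f T" and g: "\<And>i. holo_on (\<lambda>x. g x $ i) S" and "g ` S \<subseteq> T"
  shows "holo_on (\<lambda>x. f (g x)) S"
proof (rule holo_onI)
  fix x assume x: "x \<in> S"
  obtain D where D: "(f has_derivative D) (at (g x))" "\<And>c v. D (c *s v) = c * D v"
    using holo_onE[OF f, of "g x"] assms(3) x by blast
  have "\<exists>D. ((\<lambda>x. g x $ i) has_derivative D) (at x) \<and> (\<forall>c v. D (c *s v) = c * D v)" for i
    using holo_onE[OF g[of i] x] by metis
  then obtain G where G: "\<And>i. ((\<lambda>x. g x $ i) has_derivative G i) (at x)" "\<And>i c v. G i (c *s v) = c * G i v"
    by metis
  have "(g has_derivative (\<lambda>v. \<chi> i. G i v)) (at x)"
    by (rule has_derivative_vec_lambda) (use G in auto)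
  from has_derivative_compose[OF this D(1)]
  have "((\<lambda>x. f (g x)) has_derivative (\<lambda>v. D (\<chi> i. G i v))) (at x)" .
  moreover have "D (\<chi> i. G i (c *s v)) = c * D (\<chi> i. G i v)" for c v
  proof -
    have "(\<chi> i. G i (c *s v)) = c *s (\<chi> i. G i v)" by (simp add: vec_eq_iff G(2))
    then show ?thesis by (simp add: D(2))
  qed
  ultimately show "\<exists>E. ((\<lambda>x. f (g x)) has_derivative E) (at x) \<and> (\<forall>c v. E (c *s v) = c * E v)" by blast
qed

lemma holo_on_imp_continuous_on: "holo_on f S \<Longrightarrow> continuous_on S f"
  unfolding holo_on_def continuous_on_eq_continuous_within
  by (meson continuous_at_imp_continuous_at_within has_derivative_continuous)

lemma holo_on_line:
  assumes f: "holo_on f S" and T: "\<And>w. w \<in> T \<Longrightarrow> x + w *s v \<in> S" and "open T"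
  shows "(\<lambda>w. f (x + w *s v)) holomorphic_on T"
  unfolding holomorphic_on_def
proof
  fix w assume w: "w \<in> T"
  obtain D where D: "(f has_derivative D) (at (x + w *s v))" "\<And>c v. D (c *s v) = c * D v"
    using holo_onE[OF f T[OF w]] by metis
  have "((\<lambda>w. x + w *s v) has_derivative (\<lambda>w. w *s v)) (at w)"
    by (rule derivative_eq_intros refl bounded_linear_imp_has_derivative
        | simp add: linear_conv_bounded_linear[symmetric] linear_iff vec_eq_iff algebra_simps)+
  from has_derivative_compose[OF this D(1)]
  have "((\<lambda>w. f (x + w *s v)) has_derivative (\<lambda>c. D (c *s v))) (at w)" .
  then have "((\<lambda>w. f (x + w *s v)) has_field_derivative D v) (at w)"
    by (simp add: has_field_derivative_def D(2) mult_commute_abs)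
  then show "(\<lambda>w. f (x + w *s v)) field_differentiable at w within T"
    using field_differentiable_at_within field_differentiable_def by blast
qed

section \<open>Partial derivatives and Cauchy integrals\<close>

lemma pd_eq:
  assumes "(f has_derivative D) (at x)" "\<And>c v. D (c *s v) = c * D v"
  shows "pd i f x = D (axis i 1)"
proof -
  define b :: "complex^'a" where "b = axis i 1"
  have ax: "axis i w = w *s b" for w :: complex by (simp add: b_def vec_eq_iff axis_def)
  have "((\<lambda>w. x + axis i w) has_derivative (\<lambda>w. axis i w)) (at 0)"
    unfolding ax
    by (rule derivative_eq_intros refl bounded_linear_imp_has_derivative
        | simp add: linear_conv_bounded_linear[symmetric] linear_iff vec_eq_iff algebra_simps)+
  from has_derivative_compose[OF this, of f D] assms(1)
  have "((\<lambda>w. f (x + axis i w)) has_derivative (\<lambda>c. D (axis i c))) (at 0)"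
    by (simp add: axis_def zero_vec_def[symmetric] del: axis_eq_0_iff)
  then have "((\<lambda>w. f (x + axis i w)) has_field_derivative D b) (at 0)"
    unfolding has_field_derivative_def ax by (simp add: assms(2) mult_commute_abs)
  then show ?thesis unfolding pd_def b_def by (rule DERIV_imp_deriv)
qed

lemma holo_on_has_derivative:
  assumes "holo_on f S" "x \<in> S"
  shows "(f has_derivative (\<lambda>v. \<Sum>i\<in>UNIV. pd i f x * v $ i)) (at x)"
proof -
  obtain a where a: "(f has_derivative (\<lambda>v. \<Sum>i\<in>UNIV. a $ i * v $ i)) (at x)" using assms unfolding holo_on_def by blast
  have "pd j f x = a $ j" for j
    by (subst pd_eq[OF a]) (auto simp: sum_distrib_left axis_def if_distrib sum.delta mult.left_commute cong: if_cong)
  then show ?thesis using a by simp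
qed

text \<open>Discs of radius \<open>R / 3\<close> around points of the disc of radius
  \<open>R / 2\<close> stay inside the disc of radius \<open>R\<close>. Cauchy's estimate bounds the
  second derivative by \<open>2 * B / (R / 3)^2\<close>, which is the constant with 18.\<close>

lemma taylor_remainder_bound:
  assumes hol: "\<phi> holomorphic_on ball 0 R" and bd: "\<And>w. w \<in> ball 0 R \<Longrightarrow> norm (\<phi> w) < B"
    and z: "norm z < R / 2"
  shows "norm (\<phi> z - \<phi> 0 - deriv \<phi> 0 * z) \<le> 18 * B / R\<^sup>2 * (norm z)\<^sup>2"
proof -
  have R: "R > 0" using z norm_ge_zero[of z] by linarith
  have sub: "cball w (R / 3) \<subseteq> ball 0 R" if "w \<in> ball 0 (R / 2)" for w :: complex
  proof
    fix u assume "u \<in> cball w (R / 3)"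
    then have "norm u \<le> norm w + R / 3" using norm_triangle_ineq2[of u w] by (simp add: dist_norm norm_minus_commute)
    then show "u \<in> ball 0 R" using that R by simp
  qed
  have "norm (((deriv ^^ 0) \<phi>) z - (\<Sum>i\<le>1. (deriv ^^ i) \<phi> 0 * (z - 0) ^ i / fact i))
      \<le> (18 * B / R\<^sup>2) * norm (z - 0) ^ Suc 1 / fact 1"
  proof (rule complex_Taylor[where S = "ball 0 (R / 2)" and f = "\<lambda>i. (deriv ^^ i) \<phi>"])
    show "((deriv ^^ i) \<phi> has_field_derivative (deriv ^^ Suc i) \<phi> x) (at x within ball 0 (R / 2))"
      if "x \<in> ball 0 (R / 2)" for i x
    proof -
      have "(deriv ^^ i) \<phi> holomorphic_on ball 0 R" using hol by (rule holomorphic_higher_deriv) simp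
      moreover have "x \<in> ball 0 R" using that R by simp
      ultimately show ?thesis by (simp add: holomorphic_derivI[OF _ open_ball])
    qed
    show "norm ((deriv ^^ Suc 1) \<phi> x) \<le> 18 * B / R\<^sup>2" if x: "x \<in> ball 0 (R / 2)" for x
    proof -
      have "norm ((deriv ^^ 2) \<phi> x) \<le> fact 2 * B / (R / 3)\<^sup>2"
      proof (rule Cauchy_higher_deriv_bound[where y = 0])
        show "\<phi> holomorphic_on ball x (R / 3)" "continuous_on (cball x (R / 3)) \<phi>"
          using sub[OF x] hol ball_subset_cball[of x "R / 3"]
          by (meson holomorphic_on_subset subset_trans, meson holomorphic_on_imp_continuous_on holomorphic_on_subset)
        show "\<phi> w \<in> ball 0 B" if w: "w \<in> ball x (R / 3)" for w
          using bd[of w] subsetD[OF sub[OF x], of w] w by simp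
      qed (use R in auto)
      then show ?thesis by (simp add: power_divide numeral_2_eq_2[symmetric])
    qed
  qed (use z R in auto)
  then show ?thesis by (simp add: power2_eq_square algebra_simps)
qed

lemma norm_vector_scalar_mult: "norm (c *s v) = norm c * norm (v :: complex^'n)"
  by (simp add: norm_vec_def norm_mult L2_set_right_distrib)

lemma axis_scaled: "axis i h = h *s (axis i 1 :: complex^'n)"
  by (simp add: vec_eq_iff axis_def)

lemma norm_axis_complex [simp]: "norm (axis i h :: complex^'n) = norm h"
  using norm_vector_scalar_mult[of h "axis i 1 :: complex^'n"] unfolding axis_scaled[symmetric] by simp

text \<open>The one-variable bound is applied on the complex line through \<open>x\<close> in
  direction \<open>v\<close>, on the disc of radius \<open>\<rho>\<close> divided by the norm of
  \<open>v\<close>, at the parameter 1. The constant depends only on a bound of \<open>f\<close>, so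
  it is uniform when \<open>f\<close> carries a further parameter.\<close>

lemma holo_on_remainder_bound:
  assumes hol: "holo_on f S" and sub: "cball x \<rho> \<subseteq> S" and bd: "\<And>y. y \<in> cball x \<rho> \<Longrightarrow> norm (f y) < B"
    and v: "norm v < \<rho> / 2"
  shows "norm (f (x + v) - f x - (\<Sum>i\<in>UNIV. pd i f x * v $ i)) \<le> 18 * B / \<rho>\<^sup>2 * (norm v)\<^sup>2"
proof (cases "v = 0")
  case False
  have \<rho>: "\<rho> > 0" using v norm_ge_zero[of v] by linarith
  define R where "R = \<rho> / norm v"
  define \<phi> where "\<phi> w = f (x + w *s v)" for w
  have in_cball: "x + w *s v \<in> cball x \<rho>" if "w \<in> ball 0 R" for w
    using that False by (simp add: dist_norm norm_vector_scalar_mult R_def field_simps)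
  have hol\<phi>: "\<phi> holomorphic_on ball 0 R"
    unfolding \<phi>_def using hol by (rule holo_on_line) (use in_cball sub in auto)
  have "norm (\<phi> 1 - \<phi> 0 - deriv \<phi> 0 * 1) \<le> 18 * B / R\<^sup>2 * (norm (1::complex))\<^sup>2"
    by (rule taylor_remainder_bound[OF hol\<phi>])
      (use bd in_cball False v in \<open>auto simp: \<phi>_def R_def field_simps\<close>)
  moreover have "deriv \<phi> 0 = (\<Sum>i\<in>UNIV. pd i f x * v $ i)"
  proof (rule DERIV_imp_deriv)
    have x: "x \<in> S" using sub \<rho> by auto
    have "((\<lambda>w. x + w *s v) has_derivative (\<lambda>w. w *s v)) (at 0)"
      by (rule derivative_eq_intros refl bounded_linear_imp_has_derivative
        | simp add: linear_conv_bounded_linear[symmetric] linear_iff vec_eq_iff algebra_simps)+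
    moreover have "(f has_derivative (\<lambda>v. \<Sum>i\<in>UNIV. pd i f x * v $ i)) (at (x + 0 *s v))"
      using holo_on_has_derivative[OF hol x] by simp
    ultimately have "((\<lambda>w. f (x + w *s v)) has_derivative (\<lambda>w. \<Sum>i\<in>UNIV. pd i f x * (w *s v) $ i)) (at 0)"
      by (rule has_derivative_compose)
    then have "(\<phi> has_derivative (\<lambda>w. \<Sum>i\<in>UNIV. pd i f x * (w *s v) $ i)) (at 0)"
      unfolding \<phi>_def .
    then show "(\<phi> has_field_derivative (\<Sum>i\<in>UNIV. pd i f x * v $ i)) (at 0)"
      unfolding has_field_derivative_def
      by (rule has_derivative_eq_rhs) (simp add: fun_eq_iff sum_distrib_left mult_ac)
  qed
  ultimately show ?thesis by (simp add: \<phi>_def R_def power_divide)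
qed simp

text \<open>Differentiation under the integral sign. Compactness of a closed ball times the circle
  bounds the integrand, which makes the quadratic Taylor remainder uniform in \<open>w\<close>. No
  separate hypothesis on the derivative of the integrand is imposed: its continuity in
  \<open>w\<close> is derived.\<close>

lemma holo_on_contour_integral:
  assumes N: "open N" and r: "r > 0"
    and cont: "continuous_on (N \<times> sphere c r) (\<lambda>(x, w). \<Psi> x w)"
    and hol: "\<And>w. w \<in> sphere c r \<Longrightarrow> holo_on (\<lambda>x. \<Psi> x w) N"
  shows "holo_on (\<lambda>x. contour_integral (circlepath c r) (\<Psi> x)) N" (is "?th1")
    and "\<And>x i. x \<in> N \<Longrightarrow> pd i (\<lambda>x. contour_integral (circlepath c r) (\<Psi> x)) x =
      contour_integral (circlepath c r) (\<lambda>w. pd i (\<lambda>x. \<Psi> x w) x)" (is "\<And>x i. _ \<Longrightarrow> ?th2 x i")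
proof -
  let ?I = "contour_integral (circlepath c r)"
  have *: "((\<lambda>x. ?I (\<Psi> x)) has_derivative
      (\<lambda>v. \<Sum>i\<in>UNIV. ?I (\<lambda>w. pd i (\<lambda>x. \<Psi> x w) x) * v $ i)) (at x)" if x: "x \<in> N" for x
  proof -
    obtain \<rho> where \<rho>: "\<rho> > 0" "cball x \<rho> \<subseteq> N" using N x open_contains_cball by blast
    have "compact ((\<lambda>(x, w). \<Psi> x w) ` (cball x \<rho> \<times> sphere c r))"
      by (intro compact_continuous_image continuous_on_subset[OF cont] compact_Times) (use \<rho> in auto)
    then obtain B0 where B0: "\<forall>u\<in>(\<lambda>(x, w). \<Psi> x w) ` (cball x \<rho> \<times> sphere c r). norm u \<le> B0"
      using compact_imp_bounded bounded_iff by metis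
    define B where "B = \<bar>B0\<bar> + 1"
    have B: "norm (\<Psi> y w) < B" if "y \<in> cball x \<rho>" "w \<in> sphere c r" for y w
      using B0 that unfolding B_def by force
    have B_pos: "B > 0" by (simp add: B_def)
    have bound: "norm (\<Psi> (x + v) w - \<Psi> x w - (\<Sum>i\<in>UNIV. pd i (\<lambda>x. \<Psi> x w) x * v $ i)) \<le> 18 * B / \<rho>\<^sup>2 * (norm v)\<^sup>2"
      if "w \<in> sphere c r" "norm v < \<rho> / 2" for v w
      by (rule holo_on_remainder_bound[OF hol[OF that(1)] \<rho>(2)]) (use B that in auto)
    have contx: "continuous_on (sphere c r) (\<Psi> y)" if "y \<in> N" for y
    proof -
      have "continuous_on (sphere c r) (\<lambda>w. (\<lambda>(x, w). \<Psi> x w) (y, w))"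
        by (rule continuous_on_compose2[OF cont]) (use that in \<open>auto intro!: continuous_intros\<close>)
      then show ?thesis by simp
    qed
    \<comment> \<open>The uniform remainder bound makes the difference quotients converge uniformly
      on the circle, so the derivative inherits their continuity and can be integrated.\<close>
    have cont_pd: "continuous_on (sphere c r) (\<lambda>w. pd i (\<lambda>x. \<Psi> x w) x)" for i
    proof (rule uniform_limit_theorem)
      let ?q = "\<lambda>h w. (\<Psi> (x + axis i h) w - \<Psi> x w) / h"
      have ev: "\<forall>\<^sub>F h::complex in at 0. h \<noteq> 0 \<and> norm h < \<delta>" if "\<delta> > 0" for \<delta>
        using that unfolding eventually_at by (auto intro!: exI[of _ \<delta>])
      have nax: "norm (axis i h :: complex^'a) = norm h" for h by simp
      show "\<forall>\<^sub>F h in at 0. continuous_on (sphere c r) (?q h)"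
        using ev[OF half_gt_zero[OF \<rho>(1)]]
      proof eventually_elim
        case (elim h)
        have "x + axis i h \<in> N" using \<rho> elim by (intro subsetD[OF \<rho>(2)]) (simp add: dist_norm)
        then show ?case using elim contx x by (intro continuous_intros) auto
      qed
      show "uniform_limit (sphere c r) ?q (\<lambda>w. pd i (\<lambda>x. \<Psi> x w) x) (at 0)"
      proof (rule uniform_limitI)
        fix \<epsilon> :: real assume \<epsilon>: "\<epsilon> > 0"
        define \<delta> where "\<delta> = min (\<rho> / 2) (\<epsilon> / (18 * B / \<rho>\<^sup>2 + 1))"
        have pos: "18 * B / \<rho>\<^sup>2 \<ge> 0" using B_pos by simp
        have "\<delta> > 0" using \<rho>(1) \<epsilon> pos by (auto simp: \<delta>_def intro!: divide_pos_pos add_nonneg_pos)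
        from ev[OF this] show "\<forall>\<^sub>F h in at 0. \<forall>w\<in>sphere c r. dist (?q h w) (pd i (\<lambda>x. \<Psi> x w) x) < \<epsilon>"
        proof eventually_elim
          case (elim h)
          show ?case
          proof
            fix w assume w: "w \<in> sphere c r"
            have "norm (axis i h :: complex^'a) < \<rho> / 2" unfolding nax using elim by (simp add: \<delta>_def)
            from bound[OF w this]
            have "norm (\<Psi> (x + axis i h) w - \<Psi> x w - pd i (\<lambda>x. \<Psi> x w) x * h) \<le> 18 * B / \<rho>\<^sup>2 * (norm h)\<^sup>2"
              unfolding nax by (simp add: axis_def if_distrib sum.delta cong: if_cong)
            moreover have "?q h w - pd i (\<lambda>x. \<Psi> x w) x = (\<Psi> (x + axis i h) w - \<Psi> x w - pd i (\<lambda>x. \<Psi> x w) x * h) / h"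
              using elim by (simp add: field_simps)
            ultimately have "dist (?q h w) (pd i (\<lambda>x. \<Psi> x w) x) \<le> 18 * B / \<rho>\<^sup>2 * (norm h)\<^sup>2 / norm h"
              by (simp only: dist_norm norm_divide) (intro divide_right_mono, auto)
            also have "\<dots> = 18 * B / \<rho>\<^sup>2 * norm h" using elim by (simp add: power2_eq_square)
            also have "\<dots> \<le> (18 * B / \<rho>\<^sup>2 + 1) * norm h" by (intro mult_right_mono) auto
            also have "\<dots> < \<epsilon>"
            proof -
              have "norm h < \<epsilon> / (18 * B / \<rho>\<^sup>2 + 1)" using elim by (simp add: \<delta>_def)
              then show ?thesis using pos by (subst (asm) pos_less_divide_eq) (auto simp: mult.commute)
            qed
            finally show "dist (?q h w) (pd i (\<lambda>x. \<Psi> x w) x) < \<epsilon>" .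
          qed
        qed
      qed
    qed simp
    have int: "\<Psi> y contour_integrable_on circlepath c r" if "y \<in> N" for y
      using contx[OF that] r by (intro contour_integrable_continuous_circlepath) (simp add: path_image_circlepath)
    have int_pd: "(\<lambda>w. pd i (\<lambda>x. \<Psi> x w) x) contour_integrable_on circlepath c r" for i
      using cont_pd r by (intro contour_integrable_continuous_circlepath) (simp add: path_image_circlepath)
    \<comment> \<open>\<open>H\<close> is the remainder bound times the length of the circle,
      divided by the norm of the increment.\<close>
    show ?thesis
    proof (rule has_derivativeI_sandwich[where e = "\<rho> / 2" and H = "\<lambda>y. 18 * B / \<rho>\<^sup>2 * (2 * pi * r) * norm (y - x)"])
      show "bounded_linear (\<lambda>v. \<Sum>i\<in>UNIV. ?I (\<lambda>w. pd i (\<lambda>x. \<Psi> x w) x) * v $ i)"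
        by (intro bounded_linear_sum bounded_linear_const_mult bounded_linear_vec_nth)
      show "((\<lambda>y. 18 * B / \<rho>\<^sup>2 * (2 * pi * r) * norm (y - x)) \<longlongrightarrow> 0) (at x)"
        by (rule tendsto_eq_intros refl | simp)+
      fix y assume y: "y \<noteq> x" "dist y x < \<rho> / 2"
      define v where "v = y - x"
      have v: "norm v < \<rho> / 2" "y = x + v" using y by (simp_all add: v_def dist_norm)
      have yN: "y \<in> N" using \<rho> y by (intro subsetD[OF \<rho>(2)]) (simp add: dist_commute)
      have "((\<lambda>w. \<Psi> y w - \<Psi> x w - (\<Sum>i\<in>UNIV. pd i (\<lambda>x. \<Psi> x w) x * v $ i)) has_contour_integral
          (?I (\<Psi> y) - ?I (\<Psi> x) - (\<Sum>i\<in>UNIV. ?I (\<lambda>w. pd i (\<lambda>x. \<Psi> x w) x) * v $ i))) (circlepath c r)"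
        by (intro has_contour_integral_diff has_contour_integral_sum has_contour_integral_rmul
            has_contour_integral_integral int int_pd x yN) auto
      then have "norm (?I (\<Psi> y) - ?I (\<Psi> x) - (\<Sum>i\<in>UNIV. ?I (\<lambda>w. pd i (\<lambda>x. \<Psi> x w) x) * v $ i))
          \<le> 18 * B / \<rho>\<^sup>2 * (norm v)\<^sup>2 * (2 * pi * r)"
      proof (rule has_contour_integral_bound_circlepath)
        show "norm (\<Psi> y w - \<Psi> x w - (\<Sum>i\<in>UNIV. pd i (\<lambda>x. \<Psi> x w) x * v $ i)) \<le> 18 * B / \<rho>\<^sup>2 * (norm v)\<^sup>2"
          if "norm (w - c) = r" for w
          unfolding v(2) using that v(1) by (intro bound) (auto simp: dist_norm norm_minus_commute)
      qed (use r B_pos in auto)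
      then show "norm (?I (\<Psi> y) - ?I (\<Psi> x) - (\<Sum>i\<in>UNIV. ?I (\<lambda>w. pd i (\<lambda>x. \<Psi> x w) x) * (y - x) $ i)) / norm (y - x)
          \<le> 18 * B / \<rho>\<^sup>2 * (2 * pi * r) * norm (y - x)"
        using divide_right_mono[of _ _ "norm v"] y(1)
        by (fold v_def) (fastforce simp: power2_eq_square v_def mult_ac)
    qed (use \<rho> in auto)
  qed
  have **: "(\<Sum>i\<in>UNIV. a i * (c *s v) $ i) = c * (\<Sum>i\<in>UNIV. a i * v $ i)" for a c and v :: "complex^'a"
    by (simp add: sum_distrib_left mult_ac)
  show ?th1
  proof (rule holo_onI)
    fix x assume "x \<in> N"
    from *[OF this] ** show "\<exists>D. ((\<lambda>x. ?I (\<Psi> x)) has_derivative D) (at x) \<and> (\<forall>c v. D (c *s v) = c * D v)"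
      by (intro exI conjI allI)
  qed
  fix x i assume "x \<in> N"
  from pd_eq[OF *[OF this] **, of i] show "?th2 x i"
    by (simp add: axis_def if_distrib sum.delta cong: if_cong)
qed

lemma holo_on_cong:
  assumes "open S" "\<And>x. x \<in> S \<Longrightarrow> f x = g x"
  shows "holo_on f S \<longleftrightarrow> holo_on g S"
proof -
  have "holo_on g S" if f: "holo_on f S" and eq: "\<And>x. x \<in> S \<Longrightarrow> f x = g x" for f g
    unfolding holo_on_def
  proof
    fix x assume x: "x \<in> S"
    then obtain a where "(f has_derivative (\<lambda>v. \<Sum>i\<in>UNIV. a $ i * v $ i)) (at x)"
      using f unfolding holo_on_def by blast
    from has_derivative_transform_within_open[OF this assms(1) x eq]
    show "\<exists>a. (g has_derivative (\<lambda>v. \<Sum>i\<in>UNIV. a $ i * v $ i)) (at x)" by blast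
  qed
  from this[of f g] this[of g f] show ?thesis using assms(2) by auto
qed

lemma continuous_on_axis [continuous_intros]:
  assumes "continuous_on T g" shows "continuous_on T (\<lambda>w. axis i (g w) :: complex^'n)"
proof -
  have "linear (\<lambda>w::complex. w *s (axis i 1 :: complex^'n))"
    by (simp add: linear_iff vec_eq_iff algebra_simps)
  then have "continuous_on UNIV (\<lambda>w::complex. axis i w :: complex^'n)"
    by (intro linear_continuous_on) (simp only: linear_conv_bounded_linear axis_scaled[symmetric])
  then show ?thesis by (rule continuous_on_compose2) (use assms in auto)
qed

lemma open_axis_vimage:
  assumes "open S" shows "open {w. x + axis i w \<in> (S :: (complex^'n) set)}"
proof -
  have "open ((\<lambda>w::complex. x + axis i w) -` S)"
    using assms by (intro open_vimage continuous_intros)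
  then show ?thesis by (simp add: vimage_def)
qed

lemma holo_on_line_axis:
  assumes "holo_on f S" "open S"
  shows "(\<lambda>w. f (x + axis i w)) holomorphic_on {w. x + axis i w \<in> S}"
  by (rule holo_on_line[OF assms(1), of _ x "axis i 1", unfolded axis_scaled[symmetric]])
    (use open_axis_vimage[OF assms(2)] in auto)

lemma axis_0 [simp]: "x + axis i 0 = (x :: complex^'n)"
  by (simp add: vec_eq_iff axis_def)

lemma pd_cong:
  assumes "open S" "x \<in> S" "\<And>y. y \<in> S \<Longrightarrow> f y = g y"
  shows "pd i f x = pd i g x"
  unfolding pd_def
proof (rule deriv_cong_ev)
  have "\<forall>\<^sub>F w in nhds 0. w \<in> {w. x + axis i w \<in> S}"
    by (intro eventually_nhds_in_open open_axis_vimage assms) (simp add: assms)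
  then show "\<forall>\<^sub>F w in nhds 0. f (x + axis i w) = g (x + axis i w)"
    by eventually_elim (use assms(3) in auto)
qed simp

lemma holo_on_local:
  assumes "\<And>x. x \<in> S \<Longrightarrow> \<exists>N. x \<in> N \<and> holo_on f N" shows "holo_on f S"
  unfolding holo_on_def
proof
  fix x assume "x \<in> S"
  then obtain N where "x \<in> N" "holo_on f N" using assms by blast
  then show "\<exists>a. (f has_derivative (\<lambda>v. \<Sum>i\<in>UNIV. a $ i * v $ i)) (at x)" unfolding holo_on_def by blast
qed

lemma pd_contour_integral:
  assumes f: "holo_on f S" and r: "r > 0" and sub: "\<And>w. norm w \<le> r \<Longrightarrow> x + axis i w \<in> S" and "open S"
  shows "pd i f x = contour_integral (circlepath 0 r) (\<lambda>w. f (x + axis i w) / w\<^sup>2) / (2 * pi * \<i>)"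
proof -
  let ?\<phi> = "\<lambda>w. f (x + axis i w)"
  define T where "T = {w. x + axis i w \<in> S}"
  have "?\<phi> holomorphic_on T"
    unfolding T_def using f \<open>open S\<close> by (rule holo_on_line_axis)
  then have hol: "?\<phi> holomorphic_on cball 0 r"
    by (rule holomorphic_on_subset) (use sub in \<open>auto simp: T_def\<close>)
  have "((\<lambda>u. ?\<phi> u / (u - 0) ^ Suc 1) has_contour_integral (2 * pi * \<i> / fact 1 * (deriv ^^ 1) ?\<phi> 0)) (circlepath 0 r)"
    by (rule Cauchy_has_contour_integral_higher_derivative_circlepath)
      (use hol r holomorphic_on_imp_continuous_on holomorphic_on_subset[OF hol ball_subset_cball] in auto)
  from contour_integral_unique[OF this] show ?thesis
    by (simp add: pd_def power2_eq_square)
qed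

text \<open>With one radius for all \<open>x\<close> in \<open>N\<close>, the derivative is a
  contour integral of translates of \<open>g\<close>, so it is holomorphic in \<open>x\<close> and
  commutes with a further derivative. The last conclusion is a disjunction because holomorphy of
  \<open>pd j f\<close> on all of \<open>S\<close> becomes known only by gluing the third
  conclusion.\<close>

lemma pd_local_contour_integral:
  assumes f: "holo_on f S" and S: "open S" and x0: "x0 \<in> S"
  obtains r N where "r > 0" "open N" "x0 \<in> N" "N \<subseteq> S"
    "\<And>x w. x \<in> N \<Longrightarrow> norm w \<le> r \<Longrightarrow> x + axis i w \<in> S"
    "\<And>g x. holo_on g S \<Longrightarrow> x \<in> N \<Longrightarrow>
      pd i g x = contour_integral (circlepath 0 r) (\<lambda>w. 1 / (2 * pi * \<i>) * (g (x + axis i w) / w\<^sup>2))"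
    "\<And>g. holo_on g S \<Longrightarrow> holo_on (pd i g) N"
    "\<And>x j. x \<in> N \<Longrightarrow> pd j (pd i f) x = pd i (pd j f) x \<or> \<not> holo_on (pd j f) S"
proof -
  obtain R where R: "R > 0" "cball x0 R \<subseteq> S" using S x0 open_contains_cball by blast
  define r where "r = R / 2"
  define N where "N = ball x0 r"
  have r: "r > 0" using R by (simp add: r_def)
  have in_S: "x + axis i w \<in> S" if "x \<in> N" "norm w \<le> r" for x w
  proof -
    have "dist x0 (x + axis i w) \<le> dist x0 x + norm (axis i w :: complex^'a)"
      using dist_triangle[of x0 "x + axis i w" x] by (simp add: dist_norm)
    also have "\<dots> \<le> R" using that by (simp add: N_def r_def)
    finally show ?thesis using R(2) by auto
  qed
  define \<Psi> where "\<Psi> g x w = 1 / (2 * pi * \<i>) * (g (x + axis i w) / w\<^sup>2)" for g x and w :: complex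
  have pd1: "pd i g x = contour_integral (circlepath 0 r) (\<Psi> g x)" if g: "holo_on g S" and x: "x \<in> N" for g x
  proof -
    have cont: "continuous_on (sphere 0 r) (\<lambda>w. g (x + axis i w) / w\<^sup>2)"
    proof (intro continuous_on_divide continuous_intros)
      show "continuous_on (sphere 0 r) (\<lambda>w. g (x + axis i w))"
        by (rule continuous_on_compose2[OF holo_on_imp_continuous_on[OF g]])
          (use in_S[OF x] in \<open>auto intro!: continuous_intros\<close>)
    qed (use r in auto)
    then have "(\<lambda>w. g (x + axis i w) / w\<^sup>2) contour_integrable_on circlepath 0 r"
      using r by (intro contour_integrable_continuous_circlepath) (simp add: path_image_circlepath)
    then show ?thesis
      using pd_contour_integral[OF g r in_S[OF x] S] unfolding \<Psi>_def by (subst contour_integral_lmul) auto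
  qed
  have contx: "continuous_on (N \<times> sphere 0 r) (\<lambda>(x, w). \<Psi> g x w)" if g: "holo_on g S" for g
  proof -
    have "continuous_on (N \<times> sphere 0 r) (\<lambda>p. g (fst p + axis i (snd p)))"
      by (rule continuous_on_compose2[OF holo_on_imp_continuous_on[OF g]])
        (use in_S in \<open>auto intro!: continuous_intros\<close>)
    then show ?thesis unfolding \<Psi>_def case_prod_beta
      by (intro continuous_intros) (use r in auto)
  qed
  have shift: "holo_on (\<lambda>x. g (x + axis i w)) N" if g: "holo_on g S" and w: "norm w \<le> r" for g w
    by (rule holo_on_compose[OF g]) (use in_S w in \<open>auto\<close>)
  have hol: "holo_on (\<lambda>x. \<Psi> g x w) N" if g: "holo_on g S" and w: "w \<in> sphere 0 r" for g w
    unfolding \<Psi>_def divide_inverse by (intro holo_on_mult holo_on_const shift g) (use w in auto)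
  have "holo_on (pd i g) N" if g: "holo_on g S" for g
    using holo_on_contour_integral(1)[OF _ r contx[OF g] hol[OF g]] pd1[OF g]
    by (subst holo_on_cong[of N _ "\<lambda>x. contour_integral (circlepath 0 r) (\<Psi> g x)"]) (auto simp: N_def)
  moreover have "pd j (pd i f) x = pd i (pd j f) x" if x: "x \<in> N" and j: "holo_on (pd j f) S" for x j
  proof -
    have "pd j (pd i f) x = pd j (\<lambda>x. contour_integral (circlepath 0 r) (\<Psi> f x)) x"
      by (rule pd_cong[of N]) (use x pd1[OF f] in \<open>auto simp: N_def\<close>)
    also have "\<dots> = contour_integral (circlepath 0 r) (\<lambda>w. pd j (\<lambda>x. \<Psi> f x w) x)"
      by (rule holo_on_contour_integral(2)[OF _ r contx[OF f] hol[OF f] x]) (auto simp: N_def)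
    also have "\<dots> = contour_integral (circlepath 0 r) (\<Psi> (pd j f) x)"
    proof (rule contour_integral_cong)
      fix w assume "w \<in> path_image (circlepath 0 r)"
      then have w: "norm w \<le> r" using r by (simp add: path_image_circlepath)
      have "(\<lambda>u. f (x + axis i w + axis j u)) field_differentiable at 0"
      proof -
        have "(\<lambda>u. f (x + axis i w + axis j u)) holomorphic_on {u. x + axis i w + axis j u \<in> S}"
          using f S by (rule holo_on_line_axis)
        then show ?thesis
          using open_axis_vimage[OF S] in_S[OF x w] by (intro holomorphic_on_imp_differentiable_at) auto
      qed
      then have d: "deriv (\<lambda>u. c * f (x + axis i w + axis j u)) 0 = c * pd j f (x + axis i w)" for c
        unfolding pd_def by (rule deriv_cmult)
      have "pd j (\<lambda>x. \<Psi> f x w) x = deriv (\<lambda>u. (1 / (2 * pi * \<i>) / w\<^sup>2) * f (x + axis i w + axis j u)) 0"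
        unfolding pd_def \<Psi>_def by (rule arg_cong[where f = "\<lambda>F. deriv F 0"]) (simp add: fun_eq_iff add_ac)
      also have "\<dots> = \<Psi> (pd j f) x w" unfolding d by (simp add: \<Psi>_def)
      finally show "pd j (\<lambda>x. \<Psi> f x w) x = \<Psi> (pd j f) x w" .
    qed simp
    also have "\<dots> = pd i (pd j f) x" by (rule pd1[OF j x, symmetric])
    finally show ?thesis .
  qed
  ultimately show ?thesis
  proof (intro that[of r N])
    show "N \<subseteq> S" using in_S[of _ 0] r by auto
    show "\<And>g x. holo_on g S \<Longrightarrow> x \<in> N \<Longrightarrow>
      pd i g x = contour_integral (circlepath 0 r) (\<lambda>w. 1 / (2 * pi * \<i>) * (g (x + axis i w) / w\<^sup>2))"
      using pd1 unfolding \<Psi>_def .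
  qed (use r in_S in \<open>auto simp: N_def\<close>)
qed

lemma holo_on_pd:
  assumes "holo_on f S" "open S" shows "holo_on (pd i f) S"
proof (rule holo_on_local)
  fix x assume "x \<in> S"
  from pd_local_contour_integral[OF assms this, of i] assms(1) show "\<exists>N. x \<in> N \<and> holo_on (pd i f) N" by metis
qed

lemma pd_commute:
  assumes "holo_on f S" "open S" "x \<in> S" shows "pd j (pd i f) x = pd i (pd j f) x"
  using pd_local_contour_integral[OF assms, of i] holo_on_pd[OF assms(1,2)] by metis

section \<open>Traces of derivatives of nilpotent matrices\<close>

lemma fps_to_fls_sum: "fps_to_fls (sum f S) = (\<Sum>x\<in>S. fps_to_fls (f x))"
  by (induction S rule: infinite_finite_induct) auto

text \<open>The derivative is a derivation of the field of formal Laurent series, over which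
  \<open>nilpotent_trace_derivation\<close> applies.\<close>

lemma holomorphic_nilpotent_trace:
  fixes F B :: "complex \<Rightarrow> (complex, 'n::finite) smat"
  assumes T: "open T" "0 \<in> T"
    and F: "\<And>i j. (\<lambda>w. entry (F w) i j) holomorphic_on T"
    and B: "\<And>i j. (\<lambda>w. entry (B w) i j) holomorphic_on T"
    and nil: "\<And>w. w \<in> T \<Longrightarrow> F w ^ N = 0"
    and comm: "\<And>w. w \<in> T \<Longrightarrow> F w * B w = B w * F w"
  shows "tr (smat_of (\<lambda>i j. deriv (\<lambda>w. entry (F w) i j) 0) * B 0) = 0"
proof -
  define expand where "expand A = smat_of (\<lambda>i j. fps_to_fls (fps_expansion (\<lambda>w. entry (A w) i j) 0))"
    for A :: "complex \<Rightarrow> (complex, 'n) smat"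
  \<comment> \<open>\<open>repr\<close> ties a family near 0 to the matrix of its Taylor series,
    placed among the Laurent series because the trace lemmas require a field.\<close>
  define repr where "repr A Ah \<longleftrightarrow> (\<forall>i j. \<exists>a. (\<lambda>w. entry (A w) i j) has_fps_expansion a \<and> entry Ah i j = fps_to_fls a)"
    for A :: "complex \<Rightarrow> (complex, 'n) smat" and Ah :: "(complex fls, 'n) smat"
  have ev: "\<forall>\<^sub>F w in nhds 0. w \<in> T" using T by (rule eventually_nhds_in_open)
  have repr_mult: "repr (\<lambda>w. A w * C w) (Ah * Ch)" if "repr A Ah" "repr C Ch" for A C Ah Ch
    unfolding repr_def
  proof (intro allI)
    fix i j
    obtain a where a: "\<And>i j. (\<lambda>w. entry (A w) i j) has_fps_expansion a i j" "\<And>i j. entry Ah i j = fps_to_fls (a i j)"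
      using \<open>repr A Ah\<close> unfolding repr_def by metis
    obtain c where c: "\<And>i j. (\<lambda>w. entry (C w) i j) has_fps_expansion c i j" "\<And>i j. entry Ch i j = fps_to_fls (c i j)"
      using \<open>repr C Ch\<close> unfolding repr_def by metis
    have "(\<lambda>w. entry (A w * C w) i j) has_fps_expansion (\<Sum>k\<in>UNIV. a i k * c k j)"
      unfolding entry_mult by (intro has_fps_expansion_sum has_fps_expansion_mult a c)
    moreover have "entry (Ah * Ch) i j = fps_to_fls (\<Sum>k\<in>UNIV. a i k * c k j)"
      by (simp add: entry_mult a c fls_times_fps_to_fls fps_to_fls_sum)
    ultimately show "\<exists>a. (\<lambda>w. entry (A w * C w) i j) has_fps_expansion a \<and> entry (Ah * Ch) i j = fps_to_fls a" by blast
  qed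
  have repr_1: "repr (\<lambda>w. 1) 1"
    unfolding repr_def
  proof (intro allI)
    fix i j :: 'n
    show "\<exists>a. (\<lambda>w. entry 1 i j) has_fps_expansion a \<and> entry 1 i j = fps_to_fls a"
      by (cases "i = j") (auto intro!: exI[of _ "if i = j then 1 else 0 :: complex fps"])
  qed
  have repr_power: "repr (\<lambda>w. A w ^ k) (Ah ^ k)" if "repr A Ah" for A Ah k
    by (induction k) (auto intro: repr_1 repr_mult that)
  have repr_unique: "Ah = Ch" if "repr A Ah" "repr C Ch" "\<And>w. w \<in> T \<Longrightarrow> A w = C w" for A C Ah Ch
  proof (rule smat_eqI)
    fix i j
    obtain a where a: "(\<lambda>w. entry (A w) i j) has_fps_expansion a" "entry Ah i j = fps_to_fls a"
      using \<open>repr A Ah\<close> unfolding repr_def by metis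
    obtain c where c: "(\<lambda>w. entry (C w) i j) has_fps_expansion c" "entry Ch i j = fps_to_fls c"
      using \<open>repr C Ch\<close> unfolding repr_def by metis
    have "\<forall>\<^sub>F w in nhds 0. entry (A w) i j = entry (C w) i j"
      using ev by eventually_elim (simp add: \<open>\<And>w. w \<in> T \<Longrightarrow> A w = C w\<close>)
    then have "(\<lambda>w. entry (A w) i j) has_fps_expansion c"
      using c(1) by (subst has_fps_expansion_cong) auto
    then show "entry Ah i j = entry Ch i j" using a c fps_expansion_unique_complex by metis
  qed
  have expand: "(\<lambda>w. entry (A w) i j) has_fps_expansion fps_expansion (\<lambda>w. entry (A w) i j) 0"
    if "\<And>i j. (\<lambda>w. entry (A w) i j) holomorphic_on T" for A i j
    using that T by (intro analytic_at_imp_has_fps_expansion_0) (auto simp: analytic_at)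
  have repr_expand: "repr A (expand A)" if "\<And>i j. (\<lambda>w. entry (A w) i j) holomorphic_on T" for A
    using expand[OF that] unfolding repr_def expand_def by auto
  define Fh Bh where "Fh = expand F" and "Bh = expand B"
  have rF: "repr F Fh" and rB: "repr B Bh" using F B by (simp_all add: repr_expand Fh_def Bh_def)
  have repr_0: "repr (\<lambda>w. 0) 0" unfolding repr_def by (auto intro!: exI[of _ 0])
  have "Fh ^ N = 0" by (rule repr_unique[OF repr_power[OF rF] repr_0 nil])
  have cBF: "Fh * Bh = Bh * Fh"
    by (rule repr_unique[OF repr_mult[OF rF rB] repr_mult[OF rB rF] comm])
  define \<delta> where "\<delta> A = smat_of (\<lambda>i j. fls_deriv (entry A i j))" for A :: "(complex fls, 'n) smat"
  have 1: "tr (Fh * \<delta> Bh) = 0"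
    unfolding \<delta>_def by (rule nilpotent_trace_derivation[OF _ _ \<open>Fh ^ N = 0\<close> cBF]) (simp_all add: algebra_simps)
  \<comment> \<open>The derivation lemma controls the term where \<open>Bh\<close> is
    differentiated. Since \<open>Fh * Bh\<close> is nilpotent too, its trace is 0, and the product
    rule transfers the result to the term where \<open>Fh\<close> is differentiated.\<close>
  have "(Fh * Bh) ^ N = Fh ^ N * Bh ^ N" for N
  proof (induction N)
    case (Suc N)
    have "Bh * Fh ^ N = Fh ^ N * Bh" using cBF by (metis power_commuting_commutes)
    then have "Fh * Bh * (Fh ^ N * Bh ^ N) = Fh * (Fh ^ N * Bh) * Bh ^ N" by (simp only: mult.assoc flip: mult.assoc[of Bh])
    then show ?case using Suc by (simp add: mult.assoc)
  qed simp
  then have "tr (Fh * Bh) = 0" using \<open>Fh ^ N = 0\<close> by (intro nilpotent_trace[of _ N]) simp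
  then have "fls_deriv (tr (Fh * Bh)) = 0" by simp
  moreover have "fls_deriv (tr (Fh * Bh)) = tr (\<delta> Fh * Bh) + tr (Fh * \<delta> Bh)"
    by (simp add: tr_mult fls_deriv_sum \<delta>_def sum.distrib algebra_simps)
  ultimately have 2: "tr (\<delta> Fh * Bh) = 0" using 1 by simp
  define dF where "dF w = smat_of (\<lambda>i j. deriv (\<lambda>w. entry (F w) i j) w)" for w
  have "repr dF (\<delta> Fh)"
    unfolding repr_def
  proof (intro allI)
    fix i j
    have "(\<lambda>w. entry (dF w) i j) has_fps_expansion fps_deriv (fps_expansion (\<lambda>w. entry (F w) i j) 0)"
      unfolding dF_def entry_smat_of by (intro has_fps_expansion_deriv expand F)
    moreover have "entry (\<delta> Fh) i j = fps_to_fls (fps_deriv (fps_expansion (\<lambda>w. entry (F w) i j) 0))"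
      by (simp add: \<delta>_def Fh_def expand_def fls_deriv_fps_to_fls)
    ultimately show "\<exists>a. (\<lambda>w. entry (dF w) i j) has_fps_expansion a \<and> entry (\<delta> Fh) i j = fps_to_fls a" by blast
  qed
  from repr_mult[OF this rB] obtain a where
    a: "\<And>i j. (\<lambda>w. entry (dF w * B w) i j) has_fps_expansion a i j" "\<And>i j. entry (\<delta> Fh * Bh) i j = fps_to_fls (a i j)"
    unfolding repr_def by metis
  have "(\<lambda>w. tr (dF w * B w)) has_fps_expansion (\<Sum>i\<in>UNIV. a i i)"
    unfolding tr_def by (intro has_fps_expansion_sum a)
  moreover have "(\<Sum>i\<in>UNIV. a i i) = 0"
  proof -
    have "fps_to_fls (\<Sum>i\<in>UNIV. a i i) = tr (\<delta> Fh * Bh)" by (simp add: tr_def a fps_to_fls_sum)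
    then show ?thesis using 2 by simp
  qed
  ultimately have "tr (dF 0 * B 0) = 0"
    using has_fps_expansion_imp_0_eq_fps_nth_0 by fastforce
  then show ?thesis by (simp add: dF_def)
qed

section \<open>Rules for partial derivatives, the bracket in coordinates, and matrix-valued
  functions\<close>

lemma has_field_derivative_pd:
  assumes "holo_on f S" "open S" "x \<in> S"
  shows "((\<lambda>w. f (x + axis i w)) has_field_derivative pd i f x) (at 0)"
proof -
  have "(\<lambda>w. f (x + axis i w)) field_differentiable at 0"
    using holo_on_line_axis[OF assms(1,2)] open_axis_vimage[OF assms(2)] assms(3)
    by (intro holomorphic_on_imp_differentiable_at) auto
  then show ?thesis unfolding pd_def by (simp add: field_differentiable_derivI)
qed

lemma pd_const [simp]: "pd i (\<lambda>x. c) x = 0"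
  by (simp add: pd_def)

lemma pd_component: "pd i (\<lambda>x. x $ j) x = (if i = j then 1 else 0)"
proof (cases "i = j")
  case True
  have "((\<lambda>w. (x + axis i w) $ j) has_field_derivative 1) (at 0)"
    unfolding True by (simp add: axis_def) (rule derivative_eq_intros refl | simp)+
  then show ?thesis unfolding pd_def True by (simp add: DERIV_imp_deriv)
qed (simp add: pd_def axis_def)

lemma pd_add:
  assumes "holo_on f S" "holo_on g S" "open S" "x \<in> S"
  shows "pd i (\<lambda>x. f x + g x) x = pd i f x + pd i g x"
  unfolding pd_def[of i "\<lambda>x. f x + g x"]
  by (rule DERIV_imp_deriv, rule DERIV_add) (use assms has_field_derivative_pd in blast)+

lemma pd_mult:
  assumes "holo_on f S" "holo_on g S" "open S" "x \<in> S"
  shows "pd i (\<lambda>x. f x * g x) x = pd i f x * g x + f x * pd i g x"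
  unfolding pd_def[of i "\<lambda>x. f x * g x"]
  by (rule DERIV_imp_deriv, rule DERIV_cong[OF DERIV_mult])
    (use assms has_field_derivative_pd in \<open>auto simp: algebra_simps\<close>)

lemma pd_sum:
  assumes "\<And>k. k \<in> K \<Longrightarrow> holo_on (f k) S" "open S" "x \<in> S"
  shows "pd i (\<lambda>x. \<Sum>k\<in>K. f k x) x = (\<Sum>k\<in>K. pd i (f k) x)"
  using assms(1)
proof (induction K rule: infinite_finite_induct)
  case (insert k K)
  have "pd i (\<lambda>x. f k x + (\<Sum>k\<in>K. f k x)) x = pd i (f k) x + pd i (\<lambda>x. \<Sum>k\<in>K. f k x) x"
    using insert.prems assms by (intro pd_add[of _ S]) auto
  then show ?case using insert by simp
qed auto

lemma base_pt_axis [simp]: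
  "base_pt (x + axis (Inl k) w) = base_pt x + axis k w" "base_pt (x + axis (Inr k) w) = base_pt x"
  by (simp_all add: base_pt_def vec_eq_iff axis_def)

lemma pd_base_pt [simp]:
  "pd (Inl k) (\<lambda>x. f (base_pt x)) x = pd k f (base_pt x)" "pd (Inr k) (\<lambda>x. f (base_pt x)) x = 0"
  by (simp_all add: pd_def)

lemma continuous_on_base_pt: "continuous_on S base_pt"
  unfolding base_pt_def by (intro continuous_on_vec_lambda continuous_intros)

lemma open_base_pt_vimage: "open T \<Longrightarrow> open {x. base_pt x \<in> T}"
  using open_vimage[OF _ continuous_on_base_pt, of T] by (simp add: vimage_def)

lemma holo_on_base_pt: "holo_on f T \<Longrightarrow> (\<And>x. x \<in> S \<Longrightarrow> base_pt x \<in> T) \<Longrightarrow> holo_on (\<lambda>x. f (base_pt x)) S"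
  by (rule holo_on_compose[of f T]) (auto simp: base_pt_def)

definition pt :: "complex^'n \<Rightarrow> ('n \<Rightarrow> complex) \<Rightarrow> complex^('n::finite + 'n)" where
  "pt t y = (\<chi> j. case j of Inl k \<Rightarrow> t $ k | Inr k \<Rightarrow> y k)"

lemma pt_simps [simp]: "pt t y $ Inl k = t $ k" "pt t y $ Inr k = y k" "base_pt (pt t y) = t"
  by (simp_all add: pt_def base_pt_def vec_eq_iff)

lemma pt_base [simp]: "pt (base_pt x) (\<lambda>k. x $ Inr k) = x"
  by (auto simp: pt_def base_pt_def vec_eq_iff split: sum.split)

text \<open>The bracket at \<open>x\<close> depends on first derivatives at \<open>x\<close> only.
  Therefore it is enough that the gradients at this one point are combinations of other gradients,
  with coefficients that are plain numbers.\<close>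

lemma poisson_bilinear:
  assumes "\<And>i. pd i f x = (\<Sum>s\<in>S. \<alpha> s * pd i (u s) x)" "\<And>i. pd i g x = (\<Sum>s\<in>S'. \<beta> s * pd i (v s) x)"
  shows "poisson f g x = (\<Sum>s\<in>S. \<Sum>s'\<in>S'. \<alpha> s * \<beta> s' * poisson (u s) (v s') x)"
proof -
  have "poisson f g x = (\<Sum>k\<in>UNIV. \<Sum>s\<in>S. \<Sum>s'\<in>S'. \<alpha> s * \<beta> s' *
      (pd (Inl k) (u s) x * pd (Inr k) (v s') x - pd (Inr k) (u s) x * pd (Inl k) (v s') x))"
    unfolding poisson_def assms sum_product sum_subtractf[symmetric]
    by (intro sum.cong refl) (simp add: algebra_simps)
  also have "\<dots> = (\<Sum>s\<in>S. \<Sum>s'\<in>S'. \<Sum>k\<in>UNIV. \<alpha> s * \<beta> s' *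
      (pd (Inl k) (u s) x * pd (Inr k) (v s') x - pd (Inr k) (u s) x * pd (Inl k) (v s') x))"
    by (subst sum.swap, rule sum.cong[OF refl], rule sum.swap)
  finally show ?thesis by (simp add: poisson_def sum_distrib_left)
qed

definition dmat :: "'n::finite \<Rightarrow> (complex^'n \<Rightarrow> (complex, 'n) smat) \<Rightarrow> complex^'n \<Rightarrow> (complex, 'n) smat" where
  "dmat k A t = smat_of (\<lambda>p q. pd k (\<lambda>t. entry (A t) p q) t)"

lemma entry_dmat [simp]: "entry (dmat k A t) p q = pd k (\<lambda>t. entry (A t) p q) t"
  by (simp add: dmat_def)

definition holo_mat :: "(complex^'m::finite \<Rightarrow> (complex, 'n::finite) smat) \<Rightarrow> (complex^'m) set \<Rightarrow> bool" where
  "holo_mat A T \<longleftrightarrow> (\<forall>p q. holo_on (\<lambda>t. entry (A t) p q) T)"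

lemma dmat_add:
  assumes "holo_mat A T" "holo_mat C T" "open T" "t \<in> T"
  shows "dmat k (\<lambda>t. A t + C t) t = dmat k A t + dmat k C t"
  using assms by (intro smat_eqI) (auto simp: holo_mat_def intro!: pd_add)

lemma dmat_mult:
  assumes "holo_mat A T" "holo_mat C T" "open T" "t \<in> T"
  shows "dmat k (\<lambda>t. A t * C t) t = dmat k A t * C t + A t * dmat k C t"
proof (rule smat_eqI)
  fix p q
  have "pd k (\<lambda>t. \<Sum>l\<in>UNIV. entry (A t) p l * entry (C t) l q) t =
      (\<Sum>l\<in>UNIV. pd k (\<lambda>t. entry (A t) p l * entry (C t) l q) t)"
    using assms by (intro pd_sum[of _ _ T]) (auto simp: holo_mat_def)
  also have "\<dots> = (\<Sum>l\<in>UNIV. pd k (\<lambda>t. entry (A t) p l) t * entry (C t) l q + entry (A t) p l * pd k (\<lambda>t. entry (C t) l q) t)"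
    using assms by (intro sum.cong refl pd_mult[of _ T]) (auto simp: holo_mat_def)
  finally show "entry (dmat k (\<lambda>t. A t * C t) t) p q = entry (dmat k A t * C t + A t * dmat k C t) p q"
    by (simp add: entry_mult sum.distrib)
qed

lemma holo_mat_add: "holo_mat A T \<Longrightarrow> holo_mat C T \<Longrightarrow> holo_mat (\<lambda>t. A t + C t) T"
  by (auto simp: holo_mat_def)

lemma holo_mat_mult: "holo_mat A T \<Longrightarrow> holo_mat C T \<Longrightarrow> holo_mat (\<lambda>t. A t * C t) T"
  by (auto simp: holo_mat_def entry_mult intro!: holo_on_sum holo_on_mult)

section \<open>Algebras depending holomorphically on parameters\<close>

text \<open>\<open>closed\<close> is a trace form of the closedness of the one-form with components
  \<open>y i\<close> on the spectrum. Where the joint eigenvalues are simple, testing with the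
  spectral projections says that each one-form of eigenvalues is closed.\<close>

locale holo_comm_alg =
  fixes \<Omega> :: "(complex^'n::finite) set" and a :: "complex^'n \<Rightarrow> 'n \<Rightarrow> (complex, 'n) smat"
    and e :: "complex^'n \<Rightarrow> 'n \<Rightarrow> complex"
  assumes open_\<Omega>: "open \<Omega>"
    and holo_a: "holo_mat (\<lambda>t. a t i) \<Omega>"
    and holo_e: "holo_on (\<lambda>t. e t i) \<Omega>"
    and alg: "t \<in> \<Omega> \<Longrightarrow> comm_alg (a t) (e t)"
    and closed: "t \<in> \<Omega> \<Longrightarrow> (\<And>l. B * a t l = a t l * B) \<Longrightarrow>
      tr ((dmat i (\<lambda>t. a t j) t - dmat j (\<lambda>t. a t i) t) * B) = 0"
begin

abbreviation "cm t \<equiv> comm_alg.cm (a t)"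
abbreviation "spec t \<equiv> comm_alg.spec (a t) (e t)"

text \<open>\<open>rep T u U\<close>: over \<open>T\<close>, the matrix \<open>U\<close> is \<open>u\<close> evaluated at \<open>y\<^sub>i = a\<^sub>i\<close>; the matrices \<open>V m\<close> and \<open>W k\<close>
  are the evaluations of the partial derivatives of \<open>u\<close>, and the last condition is the chain rule up to
  commutators.\<close>

definition rep_wit where
  "rep_wit t u U V W \<longleftrightarrow>
     (\<forall>m. cm t (V m) \<and> cm t (W m) \<and> (\<forall>y\<in>spec t.
        rowm y (V m) = (\<lambda>j. pd (Inr m) u (pt t y) * y j) \<and> rowm y (W m) = (\<lambda>j. pd (Inl m) u (pt t y) * y j))) \<and>
     (\<forall>k B. cm t B \<longrightarrow> tr (dmat k U t * B) =
        tr (W k * B) + (\<Sum>m\<in>UNIV. tr (dmat k (\<lambda>t. a t m) t * (V m * B))))"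

definition rep :: "(complex^'n) set \<Rightarrow> (complex^('n + 'n) \<Rightarrow> complex) \<Rightarrow> (complex^'n \<Rightarrow> (complex, 'n) smat) \<Rightarrow> bool" where
  "rep T u U \<longleftrightarrow> holo_on u {x. base_pt x \<in> T} \<and> holo_mat U T \<and>
     (\<forall>t\<in>T. cm t (U t) \<and> (\<forall>y\<in>spec t. rowm y (U t) = (\<lambda>j. u (pt t y) * y j)) \<and> (\<exists>V W. rep_wit t u U V W))"

context
  fixes T assumes T: "open T" "T \<subseteq> \<Omega>"
begin

lemma rep_base:
  assumes f: "holo_on f T"
  shows "rep T (\<lambda>x. f (base_pt x)) (\<lambda>t. sc (f t) 1)"
  unfolding rep_def
proof (intro conjI ballI)
  show "holo_on (\<lambda>x. f (base_pt x)) {x. base_pt x \<in> T}" by (rule holo_on_base_pt[OF f]) simp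
  have "holo_on (\<lambda>t. f t * (if p = q then 1 else 0)) T" for p q by (intro holo_on_mult f holo_on_const)
  then show "holo_mat (\<lambda>t. sc (f t) 1 :: (complex, 'n) smat) T"
    unfolding holo_mat_def entry_simps by blast
  fix t assume t: "t \<in> T"
  interpret A: comm_alg "a t" "e t" using alg t T by auto
  show "A.cm (sc (f t) 1)" by simp
  show "rowm y (sc (f t) 1) = (\<lambda>j. f (base_pt (pt t y)) * y j)" for y by simp
  have d: "dmat k (\<lambda>t. sc (f t) 1) t = sc (pd k f t) 1" for k
  proof (rule smat_eqI)
    fix p q :: 'n
    show "entry (dmat k (\<lambda>t. sc (f t) 1) t) p q = entry (sc (pd k f t) 1) p q" by (cases "p = q") simp_all
  qed
  show "\<exists>V W. rep_wit t (\<lambda>x. f (base_pt x)) (\<lambda>t. sc (f t) 1) V W"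
    unfolding rep_wit_def
    by (rule exI[of _ "\<lambda>m. 0"], rule exI[of _ "\<lambda>k. sc (pd k f t) 1"]) (auto simp: d)
qed

lemma rep_coord: "rep T (\<lambda>x. x $ Inr i) (\<lambda>t. a t i)"
  unfolding rep_def
proof (intro conjI ballI)
  show "holo_mat (\<lambda>t. a t i) T" using holo_a T by (auto simp: holo_mat_def intro: holo_on_subset)
  fix t assume t: "t \<in> T"
  interpret A: comm_alg "a t" "e t" using alg t T by auto
  show "A.cm (a t i)" by simp
  show "rowm y (a t i) = (\<lambda>j. pt t y $ Inr i * y j)" if "y \<in> A.spec" for y
    using A.spec_rowm[OF that] by simp
  have "tr (dmat k (\<lambda>t. a t i) t * B) = (\<Sum>m\<in>UNIV. tr (dmat k (\<lambda>t. a t m) t * ((if m = i then 1 else 0) * B)))" for k B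
  proof -
    have "(\<Sum>m\<in>UNIV. tr (dmat k (\<lambda>t. a t m) t * ((if m = i then 1 else 0) * B))) =
        (\<Sum>m\<in>UNIV. if m = i then tr (dmat k (\<lambda>t. a t m) t * B) else 0)"
      by (intro sum.cong) auto
    then show ?thesis by simp
  qed
  then show "\<exists>V W. rep_wit t (\<lambda>x. x $ Inr i) (\<lambda>t. a t i) V W"
    unfolding rep_wit_def
    by (intro exI[of _ "\<lambda>m. if m = i then 1 else 0"] exI[of _ "\<lambda>k. 0"]) (auto simp: pd_component)
qed auto

lemma rep_add:
  assumes "rep T u U" "rep T v V"
  shows "rep T (\<lambda>x. u x + v x) (\<lambda>t. U t + V t)"
  unfolding rep_def
proof (intro conjI ballI)
  have hu: "holo_on u {x. base_pt x \<in> T}" and hv: "holo_on v {x. base_pt x \<in> T}"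
    and hU: "holo_mat U T" and hV: "holo_mat V T" using assms by (auto simp: rep_def)
  show "holo_on (\<lambda>x. u x + v x) {x. base_pt x \<in> T}" using hu hv by auto
  show "holo_mat (\<lambda>t. U t + V t) T" using hU hV by (rule holo_mat_add)
  fix t assume t: "t \<in> T"
  interpret A: comm_alg "a t" "e t" using alg t T by auto
  have cU: "A.cm (U t)" "\<And>y. y \<in> A.spec \<Longrightarrow> rowm y (U t) = (\<lambda>j. u (pt t y) * y j)"
    and cV: "A.cm (V t)" "\<And>y. y \<in> A.spec \<Longrightarrow> rowm y (V t) = (\<lambda>j. v (pt t y) * y j)"
    using assms t by (auto simp: rep_def)
  show "A.cm (U t + V t)" using cU cV by simp
  show "rowm y (U t + V t) = (\<lambda>j. (u (pt t y) + v (pt t y)) * y j)" if "y \<in> A.spec" for y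
    using that cU cV by (simp add: algebra_simps)
  obtain X Y where "rep_wit t u U X Y"
    using assms(1) t unfolding rep_def by blast
  then have X: "\<And>m. A.cm (X m)" "\<And>m. A.cm (Y m)"
      "\<And>m y. y \<in> A.spec \<Longrightarrow> rowm y (X m) = (\<lambda>j. pd (Inr m) u (pt t y) * y j)"
      "\<And>m y. y \<in> A.spec \<Longrightarrow> rowm y (Y m) = (\<lambda>j. pd (Inl m) u (pt t y) * y j)"
      "\<And>k B. A.cm B \<Longrightarrow> tr (dmat k U t * B) = tr (Y k * B) + (\<Sum>m\<in>UNIV. tr (dmat k (\<lambda>t. a t m) t * (X m * B)))"
    unfolding rep_wit_def by blast+
  obtain X' Y' where "rep_wit t v V X' Y'"
    using assms(2) t unfolding rep_def by blast
  then have X': "\<And>m. A.cm (X' m)" "\<And>m. A.cm (Y' m)"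
      "\<And>m y. y \<in> A.spec \<Longrightarrow> rowm y (X' m) = (\<lambda>j. pd (Inr m) v (pt t y) * y j)"
      "\<And>m y. y \<in> A.spec \<Longrightarrow> rowm y (Y' m) = (\<lambda>j. pd (Inl m) v (pt t y) * y j)"
      "\<And>k B. A.cm B \<Longrightarrow> tr (dmat k V t * B) = tr (Y' k * B) + (\<Sum>m\<in>UNIV. tr (dmat k (\<lambda>t. a t m) t * (X' m * B)))"
    unfolding rep_wit_def by blast+
  have pd: "pd j (\<lambda>x. u x + v x) (pt t y) = pd j u (pt t y) + pd j v (pt t y)" for j y
    by (rule pd_add[OF hu hv open_base_pt_vimage[OF T(1)]]) (use t in simp)
  have tr: "tr (dmat k (\<lambda>t. U t + V t) t * B) = tr ((Y k + Y' k) * B) +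
      (\<Sum>m\<in>UNIV. tr (dmat k (\<lambda>t. a t m) t * ((X m + X' m) * B)))" if "A.cm B" for k B
    using X(5)[OF that] X'(5)[OF that]
    by (simp add: dmat_add[OF hU hV T(1) t] algebra_simps sum.distrib)
  show "\<exists>X Y. rep_wit t (\<lambda>x. u x + v x) (\<lambda>t. U t + V t) X Y"
    unfolding rep_wit_def
    by (rule exI[of _ "\<lambda>m. X m + X' m"], rule exI[of _ "\<lambda>m. Y m + Y' m"])
      (use tr in \<open>simp add: X(1-4) X'(1-4) pd distrib_right\<close>)
qed

text \<open>The derivative of a matrix in the commutant need not commute with anything. Under a
  trace against the commutant the other factors can be moved around it cyclically, which is why the
  chain rule is stated with traces and passes to products.\<close>

lemma rep_mult:
  assumes "rep T u U" "rep T v V"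
  shows "rep T (\<lambda>x. u x * v x) (\<lambda>t. U t * V t)"
  unfolding rep_def
proof (intro conjI ballI)
  have hu: "holo_on u {x. base_pt x \<in> T}" and hv: "holo_on v {x. base_pt x \<in> T}"
    and hU: "holo_mat U T" and hV: "holo_mat V T" using assms by (auto simp: rep_def)
  show "holo_on (\<lambda>x. u x * v x) {x. base_pt x \<in> T}" using hu hv by auto
  show "holo_mat (\<lambda>t. U t * V t) T" using hU hV by (rule holo_mat_mult)
  fix t assume t: "t \<in> T"
  interpret A: comm_alg "a t" "e t" using alg t T by auto
  have cU: "A.cm (U t)" "\<And>y. y \<in> A.spec \<Longrightarrow> rowm y (U t) = (\<lambda>j. u (pt t y) * y j)"
    and cV: "A.cm (V t)" "\<And>y. y \<in> A.spec \<Longrightarrow> rowm y (V t) = (\<lambda>j. v (pt t y) * y j)"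
    using assms t by (auto simp: rep_def)
  show "A.cm (U t * V t)" using cU cV by simp
  show "rowm y (U t * V t) = (\<lambda>j. (u (pt t y) * v (pt t y)) * y j)" if "y \<in> A.spec" for y
    using that cU cV by (simp add: rowm_mult mult.assoc)
  obtain X Y where "rep_wit t u U X Y"
    using assms(1) t unfolding rep_def by blast
  then have X: "\<And>m. A.cm (X m)" "\<And>m. A.cm (Y m)"
      "\<And>m y. y \<in> A.spec \<Longrightarrow> rowm y (X m) = (\<lambda>j. pd (Inr m) u (pt t y) * y j)"
      "\<And>m y. y \<in> A.spec \<Longrightarrow> rowm y (Y m) = (\<lambda>j. pd (Inl m) u (pt t y) * y j)"
      "\<And>k B. A.cm B \<Longrightarrow> tr (dmat k U t * B) = tr (Y k * B) + (\<Sum>m\<in>UNIV. tr (dmat k (\<lambda>t. a t m) t * (X m * B)))"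
    unfolding rep_wit_def by blast+
  obtain X' Y' where "rep_wit t v V X' Y'"
    using assms(2) t unfolding rep_def by blast
  then have X': "\<And>m. A.cm (X' m)" "\<And>m. A.cm (Y' m)"
      "\<And>m y. y \<in> A.spec \<Longrightarrow> rowm y (X' m) = (\<lambda>j. pd (Inr m) v (pt t y) * y j)"
      "\<And>m y. y \<in> A.spec \<Longrightarrow> rowm y (Y' m) = (\<lambda>j. pd (Inl m) v (pt t y) * y j)"
      "\<And>k B. A.cm B \<Longrightarrow> tr (dmat k V t * B) = tr (Y' k * B) + (\<Sum>m\<in>UNIV. tr (dmat k (\<lambda>t. a t m) t * (X' m * B)))"
    unfolding rep_wit_def by blast+
  have pd: "pd j (\<lambda>x. u x * v x) (pt t y) = pd j u (pt t y) * v (pt t y) + u (pt t y) * pd j v (pt t y)" for j y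
    by (rule pd_mult[OF hu hv open_base_pt_vimage[OF T(1)]]) (use t in simp)
  have tr: "tr (dmat k (\<lambda>t. U t * V t) t * B) = tr ((Y k * V t + U t * Y' k) * B) +
      (\<Sum>m\<in>UNIV. tr (dmat k (\<lambda>t. a t m) t * ((X m * V t + U t * X' m) * B)))" if B: "A.cm B" for k B
  proof -
    have X'U: "X' m * (U t * B) = U t * X' m * B" for m
      using A.cm_commute[OF cU(1) X'(1)] by (metis mult.assoc)
    have "tr (dmat k (\<lambda>t. U t * V t) t * B) = tr (dmat k U t * (V t * B)) + tr (U t * dmat k V t * B)"
      by (simp add: dmat_mult[OF hU hV T(1) t] distrib_right mult.assoc)
    also have "tr (U t * dmat k V t * B) = tr (dmat k V t * (U t * B))"
      using A.cm_commute[OF cU(1) B] by (metis mult.assoc tr_mult_commute)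
    also have "tr (dmat k U t * (V t * B)) = tr (Y k * (V t * B)) + (\<Sum>m\<in>UNIV. tr (dmat k (\<lambda>t. a t m) t * (X m * (V t * B))))"
      using B cV by (intro X(5)) simp
    also have "tr (dmat k V t * (U t * B)) = tr (Y' k * (U t * B)) + (\<Sum>m\<in>UNIV. tr (dmat k (\<lambda>t. a t m) t * (X' m * (U t * B))))"
      using B cU by (intro X'(5)) simp
    also have "Y' k * (U t * B) = U t * Y' k * B"
      using A.cm_commute[OF cU(1) X'(2)] by (metis mult.assoc)
    finally show ?thesis by (simp add: X'U algebra_simps sum.distrib)
  qed
  show "\<exists>X Y. rep_wit t (\<lambda>x. u x * v x) (\<lambda>t. U t * V t) X Y"
    unfolding rep_wit_def
    by (rule exI[of _ "\<lambda>m. X m * V t + U t * X' m"], rule exI[of _ "\<lambda>m. Y m * V t + U t * Y' m"])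
      (use tr in \<open>auto simp: X(1-4) X'(1-4) cU cV pd rowm_mult distrib_right mult.assoc\<close>)
qed

lemma rep_sum:
  assumes "finite K" "\<And>k. k \<in> K \<Longrightarrow> rep T (u k) (U k)"
  shows "rep T (\<lambda>x. \<Sum>k\<in>K. u k x) (\<lambda>t. \<Sum>k\<in>K. U k t)"
  using assms
proof (induction K rule: finite_induct)
  case empty
  then show ?case using rep_base[of "\<lambda>_. 0"] by simp
next
  case (insert k K)
  then show ?case using rep_add[of "u k" "U k"] by simp
qed

text \<open>Nilpotency makes the traces of the derivatives of \<open>U\<close> and \<open>V\<close>
  against the commutant vanish. The chain rule then expresses the \<open>t\<close>-derivatives of
  \<open>u\<close> and \<open>v\<close> through derivatives of the \<open>a m\<close>. In the
  bracket these combine to differences antisymmetric in \<open>k\<close> and \<open>m\<close>, which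
  \<open>closed\<close> annihilates.\<close>

lemma poisson_rep_eq_0:
  assumes u: "rep T u U" "\<And>t. t \<in> T \<Longrightarrow> U t ^ M = 0" and v: "rep T v V" "\<And>t. t \<in> T \<Longrightarrow> V t ^ M' = 0"
    and t: "t \<in> T" and y: "y \<in> spec t"
  shows "poisson u v (pt t y) = 0"
proof -
  interpret A: comm_alg "a t" "e t" using alg t T by auto
  have nil: "tr (dmat k F t * B) = 0" if "rep T f F" "\<And>t. t \<in> T \<Longrightarrow> F t ^ N = 0" "A.cm B" for f F N k B
  proof -
    \<comment> \<open>The test matrix is given at \<open>t\<close> only. Freezing its coordinates
      \<open>\<beta>\<close> with respect to the basis matrices extends it to a family that lies in
      the commutant at every point.\<close>
    define \<beta> where "\<beta> l = (\<Sum>j\<in>UNIV. entry B l j * e t j)" for l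
    define Bt where "Bt s = (\<Sum>l\<in>UNIV. sc (\<beta> l) (a s l))" for s
    have B: "Bt t = B" using A.cm_expand[OF that(3)] by (simp add: Bt_def \<beta>_def)
    define S where "S = {w. t + axis k w \<in> T}"
    have "tr (smat_of (\<lambda>i j. deriv (\<lambda>w. entry (F (t + axis k w)) i j) 0) * Bt (t + axis k 0)) = 0"
    proof (rule holomorphic_nilpotent_trace[of S])
      show "open S" unfolding S_def by (rule open_axis_vimage[OF T(1)])
      show "0 \<in> S" using t by (simp add: S_def)
      have "holo_mat F T" using that(1) by (simp add: rep_def)
      then show "(\<lambda>w. entry (F (t + axis k w)) i j) holomorphic_on S" for i j
        unfolding S_def holo_mat_def by (intro holo_on_line_axis[of "\<lambda>t. entry (F t) i j"] T) auto
      have "holo_on (\<lambda>s. entry (Bt s) i j) T" for i j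
        unfolding Bt_def using holo_a T
        by (auto simp: holo_mat_def intro!: holo_on_sum holo_on_mult intro: holo_on_subset)
      then show "(\<lambda>w. entry (Bt (t + axis k w)) i j) holomorphic_on S" for i j
        unfolding S_def by (intro holo_on_line_axis[of "\<lambda>t. entry (Bt t) i j"] T)
      fix w assume w: "w \<in> S"
      then show "F (t + axis k w) ^ N = 0" using that(2) by (simp add: S_def)
      interpret A': comm_alg "a (t + axis k w)" "e (t + axis k w)" using alg w T by (auto simp: S_def)
      have "A'.cm (F (t + axis k w))" using that(1) w by (simp add: rep_def S_def)
      then show "F (t + axis k w) * Bt (t + axis k w) = Bt (t + axis k w) * F (t + axis k w)"
        by (rule A'.cm_commute) (auto simp: Bt_def)
    qed
    then show ?thesis by (simp add: B dmat_def pd_def)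
  qed
  obtain X Y where "rep_wit t u U X Y"
    using u(1) t unfolding rep_def by blast
  then have X: "\<And>m. A.cm (X m)" "\<And>m. A.cm (Y m)"
      "\<And>m y. y \<in> A.spec \<Longrightarrow> rowm y (X m) = (\<lambda>j. pd (Inr m) u (pt t y) * y j)"
      "\<And>m y. y \<in> A.spec \<Longrightarrow> rowm y (Y m) = (\<lambda>j. pd (Inl m) u (pt t y) * y j)"
      "\<And>k B. A.cm B \<Longrightarrow> tr (dmat k U t * B) = tr (Y k * B) + (\<Sum>m\<in>UNIV. tr (dmat k (\<lambda>t. a t m) t * (X m * B)))"
    unfolding rep_wit_def by blast+
  obtain X' Y' where "rep_wit t v V X' Y'"
    using v(1) t unfolding rep_def by blast
  then have X': "\<And>m. A.cm (X' m)" "\<And>m. A.cm (Y' m)"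
      "\<And>m y. y \<in> A.spec \<Longrightarrow> rowm y (X' m) = (\<lambda>j. pd (Inr m) v (pt t y) * y j)"
      "\<And>m y. y \<in> A.spec \<Longrightarrow> rowm y (Y' m) = (\<lambda>j. pd (Inl m) v (pt t y) * y j)"
      "\<And>k B. A.cm B \<Longrightarrow> tr (dmat k V t * B) = tr (Y' k * B) + (\<Sum>m\<in>UNIV. tr (dmat k (\<lambda>t. a t m) t * (X' m * B)))"
    unfolding rep_wit_def by blast+
  let ?d = "\<lambda>k m. dmat k (\<lambda>t. a t m) t"
  \<comment> \<open>The bracket evaluated at \<open>y = a\<close>: \<open>Y\<close>,
    \<open>Y'\<close> stand for the derivatives along the base and \<open>X\<close>,
    \<open>X'\<close> for those along the fiber.\<close>
  define H where "H = (\<Sum>k\<in>UNIV. Y k * X' k - X k * Y' k)"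
  have cH: "A.cm H" unfolding H_def using X X' by auto
  have "tr (H * B) = 0" if B: "A.cm B" for B
  proof -
    have 1: "tr (Y k * X' k * B) = - (\<Sum>m\<in>UNIV. tr (?d k m * (X m * X' k * B)))" for k
    proof -
      have "tr (Y k * (X' k * B)) + (\<Sum>m\<in>UNIV. tr (?d k m * (X m * (X' k * B)))) = 0"
        using X(5)[of "X' k * B" k] nil[OF u, of "X' k * B" k] X'(1) B by simp
      then show ?thesis by (simp add: eq_neg_iff_add_eq_0 mult.assoc)
    qed
    have 2: "tr (X k * Y' k * B) = - (\<Sum>m\<in>UNIV. tr (?d k m * (X k * X' m * B)))" for k
    proof -
      have "tr (Y' k * (X k * B)) + (\<Sum>m\<in>UNIV. tr (?d k m * (X' m * (X k * B)))) = 0"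
        using X'(5)[of "X k * B" k] nil[OF v, of "X k * B" k] X(1) B by simp
      moreover have "Y' k * (X k * B) = X k * Y' k * B" using A.cm_commute[OF X'(2) X(1)] by (metis mult.assoc)
      moreover have "X' m * (X k * B) = X k * X' m * B" for m using A.cm_commute[OF X'(1) X(1)] by (metis mult.assoc)
      ultimately show ?thesis by (simp add: eq_neg_iff_add_eq_0)
    qed
    have "tr (H * B) = (\<Sum>k\<in>UNIV. tr (Y k * X' k * B)) - (\<Sum>k\<in>UNIV. tr (X k * Y' k * B))"
      by (simp add: H_def sum_distrib_right left_diff_distrib tr_sum sum_subtractf)
    also have "\<dots> = (\<Sum>k\<in>UNIV. \<Sum>m\<in>UNIV. tr (?d k m * (X k * X' m * B))) - (\<Sum>k\<in>UNIV. \<Sum>m\<in>UNIV. tr (?d k m * (X m * X' k * B)))"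
      by (simp add: 1 2 sum_negf)
    \<comment> \<open>Exchanging the summation indices gives both sums the same matrix
      \<open>X k * X' m * B\<close>, so that only the antisymmetric difference remains in
      front.\<close>
    also have "(\<Sum>k\<in>UNIV. \<Sum>m\<in>UNIV. tr (?d k m * (X m * X' k * B))) = (\<Sum>k\<in>UNIV. \<Sum>m\<in>UNIV. tr (?d m k * (X k * X' m * B)))"
      by (rule sum.swap)
    also have "(\<Sum>k\<in>UNIV. \<Sum>m\<in>UNIV. tr (?d k m * (X k * X' m * B))) - (\<Sum>k\<in>UNIV. \<Sum>m\<in>UNIV. tr (?d m k * (X k * X' m * B)))
       = (\<Sum>k\<in>UNIV. \<Sum>m\<in>UNIV. tr ((?d k m - ?d m k) * (X k * X' m * B)))"
      by (simp add: sum_subtractf left_diff_distrib)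
    also have "\<dots> = 0"
    proof (intro sum.neutral ballI)
      fix k m
      have "A.cm (X k * X' m * B)" using X X' B by simp
      then show "tr ((?d k m - ?d m k) * (X k * X' m * B)) = 0"
        using T t by (intro closed) (auto simp: A.cm_def)
    qed
    finally show ?thesis .
  qed
  moreover have "rowm y H = (\<lambda>j. poisson u v (pt t y) * y j)"
    using y by (simp add: H_def rowm_sum fun_eq_iff rowm_mult X X')
      (simp add: poisson_def sum_distrib_left sum_distrib_right algebra_simps)
  ultimately show ?thesis using A.zero_on_spec_if_traces_zero[OF cH _ y] by blast
qed

end

end

section \<open>Division by the ideal of the spectrum\<close>

subsection \<open>Resolvents\<close>

definition sdet :: "('a::field, 'n::finite) smat \<Rightarrow> 'a" where
  "sdet A = det (\<chi> i j. entry A i j)"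

text \<open>Cramer's rule: the entries are determinants divided by the determinant, so holomorphic
  and continuous dependence on the matrix can be read off.\<close>

definition sinv :: "('a::field, 'n::finite) smat \<Rightarrow> ('a, 'n) smat" where
  "sinv A = smat_of (\<lambda>k q. det (\<chi> i j. if j = k then if i = q then 1 else 0 else entry A i j) / sdet A)"

lemma sinv_right:
  fixes A :: "('a::field, 'n::finite) smat"
  assumes "sdet A \<noteq> 0" shows "A * sinv A = 1"
proof (rule smat_eqI)
  fix p q
  let ?M = "\<chi> i j. entry A i j" and ?b = "axis q 1 :: 'a^'n"
  have "?M *v (\<chi> k. det (\<chi> i j. if j = k then ?b $ i else ?M $ i $ j) / det ?M) = ?b"
    using cramer[of ?M _ ?b] assms by (simp add: sdet_def)
  then have "(?M *v (\<chi> k. det (\<chi> i j. if j = k then ?b $ i else ?M $ i $ j) / det ?M)) $ p = ?b $ p"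
    by simp
  moreover have "det (\<chi> i j. if j = k then ?b $ i else ?M $ i $ j)
      = det (\<chi> i j. if j = k then if i = q then 1 else 0 else entry A i j)" for k
    by (rule arg_cong[where f = det]) (auto simp: vec_eq_iff axis_def)
  ultimately show "entry (A * sinv A) p q = entry 1 p q"
    by (simp add: entry_mult sinv_def sdet_def matrix_vector_mult_def axis_def)
qed

lemma holo_on_sdet: "holo_mat A T \<Longrightarrow> holo_on (\<lambda>t. sdet (A t)) T"
  unfolding sdet_def det_def holo_mat_def by (auto intro!: holo_on_sum holo_on_mult holo_on_prod holo_on_const)

lemma holo_mat_sinv:
  assumes "holo_mat A T" "\<And>t. t \<in> T \<Longrightarrow> sdet (A t) \<noteq> 0" shows "holo_mat (\<lambda>t. sinv (A t)) T"
proof -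
  have if_holo: "holo_on (\<lambda>t. if b then c else f t) T" if "holo_on f T" for b c f using that by (cases b) auto
  show ?thesis
    using assms unfolding holo_mat_def sinv_def entry_smat_of divide_inverse det_def
    by (auto intro!: holo_on_sum holo_on_mult holo_on_prod holo_on_const holo_on_inverse if_holo
        holo_on_sdet[unfolded holo_mat_def])
qed

lemma continuous_on_sdet:
  fixes A :: "'b::topological_space \<Rightarrow> (complex, 'n::finite) smat"
  assumes "\<And>i j. continuous_on S (\<lambda>x. entry (A x) i j)" shows "continuous_on S (\<lambda>x. sdet (A x))"
  unfolding sdet_def det_def using assms by (auto intro!: continuous_intros)

lemma continuous_on_sinv:
  fixes A :: "'b::topological_space \<Rightarrow> (complex, 'n::finite) smat"
  assumes "\<And>i j. continuous_on S (\<lambda>x. entry (A x) i j)" "\<And>x. x \<in> S \<Longrightarrow> sdet (A x) \<noteq> 0"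
  shows "continuous_on S (\<lambda>x. entry (sinv (A x)) i j)"
proof -
  have if_cont: "continuous_on S (\<lambda>t. if b then c else f t)" if "continuous_on S f" for b c and f :: "'b \<Rightarrow> complex"
    using that by (cases b) auto
  show ?thesis
    unfolding sinv_def entry_smat_of det_def
    using assms by (auto intro!: continuous_intros if_cont continuous_on_sdet)
qed

text \<open>A number larger in modulus than the operator norm is no eigenvalue. This shows that the
  characteristic polynomial is not identically zero, hence that its zeros are isolated.\<close>

lemma resolvent_exists:
  fixes A :: "(complex, 'n::finite) smat"
  shows "\<exists>w. sdet (sc w 1 - A) \<noteq> 0"
proof (rule ccontr)
  assume *: "\<not> ?thesis"
  let ?M = "\<chi> i j. entry A i j"
  have "linear ((*v) ?M)"
    by (auto intro!: linearI simp: matrix_vector_mult_def vec_eq_iff algebra_simps sum.distrib scaleR_sum_right)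
  then obtain K where K: "K > 0" "\<And>x. norm (?M *v x) \<le> norm x * K"
    using bounded_linear.pos_bounded linear_conv_bounded_linear by blast
  define w where "w = complex_of_real (K + 1)"
  have "det (\<chi> i j. entry (sc w 1 - A) i j) = 0" using * by (simp add: sdet_def)
  then obtain x where x: "x \<noteq> 0" "(\<chi> i j. entry (sc w 1 - A) i j) *v x = 0"
    using matrix_left_invertible_ker invertible_left_inverse invertible_det_nz by metis
  have "?M *v x = w *s x"
  proof (rule vec_eq_iff[THEN iffD2], rule)
    fix i
    have "(\<Sum>j\<in>UNIV. entry (sc w 1 - A) i j * x $ j) = 0"
      using arg_cong[OF x(2), of "\<lambda>v. v $ i"] by (simp add: matrix_vector_mult_def)
    moreover have "(\<Sum>j\<in>UNIV. entry (sc w 1 - A) i j * x $ j) =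
        (\<Sum>j\<in>UNIV. (if j = i then w * x $ j else 0) - entry A i j * x $ j)"
      by (intro sum.cong refl) (auto simp: left_diff_distrib)
    ultimately show "(?M *v x) $ i = (w *s x) $ i"
      by (simp add: matrix_vector_mult_def sum_subtractf)
  qed
  then have "norm w * norm x \<le> norm x * K" using K(2)[of x] by (simp add: norm_vector_scalar_mult)
  moreover have "norm w = K + 1" using K(1) by (simp add: w_def)
  ultimately show False using x(1) by (simp add: algebra_simps)
qed

subsection \<open>The iterated division\<close>

definition sr :: "complex^('n::finite + 'n) \<Rightarrow> 'n \<Rightarrow> complex \<Rightarrow> complex^('n + 'n)" where
  "sr x i w = (\<chi> l. if l = Inr i then w else x $ l)"

lemma sr_simps [simp]: "sr x i w $ Inl k = x $ Inl k" "sr x i w $ Inr j = (if j = i then w else x $ Inr j)"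
  "base_pt (sr x i w) = base_pt x"
  by (auto simp: sr_def base_pt_def)

lemma sr_axis: "sr x i w = sr x i 0 + axis (Inr i) w"
  by (auto simp: sr_def axis_def vec_eq_iff)

lemma sr_self [simp]: "sr x i (x $ Inr i) = x"
  by (auto simp: sr_def vec_eq_iff)

context holo_comm_alg
begin

section \<open>The ideal of the spectrum and division by it\<close>

definition ug :: "complex^('n + 'n) \<Rightarrow> complex" where
  "ug x = (\<Sum>k\<in>UNIV. e (base_pt x) k * x $ Inr k) - 1"

definition mg :: "'n \<Rightarrow> 'n \<Rightarrow> complex^('n + 'n) \<Rightarrow> complex" where
  "mg i j x = x $ Inr i * x $ Inr j - (\<Sum>k\<in>UNIV. entry (a (base_pt x) i) k j * x $ Inr k)"

text \<open>In contrast to \<open>ideal_sheaf\<close>, there is one representation on all of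
  \<open>N\<close>, with coefficients indexed by the generators. This makes sums and multiples
  immediate.\<close>

definition gen_ideal :: "(complex^('n + 'n)) set \<Rightarrow> (complex^('n + 'n) \<Rightarrow> complex) set" where
  "gen_ideal N = {f. \<exists>b0 b. holo_on b0 N \<and> (\<forall>i j. holo_on (b i j) N) \<and>
     (\<forall>x\<in>N. f x = b0 x * ug x + (\<Sum>i\<in>UNIV. \<Sum>j\<in>UNIV. b i j x * mg i j x))}"

lemma gen_ideal_cong: "f \<in> gen_ideal N \<Longrightarrow> (\<And>x. x \<in> N \<Longrightarrow> g x = f x) \<Longrightarrow> g \<in> gen_ideal N"
  unfolding gen_ideal_def by auto

lemma gen_ideal_add:
  assumes "f \<in> gen_ideal N" "g \<in> gen_ideal N" shows "(\<lambda>x. f x + g x) \<in> gen_ideal N"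
proof -
  obtain b0 b where b: "holo_on b0 N" "\<And>i j. holo_on (b i j) N"
    "\<And>x. x \<in> N \<Longrightarrow> f x = b0 x * ug x + (\<Sum>i\<in>UNIV. \<Sum>j\<in>UNIV. b i j x * mg i j x)"
    using assms(1) unfolding gen_ideal_def by blast
  obtain c0 c where c: "holo_on c0 N" "\<And>i j. holo_on (c i j) N"
    "\<And>x. x \<in> N \<Longrightarrow> g x = c0 x * ug x + (\<Sum>i\<in>UNIV. \<Sum>j\<in>UNIV. c i j x * mg i j x)"
    using assms(2) unfolding gen_ideal_def by blast
  have "\<forall>x\<in>N. f x + g x = (b0 x + c0 x) * ug x + (\<Sum>i\<in>UNIV. \<Sum>j\<in>UNIV. (b i j x + c i j x) * mg i j x)"
    using b(3) c(3) by (simp add: algebra_simps sum.distrib)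
  moreover have "holo_on (\<lambda>x. b0 x + c0 x) N" "\<forall>i j. holo_on (\<lambda>x. b i j x + c i j x) N" using b c by auto
  ultimately show ?thesis
    unfolding gen_ideal_def mem_Collect_eq
    by (intro exI[of _ "\<lambda>x. b0 x + c0 x"] exI[of _ "\<lambda>i j x. b i j x + c i j x"]) blast
qed

lemma gen_ideal_mult:
  assumes "f \<in> gen_ideal N" "holo_on h N" shows "(\<lambda>x. h x * f x) \<in> gen_ideal N"
proof -
  obtain b0 b where b: "holo_on b0 N" "\<And>i j. holo_on (b i j) N"
    "\<And>x. x \<in> N \<Longrightarrow> f x = b0 x * ug x + (\<Sum>i\<in>UNIV. \<Sum>j\<in>UNIV. b i j x * mg i j x)"
    using assms(1) unfolding gen_ideal_def by blast
  have "\<forall>x\<in>N. h x * f x = (h x * b0 x) * ug x + (\<Sum>i\<in>UNIV. \<Sum>j\<in>UNIV. (h x * b i j x) * mg i j x)"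
    using b(3) by (simp add: distrib_left sum_distrib_left mult.assoc)
  moreover have "holo_on (\<lambda>x. h x * b0 x) N" "\<forall>i j. holo_on (\<lambda>x. h x * b i j x) N" using b assms(2) by auto
  ultimately show ?thesis
    unfolding gen_ideal_def mem_Collect_eq
    by (intro exI[of _ "\<lambda>x. h x * b0 x"] exI[of _ "\<lambda>i j x. h x * b i j x"]) blast
qed

lemma gen_ideal_0: "(\<lambda>x. 0) \<in> gen_ideal N"
  unfolding gen_ideal_def mem_Collect_eq by (rule exI[of _ "\<lambda>x. 0"], rule exI[of _ "\<lambda>i j x. 0"]) simp

lemma gen_ideal_ug: "ug \<in> gen_ideal N"
  unfolding gen_ideal_def mem_Collect_eq by (rule exI[of _ "\<lambda>x. 1"], rule exI[of _ "\<lambda>i j x. 0"]) simp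

lemma gen_ideal_mg: "mg i j \<in> gen_ideal N"
proof -
  have "(\<Sum>p\<in>UNIV. \<Sum>q\<in>UNIV. (if p = i then if q = j then 1 else 0 else 0) * mg p q x) = mg i j x" for x
  proof -
    have "(\<Sum>p\<in>UNIV. \<Sum>q\<in>UNIV. (if p = i then if q = j then 1 else 0 else 0) * mg p q x) =
        (\<Sum>p\<in>UNIV. if p = i then \<Sum>q\<in>UNIV. if q = j then mg p q x else 0 else 0)"
      by (intro sum.cong refl) (auto intro!: sum.cong simp del: sum.delta sum.delta')
    then show ?thesis by simp
  qed
  then show ?thesis unfolding gen_ideal_def mem_Collect_eq
    by (intro exI[of _ "\<lambda>x. 0"] exI[of _ "\<lambda>p q x. if p = i then if q = j then 1 else 0 else 0"]) simp
qed

lemma gen_ideal_sum: "(\<And>k. k \<in> K \<Longrightarrow> f k \<in> gen_ideal N) \<Longrightarrow> (\<lambda>x. \<Sum>k\<in>K. f k x) \<in> gen_ideal N"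
  by (induction K rule: infinite_finite_induct) (auto simp: gen_ideal_0 gen_ideal_add)

lemma gen_ideal_uminus: "f \<in> gen_ideal N \<Longrightarrow> (\<lambda>x. - f x) \<in> gen_ideal N"
  using gen_ideal_mult[of f N "\<lambda>x. - 1"] by simp

lemma spec_iff:
  assumes "base_pt x \<in> \<Omega>"
  shows "(\<lambda>k. x $ Inr k) \<in> spec (base_pt x) \<longleftrightarrow> ug x = 0 \<and> (\<forall>i j. mg i j x = 0)"
proof -
  interpret A: comm_alg "a (base_pt x)" "e (base_pt x)" using alg assms by auto
  show ?thesis by (auto simp: A.spec_def ug_def mg_def)
qed

definition polydisc :: "(complex^'n) set \<Rightarrow> ('n \<Rightarrow> complex) \<Rightarrow> real \<Rightarrow> (complex^('n + 'n)) set" where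
  "polydisc T y0 \<epsilon> = {x. base_pt x \<in> T \<and> (\<forall>i. norm (x $ Inr i - y0 i) < \<epsilon>)}"

lemma open_polydisc: "open T \<Longrightarrow> open (polydisc T y0 \<epsilon>)"
proof -
  assume "open T"
  have "polydisc T y0 \<epsilon> = {x. base_pt x \<in> T} \<inter> (\<Inter>i\<in>UNIV. {x. norm (x $ Inr i - y0 i) < \<epsilon>})"
    by (auto simp: polydisc_def)
  moreover have "open {x :: complex^('n + 'n). norm (x $ Inr i - y0 i) < \<epsilon>}" for i
    by (intro open_Collect_less continuous_intros)
  ultimately show ?thesis
    using open_base_pt_vimage[OF \<open>open T\<close>] by (simp only:) (intro open_Int open_INT; simp)
qed

text \<open>The state of the division after the fiber variables in \<open>J\<close> have been
  eliminated from the coefficients. They live on the larger polydisc, which contains the circles of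
  the next Cauchy integral, whereas the congruence holds on the smaller one, inside the circles. The
  last clause gives the value at a point of the spectrum: coordinates in \<open>J\<close> are
  substituted if they lie inside the circles, and otherwise the value is 0.\<close>

definition division_rep where
  "division_rep T y0 \<epsilon> \<epsilon>' h J c \<longleftrightarrow>
     (\<forall>k. holo_on (c k) (polydisc T y0 \<epsilon>')) \<and>
     (\<forall>k. \<forall>x\<in>polydisc T y0 \<epsilon>'. \<forall>x'\<in>polydisc T y0 \<epsilon>'. base_pt x = base_pt x' \<longrightarrow> (\<forall>i. i \<notin> J \<longrightarrow> x $ Inr i = x' $ Inr i) \<longrightarrow> c k x = c k x') \<and>
     (\<lambda>x. h x - (\<Sum>k\<in>UNIV. x $ Inr k * c k x)) \<in> gen_ideal (polydisc T y0 \<epsilon>) \<and>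
     (\<forall>x\<in>polydisc T y0 \<epsilon>'. \<forall>y\<in>spec (base_pt x). (\<Sum>k\<in>UNIV. y k * c k x) =
        (if \<forall>j\<in>J. norm (y j - y0 j) < \<epsilon> then h (pt (base_pt x) (\<lambda>j. if j \<in> J then y j else x $ Inr j)) else 0))"

text \<open>In the Cauchy integral of \<open>c k\<close> over the variable \<open>i\<close>, the
  kernel is replaced by the resolvent of \<open>a t i\<close>, which removes this variable. For a
  row \<open>y\<close> the two kernels differ by \<open>(y i * y - y a) R / (w - y i)\<close>, and
  the entries of the row \<open>y i * y - y a\<close> are generators. At a point of the spectrum
  they vanish, and what is left is the ordinary Cauchy integral with pole at the eigenvalue.\<close>

lemma division_step:
  assumes T: "open T" "T \<subseteq> \<Omega>" and \<epsilon>: "0 < \<epsilon>" "\<epsilon> < \<epsilon>'"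
    and inv: "\<And>t i w. t \<in> T \<Longrightarrow> w \<in> sphere (y0 i) \<epsilon> \<Longrightarrow> sdet (sc w 1 - a t i) \<noteq> 0"
    and c: "division_rep T y0 \<epsilon> \<epsilon>' h J c" and i: "i \<notin> J"
  shows "\<exists>c'. division_rep T y0 \<epsilon> \<epsilon>' h (insert i J) c'"
proof -
  let ?N' = "polydisc T y0 \<epsilon>'" and ?N = "polydisc T y0 \<epsilon>" and ?S = "sphere (y0 i) \<epsilon>"
  let ?I = "\<lambda>f. contour_integral (circlepath (y0 i) \<epsilon>) f / (2 * of_real pi * \<i>)"
  have holc: "holo_on (c k) ?N'" for k using c by (simp add: division_rep_def)
  have c_indep: "c k x = c k x'" if "x \<in> ?N'" "x' \<in> ?N'" "base_pt x = base_pt x'" "\<forall>j. j \<notin> J \<longrightarrow> x $ Inr j = x' $ Inr j"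
    for k x x' using c that unfolding division_rep_def by blast
  have c_val: "(\<Sum>k\<in>UNIV. y k * c k x) =
        (if \<forall>j\<in>J. norm (y j - y0 j) < \<epsilon> then h (pt (base_pt x) (\<lambda>j. if j \<in> J then y j else x $ Inr j)) else 0)"
    if "x \<in> ?N'" "y \<in> spec (base_pt x)" for x y using c that unfolding division_rep_def by blast
  have N_sub: "?N \<subseteq> ?N'" using \<epsilon> by (auto simp: polydisc_def intro: less_trans)
  have sr_in: "sr x i w \<in> ?N'" if "x \<in> ?N'" "norm (w - y0 i) < \<epsilon>'" for x w
    using that by (auto simp: polydisc_def)
  have S: "norm (w - y0 i) < \<epsilon>'" if "w \<in> ?S" for w using that \<epsilon> by (simp add: dist_norm norm_minus_commute)
  define R where "R t w = sinv (sc w 1 - a t i)" for t w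
  define C where "C q x w = (\<Sum>k\<in>UNIV. entry (R (base_pt x) w) q k * c k (sr x i w))" for q x w
  have holo_a': "holo_mat (\<lambda>x. a (base_pt x) i) ?N'"
    using holo_a T by (auto simp: holo_mat_def polydisc_def intro!: holo_on_base_pt[of _ \<Omega>])
  have holR: "holo_mat (\<lambda>x. R (base_pt x) w) ?N'" if w: "w \<in> ?S" for w
    unfolding R_def
    by (rule holo_mat_sinv) (use holo_a' inv w in \<open>auto simp: holo_mat_def polydisc_def intro!: holo_on_diff\<close>)
  have hol_sr: "holo_on (\<lambda>x. c k (sr x i w)) ?N'" if "w \<in> ?S" for k w
  proof (rule holo_on_compose[OF holc])
    show "holo_on (\<lambda>x. sr x i w $ l) ?N'" for l by (cases "l = Inr i") (auto simp: sr_def)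
  qed (use sr_in S that in auto)
  have holC: "holo_on (\<lambda>x. C q x w) ?N'" if "w \<in> ?S" for q w
    unfolding C_def using holR[OF that] hol_sr[OF that] unfolding holo_mat_def
    by (intro holo_on_sum holo_on_mult) blast+
  have contR: "continuous_on (?N' \<times> ?S) (\<lambda>z. entry (R (base_pt (fst z)) (snd z)) p q)" for p q
    unfolding R_def
  proof (rule continuous_on_sinv)
    show "sdet (sc (snd z) 1 - a (base_pt (fst z)) i) \<noteq> 0" if "z \<in> ?N' \<times> ?S" for z
      using that inv by (auto simp: polydisc_def)
    have "continuous_on (?N' \<times> ?S) (\<lambda>z. entry (a (base_pt (fst z)) i) p q)" for p q
      by (rule continuous_on_compose2[OF holo_on_imp_continuous_on, of "\<lambda>x. entry (a (base_pt x) i) p q" ?N' _ fst])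
        (use holo_a' in \<open>auto simp: holo_mat_def intro!: continuous_intros\<close>)
    then show "continuous_on (?N' \<times> ?S) (\<lambda>z. entry (sc (snd z) 1 - a (base_pt (fst z)) i) p q)" for p q
      by (auto intro!: continuous_intros)
  qed
  have cont_sr: "continuous_on (?N' \<times> ?S) (\<lambda>z. c k (sr (fst z) i (snd z)))" for k
  proof (rule continuous_on_compose2[OF holo_on_imp_continuous_on[OF holc]])
    have "continuous_on (?N' \<times> ?S) (\<lambda>z. if l = Inr i then snd z else fst z $ l)" for l
      by (cases "l = Inr i") (auto intro!: continuous_intros)
    then show "continuous_on (?N' \<times> ?S) (\<lambda>z. sr (fst z) i (snd z))"
      unfolding sr_def by (intro continuous_on_vec_lambda)
  qed (use sr_in S in auto)
  have contC: "continuous_on (?N' \<times> ?S) (\<lambda>z. C q (fst z) (snd z))" for q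
    unfolding C_def by (intro continuous_intros contR cont_sr)
  define c' where "c' q x = ?I (C q x)" for q x
  have integrable: "f contour_integrable_on circlepath (y0 i) \<epsilon>" if "continuous_on ?S f" for f
    using that \<epsilon> by (intro contour_integrable_continuous_circlepath) (simp add: path_image_circlepath)
  have cont_slice: "continuous_on ?S (\<lambda>w. g x w)"
    if "continuous_on (D \<times> ?S) (\<lambda>z. g (fst z) (snd z))" "x \<in> D" for g :: "_ \<Rightarrow> _ \<Rightarrow> complex" and x and D :: "(complex^('n + 'n)) set"
  proof -
    have "continuous_on ?S (\<lambda>w. g (fst (x, w)) (snd (x, w)))"
      by (rule continuous_on_compose2[OF that(1)]) (use that(2) in \<open>auto intro!: continuous_on_Pair continuous_on_const continuous_on_id\<close>)
    then show ?thesis by simp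
  qed
  have holc': "holo_on (c' q) ?N'" for q
    unfolding c'_def divide_inverse using holo_on_contour_integral(1)[OF open_polydisc[OF T(1)] \<epsilon>(1), of y0 \<epsilon>' "y0 i" "C q"]
      contC[of q] holC by (intro holo_on_mult holo_on_const) (auto simp: case_prod_beta)
  have indep: "c' q x = c' q x'" if x: "x \<in> ?N'" "x' \<in> ?N'" "base_pt x = base_pt x'"
      "\<And>j. j \<notin> insert i J \<Longrightarrow> x $ Inr j = x' $ Inr j" for q x x'
  proof -
    have "contour_integral (circlepath (y0 i) \<epsilon>) (C q x) = contour_integral (circlepath (y0 i) \<epsilon>) (C q x')"
    proof (rule contour_integral_cong)
      fix w assume "w \<in> path_image (circlepath (y0 i) \<epsilon>)"
      then have w: "norm (w - y0 i) < \<epsilon>'" using \<epsilon> S by (simp add: path_image_circlepath)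
      have "c k (sr x i w) = c k (sr x' i w)" for k
        by (rule c_indep[OF sr_in[OF x(1) w] sr_in[OF x(2) w]]) (use x(3,4) in auto)
      then show "C q x w = C q x' w" by (simp add: C_def x(3))
    qed simp
    then show ?thesis by (simp add: c'_def)
  qed
  have A_R: "(sc w 1 - a t i) * R t w = 1" if "t \<in> T" "w \<in> ?S" for t w
    unfolding R_def by (rule sinv_right[OF inv[OF that]])
  have hol_line: "(\<lambda>w. c k (sr x i w)) holomorphic_on ball (y0 i) \<epsilon>'" if x: "x \<in> ?N'" for k x
  proof -
    have "(\<lambda>w. c k (sr x i 0 + axis (Inr i) w)) holomorphic_on {w. sr x i 0 + axis (Inr i) w \<in> ?N'}"
      by (rule holo_on_line_axis[OF holc open_polydisc[OF T(1)]])
    then show ?thesis unfolding sr_axis[symmetric]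
      by (rule holomorphic_on_subset) (use sr_in[OF x] in \<open>auto simp: dist_norm norm_minus_commute\<close>)
  qed
  \<comment> \<open>This is \<open>y = y (w - a) R\<close>, expanded.\<close>
  have rowm_R: "y q = w * rowm y (R t w) q - rowm (rowm y (a t i)) (R t w) q"
    if "t \<in> T" "w \<in> ?S" for y q t w
  proof -
    have "y q = rowm y ((sc w 1 - a t i) * R t w) q" by (simp add: A_R[OF that])
    also have "\<dots> = rowm (\<lambda>j. w * y j - rowm y (a t i) j) (R t w) q" by (simp add: rowm_mult)
    finally show ?thesis by (simp add: rowm_def algebra_simps sum_subtractf sum_distrib_left)
  qed
  have sum_C: "(\<Sum>k\<in>UNIV. y k * C k x w) = (\<Sum>q\<in>UNIV. rowm y (R (base_pt x) w) q * c q (sr x i w))" for y x w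
    unfolding C_def rowm_def sum_distrib_left sum_distrib_right mult.assoc by (rule sum.swap)
  have mem: "(\<lambda>x. h x - (\<Sum>k\<in>UNIV. x $ Inr k * c' k x)) \<in> gen_ideal ?N"
  proof -
    define b where "b j x = ?I (\<lambda>w. C j x w / (w - x $ Inr i))" for j x
    have ne: "w - x $ Inr i \<noteq> 0" if "x \<in> ?N" "w \<in> ?S" for x w
      using that by (auto simp: polydisc_def dist_norm norm_minus_commute)
    have contb: "continuous_on (?N \<times> ?S) (\<lambda>z. C j (fst z) (snd z) / (snd z - fst z $ Inr i))" for j
      by (intro continuous_on_divide continuous_on_subset[OF contC] continuous_intros) (use N_sub ne in auto)
    have holb: "holo_on (b j) ?N" for j
    proof -
      have "holo_on (\<lambda>x. C j x w / (w - x $ Inr i)) ?N" if "w \<in> ?S" for w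
        unfolding divide_inverse using ne[OF _ that] holo_on_subset[OF holC[OF that] N_sub] by (intro holo_on_mult holo_on_inverse) auto
      then have "holo_on (\<lambda>x. contour_integral (circlepath (y0 i) \<epsilon>) (\<lambda>w. C j x w / (w - x $ Inr i))) ?N"
        by (intro holo_on_contour_integral(1)[OF open_polydisc[OF T(1)] \<epsilon>(1)])
          (use contb[of j] in \<open>auto simp: case_prod_beta\<close>)
      then show ?thesis unfolding b_def divide_inverse by (intro holo_on_mult) auto
    qed
    have "h x - (\<Sum>k\<in>UNIV. x $ Inr k * c' k x) = (h x - (\<Sum>k\<in>UNIV. x $ Inr k * c k x)) + (\<Sum>j\<in>UNIV. b j x * mg i j x)"
      if x: "x \<in> ?N" for x
    proof -
      define y where "y k = x $ Inr k" for k
      have xN': "x \<in> ?N'" and xT: "base_pt x \<in> T" using x N_sub by (auto simp: polydisc_def)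
      have yi: "y i \<in> ball (y0 i) \<epsilon>" using x by (simp add: y_def polydisc_def dist_norm norm_minus_commute)
      have 1: "((\<lambda>w. c k (sr x i w) / (w - y i)) has_contour_integral (2 * of_real pi * \<i> * c k x)) (circlepath (y0 i) \<epsilon>)" for k
      proof -
        have sub: "cball (y0 i) \<epsilon> \<subseteq> ball (y0 i) \<epsilon>'" using \<epsilon> by auto
        have "((\<lambda>w. c k (sr x i w) / (w - y i)) has_contour_integral (2 * of_real pi * \<i> * c k (sr x i (y i)))) (circlepath (y0 i) \<epsilon>)"
          by (rule Cauchy_integral_circlepath)
            (use holomorphic_on_subset[OF hol_line[OF xN'] sub] holomorphic_on_imp_continuous_on
              holomorphic_on_subset[OF _ ball_subset_cball] yi in \<open>auto simp: dist_norm norm_minus_commute\<close>)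
        then show ?thesis by (simp add: y_def)
      qed
      have 2: "(C k x has_contour_integral (2 * of_real pi * \<i> * c' k x)) (circlepath (y0 i) \<epsilon>)" for k
      proof -
        have "C k x contour_integrable_on circlepath (y0 i) \<epsilon>"
          using cont_slice[OF contC xN', of k] by (intro integrable) simp
        then show ?thesis using has_contour_integral_integral by (fastforce simp: c'_def)
      qed
      have 3: "((\<lambda>w. C j x w / (w - y i)) has_contour_integral (2 * of_real pi * \<i> * b j x)) (circlepath (y0 i) \<epsilon>)" for j
      proof -
        have "(\<lambda>w. C j x w / (w - y i)) contour_integrable_on circlepath (y0 i) \<epsilon>"
          using cont_slice[OF contb x, of j] by (intro integrable) (simp add: y_def)
        then show ?thesis using has_contour_integral_integral by (fastforce simp: b_def y_def)
      qed
      have "((\<lambda>w. \<Sum>k\<in>UNIV. y k * (c k (sr x i w) / (w - y i) - C k x w)) has_contour_integral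
          (\<Sum>k\<in>UNIV. y k * (2 * of_real pi * \<i> * c k x - 2 * of_real pi * \<i> * c' k x))) (circlepath (y0 i) \<epsilon>)"
        by (intro has_contour_integral_sum has_contour_integral_lmul has_contour_integral_diff 1 2) auto
      then have "((\<lambda>w. \<Sum>j\<in>UNIV. mg i j x * (C j x w / (w - y i))) has_contour_integral
          (\<Sum>k\<in>UNIV. y k * (2 * of_real pi * \<i> * c k x - 2 * of_real pi * \<i> * c' k x))) (circlepath (y0 i) \<epsilon>)"
      proof (rule has_contour_integral_eq)
        fix w assume "w \<in> path_image (circlepath (y0 i) \<epsilon>)"
        then have w: "w \<in> ?S" using \<epsilon> by (simp add: path_image_circlepath)
        have D: "w - y i \<noteq> 0" using ne[OF x w] by (simp add: y_def)
        let ?Y = "rowm y (R (base_pt x) w)" and ?r = "rowm (rowm y (a (base_pt x) i)) (R (base_pt x) w)"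
        have m: "mg i j x = y i * y j - rowm y (a (base_pt x) i) j" for j
          by (simp add: mg_def y_def rowm_def mult.commute)
        have mR: "rowm (\<lambda>j. mg i j x) (R (base_pt x) w) q = y i * ?Y q - ?r q" for q
          unfolding m by (simp add: rowm_def algebra_simps sum_subtractf sum_distrib_left)
        \<comment> \<open>After multiplication by \<open>w - y i\<close> the difference of the
          kernels is \<open>y - (w - y i) y R\<close>. Inserting \<open>rowm_R\<close> for
          \<open>y\<close> turns it into the row of the generators \<open>mg i j\<close> times the
          resolvent.\<close>
        have "(w - y i) * (\<Sum>k\<in>UNIV. y k * (c k (sr x i w) / (w - y i) - C k x w)) =
            (\<Sum>k\<in>UNIV. y k * c k (sr x i w)) - (w - y i) * (\<Sum>k\<in>UNIV. y k * C k x w)"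
          unfolding sum_distrib_left sum_subtractf[symmetric]
          by (intro sum.cong refl) (use D in \<open>simp add: field_simps\<close>)
        also have "\<dots> = (\<Sum>q\<in>UNIV. (y q - (w - y i) * ?Y q) * c q (sr x i w))"
          unfolding sum_C by (simp add: left_diff_distrib sum_subtractf sum_distrib_left mult.assoc)
        also have "\<dots> = (\<Sum>q\<in>UNIV. rowm (\<lambda>j. mg i j x) (R (base_pt x) w) q * c q (sr x i w))"
          unfolding mR by (subst (1) rowm_R[OF xT w]) (simp add: algebra_simps)
        also have "\<dots> = (\<Sum>j\<in>UNIV. mg i j x * C j x w)" by (rule sum_C[symmetric])
        also have "\<dots> = (w - y i) * (\<Sum>j\<in>UNIV. mg i j x * (C j x w / (w - y i)))"
          using D by (simp add: sum_distrib_left)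
        finally show "(\<Sum>k\<in>UNIV. y k * (c k (sr x i w) / (w - y i) - C k x w)) = (\<Sum>j\<in>UNIV. mg i j x * (C j x w / (w - y i)))"
          using D by simp
      qed
      moreover have "((\<lambda>w. \<Sum>j\<in>UNIV. mg i j x * (C j x w / (w - y i))) has_contour_integral
          (\<Sum>j\<in>UNIV. mg i j x * (2 * of_real pi * \<i> * b j x))) (circlepath (y0 i) \<epsilon>)"
        by (intro has_contour_integral_sum has_contour_integral_lmul 3) auto
      ultimately have "(\<Sum>k\<in>UNIV. y k * (2 * of_real pi * \<i> * c k x - 2 * of_real pi * \<i> * c' k x)) = (\<Sum>j\<in>UNIV. mg i j x * (2 * of_real pi * \<i> * b j x))"
        by (rule has_contour_integral_unique)
      moreover have "(\<Sum>k\<in>UNIV. y k * (2 * of_real pi * \<i> * c k x - 2 * of_real pi * \<i> * c' k x)) =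
          (2 * of_real pi * \<i>) * ((\<Sum>k\<in>UNIV. y k * c k x) - (\<Sum>k\<in>UNIV. y k * c' k x))"
        by (simp add: algebra_simps sum_subtractf sum_distrib_left)
      moreover have "(\<Sum>j\<in>UNIV. mg i j x * (2 * of_real pi * \<i> * b j x)) = (2 * of_real pi * \<i>) * (\<Sum>j\<in>UNIV. b j x * mg i j x)"
        by (simp add: sum_distrib_left mult_ac)
      ultimately have "(\<Sum>k\<in>UNIV. y k * c k x) - (\<Sum>k\<in>UNIV. y k * c' k x) = (\<Sum>j\<in>UNIV. b j x * mg i j x)" by simp
      then show ?thesis unfolding y_def by (simp add: algebra_simps)
    qed
    moreover have "(\<lambda>x. (h x - (\<Sum>k\<in>UNIV. x $ Inr k * c k x)) + (\<Sum>j\<in>UNIV. b j x * mg i j x)) \<in> gen_ideal ?N"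
      using c holb by (intro gen_ideal_add gen_ideal_sum gen_ideal_mult gen_ideal_mg) (auto simp: division_rep_def)
    ultimately show ?thesis by (rule gen_ideal_cong[rotated])
  qed
  have val: "(\<Sum>k\<in>UNIV. y k * c' k x) =
        (if \<forall>j\<in>insert i J. norm (y j - y0 j) < \<epsilon> then h (pt (base_pt x) (\<lambda>j. if j \<in> insert i J then y j else x $ Inr j)) else 0)"
    if x: "x \<in> ?N'" and y: "y \<in> spec (base_pt x)" for x y
  proof -
    have xT: "base_pt x \<in> T" using x by (simp add: polydisc_def)
    interpret A: comm_alg "a (base_pt x)" "e (base_pt x)" using alg xT T by auto
    define G where "G w = (\<Sum>q\<in>UNIV. y q * c q (sr x i w))" for w
    have holG: "G holomorphic_on ball (y0 i) \<epsilon>'" unfolding G_def by (intro holomorphic_intros hol_line x)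
    have Gval: "G w = (if \<forall>j\<in>J. norm (y j - y0 j) < \<epsilon> then
        h (pt (base_pt x) (\<lambda>j. if j \<in> J then y j else sr x i w $ Inr j)) else 0)" if "norm (w - y0 i) < \<epsilon>'" for w
      using c_val[OF sr_in[OF x that], of y] y unfolding G_def by (simp only: sr_simps(3))
    \<comment> \<open>Here \<open>y\<close> is a left eigenvector, so the resolvent acts on it as
      \<open>1 / (w - y i)\<close>. As \<open>y\<close> is not zero, this also shows that the circle
      does not meet \<open>y i\<close>.\<close>
    have key: "(w - y i) * rowm y (R (base_pt x) w) q = y q" if w: "w \<in> ?S" for w q
      using rowm_R[OF xT w, of y q] by (simp add: A.spec_rowm[OF y] left_diff_distrib)
    obtain q0 where q0: "y q0 \<noteq> 0" using A.spec_nonzero[OF y] by blast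
    have ne: "w - y i \<noteq> 0" if w: "w \<in> ?S" for w using key[OF w, of q0] q0 by auto
    have int2: "(C k x has_contour_integral (2 * of_real pi * \<i> * c' k x)) (circlepath (y0 i) \<epsilon>)" for k
    proof -
      have "C k x contour_integrable_on circlepath (y0 i) \<epsilon>"
        using cont_slice[OF contC x, of k] by (intro integrable) simp
      then show ?thesis using has_contour_integral_integral by (fastforce simp: c'_def)
    qed
    have "((\<lambda>w. \<Sum>k\<in>UNIV. y k * C k x w) has_contour_integral (\<Sum>k\<in>UNIV. y k * (2 * of_real pi * \<i> * c' k x))) (circlepath (y0 i) \<epsilon>)"
      by (intro has_contour_integral_sum has_contour_integral_lmul int2) auto
    moreover have "(\<Sum>k\<in>UNIV. y k * (2 * of_real pi * \<i> * c' k x)) = 2 * of_real pi * \<i> * (\<Sum>k\<in>UNIV. y k * c' k x)"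
      by (simp add: sum_distrib_left mult_ac)
    ultimately have "((\<lambda>w. \<Sum>k\<in>UNIV. y k * C k x w) has_contour_integral (2 * of_real pi * \<i> * (\<Sum>k\<in>UNIV. y k * c' k x))) (circlepath (y0 i) \<epsilon>)"
      by simp
    then have int: "((\<lambda>w. G w / (w - y i)) has_contour_integral (2 * of_real pi * \<i> * (\<Sum>k\<in>UNIV. y k * c' k x))) (circlepath (y0 i) \<epsilon>)"
    proof (rule has_contour_integral_eq)
      fix w assume "w \<in> path_image (circlepath (y0 i) \<epsilon>)"
      then have w: "w \<in> ?S" using \<epsilon> by (simp add: path_image_circlepath)
      have "rowm y (R (base_pt x) w) q = y q / (w - y i)" for q using key[OF w, of q] ne[OF w] by (simp add: field_simps)
      then show "(\<Sum>k\<in>UNIV. y k * C k x w) = G w / (w - y i)"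
        unfolding sum_C G_def by (simp add: sum_divide_distrib)
    qed
    show ?thesis
    proof (cases "norm (y i - y0 i) < \<epsilon>")
      case True
      have sub: "cball (y0 i) \<epsilon> \<subseteq> ball (y0 i) \<epsilon>'" using \<epsilon> by auto
      have "((\<lambda>w. G w / (w - y i)) has_contour_integral (2 * of_real pi * \<i> * G (y i))) (circlepath (y0 i) \<epsilon>)"
        by (rule Cauchy_integral_circlepath)
          (use holomorphic_on_subset[OF holG sub] holomorphic_on_imp_continuous_on
            holomorphic_on_subset[OF _ ball_subset_cball] True in \<open>auto simp: dist_norm norm_minus_commute\<close>)
      from has_contour_integral_unique[OF int this]
      have "(\<Sum>k\<in>UNIV. y k * c' k x) = G (y i)" by simp
      moreover have "(\<lambda>j. if j \<in> J then y j else sr x i (y i) $ Inr j) = (\<lambda>j. if j \<in> insert i J then y j else x $ Inr j)"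
        by auto
      ultimately show ?thesis using True \<epsilon> Gval[of "y i"] by simp
    next
      case False
      have "norm (y i - y0 i) \<noteq> \<epsilon>" using ne[of "y i"] by (auto simp: dist_norm norm_minus_commute)
      then have far: "norm (y i - y0 i) > \<epsilon>" using False by simp
      \<comment> \<open>A disc that contains the circle, excludes the pole \<open>y i\<close> and
        stays in the domain of \<open>G\<close>.\<close>
      define \<rho> where "\<rho> = min \<epsilon>' (norm (y i - y0 i))"
      have "((\<lambda>w. G w / (w - y i)) has_contour_integral 0) (circlepath (y0 i) \<epsilon>)"
      proof (rule Cauchy_theorem_disc_simple)
        show "(\<lambda>w. G w / (w - y i)) holomorphic_on ball (y0 i) \<rho>"
          by (intro holomorphic_intros holomorphic_on_subset[OF holG])
            (auto simp: \<rho>_def dist_norm norm_minus_commute)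
        show "path_image (circlepath (y0 i) \<epsilon>) \<subseteq> ball (y0 i) \<rho>"
          using \<epsilon> far by (auto simp: path_image_circlepath \<rho>_def)
      qed auto
      from has_contour_integral_unique[OF int this]
      have "(\<Sum>k\<in>UNIV. y k * c' k x) = 0" by simp
      then show ?thesis using False by simp
    qed
  qed
  show ?thesis using holc' indep mem val unfolding division_rep_def by (intro exI[of _ c']) blast
qed

lemma polydisc_mono: "\<epsilon> \<le> \<epsilon>' \<Longrightarrow> polydisc T y0 \<epsilon> \<subseteq> polydisc T y0 \<epsilon>'"
  by (auto simp: polydisc_def intro: less_le_trans)

text \<open>Modulo the unit generator, 1 is the linear form with coefficients \<open>e\<close>.
  Multiplying by \<open>h\<close> makes \<open>h\<close> formally linear in \<open>y\<close>, with
  coefficients that still depend on all fiber variables.\<close>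

lemma division_start:
  assumes "0 < \<epsilon>" "\<epsilon> < \<epsilon>'" "T \<subseteq> \<Omega>" "holo_on h (polydisc T y0 \<epsilon>')"
  shows "division_rep T y0 \<epsilon> \<epsilon>' h {} (\<lambda>k x. h x * e (base_pt x) k)"
proof -
  have sub: "polydisc T y0 \<epsilon> \<subseteq> polydisc T y0 \<epsilon>'" using assms by (auto simp: polydisc_def intro: less_trans)
  have he: "holo_on (\<lambda>x. e (base_pt x) k) (polydisc T y0 \<epsilon>')" for k
    using assms(3) by (intro holo_on_base_pt[OF holo_e]) (auto simp: polydisc_def)
  have "h x - (\<Sum>k\<in>UNIV. x $ Inr k * (h x * e (base_pt x) k)) = (- h x) * ug x" for x
    by (simp add: ug_def algebra_simps sum_distrib_left sum_negf)
  moreover have "(\<lambda>x. (- h x) * ug x) \<in> gen_ideal (polydisc T y0 \<epsilon>)"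
    using holo_on_subset[OF assms(4) sub] by (intro gen_ideal_mult gen_ideal_ug) auto
  moreover have "x = x'" if "base_pt x = base_pt x'" "\<forall>i. x $ Inr i = x' $ Inr i" for x x' :: "complex^('n + 'n)"
  proof -
    have "x = pt (base_pt x) (\<lambda>k. x $ Inr k)" by simp
    also have "\<dots> = x'" using that by simp
    finally show ?thesis .
  qed
  moreover have "(\<Sum>k\<in>UNIV. y k * (h x * e (base_pt x) k)) = h x"
    if "x \<in> polydisc T y0 \<epsilon>'" "y \<in> spec (base_pt x)" for x y
  proof -
    interpret A: comm_alg "a (base_pt x)" "e (base_pt x)" using that assms(3) by (intro alg) (auto simp: polydisc_def)
    have "(\<Sum>k\<in>UNIV. y k * (h x * e (base_pt x) k)) = h x * (\<Sum>k\<in>UNIV. e (base_pt x) k * y k)"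
      by (simp add: sum_distrib_left mult_ac)
    then show ?thesis using that(2) by (simp add: A.spec_def)
  qed
  ultimately show ?thesis
    unfolding division_rep_def using he assms(4) by (auto intro!: holo_on_mult)
qed

text \<open>The value 0 outside of the polydisc is essential: if \<open>h\<close> vanishes at the
  points of the spectrum in the polydisc, then the linear remainder vanishes at every point of the
  spectrum over \<open>T\<close>, which is what nilpotency of its matrix requires.\<close>

lemma division:
  assumes T: "open T" "T \<subseteq> \<Omega>" and \<epsilon>: "0 < \<epsilon>" "\<epsilon> < \<epsilon>'"
    and inv: "\<And>t i w. t \<in> T \<Longrightarrow> w \<in> sphere (y0 i) \<epsilon> \<Longrightarrow> sdet (sc w 1 - a t i) \<noteq> 0"
    and h: "holo_on h (polydisc T y0 \<epsilon>')"
  obtains c where "\<And>k. holo_on (c k) T"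
    "(\<lambda>x. h x - (\<Sum>k\<in>UNIV. x $ Inr k * c k (base_pt x))) \<in> gen_ideal (polydisc T y0 \<epsilon>)"
    "\<And>t y. t \<in> T \<Longrightarrow> y \<in> spec t \<Longrightarrow> (\<Sum>k\<in>UNIV. y k * c k t) = (if pt t y \<in> polydisc T y0 \<epsilon> then h (pt t y) else 0)"
proof -
  have "\<exists>c. division_rep T y0 \<epsilon> \<epsilon>' h J c" if "finite J" for J
    using that
  proof (induction J rule: finite_induct)
    case empty
    then show ?case using division_start[OF \<epsilon> T(2) h] by blast
  next
    case (insert i J)
    from insert.IH obtain c where "division_rep T y0 \<epsilon> \<epsilon>' h J c" ..
    from division_step[OF T \<epsilon> inv this insert.hyps(2)] show ?case .
  qed
  from this[of UNIV, OF finite] obtain c where c: "division_rep T y0 \<epsilon> \<epsilon>' h UNIV c" ..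
  have c_indep: "c k x = c k x'" if "x \<in> polydisc T y0 \<epsilon>'" "x' \<in> polydisc T y0 \<epsilon>'" "base_pt x = base_pt x'"
    for k x x'
    using c[unfolded division_rep_def, THEN conjunct2, THEN conjunct1, rule_format, of x x' k] that by simp
  have c_val: "(\<Sum>k\<in>UNIV. y k * c k x) =
        (if \<forall>j\<in>UNIV. norm (y j - y0 j) < \<epsilon> then h (pt (base_pt x) (\<lambda>j. if j \<in> UNIV then y j else x $ Inr j)) else 0)"
    if "x \<in> polydisc T y0 \<epsilon>'" "y \<in> spec (base_pt x)" for x y using c that unfolding division_rep_def by blast
  \<comment> \<open>The coefficients no longer depend on the fiber coordinates, so they are
    evaluated at the center \<open>y0\<close>, which belongs to every fiber of the polydisc.\<close>
  define c' where "c' k t = c k (pt t y0)" for k t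
  have in_pd: "pt t y0 \<in> polydisc T y0 \<epsilon>'" if "t \<in> T" for t using that \<epsilon> by (simp add: polydisc_def)
  have "holo_on (c' k) T" for k
    unfolding c'_def
  proof (rule holo_on_compose[of "c k" "polydisc T y0 \<epsilon>'"])
    show "holo_on (\<lambda>t. pt t y0 $ l) T" for l by (cases l) auto
  qed (use c in_pd in \<open>auto simp: division_rep_def\<close>)
  moreover have "(\<lambda>x. h x - (\<Sum>k\<in>UNIV. x $ Inr k * c' k (base_pt x))) \<in> gen_ideal (polydisc T y0 \<epsilon>)"
  proof (rule gen_ideal_cong)
    show "(\<lambda>x. h x - (\<Sum>k\<in>UNIV. x $ Inr k * c k x)) \<in> gen_ideal (polydisc T y0 \<epsilon>)"
      using c by (simp add: division_rep_def)
    fix x assume x: "x \<in> polydisc T y0 \<epsilon>"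
    then have "x \<in> polydisc T y0 \<epsilon>'" "base_pt x \<in> T" using \<epsilon> by (auto simp: polydisc_def intro: less_trans)
    then have "c k (pt (base_pt x) y0) = c k x" for k
      by (intro c_indep in_pd) auto
    then show "h x - (\<Sum>k\<in>UNIV. x $ Inr k * c' k (base_pt x)) = h x - (\<Sum>k\<in>UNIV. x $ Inr k * c k x)"
      by (simp add: c'_def)
  qed
  moreover have "(\<Sum>k\<in>UNIV. y k * c' k t) = (if pt t y \<in> polydisc T y0 \<epsilon> then h (pt t y) else 0)"
    if t: "t \<in> T" and y: "y \<in> spec t" for t y
  proof -
    have "(\<Sum>k\<in>UNIV. y k * c k (pt t y0)) = (if \<forall>j. norm (y j - y0 j) < \<epsilon> then h (pt t y) else 0)"
      using c_val[OF in_pd[OF t], of y] y by simp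
    then show ?thesis using t by (simp add: c'_def polydisc_def)
  qed
  ultimately show ?thesis using that by blast
qed

text \<open>Around each coordinate of \<open>x0\<close> there is a circle free of eigenvalues over
  the base point, and by compactness the same circle stays free of them over a neighborhood
  \<open>T\<close>.\<close>

lemma good_polydisc:
  assumes W: "open W" "x0 \<in> W" and x0: "base_pt x0 \<in> \<Omega>"
  obtains T \<epsilon> \<epsilon>' where "open T" "T \<subseteq> \<Omega>" "base_pt x0 \<in> T" "0 < \<epsilon>" "\<epsilon> < \<epsilon>'" "polydisc T (\<lambda>i. x0 $ Inr i) \<epsilon>' \<subseteq> W"
    "\<And>t i w. t \<in> T \<Longrightarrow> w \<in> sphere (x0 $ Inr i) \<epsilon> \<Longrightarrow> sdet (sc w 1 - a t i) \<noteq> 0"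
proof -
  define y0 where "y0 i = x0 $ Inr i" for i
  define t0 where "t0 = base_pt x0"
  obtain e1 where e1: "e1 > 0" "ball x0 e1 \<subseteq> W" using W open_contains_ball by blast
  \<comment> \<open>The norm is at most the sum of the moduli of the coordinates, hence the division
    by their number.\<close>
  define e0 where "e0 = e1 / CARD('n + 'n)"
  have "0 < CARD('n + 'n)" by (rule zero_less_card_finite)
  then have e0: "e0 > 0" using e1(1) by (simp add: e0_def)
  have inW: "x \<in> W" if "\<And>l. norm (x $ l - x0 $ l) < e0" for x
  proof -
    have "norm (x - x0) \<le> (\<Sum>l\<in>UNIV. norm ((x - x0) $ l))" unfolding norm_vec_def by (rule L2_set_le_sum) simp
    also have "\<dots> < (\<Sum>l\<in>(UNIV :: ('n + 'n) set). e0)" using that by (intro sum_strict_mono) auto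
    also have "\<dots> = e1" using \<open>0 < CARD('n + 'n)\<close> by (simp add: e0_def)
    finally show ?thesis using e1(2) by (auto simp: dist_norm norm_minus_commute)
  qed
  \<comment> \<open>As a function of \<open>w\<close> the determinant is entire and not identically
    0, so it has no zeros in a small punctured disc around each coordinate of the center, even if
    that coordinate is itself an eigenvalue.\<close>
  have hol: "(\<lambda>w. sdet (sc w 1 - a t0 i)) holomorphic_on UNIV" for i
    unfolding sdet_def det_def by (auto intro!: holomorphic_intros)
  have "\<exists>d>0. \<forall>w. w \<noteq> y0 i \<and> dist w (y0 i) < d \<longrightarrow> sdet (sc w 1 - a t0 i) \<noteq> 0" for i
  proof -
    obtain w where w: "sdet (sc w 1 - a t0 i) \<noteq> 0" using resolvent_exists by blast
    have "\<forall>\<^sub>F w in at (y0 i). sdet (sc w 1 - a t0 i) \<noteq> 0 \<and> w \<in> UNIV"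
      by (rule non_zero_neighbour_alt[OF hol]) (use w in auto)
    then show ?thesis unfolding eventually_at by auto
  qed
  then obtain d where d: "\<And>i. d i > 0" "\<And>i w. w \<noteq> y0 i \<Longrightarrow> dist w (y0 i) < d i \<Longrightarrow> sdet (sc w 1 - a t0 i) \<noteq> 0"
    by metis
  define \<epsilon>' where "\<epsilon>' = min e0 (Min (range d))"
  \<comment> \<open>The circle of radius \<open>\<epsilon>\<close> avoids the center and remains
    inside each of the zero-free punctured discs.\<close>
  define \<epsilon> where "\<epsilon> = \<epsilon>' / 2"
  have "Min (range d) > 0" using d(1) by (subst Min_gr_iff) auto
  then have "\<epsilon>' > 0" using e0 by (simp add: \<epsilon>'_def)
  then have \<epsilon>: "0 < \<epsilon>" "\<epsilon> < \<epsilon>'" "\<epsilon>' \<le> e0" by (simp_all add: \<epsilon>_def) (simp add: \<epsilon>'_def)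
  have "\<epsilon> < d i" for i
  proof -
    have "\<epsilon>' \<le> d i" unfolding \<epsilon>'_def by (intro min.coboundedI2 Min_le) auto
    then show ?thesis using \<epsilon> by simp
  qed
  then have nz: "sdet (sc w 1 - a t0 i) \<noteq> 0" if "w \<in> sphere (y0 i) \<epsilon>" for w i
    using that \<epsilon>(1) by (intro d(2)) (auto simp: dist_commute)
  obtain r where r: "r > 0" "cball t0 r \<subseteq> \<Omega>" using open_\<Omega> x0 open_contains_cball unfolding t0_def by blast
  have "\<exists>\<delta>>0. \<delta> \<le> r \<and> (\<forall>t\<in>ball t0 \<delta>. \<forall>w\<in>sphere (y0 i) \<epsilon>. sdet (sc w 1 - a t i) \<noteq> 0)" for i
  proof -
    let ?f = "\<lambda>z. sdet (sc (snd z) 1 - a (fst z) i)" and ?K = "cball t0 r \<times> sphere (y0 i) \<epsilon>"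
    have "continuous_on ?K (\<lambda>z. entry (a (fst z) i) p q)" for p q
      by (rule continuous_on_compose2[OF holo_on_imp_continuous_on, of "\<lambda>x. entry (a x i) p q" \<Omega> _ fst])
        (use holo_a r in \<open>auto simp: holo_mat_def intro!: continuous_intros\<close>)
    then have cont: "continuous_on ?K ?f"
      by (intro continuous_on_sdet) (auto intro!: continuous_intros)
    then have uc: "uniformly_continuous_on ?K ?f"
      by (intro compact_uniformly_continuous compact_Times) auto
    have "continuous_on (sphere (y0 i) \<epsilon>) (\<lambda>w. norm (?f (t0, w)))"
      by (intro continuous_on_norm continuous_on_compose2[OF cont])
        (use r in \<open>auto intro!: continuous_on_Pair continuous_on_const continuous_on_id\<close>)
    then obtain w0 where w0: "w0 \<in> sphere (y0 i) \<epsilon>" "\<And>w. w \<in> sphere (y0 i) \<epsilon> \<Longrightarrow> norm (?f (t0, w0)) \<le> norm (?f (t0, w))"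
      using continuous_attains_inf[of "sphere (y0 i) \<epsilon>" "\<lambda>w. norm (?f (t0, w))"] \<epsilon>(1) by auto
    \<comment> \<open>The minimum of the modulus of the determinant on the circle serves as the
      tolerance for uniform continuity: a change smaller than it cannot reach 0.\<close>
    have m: "norm (?f (t0, w0)) > 0" using nz[OF w0(1)] by simp
    obtain \<delta> where \<delta>: "\<delta> > 0" "\<And>z z'. z \<in> ?K \<Longrightarrow> z' \<in> ?K \<Longrightarrow> dist z' z < \<delta> \<Longrightarrow> dist (?f z') (?f z) < norm (?f (t0, w0))"
      using uc m unfolding uniformly_continuous_on_def by metis
    show ?thesis
    proof (intro exI[of _ "min \<delta> r"] conjI ballI)
      fix t w assume t: "t \<in> ball t0 (min \<delta> r)" and w: "w \<in> sphere (y0 i) \<epsilon>"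
      have "dist (?f (t, w)) (?f (t0, w)) < norm (?f (t0, w0))"
        by (rule \<delta>(2)) (use t w r in \<open>auto simp: dist_Pair_Pair dist_commute\<close>)
      then show "sdet (sc w 1 - a t i) \<noteq> 0" using w0(2)[OF w] by (auto simp: dist_norm)
    qed (use \<delta> r in auto)
  qed
  then obtain \<delta> where \<delta>: "\<And>i. \<delta> i > 0" "\<And>i. \<delta> i \<le> r" "\<And>i t w. t \<in> ball t0 (\<delta> i) \<Longrightarrow> w \<in> sphere (y0 i) \<epsilon> \<Longrightarrow> sdet (sc w 1 - a t i) \<noteq> 0"
    by metis
  define T where "T = ball t0 (min e0 (Min (range \<delta>)))"
  have "Min (range \<delta>) > 0" using \<delta>(1) by (subst Min_gr_iff) auto
  then have t0T: "t0 \<in> T" using e0 by (simp add: T_def)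
  have T\<delta>: "T \<subseteq> ball t0 (\<delta> i)" for i
  proof -
    have "Min (range \<delta>) \<le> \<delta> i" by (intro Min_le) auto
    then show ?thesis by (auto simp: T_def)
  qed
  have "polydisc T y0 \<epsilon>' \<subseteq> W"
  proof
    fix x assume x: "x \<in> polydisc T y0 \<epsilon>'"
    show "x \<in> W"
    proof (rule inW)
      fix l show "norm (x $ l - x0 $ l) < e0"
      proof (cases l)
        case (Inl k)
        have "norm ((base_pt x - t0) $ k) \<le> norm (base_pt x - t0)" by (rule Finite_Cartesian_Product.norm_nth_le)
        also have "\<dots> < e0" using x by (simp add: polydisc_def T_def dist_norm norm_minus_commute)
        finally show ?thesis by (simp add: Inl base_pt_def t0_def)
      next
        case (Inr k)
        then show ?thesis using x \<epsilon>(3) by (simp add: polydisc_def y0_def) (meson less_le_trans)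
      qed
    qed
  qed
  moreover have "T \<subseteq> \<Omega>"
  proof -
    have "ball t0 (\<delta> i) \<subseteq> cball t0 r" for i using \<delta>(2)[of i] by auto
    then show ?thesis using T\<delta> r(2) by blast
  qed
  ultimately show ?thesis
    using that[of T \<epsilon> \<epsilon>'] \<epsilon>(1,2) t0T \<delta>(3) T\<delta> unfolding y0_def t0_def[symmetric]
    by (auto simp: T_def)
qed

text \<open>Modulo the generators, powers of the linear form are linear forms again and follow the
  powers of the corresponding element of the algebra. This element is nilpotent by
  \<open>nilpotent_if_zero_on_spec\<close>, with an exponent independent of
  \<open>t\<close>.\<close>

lemma linear_form_power:
  assumes T: "T \<subseteq> \<Omega>" and c: "\<And>k. holo_on (c k) T" and N: "\<And>x. x \<in> N \<Longrightarrow> base_pt x \<in> T"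
    and zero: "\<And>t y. t \<in> T \<Longrightarrow> y \<in> spec t \<Longrightarrow> (\<Sum>k\<in>UNIV. y k * c k t) = 0"
  shows "(\<lambda>x. (\<Sum>k\<in>UNIV. x $ Inr k * c k (base_pt x)) ^ Suc (DIM(complex^'n^'n))) \<in> gen_ideal N"
proof -
  define F where "F t = (\<Sum>k\<in>UNIV. sc (c k t) (a t k))" for t
  define f0 where "f0 x = (\<Sum>k\<in>UNIV. x $ Inr k * c k (base_pt x))" for x
  \<comment> \<open>The coordinates of the \<open>m\<close>-th power of the element, as
    \<open>F t ^ m\<close> applied to the unit.\<close>
  define v where "v m t k = (\<Sum>j\<in>UNIV. entry (F t ^ m) k j * e t j)" for m t k
  have holF: "holo_mat F T"
    using holo_a T c unfolding F_def holo_mat_def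
    by (auto intro!: holo_on_sum holo_on_mult intro: holo_on_subset)
  have holFm: "holo_mat (\<lambda>t. F t ^ m) T" for m
    by (induction m) (auto intro!: holo_mat_mult holF, simp add: holo_mat_def)
  have holv: "holo_on (\<lambda>x. v m (base_pt x) k) N" for m k
  proof -
    have "holo_on (\<lambda>t. v m t k) T"
      using holFm[of m] holo_e T unfolding v_def holo_mat_def
      by (auto intro!: holo_on_sum holo_on_mult intro: holo_on_subset)
    then show ?thesis by (rule holo_on_base_pt) (use N in auto)
  qed
  have holc: "holo_on (\<lambda>x. c k (base_pt x)) N" for k by (rule holo_on_base_pt[OF c]) (use N in auto)
  have "(\<lambda>x. f0 x ^ m - (\<Sum>k\<in>UNIV. x $ Inr k * v m (base_pt x) k)) \<in> gen_ideal N" for m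
  proof (induction m)
    case 0
    have "v 0 t k = e t k" for t k
    proof -
      have "v 0 t k = (\<Sum>j\<in>UNIV. if k = j then e t j else 0)" unfolding v_def by (intro sum.cong) auto
      then show ?thesis by simp
    qed
    then have "f0 x ^ 0 - (\<Sum>k\<in>UNIV. x $ Inr k * v 0 (base_pt x) k) = - ug x" for x
      by (simp add: ug_def mult.commute)
    then show ?case using gen_ideal_uminus[OF gen_ideal_ug] by simp
  next
    case (Suc m)
    have "f0 x ^ Suc m - (\<Sum>k\<in>UNIV. x $ Inr k * v (Suc m) (base_pt x) k) =
        f0 x * (f0 x ^ m - (\<Sum>k\<in>UNIV. x $ Inr k * v m (base_pt x) k)) +
        (\<Sum>i\<in>UNIV. \<Sum>l\<in>UNIV. (c i (base_pt x) * v m (base_pt x) l) * mg i l x)" for x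
    proof -
      let ?t = "base_pt x"
      have "v (Suc m) ?t k = (\<Sum>l\<in>UNIV. entry (F ?t) k l * v m ?t l)" for k
        unfolding v_def power_Suc entry_mult sum_distrib_left sum_distrib_right mult.assoc by (rule sum.swap)
      then have 1: "v (Suc m) ?t k = (\<Sum>i\<in>UNIV. \<Sum>l\<in>UNIV. c i ?t * v m ?t l * entry (a ?t i) k l)" for k
        unfolding F_def by (simp add: sum_distrib_left sum_distrib_right mult_ac) (rule sum.swap)
      have "(\<Sum>k\<in>UNIV. x $ Inr k * v (Suc m) ?t k) =
          (\<Sum>k\<in>UNIV. \<Sum>i\<in>UNIV. \<Sum>l\<in>UNIV. c i ?t * v m ?t l * (entry (a ?t i) k l * x $ Inr k))"
        unfolding 1 by (simp add: sum_distrib_left mult_ac)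
      also have "\<dots> = (\<Sum>i\<in>UNIV. \<Sum>l\<in>UNIV. \<Sum>k\<in>UNIV. c i ?t * v m ?t l * (entry (a ?t i) k l * x $ Inr k))"
        by (subst sum.swap, rule sum.cong[OF refl], rule sum.swap)
      finally have "(\<Sum>k\<in>UNIV. x $ Inr k * v (Suc m) ?t k) =
          (\<Sum>i\<in>UNIV. \<Sum>l\<in>UNIV. c i ?t * v m ?t l * (\<Sum>k\<in>UNIV. entry (a ?t i) k l * x $ Inr k))"
        by (simp add: sum_distrib_left)
      moreover have "f0 x * (\<Sum>l\<in>UNIV. x $ Inr l * v m ?t l) =
          (\<Sum>i\<in>UNIV. \<Sum>l\<in>UNIV. c i ?t * v m ?t l * (x $ Inr i * x $ Inr l))"
        unfolding f0_def sum_product by (intro sum.cong refl) (simp add: mult_ac)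
      moreover have "(\<Sum>i\<in>UNIV. \<Sum>l\<in>UNIV. (c i ?t * v m ?t l) * mg i l x) =
          (\<Sum>i\<in>UNIV. \<Sum>l\<in>UNIV. c i ?t * v m ?t l * (x $ Inr i * x $ Inr l)) -
          (\<Sum>i\<in>UNIV. \<Sum>l\<in>UNIV. c i ?t * v m ?t l * (\<Sum>k\<in>UNIV. entry (a ?t i) k l * x $ Inr k))"
        by (simp add: mg_def right_diff_distrib sum_subtractf)
      ultimately show ?thesis by (simp add: right_diff_distrib)
    qed
    moreover have "holo_on f0 N" unfolding f0_def using holc by (intro holo_on_sum holo_on_mult) auto
    ultimately show ?case using Suc holc holv
      by (intro gen_ideal_cong[OF gen_ideal_add[OF gen_ideal_mult[OF Suc] gen_ideal_sum[OF gen_ideal_sum[OF gen_ideal_mult[OF gen_ideal_mg]]]]]) auto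
  qed
  from this[of "Suc (DIM(complex^'n^'n))"]
  have *: "(\<lambda>x. f0 x ^ Suc (DIM(complex^'n^'n)) - (\<Sum>k\<in>UNIV. x $ Inr k * v (Suc (DIM(complex^'n^'n))) (base_pt x) k)) \<in> gen_ideal N" .
  have "v (Suc (DIM(complex^'n^'n))) t k = 0" if t: "t \<in> T" for t k
  proof -
    interpret A: comm_alg "a t" "e t" using t T by (intro alg) auto
    have "F t ^ Suc (DIM(complex^'n^'n)) = 0"
      unfolding F_def by (rule A.nilpotent_if_zero_on_spec) (use zero[OF t] in \<open>simp add: mult.commute\<close>)
    then show ?thesis by (simp only: v_def) simp
  qed
  then show ?thesis using N by (intro gen_ideal_cong[OF *]) (simp add: f0_def del: power_Suc)
qed

text \<open>Division gives \<open>f\<close> congruent to a linear form \<open>f0\<close>. The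
  factorization of a difference of powers shows that \<open>f ^ M\<close> is congruent to
  \<open>f0 ^ M\<close>, and the latter is in the ideal.\<close>

lemma vanishing_imp_power_in_ideal:
  assumes W: "open W" "x0 \<in> W" "\<And>x. x \<in> W \<Longrightarrow> base_pt x \<in> \<Omega>" and f: "holo_on f W"
    and zero: "\<And>x. x \<in> W \<Longrightarrow> (\<lambda>k. x $ Inr k) \<in> spec (base_pt x) \<Longrightarrow> f x = 0"
  obtains N M where "open N" "x0 \<in> N" "N \<subseteq> W" "(\<lambda>x. f x ^ M) \<in> gen_ideal N"
proof -
  obtain T \<epsilon> \<epsilon>' where T: "open T" "T \<subseteq> \<Omega>" "base_pt x0 \<in> T" "0 < \<epsilon>" "\<epsilon> < \<epsilon>'" "polydisc T (\<lambda>i. x0 $ Inr i) \<epsilon>' \<subseteq> W"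
    and inv: "\<And>t i w. t \<in> T \<Longrightarrow> w \<in> sphere (x0 $ Inr i) \<epsilon> \<Longrightarrow> sdet (sc w 1 - a t i) \<noteq> 0"
    using good_polydisc[OF W(1,2) W(3)[OF W(2)]] by blast
  define N where "N = polydisc T (\<lambda>i. x0 $ Inr i) \<epsilon>"
  have NW: "N \<subseteq> W"
      using polydisc_mono[OF less_imp_le[OF T(5)]] T(6) unfolding N_def by (rule order_trans)
  obtain c where c: "\<And>k. holo_on (c k) T"
    "(\<lambda>x. f x - (\<Sum>k\<in>UNIV. x $ Inr k * c k (base_pt x))) \<in> gen_ideal N"
    "\<And>t y. t \<in> T \<Longrightarrow> y \<in> spec t \<Longrightarrow> (\<Sum>k\<in>UNIV. y k * c k t) = (if pt t y \<in> N then f (pt t y) else 0)"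
    using division[OF T(1,2,4,5) inv holo_on_subset[OF f T(6)]] unfolding N_def by blast
  define f0 where "f0 x = (\<Sum>k\<in>UNIV. x $ Inr k * c k (base_pt x))" for x
  \<comment> \<open>At points of the spectrum in \<open>N\<close> the function \<open>f\<close>
    vanishes by assumption, and at those outside the division has produced the value 0.\<close>
  have zero': "(\<Sum>k\<in>UNIV. y k * c k t) = 0" if "t \<in> T" "y \<in> spec t" for t y
    using c(3)[OF that] zero[of "pt t y"] that NW by auto
  define M where "M = Suc (DIM(complex^'n^'n))"
  have 1: "(\<lambda>x. f0 x ^ M) \<in> gen_ideal N"
    unfolding f0_def M_def by (rule linear_form_power[OF T(2) c(1) _ zero']) (auto simp: N_def polydisc_def)
  have "holo_on f0 N"
    unfolding f0_def by (intro holo_on_sum holo_on_mult holo_on_component holo_on_base_pt[OF c(1)]) (auto simp: N_def polydisc_def)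
  then have "holo_on (\<lambda>x. \<Sum>i<M. f0 x ^ (M - Suc i) * f x ^ i) N"
    using holo_on_subset[OF f NW] by (intro holo_on_sum holo_on_mult holo_on_power)
  from gen_ideal_add[OF 1 gen_ideal_mult[OF c(2) this]]
  have "(\<lambda>x. f x ^ M) \<in> gen_ideal N"
  proof (rule gen_ideal_cong)
    fix x
    have "f x ^ M - f0 x ^ M = (f x - f0 x) * (\<Sum>i<M. f0 x ^ (M - Suc i) * f x ^ i)" by (rule power_diff_sumr2)
    then show "f x ^ M = f0 x ^ M + (\<Sum>i<M. f0 x ^ (M - Suc i) * f x ^ i) * (f x - (\<Sum>k\<in>UNIV. x $ Inr k * c k (base_pt x)))"
      by (simp add: f0_def algebra_simps)
  qed
  moreover have "open N" "x0 \<in> N" using T by (auto simp: N_def open_polydisc) (auto simp: polydisc_def)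
  ultimately show ?thesis using that NW by blast
qed

abbreviation "gens \<equiv> insert ug {mg i j | i j. True}"

lemma gen_ideal_in_ideal_sheaf:
  assumes "f \<in> gen_ideal N" "holo_on f N" "open N"
  shows "f \<in> ideal_sheaf gens N"
proof -
  obtain b0 b where b: "holo_on b0 N" "\<And>i j. holo_on (b i j) N"
    "\<And>x. x \<in> N \<Longrightarrow> f x = b0 x * ug x + (\<Sum>i\<in>UNIV. \<Sum>j\<in>UNIV. b i j x * mg i j x)"
    using assms(1) unfolding gen_ideal_def by blast
  define F where "F = insert ug ((\<lambda>(i, j). mg i j) ` UNIV)"
  have F: "finite F" "F \<subseteq> gens" by (auto simp: F_def)
  \<comment> \<open>In \<open>ideal_sheaf\<close> the coefficients are indexed by functions.
    Different index pairs may give the same generator, so their coefficients are added up.\<close>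
  define \<beta> where "\<beta> g x = (if g = ug then b0 x else 0) + (\<Sum>p\<in>UNIV. if mg (fst p) (snd p) = g then b (fst p) (snd p) x else 0)"
    for g x
  have "holo_on (\<lambda>x. if P then h x else 0) N" if "holo_on h N" for P h using that by (cases P) auto
  then have hol: "holo_on (\<beta> g) N" for g
    unfolding \<beta>_def using b by (intro holo_on_add holo_on_sum) auto
  have "f x = (\<Sum>g\<in>F. \<beta> g x * g x)" if "x \<in> N" for x
  proof -
    have "(\<Sum>g\<in>F. \<beta> g x * g x) = (\<Sum>g\<in>F. if g = ug then b0 x * g x else 0) +
        (\<Sum>g\<in>F. \<Sum>p\<in>UNIV. if mg (fst p) (snd p) = g then b (fst p) (snd p) x * g x else 0)"
      unfolding \<beta>_def distrib_right sum.distrib sum_distrib_right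
      by (intro arg_cong2[of _ _ _ _ "(+)"] sum.cong refl) auto
    also have "(\<Sum>g\<in>F. if g = ug then b0 x * g x else 0) = b0 x * ug x" using F(1) by (simp add: F_def)
    also have "(\<Sum>g\<in>F. \<Sum>p\<in>UNIV. if mg (fst p) (snd p) = g then b (fst p) (snd p) x * g x else 0) =
        (\<Sum>p\<in>UNIV. \<Sum>g\<in>F. if mg (fst p) (snd p) = g then b (fst p) (snd p) x * g x else 0)" by (rule sum.swap)
    also have "\<dots> = (\<Sum>p\<in>UNIV. b (fst p) (snd p) x * mg (fst p) (snd p) x)"
    proof (rule sum.cong[OF refl])
      fix p :: "'n \<times> 'n"
      have "mg (fst p) (snd p) \<in> F" by (auto simp: F_def case_prod_beta)
      then show "(\<Sum>g\<in>F. if mg (fst p) (snd p) = g then b (fst p) (snd p) x * g x else 0) = b (fst p) (snd p) x * mg (fst p) (snd p) x"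
        using F(1) by simp
    qed
    also have "\<dots> = (\<Sum>i\<in>UNIV. \<Sum>j\<in>UNIV. b i j x * mg i j x)"
      by (simp add: sum.cartesian_product case_prod_beta)
    finally show ?thesis using b(3)[OF that] by simp
  qed
  then show ?thesis
    unfolding ideal_sheaf_def using assms(2,3) F hol by (auto intro!: exI[of _ N] exI[of _ F] exI[of _ \<beta>])
qed

text \<open>Membership in the radical becomes a pointwise condition, so the bracket has to be
  evaluated only at points of the spectrum. One direction evaluates the generators there, the other
  is the local Nullstellensatz.\<close>

lemma radical_iff:
  assumes W: "open W" "\<And>x. x \<in> W \<Longrightarrow> base_pt x \<in> \<Omega>"
  shows "f \<in> radical_sheaf (ideal_sheaf gens) W \<longleftrightarrow>
    holo_on f W \<and> (\<forall>x\<in>W. (\<lambda>k. x $ Inr k) \<in> spec (base_pt x) \<longrightarrow> f x = 0)"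
proof
  assume f: "f \<in> radical_sheaf (ideal_sheaf gens) W"
  have "f x = 0" if x: "x \<in> W" "(\<lambda>k. x $ Inr k) \<in> spec (base_pt x)" for x
  proof -
    obtain N k where N: "x \<in> N" "(\<lambda>y. f y ^ k) \<in> ideal_sheaf gens N"
      using f x(1) unfolding radical_sheaf_def by blast
    obtain N' F b where N': "x \<in> N'" "F \<subseteq> gens" "\<forall>y\<in>N'. f y ^ k = (\<Sum>g\<in>F. b g y * g y)"
      using N unfolding ideal_sheaf_def by blast
    have "g x = 0" if "g \<in> F" for g using that N'(2) spec_iff[OF W(2)[OF x(1)]] x(2) by auto
    then have "(\<Sum>g\<in>F. b g x * g x) = 0" by (intro sum.neutral) simp
    then have "f x ^ k = 0" using N'(1,3) by simp
    then show ?thesis by simp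
  qed
  then show "holo_on f W \<and> (\<forall>x\<in>W. (\<lambda>k. x $ Inr k) \<in> spec (base_pt x) \<longrightarrow> f x = 0)"
    using f by (simp add: radical_sheaf_def)
next
  assume f: "holo_on f W \<and> (\<forall>x\<in>W. (\<lambda>k. x $ Inr k) \<in> spec (base_pt x) \<longrightarrow> f x = 0)"
  show "f \<in> radical_sheaf (ideal_sheaf gens) W"
    unfolding radical_sheaf_def mem_Collect_eq
  proof (intro conjI ballI)
    fix x assume x: "x \<in> W"
    obtain N M where N: "open N" "x \<in> N" "N \<subseteq> W" "(\<lambda>x. f x ^ M) \<in> gen_ideal N"
      using vanishing_imp_power_in_ideal[OF W(1) x W(2)] f by metis
    have "holo_on (\<lambda>x. f x ^ M) N" using f N(3) by (intro holo_on_power) (auto intro: holo_on_subset)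
    then have "(\<lambda>x. f x ^ M) \<in> ideal_sheaf gens N" using gen_ideal_in_ideal_sheaf[OF N(4)] N(1) by blast
    then show "\<exists>N. open N \<and> x \<in> N \<and> N \<subseteq> W \<and> (\<exists>k. (\<lambda>y. f y ^ k) \<in> ideal_sheaf gens N)" using N by blast
  qed (use f in simp)
qed

section \<open>The bracket of functions in the radical\<close>

lemma rep_linear_form:
  assumes "open T" "T \<subseteq> \<Omega>" "\<And>k. holo_on (c k) T"
  shows "rep T (\<lambda>x. \<Sum>k\<in>UNIV. c k (base_pt x) * x $ Inr k) (\<lambda>t. \<Sum>k\<in>UNIV. sc (c k t) (a t k))"
proof -
  have "rep T (\<lambda>x. \<Sum>k\<in>UNIV. c k (base_pt x) * x $ Inr k) (\<lambda>t. \<Sum>k\<in>UNIV. sc (c k t) 1 * a t k)"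
    by (intro rep_sum rep_mult rep_base rep_coord assms) auto
  then show ?thesis by simp
qed

text \<open>The matrices satisfy the equations of the spectrum, so a generator evaluates to the zero
  matrix. The exponent 1 puts this in the form that \<open>poisson_rep_eq_0\<close> expects; the
  same holds for \<open>rep_mg\<close>.\<close>

lemma rep_ug:
  assumes "open T" "T \<subseteq> \<Omega>"
  shows "\<exists>U. rep T ug U \<and> (\<forall>t\<in>T. U t ^ 1 = 0)"
proof (intro exI conjI ballI)
  have "rep T (\<lambda>x. (\<Sum>k\<in>UNIV. e (base_pt x) k * x $ Inr k) + - 1) (\<lambda>t. (\<Sum>k\<in>UNIV. sc (e t k) (a t k)) + sc (- 1) 1)"
    using assms holo_on_subset[OF holo_e assms(2)]
    by (intro rep_add rep_linear_form rep_base[of T "\<lambda>_. - 1"]) auto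
  moreover have "(\<lambda>x. (\<Sum>k\<in>UNIV. e (base_pt x) k * x $ Inr k) + - 1) = ug" by (auto simp: ug_def)
  ultimately show "rep T ug (\<lambda>t. (\<Sum>k\<in>UNIV. sc (e t k) (a t k)) + sc (- 1) 1)" by (simp only:)
  fix t assume t: "t \<in> T"
  interpret A: comm_alg "a t" "e t" using t assms by (intro alg) auto
  have "sc (- 1) 1 = (- 1 :: (complex, 'n) smat)" by (rule smat_eqI) simp
  then show "((\<Sum>k\<in>UNIV. sc (e t k) (a t k)) + sc (- 1) 1) ^ 1 = 0" by (simp add: A.unit)
qed

lemma rep_mg:
  assumes "open T" "T \<subseteq> \<Omega>"
  shows "\<exists>U. rep T (mg i j) U \<and> (\<forall>t\<in>T. U t ^ 1 = 0)"
proof (intro exI conjI ballI)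
  have "holo_on (\<lambda>t. - entry (a t i) k j) T" for k
    using holo_a[of i] assms by (intro holo_on_uminus) (auto simp: holo_mat_def intro: holo_on_subset)
  then have "rep T (\<lambda>x. x $ Inr i * x $ Inr j + (\<Sum>k\<in>UNIV. - entry (a (base_pt x) i) k j * x $ Inr k))
      (\<lambda>t. a t i * a t j + (\<Sum>k\<in>UNIV. sc (- entry (a t i) k j) (a t k)))"
    using assms by (intro rep_add rep_mult rep_coord rep_linear_form[of T "\<lambda>k t. - entry (a t i) k j"]) auto
  moreover have "(\<lambda>x. x $ Inr i * x $ Inr j + (\<Sum>k\<in>UNIV. - entry (a (base_pt x) i) k j * x $ Inr k)) = mg i j"
    by (auto simp: mg_def sum_negf)
  ultimately show "rep T (mg i j) (\<lambda>t. a t i * a t j + (\<Sum>k\<in>UNIV. sc (- entry (a t i) k j) (a t k)))" by (simp only:)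
  fix t assume t: "t \<in> T"
  interpret A: comm_alg "a t" "e t" using t assms by (intro alg) auto
  have "sc (- c) X = - sc c X" for c and X :: "(complex, 'n) smat" by (rule smat_eqI) simp
  then show "(a t i * a t j + (\<Sum>k\<in>UNIV. sc (- entry (a t i) k j) (a t k))) ^ 1 = 0" by (simp add: A.a_mult sum_negf)
qed

theorem radical_poisson:
  assumes W: "open W" "\<And>x. x \<in> W \<Longrightarrow> base_pt x \<in> \<Omega>"
    and f: "f \<in> radical_sheaf (ideal_sheaf gens) W" and g: "g \<in> radical_sheaf (ideal_sheaf gens) W"
  shows "poisson f g \<in> radical_sheaf (ideal_sheaf gens) W"
proof -
  have rad: "F \<in> radical_sheaf (ideal_sheaf gens) W \<longleftrightarrow>
    holo_on F W \<and> (\<forall>x\<in>W. (\<lambda>k. x $ Inr k) \<in> spec (base_pt x) \<longrightarrow> F x = 0)" for F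
    using W by (rule radical_iff)
  have hol: "holo_on f W" "holo_on g W"
    and zf: "\<forall>x\<in>W. (\<lambda>k. x $ Inr k) \<in> spec (base_pt x) \<longrightarrow> f x = 0"
    and zg: "\<forall>x\<in>W. (\<lambda>k. x $ Inr k) \<in> spec (base_pt x) \<longrightarrow> g x = 0"
    using f g unfolding rad by blast+
  have "poisson f g x0 = 0" if x0: "x0 \<in> W" and y0: "(\<lambda>k. x0 $ Inr k) \<in> spec (base_pt x0)" for x0
  proof -
    obtain T \<epsilon> \<epsilon>' where T: "open T" "T \<subseteq> \<Omega>" "base_pt x0 \<in> T" "0 < \<epsilon>" "\<epsilon> < \<epsilon>'" "polydisc T (\<lambda>i. x0 $ Inr i) \<epsilon>' \<subseteq> W"
      and inv: "\<And>t i w. t \<in> T \<Longrightarrow> w \<in> sphere (x0 $ Inr i) \<epsilon> \<Longrightarrow> sdet (sc w 1 - a t i) \<noteq> 0"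
      using good_polydisc[OF W(1) x0 W(2)[OF x0]] by blast
    define N where "N = polydisc T (\<lambda>i. x0 $ Inr i) \<epsilon>"
    have NW: "N \<subseteq> W"
      using polydisc_mono[OF less_imp_le[OF T(5)]] T(6) unfolding N_def by (rule order_trans)
    have oN: "open N" "x0 \<in> N" using T by (auto simp: N_def open_polydisc) (auto simp: polydisc_def)
    \<comment> \<open>The index type enumerates the summands of the division: \<open>None\<close> is
      the linear remainder, \<open>Some None\<close> the unit generator, and the other values are
      the generators \<open>mg i j\<close>. Only the gradient at \<open>x0\<close> is
      decomposed.\<close>
    have decomp: "\<exists>(u :: ('n \<times> 'n) option option \<Rightarrow> _) \<alpha>. (\<forall>l. pd l F x0 = (\<Sum>s\<in>UNIV. \<alpha> s * pd l (u s) x0)) \<and>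
        (\<forall>s. \<exists>U M. rep T (u s) U \<and> (\<forall>t\<in>T. U t ^ M = 0))"
      if F: "holo_on F W" and zero: "\<forall>x\<in>W. (\<lambda>k. x $ Inr k) \<in> spec (base_pt x) \<longrightarrow> F x = 0" for F
    proof -
      obtain c where c: "\<And>k. holo_on (c k) T"
        "(\<lambda>x. F x - (\<Sum>k\<in>UNIV. x $ Inr k * c k (base_pt x))) \<in> gen_ideal N"
        "\<And>t y. t \<in> T \<Longrightarrow> y \<in> spec t \<Longrightarrow> (\<Sum>k\<in>UNIV. y k * c k t) = (if pt t y \<in> N then F (pt t y) else 0)"
        using division[OF T(1,2,4,5) inv holo_on_subset[OF F T(6)]] unfolding N_def by blast
      define f0 where "f0 x = (\<Sum>k\<in>UNIV. c k (base_pt x) * x $ Inr k)" for x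
      obtain b0 b where b: "holo_on b0 N" "\<And>i j. holo_on (b i j) N"
        "\<And>x. x \<in> N \<Longrightarrow> F x - (\<Sum>k\<in>UNIV. x $ Inr k * c k (base_pt x)) = b0 x * ug x + (\<Sum>i\<in>UNIV. \<Sum>j\<in>UNIV. b i j x * mg i j x)"
        using c(2) unfolding gen_ideal_def by blast
      have zero': "(\<Sum>k\<in>UNIV. c k t * y k) = 0" if "t \<in> T" "y \<in> spec t" for t y
        using c(3)[OF that] zero[rule_format, of "pt t y"] that NW by (auto simp: mult.commute)
      define u where "u s = (case s of None \<Rightarrow> f0 | Some None \<Rightarrow> ug | Some (Some (i, j)) \<Rightarrow> mg i j)" for s
      define \<beta> where "\<beta> s = (case s of None \<Rightarrow> (\<lambda>x. 1) | Some None \<Rightarrow> b0 | Some (Some (i, j)) \<Rightarrow> b i j)" for s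
      have rep: "\<exists>U M. rep T (u s) U \<and> (\<forall>t\<in>T. U t ^ M = 0)" for s
      proof (cases s)
        case None
        have "rep T f0 (\<lambda>t. \<Sum>k\<in>UNIV. sc (c k t) (a t k))"
          unfolding f0_def by (rule rep_linear_form[OF T(1,2) c(1)])
        moreover have "(\<Sum>k\<in>UNIV. sc (c k t) (a t k)) ^ Suc (DIM(complex^'n^'n)) = 0" if t: "t \<in> T" for t
        proof -
          interpret A: comm_alg "a t" "e t" using t T by (intro alg) auto
          show ?thesis by (rule A.nilpotent_if_zero_on_spec) (rule zero'[OF t])
        qed
        ultimately show ?thesis unfolding u_def None option.case by blast
      next
        case (Some s')
        show ?thesis
        proof (cases s')
          case None
          have "u s = ug" by (simp add: u_def Some None)
          then show ?thesis using rep_ug[OF T(1,2)] by metis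
        next
          case (Some p)
          have "u s = mg (fst p) (snd p)" by (simp add: u_def \<open>s = Some s'\<close> Some case_prod_beta)
          then show ?thesis using rep_mg[OF T(1,2)] by metis
        qed
      qed
      have hol_u: "holo_on (u s) N" for s
      proof -
        have "holo_on (u s) {x. base_pt x \<in> T}" using rep[of s] by (auto simp: rep_def)
        then show ?thesis by (rule holo_on_subset) (auto simp: N_def polydisc_def)
      qed
      have hol_\<beta>: "holo_on (\<beta> s) N" for s using b by (auto simp: \<beta>_def split: option.split)
      have sum_opt: "(\<Sum>s\<in>UNIV. h s) = h None + (h (Some None) + (\<Sum>i\<in>UNIV. \<Sum>j\<in>UNIV. h (Some (Some (i, j)))))"
        for h :: "('n \<times> 'n) option option \<Rightarrow> complex"
      proof -
        have *: "(\<Sum>s\<in>UNIV. h s) = h None + (\<Sum>p\<in>UNIV. h (Some p))" for h :: "('b::finite) option \<Rightarrow> complex"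
          by (simp add: UNIV_option_conv sum.reindex)
        show ?thesis by (simp only: *[of h]) (simp add: *[of "\<lambda>p. h (Some p)"] sum.cartesian_product)
      qed
      have F_eq: "F x = (\<Sum>s\<in>UNIV. \<beta> s x * u s x)" if "x \<in> N" for x
        using b(3)[OF that] unfolding sum_opt by (simp add: \<beta>_def u_def f0_def algebra_simps)
      have pd_F: "pd l F x0 = (\<Sum>s\<in>UNIV. pd l (\<beta> s) x0 * u s x0 + \<beta> s x0 * pd l (u s) x0)" for l
      proof -
        have "pd l F x0 = pd l (\<lambda>x. \<Sum>s\<in>UNIV. \<beta> s x * u s x) x0" by (rule pd_cong[OF oN F_eq])
        also have "\<dots> = (\<Sum>s\<in>UNIV. pd l (\<lambda>x. \<beta> s x * u s x) x0)"
          by (rule pd_sum[OF _ oN]) (intro holo_on_mult hol_\<beta> hol_u)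
        also have "\<dots> = (\<Sum>s\<in>UNIV. pd l (\<beta> s) x0 * u s x0 + \<beta> s x0 * pd l (u s) x0)"
          by (intro sum.cong refl pd_mult[OF hol_\<beta> hol_u oN])
        finally show ?thesis .
      qed
      \<comment> \<open>The generators vanish at the point \<open>x0\<close> of the spectrum, and
        the coefficient of the linear remainder is the constant 1. So no derivative of a coefficient
        survives.\<close>
      have zero0: "pd l (\<beta> s) x0 * u s x0 = 0" for l s
      proof (cases s)
        case (Some s')
        have "u s x0 = 0" using y0 spec_iff[OF W(2)[OF x0]] by (auto simp: u_def Some split: option.split)
        then show ?thesis by simp
      qed (simp add: \<beta>_def)
      have "pd l F x0 = (\<Sum>s\<in>UNIV. \<beta> s x0 * pd l (u s) x0)" for l
        unfolding pd_F zero0 by simp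
      then show ?thesis using rep by (intro exI[of _ u] exI[of _ "\<lambda>s. \<beta> s x0"]) blast
    qed
    obtain u :: "('n \<times> 'n) option option \<Rightarrow> _" and \<alpha> where u: "(\<forall>l. pd l f x0 = (\<Sum>s\<in>UNIV. \<alpha> s * pd l (u s) x0)) \<and>
      (\<forall>s. \<exists>U M. rep T (u s) U \<and> (\<forall>t\<in>T. U t ^ M = 0))" using decomp[OF hol(1) zf] by (elim exE) (rule that)
    obtain v :: "('n \<times> 'n) option option \<Rightarrow> _" and \<beta> where v: "(\<forall>l. pd l g x0 = (\<Sum>s\<in>UNIV. \<beta> s * pd l (v s) x0)) \<and>
      (\<forall>s. \<exists>U M. rep T (v s) U \<and> (\<forall>t\<in>T. U t ^ M = 0))" using decomp[OF hol(2) zg] by (elim exE) (rule that)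
    have "poisson (u s) (v s') x0 = 0" for s s'
    proof -
      obtain U M where U: "rep T (u s) U" "\<And>t. t \<in> T \<Longrightarrow> U t ^ M = 0" using conjunct2[OF u] by metis
      obtain V M' where V: "rep T (v s') V" "\<And>t. t \<in> T \<Longrightarrow> V t ^ M' = 0" using conjunct2[OF v] by metis
      from poisson_rep_eq_0[OF T(1,2) U V T(3) y0] show ?thesis by simp
    qed
    then show ?thesis unfolding poisson_bilinear[OF conjunct1[OF u, rule_format] conjunct1[OF v, rule_format]] by simp
  qed
  moreover have "holo_on (poisson f g) W"
    unfolding poisson_def using hol W(1) by (intro holo_on_sum holo_on_diff holo_on_mult holo_on_pd)
  ultimately show ?thesis unfolding rad by blast
qed

end

section \<open>Charts and vector fields\<close>

lemma pd_compose:
  fixes g :: "complex^'n \<Rightarrow> complex^'m"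
  assumes f: "holo_on f T" and g: "\<And>k. holo_on (\<lambda>x. g x $ k) S" and "g x \<in> T" "x \<in> S"
  shows "pd i (\<lambda>x. f (g x)) x = (\<Sum>k\<in>UNIV. pd i (\<lambda>x. g x $ k) x * pd k f (g x))"
proof -
  have "(g has_derivative (\<lambda>v. \<chi> k. \<Sum>i\<in>UNIV. pd i (\<lambda>x. g x $ k) x * v $ i)) (at x)"
    by (rule has_derivative_vec_lambda) (rule holo_on_has_derivative[OF g \<open>x \<in> S\<close>])
  from has_derivative_compose[OF this holo_on_has_derivative[OF f \<open>g x \<in> T\<close>]]
  have "((\<lambda>x. f (g x)) has_derivative (\<lambda>v. \<Sum>k\<in>UNIV. pd k f (g x) * (\<Sum>i\<in>UNIV. pd i (\<lambda>x. g x $ k) x * v $ i))) (at x)"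
    by simp
  from pd_eq[OF this, of i] show ?thesis
    by (simp add: sum_distrib_left mult_ac axis_def if_distrib sum.delta cong: if_cong)
qed

lemma holo_on_congI:
  "holo_on f S \<Longrightarrow> open S \<Longrightarrow> (\<And>x. x \<in> S \<Longrightarrow> g x = f x) \<Longrightarrow> holo_on g S"
  using holo_on_cong[of S g f] by simp

lemma chart_props:
  assumes "complex_atlas B" "(V, \<psi>) \<in> B"
  shows "open V" "open (\<psi> ` V)" "\<And>p. p \<in> V \<Longrightarrow> inv_into V \<psi> (\<psi> p) = p"
    "\<And>x. x \<in> \<psi> ` V \<Longrightarrow> \<psi> (inv_into V \<psi> x) = x" "\<And>x. x \<in> \<psi> ` V \<Longrightarrow> inv_into V \<psi> x \<in> V"
    "continuous_on (\<psi> ` V) (inv_into V \<psi>)" "continuous_on V \<psi>"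
    "\<And>W. open W \<Longrightarrow> W \<subseteq> V \<Longrightarrow> open (\<psi> ` W)"
proof -
  have *: "open V" "open (\<psi> ` V)" and hom: "homeomorphism V (\<psi> ` V) \<psi> (inv_into V \<psi>)"
    using assms unfolding complex_atlas_def by auto
  show "open V" "open (\<psi> ` V)" by (fact *)+
  show "continuous_on (\<psi> ` V) (inv_into V \<psi>)" "continuous_on V \<psi>"
    using hom by (simp_all add: homeomorphism_def)
  show inv: "inv_into V \<psi> (\<psi> p) = p" if "p \<in> V" for p using hom that by (simp add: homeomorphism_def)
  show "\<psi> (inv_into V \<psi> x) = x" "inv_into V \<psi> x \<in> V" if "x \<in> \<psi> ` V" for x
    using that by (auto intro: f_inv_into_f inv_into_into)
  fix W assume W: "open W" "W \<subseteq> V"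
  have "\<psi> ` W = inv_into V \<psi> -` W \<inter> \<psi> ` V" using W(2) inv by (auto simp: image_iff)
  moreover have "open (inv_into V \<psi> -` W \<inter> \<psi> ` V)"
    using hom W(1) *(2) continuous_on_open_vimage by (auto simp: homeomorphism_def)
  ultimately show "open (\<psi> ` W)" by simp
qed

lemma atlas_transition:
  fixes B :: "('m::topological_space, 'n::finite) chart set" and \<psi> :: "'m \<Rightarrow> complex^'n"
  assumes "complex_atlas B" "(U, \<phi>) \<in> B" "(V, \<psi>) \<in> B"
  shows "holo_on (\<lambda>x. \<psi> (inv_into U \<phi> x) $ i) (\<phi> ` (U \<inter> V))"
  using assms unfolding complex_atlas_def by blast

lemma holo_transfer:
  assumes B: "complex_atlas B" "(U, \<phi>) \<in> B" "(V, \<psi>) \<in> B" and W: "open W" "W \<subseteq> U" "W \<subseteq> V"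
    and f: "holo_on (\<lambda>x. f (inv_into V \<psi> x)) (\<psi> ` W)"
  shows "holo_on (\<lambda>x. f (inv_into U \<phi> x)) (\<phi> ` W)"
proof -
  note U = chart_props[OF B(1,2)] and V = chart_props[OF B(1,3)]
  have "holo_on (\<lambda>x. f (inv_into V \<psi> (\<psi> (inv_into U \<phi> x)))) (\<phi> ` W)"
  proof (rule holo_on_compose[OF f])
    show "holo_on (\<lambda>x. \<psi> (inv_into U \<phi> x) $ i) (\<phi> ` W)" for i
      using W by (intro holo_on_subset[OF atlas_transition[OF B]]) auto
    show "(\<lambda>x. \<psi> (inv_into U \<phi> x)) ` \<phi> ` W \<subseteq> \<psi> ` W" using W U(3) by auto
  qed
  then show ?thesis
  proof (rule holo_on_congI[OF _ U(8)[OF W(1,2)]])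
    fix x assume "x \<in> \<phi> ` W"
    then obtain p where p: "p \<in> W" "x = \<phi> p" by blast
    then have "p \<in> U" "p \<in> V" using W by auto
    then show "f (inv_into U \<phi> x) = f (inv_into V \<psi> (\<psi> (inv_into U \<phi> x)))" by (simp add: p(2) U(3) V(3))
  qed
qed

section \<open>Holomorphic functions and vector fields in charts\<close>

lemma coord_vf_eq: "coord_vf (V, \<psi>) i f p = pd i (\<lambda>x. f (inv_into V \<psi> x)) (\<psi> p)"
  by (simp add: coord_vf_def)

lemma holo_funD: "holo_fun A W f \<Longrightarrow> (V, \<psi>) \<in> A \<Longrightarrow> holo_on (\<lambda>x. f (inv_into V \<psi> x)) (\<psi> ` (V \<inter> W))"
  unfolding holo_fun_def by (drule (1) bspec) simp

lemma holo_funI: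
  assumes "\<And>V \<psi>. (V, \<psi>) \<in> A \<Longrightarrow> holo_on (\<lambda>x. f (inv_into V \<psi> x)) (\<psi> ` (V \<inter> W))" shows "holo_fun A W f"
  unfolding holo_fun_def using assms by (intro ballI) (simp add: case_prod_beta)

lemma holo_fun_subset: "holo_fun A W f \<Longrightarrow> W' \<subseteq> W \<Longrightarrow> holo_fun A W' f"
  by (rule holo_funI, rule holo_on_subset[OF holo_funD]) auto

lemma holo_fun_const [simp, intro]: "holo_fun A W (\<lambda>_. c)"
  by (auto simp: holo_fun_def)

lemma holo_fun_add [intro]: "holo_fun A W f \<Longrightarrow> holo_fun A W g \<Longrightarrow> holo_fun A W (\<lambda>p. f p + g p)"
  by (fastforce simp: holo_fun_def)

lemma holo_fun_mult [intro]: "holo_fun A W f \<Longrightarrow> holo_fun A W g \<Longrightarrow> holo_fun A W (\<lambda>p. f p * g p)"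
  by (fastforce simp: holo_fun_def)

lemma holo_fun_diff [intro]: "holo_fun A W f \<Longrightarrow> holo_fun A W g \<Longrightarrow> holo_fun A W (\<lambda>p. f p - g p)"
  by (fastforce simp: holo_fun_def)

lemma holo_fun_sum [intro]: "(\<And>k. k \<in> K \<Longrightarrow> holo_fun A W (f k)) \<Longrightarrow> holo_fun A W (\<lambda>p. \<Sum>k\<in>K. f k p)"
  by (induction K rule: infinite_finite_induct) auto

text \<open>The properties of an atlas on which the calculus of bundle sections rests. They can be
  checked directly for \<open>line_atlas\<close>, so one theory serves bundles over the manifold and
  over its product with the line.\<close>

definition good_atlas :: "('m::topological_space, 'n::finite) chart set \<Rightarrow> bool" where
  "good_atlas B \<longleftrightarrow> (\<forall>V \<psi>. (V, \<psi>) \<in> B \<longrightarrow> inj_on \<psi> V \<and> (\<forall>W. open W \<longrightarrow> open (\<psi> ` (V \<inter> W))))"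

lemma good_atlas_complex: "complex_atlas B \<Longrightarrow> good_atlas B"
  unfolding good_atlas_def
proof (intro allI impI conjI)
  fix V \<psi> W assume B: "complex_atlas B" "(V, \<psi>) \<in> B"
  note v = chart_props[OF B]
  show "inj_on \<psi> V" by (rule inj_on_inverseI[of _ "inv_into V \<psi>"]) (rule v(3))
  show "open (\<psi> ` (V \<inter> W))" if "open W" using v(1) that by (intro v(8)) auto
qed

lemma holo_fun_cong:
  assumes B: "good_atlas B" and f: "holo_fun B W f" and W: "open W" and eq: "\<And>p. p \<in> W \<Longrightarrow> g p = f p"
  shows "holo_fun B W g"
proof (rule holo_funI)
  fix V \<psi> assume V: "(V, \<psi>) \<in> B"
  have inj: "inj_on \<psi> V" and op: "open (\<psi> ` (V \<inter> W))" using B V W by (auto simp: good_atlas_def)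
  show "holo_on (\<lambda>x. g (inv_into V \<psi> x)) (\<psi> ` (V \<inter> W))"
  proof (rule holo_on_congI[OF holo_funD[OF f V] op])
    fix x assume "x \<in> \<psi> ` (V \<inter> W)"
    then show "g (inv_into V \<psi> x) = f (inv_into V \<psi> x)" using inv_into_f_f[OF inj] eq by auto
  qed
qed

lemma holo_near_I: "holo_fun A W f \<Longrightarrow> open W \<Longrightarrow> p \<in> W \<Longrightarrow> holo_near A p f"
  by (auto simp: holo_near_def)

lemma vf_eqD: "vf_eq A V X Y \<Longrightarrow> p \<in> V \<Longrightarrow> holo_near A p f \<Longrightarrow> X f p = Y f p"
  by (simp add: vf_eq_def)

lemma vf_eq_subset: "vf_eq A V X Y \<Longrightarrow> V' \<subseteq> V \<Longrightarrow> vf_eq A V' X Y"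
  by (auto simp: vf_eq_def)

definition vf_on where
  "vf_on A V U \<phi> X a \<longleftrightarrow> (\<forall>i. holo_fun A (U \<inter> V) (a i)) \<and>
     (\<forall>p\<in>U \<inter> V. \<forall>f. holo_near A p f \<longrightarrow> X f p = (\<Sum>i\<in>UNIV. a i p * coord_vf (U, \<phi>) i f p))"

lemma vf_onD:
  assumes "vf_on A V U \<phi> X a"
  shows "holo_fun A (U \<inter> V) (a i)"
    "p \<in> U \<Longrightarrow> p \<in> V \<Longrightarrow> holo_near A p f \<Longrightarrow> X f p = (\<Sum>i\<in>UNIV. a i p * coord_vf (U, \<phi>) i f p)"
  using assms by (simp_all add: vf_on_def)

lemma vfs_chart: "X \<in> vfs A V \<Longrightarrow> (U, \<phi>) \<in> A \<Longrightarrow> \<exists>a. vf_on A V U \<phi> X a"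
  unfolding vfs_def vf_on_def mem_Collect_eq by (drule (1) bspec) (simp only: prod.case)

lemma vfsI:
  assumes "\<And>U \<phi>. (U, \<phi>) \<in> A \<Longrightarrow> \<exists>a. vf_on A V U \<phi> X a"
  shows "X \<in> vfs A V"
  unfolding vfs_def mem_Collect_eq
proof (rule ballI)
  fix c assume c: "c \<in> A"
  obtain U \<phi> where "c = (U, \<phi>)" by fastforce
  then show "case c of (U, \<phi>) \<Rightarrow> \<exists>a. (\<forall>i. holo_fun A (U \<inter> V) (a i)) \<and>
     (\<forall>p\<in>U \<inter> V. \<forall>f. holo_near A p f \<longrightarrow> X f p = (\<Sum>i\<in>UNIV. a i p * coord_vf (U, \<phi>) i f p))"
    using assms[of U \<phi>] c by (simp only: prod.case vf_on_def)
qed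

lemma vfs_subset: assumes "X \<in> vfs A V" "V' \<subseteq> V" shows "X \<in> vfs A V'"
proof (rule vfsI)
  fix U \<phi> assume "(U, \<phi>) \<in> A"
  from vfs_chart[OF assms(1) this] obtain a where a: "vf_on A V U \<phi> X a" ..
  have "holo_fun A (U \<inter> V') (a i)" for i by (rule holo_fun_subset[OF vf_onD(1)[OF a]]) (use assms(2) in auto)
  then have "vf_on A V' U \<phi> X a" using vf_onD(2)[OF a] assms(2) unfolding vf_on_def by blast
  then show "\<exists>a. vf_on A V' U \<phi> X a" by blast
qed

lemma vfs_add: assumes "X \<in> vfs A V" "Y \<in> vfs A V" shows "vf_add X Y \<in> vfs A V"
proof (rule vfsI)
  fix U \<phi> assume c: "(U, \<phi>) \<in> A"
  from vfs_chart[OF assms(1) c] obtain a where a: "vf_on A V U \<phi> X a" ..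
  from vfs_chart[OF assms(2) c] obtain b where b: "vf_on A V U \<phi> Y b" ..
  have "vf_on A V U \<phi> (vf_add X Y) (\<lambda>i p. a i p + b i p)"
    unfolding vf_on_def
    by (auto simp: vf_onD[OF a] vf_onD[OF b] vf_add_def distrib_right sum.distrib intro!: holo_fun_add)
  then show "\<exists>a. vf_on A V U \<phi> (vf_add X Y) a" by blast
qed

lemma vfs_scale: assumes "X \<in> vfs A V" "holo_fun A V g" shows "vf_scale g X \<in> vfs A V"
proof (rule vfsI)
  fix U \<phi> assume c: "(U, \<phi>) \<in> A"
  from vfs_chart[OF assms(1) c] obtain a where a: "vf_on A V U \<phi> X a" ..
  have "holo_fun A (U \<inter> V) g" using assms(2) by (rule holo_fun_subset) auto
  then have "vf_on A V U \<phi> (vf_scale g X) (\<lambda>i p. g p * a i p)"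
    unfolding vf_on_def
    by (auto simp: vf_onD[OF a] vf_scale_def mult.assoc sum_distrib_left intro!: holo_fun_mult)
  then show "\<exists>a. vf_on A V U \<phi> (vf_scale g X) a" by blast
qed

definition vf_sum :: "'i set \<Rightarrow> ('i \<Rightarrow> 'm \<Rightarrow> complex) \<Rightarrow> ('i \<Rightarrow> 'm vf) \<Rightarrow> 'm vf" where
  "vf_sum J x X = (\<lambda>f p. \<Sum>k\<in>J. x k p * X k f p)"

lemma vf_sum_insert: "finite J \<Longrightarrow> i \<notin> J \<Longrightarrow> vf_sum (insert i J) x X = vf_add (vf_scale (x i) (X i)) (vf_sum J x X)"
  by (auto simp: vf_sum_def vf_add_def vf_scale_def)

lemma vf_sum_empty: "vf_sum {} x X = vf_scale (\<lambda>_. 0) Y"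
  by (auto simp: vf_sum_def vf_scale_def)

lemma vfs_sum:
  assumes "finite J" "\<And>k. k \<in> J \<Longrightarrow> X k \<in> vfs A V" "\<And>k. k \<in> J \<Longrightarrow> holo_fun A V (x k)"
  shows "vf_sum J x X \<in> vfs A V"
  using assms
proof (induction J rule: finite_induct)
  case empty
  have "(\<lambda>f p. 0) \<in> vfs A V" by (rule vfsI, rule exI[of _ "\<lambda>i p. 0"]) (simp add: vf_on_def)
  then show ?case by (simp add: vf_sum_def)
next
  case (insert i J)
  then show ?case by (simp add: vf_sum_insert vfs_add vfs_scale)
qed

text \<open>The chart need not belong to \<open>A\<close>. Functions and vector fields are defined
  by the charts of \<open>A\<close>, but the claim concerns all local coordinates, so everything has
  to be carried over to a merely compatible chart.\<close>

locale manifold_chart =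
  fixes A :: "('m::topological_space, 'n::finite) chart set" and U \<phi>
  assumes atlas: "complex_atlas A" and chart: "complex_atlas (insert (U, \<phi>) A)"
begin

abbreviation "\<phi>i \<equiv> inv_into U \<phi>"

lemmas chart_simps = chart_props[OF chart insertI1]

lemma good_A: "good_atlas A" by (rule good_atlas_complex[OF atlas])

lemma open_U: "open U" by (rule chart_simps)

lemma atlas_cover: obtains V \<psi> where "(V, \<psi>) \<in> A" "p \<in> V"
proof -
  have "p \<in> (\<Union>(V, \<psi>)\<in>A. V)" using atlas by (simp add: complex_atlas_def)
  then obtain d where d: "d \<in> A" "p \<in> (case d of (V, \<psi>) \<Rightarrow> V)" by blast
  show ?thesis by (rule that[of "fst d" "snd d"]) (use d in \<open>simp_all add: case_prod_beta\<close>)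
qed

lemma holo_fun_chart:
  assumes f: "holo_fun A W f" and W: "open W" "W \<subseteq> V" and V: "(V, \<psi>) \<in> insert (U, \<phi>) A"
  shows "holo_on (\<lambda>x. f (inv_into V \<psi> x)) (\<psi> ` W)"
proof (rule holo_on_local)
  fix x assume "x \<in> \<psi> ` W"
  then obtain p where p: "p \<in> W" "x = \<psi> p" by blast
  obtain V' \<psi>' where V': "(V', \<psi>') \<in> A" "p \<in> V'" by (rule atlas_cover)
  have o: "open (W \<inter> V')" using W chart_props(1)[OF atlas V'(1)] by auto
  have "holo_on (\<lambda>x. f (inv_into V' \<psi>' x)) (\<psi>' ` (W \<inter> V'))"
    using f V'(1) unfolding holo_fun_def by (auto simp: Int_commute)
  then have "holo_on (\<lambda>x. f (inv_into V \<psi> x)) (\<psi> ` (W \<inter> V'))"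
    by (rule holo_transfer[OF chart V insertI2[OF V'(1)] o, rotated -1]) (use W in auto)
  moreover have "x \<in> \<psi> ` (W \<inter> V')" using p V' by blast
  ultimately show "\<exists>N. x \<in> N \<and> holo_on (\<lambda>x. f (inv_into V \<psi> x)) N" by (intro exI conjI)
qed

lemma holo_fun_from_chart:
  assumes W: "open W" "W \<subseteq> U" and f: "holo_on (\<lambda>x. f (\<phi>i x)) (\<phi> ` W)"
  shows "holo_fun A W f"
  unfolding holo_fun_def
proof clarify
  fix V \<psi> assume V: "(V, \<psi>) \<in> A"
  have "open (V \<inter> W)" using W chart_props(1)[OF atlas V] by auto
  moreover have "holo_on (\<lambda>x. f (\<phi>i x)) (\<phi> ` (V \<inter> W))" using f by (rule holo_on_subset) auto
  ultimately show "holo_on (\<lambda>x. f (inv_into V \<psi> x)) (\<psi> ` (V \<inter> W))"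
    using W by (intro holo_transfer[OF chart insertI2[OF V] insertI1]) auto
qed

lemma holo_fun_local:
  assumes "\<And>p. p \<in> W \<Longrightarrow> \<exists>W'. p \<in> W' \<and> holo_fun A W' f"
  shows "holo_fun A W f"
  unfolding holo_fun_def
proof clarify
  fix V \<psi> assume V: "(V, \<psi>) \<in> A"
  show "holo_on (\<lambda>x. f (inv_into V \<psi> x)) (\<psi> ` (V \<inter> W))"
  proof (rule holo_on_local)
    fix x assume "x \<in> \<psi> ` (V \<inter> W)"
    then obtain p where p: "p \<in> V" "p \<in> W" "x = \<psi> p" by blast
    obtain W' where "p \<in> W'" "holo_fun A W' f" using assms[OF p(2)] by blast
    then show "\<exists>N. x \<in> N \<and> holo_on (\<lambda>x. f (inv_into V \<psi> x)) N"
      using p V by (intro exI[of _ "\<psi> ` (V \<inter> W')"]) (auto simp: holo_fun_def)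
  qed
qed

lemma holo_fun_coordinate: "holo_fun A U (\<lambda>q. \<phi> q $ k)"
proof (rule holo_fun_from_chart[OF open_U order_refl])
  have "holo_on (\<lambda>x. x $ k) (\<phi> ` U)" by auto
  then show "holo_on (\<lambda>x. \<phi> (\<phi>i x) $ k) (\<phi> ` U)"
    using holo_on_cong[OF chart_simps(2), of "\<lambda>x. \<phi> (\<phi>i x) $ k" "\<lambda>x. x $ k"] chart_simps(4) by simp
qed

lemma chart_chain_rule:
  assumes V: "(V, \<psi>) \<in> insert (U, \<phi>) A" and V': "(V', \<psi>') \<in> insert (U, \<phi>) A" and p: "p \<in> V" "p \<in> V'"
    and f: "holo_near A p f"
  shows "coord_vf (V, \<psi>) j f p = (\<Sum>k\<in>UNIV. coord_vf (V, \<psi>) j (\<lambda>q. \<psi>' q $ k) p * coord_vf (V', \<psi>') k f p)"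
proof -
  note v = chart_props[OF chart V] and v' = chart_props[OF chart V']
  obtain W0 where W0: "open W0" "p \<in> W0" "holo_fun A W0 f" using f unfolding holo_near_def by blast
  define W where "W = W0 \<inter> V \<inter> V'"
  have W: "open W" "p \<in> W" "W \<subseteq> V" "W \<subseteq> V'" using W0 p v(1) v'(1) by (auto simp: W_def)
  have fW: "holo_fun A W f" using W0(3) by (rule holo_fun_subset) (auto simp: W_def)
  have "coord_vf (V, \<psi>) j f p = pd j (\<lambda>x. f (inv_into V' \<psi>' (\<psi>' (inv_into V \<psi> x)))) (\<psi> p)"
    unfolding coord_vf_eq
  proof (rule pd_cong[OF v(8)[OF W(1,3)]])
    fix y assume "y \<in> \<psi> ` W"
    then obtain q where q: "q \<in> W" "y = \<psi> q" by blast
    then have "q \<in> V" "q \<in> V'" using W by auto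
    then show "f (inv_into V \<psi> y) = f (inv_into V' \<psi>' (\<psi>' (inv_into V \<psi> y)))"
      by (simp add: q(2) v(3) v'(3))
  qed (use W in auto)
  also have "\<dots> = (\<Sum>k\<in>UNIV. pd j (\<lambda>x. \<psi>' (inv_into V \<psi> x) $ k) (\<psi> p) *
      pd k (\<lambda>x. f (inv_into V' \<psi>' x)) (\<psi>' (inv_into V \<psi> (\<psi> p))))"
    by (rule pd_compose[OF holo_fun_chart[OF fW W(1,4) V'] atlas_transition[OF chart V V']])
      (use W v(3) in \<open>auto\<close>)
  finally show ?thesis using v(3)[OF p(1)] by (simp add: coord_vf_eq)
qed

abbreviation "X \<equiv> coord_vf (U, \<phi>)"

lemma X_eq: "X i f p = pd i (\<lambda>x. f (\<phi>i x)) (\<phi> p)"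
  by (rule coord_vf_eq)

lemma holo_fun_X:
  assumes "holo_fun A W f" "open W" "W \<subseteq> U" shows "holo_fun A W (X i f)"
proof (rule holo_fun_from_chart[OF assms(2,3)])
  have o: "open (\<phi> ` W)" using chart_simps(8) assms by blast
  have "holo_on (pd i (\<lambda>x. f (\<phi>i x))) (\<phi> ` W)"
    by (intro holo_on_pd o holo_fun_chart[OF assms insertI1])
  then show "holo_on (\<lambda>x. X i f (\<phi>i x)) (\<phi> ` W)"
  proof (rule holo_on_congI[OF _ o])
    fix x assume "x \<in> \<phi> ` W"
    then have "x \<in> \<phi> ` U" using assms(3) by auto
    then show "X i f (\<phi>i x) = pd i (\<lambda>x. f (\<phi>i x)) x" by (simp add: X_eq chart_simps(4))
  qed
qed

lemma X_cong:
  assumes "open W" "p \<in> W" "W \<subseteq> U" "\<And>q. q \<in> W \<Longrightarrow> f q = g q" shows "X i f p = X i g p"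
  unfolding X_eq
  by (rule pd_cong[OF chart_simps(8)[OF assms(1,3)]]) (use assms chart_simps(3) in auto)

lemma X_coordinate: "p \<in> U \<Longrightarrow> X i (\<lambda>q. \<phi> q $ k) p = (if i = k then 1 else 0)"
  unfolding X_eq pd_component[of i k "\<phi> p", symmetric]
  by (rule pd_cong[OF chart_simps(2)]) (use chart_simps(4) in auto)

lemma X_const [simp]: "X i (\<lambda>q. c) p = 0"
  by (simp add: X_eq)

lemma X_mult:
  assumes "holo_fun A W f" "holo_fun A W g" "open W" "W \<subseteq> U" "p \<in> W"
  shows "X i (\<lambda>q. f q * g q) p = X i f p * g p + f p * X i g p"
proof -
  have "pd i (\<lambda>x. f (\<phi>i x) * g (\<phi>i x)) (\<phi> p) = pd i (\<lambda>x. f (\<phi>i x)) (\<phi> p) * g (\<phi>i (\<phi> p)) + f (\<phi>i (\<phi> p)) * pd i (\<lambda>x. g (\<phi>i x)) (\<phi> p)"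
    by (rule pd_mult[OF holo_fun_chart[OF assms(1,3,4) insertI1] holo_fun_chart[OF assms(2,3,4) insertI1]])
      (use assms chart_simps(8) in auto)
  then show ?thesis using assms chart_simps(3) by (auto simp: X_eq)
qed

lemma X_commute:
  assumes "holo_near A p f" "p \<in> U" shows "X i (X j f) p = X j (X i f) p"
proof -
  obtain W0 where W0: "open W0" "p \<in> W0" "holo_fun A W0 f" using assms unfolding holo_near_def by blast
  define W where "W = W0 \<inter> U"
  have W: "open W" "p \<in> W" "W \<subseteq> U" using W0 assms open_U by (auto simp: W_def)
  have "holo_fun A W f" by (rule holo_fun_subset[OF W0(3)]) (simp add: W_def)
  then have f: "holo_on (\<lambda>x. f (\<phi>i x)) (\<phi> ` W)" by (rule holo_fun_chart[OF _ W(1,3) insertI1])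
  have o: "open (\<phi> ` W)" using chart_simps(8) W by blast
  have *: "X i (X j f) p = pd i (pd j (\<lambda>x. f (\<phi>i x))) (\<phi> p)" for i j
    unfolding X_eq[of i "X j f"]
  proof (rule pd_cong[OF o])
    show "\<phi> p \<in> \<phi> ` W" using W by blast
    fix x assume "x \<in> \<phi> ` W"
    then have "x \<in> \<phi> ` U" using W(3) by auto
    then show "X j f (\<phi>i x) = pd j (\<lambda>x. f (\<phi>i x)) x" by (simp add: X_eq chart_simps(4))
  qed
  show ?thesis unfolding * by (rule pd_commute[OF f o]) (use W in auto)
qed

lemma X_in_vfs: "X i \<in> vfs A U"
proof (rule vfsI)
  fix V \<psi> assume V: "(V, \<psi>) \<in> A"
  have "holo_fun A (V \<inter> U) (\<lambda>q. \<psi> q $ k)" for k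
  proof (rule holo_fun_from_chart)
    show "open (V \<inter> U)" using chart_props(1)[OF atlas V] open_U by auto
    show "holo_on (\<lambda>x. \<psi> (\<phi>i x) $ k) (\<phi> ` (V \<inter> U))"
      using atlas_transition[OF chart insertI1 insertI2[OF V], of k] by (simp add: Int_commute)
  qed auto
  then have "holo_fun A (V \<inter> U) (X i (\<lambda>q. \<psi> q $ k))" for k
    using chart_props(1)[OF atlas V] open_U by (intro holo_fun_X) auto
  then have "vf_on A U V \<psi> (X i) (\<lambda>k. X i (\<lambda>q. \<psi> q $ k))"
    unfolding vf_on_def using chart_chain_rule[OF insertI1 insertI2[OF V]] by auto
  then show "\<exists>a. vf_on A U V \<psi> (X i) a" by blast
qed

definition coeff :: "'m vf \<Rightarrow> 'n \<Rightarrow> 'm \<Rightarrow> complex" where "coeff Y k = Y (\<lambda>q. \<phi> q $ k)"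

text \<open>Applying the field to the coordinate functions defines the coefficients without
  reference to \<open>A\<close>. Their holomorphy is checked locally in charts of \<open>A\<close>,
  and the chain rule between the two charts gives the expansion.\<close>

lemma vf_expand:
  assumes Y: "Y \<in> vfs A V" and V: "open V" "V \<subseteq> U"
  shows "holo_fun A V (coeff Y k)" "vf_eq A V Y (vf_sum UNIV (coeff Y) X)"
proof -
  have near: "holo_near A p (\<lambda>q. \<phi> q $ k)" if "p \<in> V" for p k
    using holo_near_I[OF holo_fun_coordinate open_U] that V by blast
  show "holo_fun A V (coeff Y k)"
  proof (rule holo_fun_local)
    fix p assume p: "p \<in> V"
    obtain V' \<psi> where V': "(V', \<psi>) \<in> A" "p \<in> V'" by (rule atlas_cover)
    from vfs_chart[OF Y V'(1)] obtain a where a: "vf_on A V V' \<psi> Y a" ..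
    interpret V': manifold_chart A V' \<psi>
      using atlas V'(1) by unfold_locales (simp_all add: insert_absorb)
    have o: "open (V' \<inter> V)" using V(1) V'.open_U by auto
    have "holo_fun A (V' \<inter> V) (\<lambda>q. \<Sum>i\<in>UNIV. a i q * coord_vf (V', \<psi>) i (\<lambda>q. \<phi> q $ k) q)"
      using V by (intro holo_fun_sum holo_fun_mult vf_onD(1)[OF a] V'.holo_fun_X[OF holo_fun_subset[OF holo_fun_coordinate] o]) auto
    then have "holo_fun A (V' \<inter> V) (coeff Y k)"
      by (rule holo_fun_cong[OF good_A _ o]) (simp add: coeff_def vf_onD(2)[OF a] near)
    then show "\<exists>W'. p \<in> W' \<and> holo_fun A W' (coeff Y k)" using p V' by blast
  qed
  show "vf_eq A V Y (vf_sum UNIV (coeff Y) X)"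
    unfolding vf_eq_def
  proof (intro ballI allI impI)
    fix p f assume p: "p \<in> V" and f: "holo_near A p f"
    obtain V' \<psi> where V': "(V', \<psi>) \<in> A" "p \<in> V'" by (rule atlas_cover)
    from vfs_chart[OF Y V'(1)] obtain a where "vf_on A V V' \<psi> Y a" ..
    note a = vf_onD(2)[OF this]
    have "Y f p = (\<Sum>i\<in>UNIV. \<Sum>k\<in>UNIV. a i p * (coord_vf (V', \<psi>) i (\<lambda>q. \<phi> q $ k) p * X k f p))"
      using a[OF V'(2) p f] chart_chain_rule[OF insertI2[OF V'(1)] insertI1 V'(2) _ f] p V(2)
      by (auto simp: sum_distrib_left)
    also have "\<dots> = (\<Sum>k\<in>UNIV. \<Sum>i\<in>UNIV. a i p * (coord_vf (V', \<psi>) i (\<lambda>q. \<phi> q $ k) p * X k f p))" by (rule sum.swap)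
    also have "\<dots> = vf_sum UNIV (coeff Y) X f p"
      using a[OF V'(2) p near[OF p]] by (simp add: vf_sum_def coeff_def sum_distrib_right mult.assoc)
    finally show "Y f p = vf_sum UNIV (coeff Y) X f p" .
  qed
qed

lemma coeff_vf_sum: "p \<in> U \<Longrightarrow> coeff (vf_sum UNIV x X) k p = x k p"
  by (simp add: coeff_def vf_sum_def X_coordinate if_distrib sum.delta sum.delta' cong: if_cong)

lemma coeff_cong:
  assumes "vf_eq A V Y Z" "p \<in> V" "V \<subseteq> U" shows "coeff Y k p = coeff Z k p"
  unfolding coeff_def by (rule vf_eqD[OF assms(1,2)])
    (use holo_near_I[OF holo_fun_coordinate open_U] assms in blast)

lemma lie_bracket_X: "vf_eq A U (lie_bracket (X i) (X j)) (vf_scale (\<lambda>_. 0) (X i))" "lie_bracket (X i) (X j) \<in> vfs A U"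
proof -
  show *: "vf_eq A U (lie_bracket (X i) (X j)) (vf_scale (\<lambda>_. 0) (X i))"
    by (auto simp: vf_eq_def lie_bracket_def vf_scale_def X_commute)
  show "lie_bracket (X i) (X j) \<in> vfs A U"
    by (rule vfsI, rule exI[of _ "\<lambda>i p. 0"]) (use * in \<open>auto simp: vf_on_def vf_eq_def vf_scale_def\<close>)
qed

end

section \<open>Vector bundles\<close>

locale holo_bundle =
  fixes B :: "('b::topological_space, 'n::finite) chart set" and E :: "('b, 'k, 'r::finite) vbundle"
  assumes good_B: "good_atlas B" and E: "holo_vbundle B E"
begin

definition fiber :: "'b \<Rightarrow> 'k set" where "fiber p = {v \<in> Tot E. Pr E v = p}"

definition triv :: "'b set \<Rightarrow> ('k \<Rightarrow> complex^'r) \<Rightarrow> 'b \<Rightarrow> bool" where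
  "triv V h p \<longleftrightarrow> (V, h) \<in> Trivs E \<and> p \<in> V"

lemma triv_exists: "\<exists>V h. triv V h p"
proof -
  have "p \<in> (\<Union>(V, h)\<in>Trivs E. V)" using E by (simp add: holo_vbundle_def)
  then obtain c where "c \<in> Trivs E" "p \<in> (case c of (V, h) \<Rightarrow> V)" by blast
  then have "triv (fst c) (snd c) p" by (simp add: triv_def case_prod_beta)
  then show ?thesis by blast
qed

lemma triv_bij:
  assumes "triv V h p" shows "bij_betw h (fiber p) UNIV"
proof -
  have "\<forall>(V, h)\<in>Trivs E. open V \<and> (\<forall>p\<in>V. bij_betw h {v \<in> Tot E. Pr E v = p} UNIV)"
    using E by (simp add: holo_vbundle_def)
  from bspec[OF this, of "(V, h)"] assms show ?thesis by (simp add: triv_def fiber_def)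
qed

lemma triv_open: "(V, h) \<in> Trivs E \<Longrightarrow> open V"
proof -
  assume *: "(V, h) \<in> Trivs E"
  have "\<forall>(V, h)\<in>Trivs E. open V \<and> (\<forall>p\<in>V. bij_betw h {v \<in> Tot E. Pr E v = p} UNIV)"
    using E by (simp add: holo_vbundle_def)
  from bspec[OF this *] show ?thesis by simp
qed

lemma triv_inj: "triv V h p \<Longrightarrow> u \<in> fiber p \<Longrightarrow> v \<in> fiber p \<Longrightarrow> h u = h v \<Longrightarrow> u = v"
  using triv_bij by (metis bij_betw_def inj_onD)

definition unh :: "('k \<Rightarrow> complex^'r) \<Rightarrow> 'b \<Rightarrow> complex^'r \<Rightarrow> 'k" where
  "unh h p = inv_into (fiber p) h"

lemma unh: assumes "triv V h p" shows "unh h p x \<in> fiber p" "h (unh h p x) = x"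
  using triv_bij[OF assms] unfolding unh_def bij_betw_def
  by (metis inv_into_into UNIV_I, metis f_inv_into_f UNIV_I)

lemma transition:
  assumes "(V, h) \<in> Trivs E" "(V', h') \<in> Trivs E"
  obtains g :: "'b \<Rightarrow> complex^'r^'r" where "\<And>i j. holo_fun B (V \<inter> V') (\<lambda>p. g p $ i $ j)"
    "\<And>p v. p \<in> V \<Longrightarrow> p \<in> V' \<Longrightarrow> v \<in> fiber p \<Longrightarrow> h' v = g p *v h v"
proof -
  have "\<forall>(V, h)\<in>Trivs E. \<forall>(V', h')\<in>Trivs E. \<exists>g :: 'b \<Rightarrow> complex^'r^'r.
        (\<forall>i j. holo_fun B (V \<inter> V') (\<lambda>p. g p $ i $ j)) \<and>
        (\<forall>v\<in>Tot E. Pr E v \<in> V \<inter> V' \<longrightarrow> h' v = g (Pr E v) *v h v)"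
    using E by (simp add: holo_vbundle_def)
  from bspec[OF this assms(1)] have "\<forall>(V', h')\<in>Trivs E. \<exists>g :: 'b \<Rightarrow> complex^'r^'r.
        (\<forall>i j. holo_fun B (V \<inter> V') (\<lambda>p. g p $ i $ j)) \<and>
        (\<forall>v\<in>Tot E. Pr E v \<in> V \<inter> V' \<longrightarrow> h' v = g (Pr E v) *v h v)" by simp
  from bspec[OF this assms(2)] obtain g :: "'b \<Rightarrow> complex^'r^'r" where
    g: "(\<forall>i j. holo_fun B (V \<inter> V') (\<lambda>p. g p $ i $ j)) \<and>
        (\<forall>v\<in>Tot E. Pr E v \<in> V \<inter> V' \<longrightarrow> h' v = g (Pr E v) *v h v)" by auto
  show ?thesis by (rule that[of g]) (use g in \<open>auto simp: fiber_def\<close>)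
qed

text \<open>The condition imposed by one trivialization determines \<open>w\<close>, and linearity
  of the transition matrices carries it to all the others. This makes the descriptions in
  \<open>fib_add\<close> and \<open>fib_scale\<close> meaningful.\<close>

lemma fiber_combination:
  assumes u: "u \<in> fiber p" and v: "v \<in> fiber p"
  shows "\<exists>!w. w \<in> Tot E \<and> Pr E w = p \<and> (\<forall>(V, h)\<in>Trivs E. p \<in> V \<longrightarrow> h w = c *s h u + d *s h v)"
proof -
  obtain V h where t: "triv V h p" using triv_exists by blast
  define w where "w = unh h p (c *s h u + d *s h v)"
  have w: "w \<in> fiber p" "h w = c *s h u + d *s h v" unfolding w_def by (rule unh[OF t])+
  have "h' w = c *s h' u + d *s h' v" if t': "triv V' h' p" for V' h'
  proof -
    have m: "(V, h) \<in> Trivs E" "(V', h') \<in> Trivs E" "p \<in> V" "p \<in> V'" using t t' by (auto simp: triv_def)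
    obtain g :: "'b \<Rightarrow> complex^'r^'r" where g: "\<And>v. v \<in> fiber p \<Longrightarrow> h' v = g p *v h v"
      using transition[OF m(1,2)] m(3,4) by metis
    show ?thesis
      by (simp add: g w u v matrix_vector_right_distrib matrix_vector_mult_scaleR vec_eq_iff matrix_vector_mult_def
          sum_distrib_left algebra_simps sum.distrib)
  qed
  then have ex: "w \<in> Tot E \<and> Pr E w = p \<and> (\<forall>(V, h)\<in>Trivs E. p \<in> V \<longrightarrow> h w = c *s h u + d *s h v)"
    using w(1) unfolding fiber_def triv_def by fastforce
  show ?thesis
  proof (rule ex1I[of _ w])
    fix w' assume w': "w' \<in> Tot E \<and> Pr E w' = p \<and> (\<forall>(V, h)\<in>Trivs E. p \<in> V \<longrightarrow> h w' = c *s h u + d *s h v)"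
    then have "h w' = c *s h u + d *s h v" using t by (auto simp: triv_def)
    then show "w' = w" using triv_inj[OF t _ w(1)] w' w(2) by (simp add: fiber_def)
  qed (rule ex)
qed

lemma fib_add:
  assumes "u \<in> fiber p" "v \<in> fiber p"
  shows "fib_add E u v \<in> fiber p" "triv V h p \<Longrightarrow> h (fib_add E u v) = h u + h v"
proof -
  have p: "Pr E u = p" using assms(1) by (simp add: fiber_def)
  have "\<exists>!w. w \<in> Tot E \<and> Pr E w = p \<and> (\<forall>(V, h)\<in>Trivs E. p \<in> V \<longrightarrow> h w = h u + h v)"
    using fiber_combination[OF assms, of 1 1] by simp
  from theI'[OF this] have *: "fib_add E u v \<in> Tot E \<and> Pr E (fib_add E u v) = p \<and>
      (\<forall>(V, h)\<in>Trivs E. p \<in> V \<longrightarrow> h (fib_add E u v) = h u + h v)"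
    unfolding fib_add_def p .
  then show "fib_add E u v \<in> fiber p" by (simp add: fiber_def)
  show "h (fib_add E u v) = h u + h v" if "triv V h p" using * that by (auto simp: triv_def)
qed

lemma fib_scale:
  assumes "u \<in> fiber p"
  shows "fib_scale E c u \<in> fiber p" "triv V h p \<Longrightarrow> h (fib_scale E c u) = c *s h u"
proof -
  have p: "Pr E u = p" using assms(1) by (simp add: fiber_def)
  have "\<exists>!w. w \<in> Tot E \<and> Pr E w = p \<and> (\<forall>(V, h)\<in>Trivs E. p \<in> V \<longrightarrow> h w = c *s h u)"
    using fiber_combination[OF assms assms, of c 0] by simp
  from theI'[OF this] have *: "fib_scale E c u \<in> Tot E \<and> Pr E (fib_scale E c u) = p \<and>
      (\<forall>(V, h)\<in>Trivs E. p \<in> V \<longrightarrow> h (fib_scale E c u) = c *s h u)"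
    unfolding fib_scale_def p .
  then show "fib_scale E c u \<in> fiber p" by (simp add: fiber_def)
  show "h (fib_scale E c u) = c *s h u" if "triv V h p" using * that by (auto simp: triv_def)
qed

lemma s_add:
  assumes "s p \<in> fiber p" "t p \<in> fiber p"
  shows "s_add E s t p \<in> fiber p" "triv V h p \<Longrightarrow> h (s_add E s t p) = h (s p) + h (t p)"
  using fib_add[OF assms] by (simp_all add: s_add_def)

lemma s_scale:
  assumes "s p \<in> fiber p"
  shows "s_scale E f s p \<in> fiber p" "triv V h p \<Longrightarrow> h (s_scale E f s p) = f p *s h (s p)"
  using fib_scale[OF assms] by (simp_all add: s_scale_def)

lemma s_diff:
  assumes "s p \<in> fiber p" "t p \<in> fiber p"
  shows "s_diff E s t p \<in> fiber p" "triv V h p \<Longrightarrow> h (s_diff E s t p) = h (s p) - h (t p)"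
proof -
  show "s_diff E s t p \<in> fiber p" unfolding s_diff_def by (intro s_add s_scale assms)
  show "h (s_diff E s t p) = h (s p) - h (t p)" if "triv V h p"
    unfolding s_diff_def using s_add(2)[of s p "s_scale E (\<lambda>_. - 1) t", OF assms(1) s_scale(1)[of t p, OF assms(2)] that] s_scale(2)[of t p, OF assms(2) that]
    by (simp add: vec_eq_iff)
qed

lemma sectsD:
  assumes "s \<in> sects B E W"
  shows "p \<in> W \<Longrightarrow> s p \<in> fiber p" "(V, h) \<in> Trivs E \<Longrightarrow> holo_fun B (V \<inter> W) (\<lambda>p. h (s p) $ j)"
proof -
  show "s p \<in> fiber p" if "p \<in> W" using assms that by (simp add: sects_def fiber_def)
  have "\<forall>(V, h)\<in>Trivs E. \<forall>j. holo_fun B (V \<inter> W) (\<lambda>p. h (s p) $ j)" using assms by (simp add: sects_def)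
  from bspec[OF this, of "(V, h)"] show "holo_fun B (V \<inter> W) (\<lambda>p. h (s p) $ j)" if "(V, h) \<in> Trivs E" using that by simp
qed

lemma sectsI:
  assumes "\<And>p. p \<in> W \<Longrightarrow> s p \<in> fiber p" "\<And>V h j. (V, h) \<in> Trivs E \<Longrightarrow> holo_fun B (V \<inter> W) (\<lambda>p. h (s p) $ j)"
  shows "s \<in> sects B E W"
  using assms unfolding sects_def fiber_def by (simp add: case_prod_beta)

lemma sects_subset: assumes "s \<in> sects B E W" "W' \<subseteq> W" shows "s \<in> sects B E W'"
proof (rule sectsI)
  show "s p \<in> fiber p" if "p \<in> W'" for p using sectsD(1)[OF assms(1)] that assms(2) by blast
  show "holo_fun B (V \<inter> W') (\<lambda>p. h (s p) $ j)" if "(V, h) \<in> Trivs E" for V h j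
    by (rule holo_fun_subset[OF sectsD(2)[OF assms(1) that]]) (use assms(2) in auto)
qed

lemma sects_cong:
  assumes "s \<in> sects B E W" "open W" "\<And>p. p \<in> W \<Longrightarrow> t p = s p" shows "t \<in> sects B E W"
proof (rule sectsI)
  show "t p \<in> fiber p" if "p \<in> W" for p using sectsD(1)[OF assms(1) that] assms(3)[OF that] by simp
  show "holo_fun B (V \<inter> W) (\<lambda>p. h (t p) $ j)" if "(V, h) \<in> Trivs E" for V h j
    by (rule holo_fun_cong[OF good_B sectsD(2)[OF assms(1) that]]) (use assms triv_open[OF that] in auto)
qed

lemma sects_add:
  assumes "s \<in> sects B E W" "t \<in> sects B E W" "open W" shows "s_add E s t \<in> sects B E W"
proof (rule sectsI)
  show "s_add E s t p \<in> fiber p" if "p \<in> W" for p using s_add(1) sectsD(1)[OF assms(1) that] sectsD(1)[OF assms(2) that] by blast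
  show "holo_fun B (V \<inter> W) (\<lambda>p. h (s_add E s t p) $ j)" if "(V, h) \<in> Trivs E" for V h j
  proof (rule holo_fun_cong[OF good_B holo_fun_add[OF sectsD(2)[OF assms(1) that] sectsD(2)[OF assms(2) that]]])
    fix p assume "p \<in> V \<inter> W"
    then have "triv V h p" "s p \<in> fiber p" "t p \<in> fiber p" using that sectsD(1)[OF assms(1)] sectsD(1)[OF assms(2)] by (auto simp: triv_def)
    then show "h (s_add E s t p) $ j = h (s p) $ j + h (t p) $ j" using s_add(2)[of s p t V h] by simp
  qed (use assms triv_open[OF that] in auto)
qed

lemma sects_scale:
  assumes "s \<in> sects B E W" "holo_fun B W f" "open W" shows "s_scale E f s \<in> sects B E W"
proof (rule sectsI)
  show "s_scale E f s p \<in> fiber p" if "p \<in> W" for p using s_scale(1) sectsD(1)[OF assms(1) that] by blast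
  show "holo_fun B (V \<inter> W) (\<lambda>p. h (s_scale E f s p) $ j)" if "(V, h) \<in> Trivs E" for V h j
  proof (rule holo_fun_cong[OF good_B holo_fun_mult[OF holo_fun_subset[OF assms(2)] sectsD(2)[OF assms(1) that]]])
    fix p assume "p \<in> V \<inter> W"
    then have "triv V h p" "s p \<in> fiber p" using that sectsD(1)[OF assms(1)] by (auto simp: triv_def)
    then show "h (s_scale E f s p) $ j = f p * h (s p) $ j" using s_scale(2)[of s p V h f] by simp
  qed (use assms triv_open[OF that] in auto)
qed

lemma sects_unh:
  assumes V: "(V, h) \<in> Trivs E" and W: "open W" "W \<subseteq> V" and x: "\<And>j. holo_fun B W (\<lambda>p. x p $ j)"
  shows "(\<lambda>p. unh h p (x p)) \<in> sects B E W"
proof (rule sectsI)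
  have t: "triv V h p" if "p \<in> W" for p using V W that by (auto simp: triv_def)
  show "unh h p (x p) \<in> fiber p" if "p \<in> W" for p by (rule unh(1)[OF t[OF that]])
  fix V' h' j assume V': "(V', h') \<in> Trivs E"
  obtain g :: "'b \<Rightarrow> complex^'r^'r" where g: "\<And>i j. holo_fun B (V \<inter> V') (\<lambda>p. g p $ i $ j)"
    "\<And>p v. p \<in> V \<Longrightarrow> p \<in> V' \<Longrightarrow> v \<in> fiber p \<Longrightarrow> h' v = g p *v h v" using transition[OF V V'] by metis
  have "holo_fun B (V' \<inter> W) (\<lambda>p. \<Sum>i\<in>UNIV. g p $ j $ i * x p $ i)"
    using W by (intro holo_fun_sum holo_fun_mult holo_fun_subset[OF g(1)] holo_fun_subset[OF x]) auto
  then show "holo_fun B (V' \<inter> W) (\<lambda>p. h' (unh h p (x p)) $ j)"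
  proof (rule holo_fun_cong[OF good_B])
    show "open (V' \<inter> W)" using W triv_open[OF V'] by auto
    fix p assume p: "p \<in> V' \<inter> W"
    then show "h' (unh h p (x p)) $ j = (\<Sum>i\<in>UNIV. g p $ j $ i * x p $ i)"
      using g(2)[of p "unh h p (x p)"] unh[OF t] W by (auto simp: matrix_vector_mult_def)
  qed
qed

text \<open>The case \<open>\<delta> = 0\<close> covers Higgs fields, the case of a vector field \<open>\<delta>\<close> covers connections.\<close>

lemma leibniz_sum:
  assumes W: "open W" "W0 \<subseteq> W"
    and val: "\<And>s p. s \<in> sects B E W \<Longrightarrow> p \<in> W0 \<Longrightarrow> T s p \<in> fiber p"
    and loc: "\<And>s s'. s \<in> sects B E W \<Longrightarrow> s' \<in> sects B E W \<Longrightarrow> s_eq W s s' \<Longrightarrow> s_eq W0 (T s) (T s')"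
    and add: "\<And>s t. s \<in> sects B E W \<Longrightarrow> t \<in> sects B E W \<Longrightarrow> s_eq W0 (T (s_add E s t)) (s_add E (T s) (T t))"
    and leib: "\<And>s f p V h. s \<in> sects B E W \<Longrightarrow> holo_fun B W f \<Longrightarrow> p \<in> W0 \<Longrightarrow> triv V h p \<Longrightarrow>
        h (T (s_scale E f s) p) = \<delta> f p *s h (s p) + f p *s h (T s p)"
    and J: "finite J" and s: "\<And>k. k \<in> J \<Longrightarrow> s k \<in> sects B E W" and x: "\<And>k. k \<in> J \<Longrightarrow> holo_fun B W (x k)"
    and t: "t \<in> sects B E W"
    and t_eq: "\<And>p. p \<in> W \<Longrightarrow> \<exists>V h. triv V h p \<and> h (t p) = (\<Sum>k\<in>J. x k p *s h (s k p))"
    and p: "p \<in> W0" "triv V h p"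
  shows "h (T t p) = (\<Sum>k\<in>J. \<delta> (x k) p *s h (s k p) + x k p *s h (T (s k) p))"
  using J s x t t_eq
proof (induction J arbitrary: t rule: finite_induct)
  case empty
  \<comment> \<open>A section that vanishes in a trivialization equals 0 times itself, so the
    Leibniz rule yields the value of \<open>T\<close> at it.\<close>
  have eq: "s_eq W t (s_scale E (\<lambda>_. 0) t)"
    unfolding s_eq_def
  proof
    fix q assume q: "q \<in> W"
    obtain V h where h: "triv V h q" "h (t q) = 0" using empty.prems(4)[OF q] by auto
    have tq: "t q \<in> fiber q" by (rule sectsD(1)[OF empty.prems(3) q])
    show "t q = s_scale E (\<lambda>_. 0) t q"
      by (rule triv_inj[OF h(1) tq s_scale(1)[of t, OF tq]]) (simp add: s_scale(2)[of t, OF tq h(1)] h(2))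
  qed
  have pW: "p \<in> W" using p W by auto
  have sc: "s_scale E (\<lambda>_. 0) t \<in> sects B E W" by (rule sects_scale[OF empty.prems(3) _ W(1)]) simp
  have "T t p = T (s_scale E (\<lambda>_. 0) t) p" using loc[OF empty.prems(3) sc eq] p by (simp add: s_eq_def)
  then have "h (T t p) = \<delta> (\<lambda>_. 0) p *s h (t p)" using leib[OF empty.prems(3) _ p, of "\<lambda>_. 0"] by simp
  moreover have "h (t p) = 0"
  proof -
    have tp: "t p \<in> fiber p" by (rule sectsD(1)[OF empty.prems(3) pW])
    have "h (t p) = h (s_scale E (\<lambda>_. 0) t p)" using eq pW by (simp add: s_eq_def)
    also have "\<dots> = 0" using s_scale(2)[of t, OF tp p(2)] by simp
    finally show ?thesis .
  qed
  ultimately show ?case by simp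
next
  case (insert k J)
  let ?t1 = "s_scale E (x k) (s k)"
  \<comment> \<open>Removing one summand from \<open>t\<close> leaves a section to which the
    induction hypothesis applies, so the sum never has to be formed by iterating
    \<open>s_add\<close>.\<close>
  define t' where "t' = s_diff E t ?t1"
  have sk: "s k \<in> sects B E W" and xk: "holo_fun B W (x k)" using insert.prems by auto
  have t1: "?t1 \<in> sects B E W" by (rule sects_scale[OF sk xk W(1)])
  have t': "t' \<in> sects B E W"
    unfolding t'_def s_diff_def by (intro sects_add sects_scale t1 insert.prems W) simp
  have fib: "t q \<in> fiber q" "s k q \<in> fiber q" "?t1 q \<in> fiber q" "t' q \<in> fiber q" if "q \<in> W" for q
    using sectsD(1)[OF insert.prems(3) that] sectsD(1)[OF sk that] sectsD(1)[OF t1 that] sectsD(1)[OF t' that] .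
  have t'_eq: "h (t' q) = h (t q) - x k q *s h (s k q)" if "q \<in> W" "triv V h q" for q V h
    unfolding t'_def using s_diff(2)[of t q ?t1, OF fib(1)[OF that(1)] fib(3)[OF that(1)] that(2)]
      s_scale(2)[of "s k" q, OF fib(2)[OF that(1)] that(2)] by simp
  have IH: "h (T t' p) = (\<Sum>k\<in>J. \<delta> (x k) p *s h (s k p) + x k p *s h (T (s k) p))"
  proof (rule insert.IH[OF _ _ t'])
    fix q assume q: "q \<in> W"
    obtain V h where h: "triv V h q" "h (t q) = (\<Sum>k\<in>insert k J. x k q *s h (s k q))" using insert.prems(4)[OF q] by blast
    have "h (t' q) = (\<Sum>k\<in>J. x k q *s h (s k q))" using t'_eq[OF q h(1)] h(2) insert.hyps by simp
    then show "\<exists>V h. triv V h q \<and> h (t' q) = (\<Sum>k\<in>J. x k q *s h (s k q))" using h(1) by blast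
  qed (use insert.prems in auto)
  have add_t: "s_eq W t (s_add E t' ?t1)"
    unfolding s_eq_def
  proof
    fix q assume q: "q \<in> W"
    obtain V h where h: "triv V h q" using triv_exists by blast
    show "t q = s_add E t' ?t1 q"
      by (rule triv_inj[OF h fib(1)[OF q] s_add(1)[of t' q ?t1, OF fib(4,3)[OF q]]])
        (simp add: s_add(2)[of t' q ?t1, OF fib(4,3)[OF q] h] t'_eq[OF q h] s_scale(2)[of "s k" q, OF fib(2)[OF q] h])
  qed
  have pW: "p \<in> W" using p W by auto
  have "T t p = T (s_add E t' ?t1) p"
    using loc[OF insert.prems(3) sects_add[OF t' t1 W(1)] add_t] p by (simp add: s_eq_def)
  also have "\<dots> = s_add E (T t') (T ?t1) p" using add[OF t' t1] p by (simp add: s_eq_def)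
  finally have "h (T t p) = h (T t' p) + h (T ?t1 p)"
    using s_add(2)[of "T t'" p "T ?t1", OF val[OF t' p(1)] val[OF t1 p(1)] p(2)] by simp
  then show ?case using IH leib[OF sk xk p] insert.hyps by (simp add: add_ac)
qed

end

section \<open>Frames of primitive Higgs bundles\<close>

context
  fixes A :: "('m::topological_space, 'n::finite) chart set" and K :: "('m, 'k, 'r::finite) vbundle" and P
  assumes P: "vf_linear A K P"
begin

lemma vf_linear_rules:
  assumes "open V" "Y \<in> vfs A V" "s \<in> sects A K V"
  shows "P Y s \<in> sects A K V"
    "Y' \<in> vfs A V \<Longrightarrow> s' \<in> sects A K V \<Longrightarrow> vf_eq A V Y Y' \<Longrightarrow> s_eq V s s' \<Longrightarrow> s_eq V (P Y s) (P Y' s')"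
    "Y' \<in> vfs A V \<Longrightarrow> s_eq V (P (vf_add Y Y') s) (s_add K (P Y s) (P Y' s))"
    "holo_fun A V f \<Longrightarrow> s_eq V (P (vf_scale f Y) s) (s_scale K f (P Y s))"
    "t \<in> sects A K V \<Longrightarrow> s_eq V (P Y (s_add K s t)) (s_add K (P Y s) (P Y t))"
proof -
  note * = P[unfolded vf_linear_def, THEN spec, THEN mp, OF assms(1), THEN bspec, OF assms(2), THEN bspec, OF assms(3)]
  show "P Y s \<in> sects A K V" using * by (rule conjunct1)
  show "s_eq V (P Y s) (P Y' s')" if "Y' \<in> vfs A V" "s' \<in> sects A K V" "vf_eq A V Y Y'" "s_eq V s s'"
    using *[THEN conjunct2, THEN conjunct1] that by blast
  show "s_eq V (P (vf_add Y Y') s) (s_add K (P Y s) (P Y' s))" if "Y' \<in> vfs A V"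
    using *[THEN conjunct2, THEN conjunct2, THEN conjunct1] that by blast
  show "s_eq V (P (vf_scale f Y) s) (s_scale K f (P Y s))" if "holo_fun A V f"
    using *[THEN conjunct2, THEN conjunct2, THEN conjunct2, THEN conjunct1] that by blast
  show "s_eq V (P Y (s_add K s t)) (s_add K (P Y s) (P Y t))" if "t \<in> sects A K V"
    using *[THEN conjunct2, THEN conjunct2, THEN conjunct2, THEN conjunct2] that by blast
qed

end

lemma vf_eq_refl: "vf_eq A V Y Y" by (simp add: vf_eq_def)

lemma zero_in_vfs: "(\<lambda>f p. 0) \<in> vfs A V"
  by (rule vfsI, rule exI[of _ "\<lambda>i p. 0"]) (simp add: vf_on_def)

lemma (in holo_bundle) vf_linear_sum:
  assumes P: "vf_linear B E P" and V: "open V" and s: "s \<in> sects B E V" and J: "finite J"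
    and Y: "\<And>k. k \<in> J \<Longrightarrow> Y k \<in> vfs B V" and x: "\<And>k. k \<in> J \<Longrightarrow> holo_fun B V (x k)" and p: "p \<in> V" "triv V' h p"
  shows "h (P (vf_sum J x Y) s p) = (\<Sum>k\<in>J. x k p *s h (P (Y k) s p))"
  using J Y x
proof (induction J rule: finite_induct)
  case empty
  let ?Z = "\<lambda>f p. 0"
  have "P (vf_sum {} x Y) s p = s_scale E (\<lambda>_. 0) (P ?Z s) p"
    using vf_linear_rules(4)[OF P V zero_in_vfs s, of "\<lambda>_. 0"] p by (simp add: s_eq_def vf_sum_empty[of x Y ?Z])
  moreover have "P ?Z s p \<in> fiber p" by (rule sectsD(1)[OF vf_linear_rules(1)[OF P V zero_in_vfs s] p(1)])
  ultimately show ?case using s_scale(2)[of "P ?Z s" p V' h "\<lambda>_. 0"] p(2) by simp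
next
  case (insert k J)
  have Yk: "Y k \<in> vfs B V" and xk: "holo_fun B V (x k)" using insert.prems by auto
  have S: "vf_sum J x Y \<in> vfs B V" by (rule vfs_sum) (use insert in auto)
  have xY: "vf_scale (x k) (Y k) \<in> vfs B V" by (rule vfs_scale[OF Yk xk])
  have f1: "P (Y k) s p \<in> fiber p" by (rule sectsD(1)[OF vf_linear_rules(1)[OF P V Yk s] p(1)])
  have f2: "P (vf_sum J x Y) s p \<in> fiber p" by (rule sectsD(1)[OF vf_linear_rules(1)[OF P V S s] p(1)])
  have f3: "P (vf_scale (x k) (Y k)) s p \<in> fiber p" by (rule sectsD(1)[OF vf_linear_rules(1)[OF P V xY s] p(1)])
  have "P (vf_sum (insert k J) x Y) s p = s_add E (P (vf_scale (x k) (Y k)) s) (P (vf_sum J x Y) s) p"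
    using vf_linear_rules(3)[OF P V xY s S] p insert.hyps by (simp add: s_eq_def vf_sum_insert)
  then have "h (P (vf_sum (insert k J) x Y) s p) = h (P (vf_scale (x k) (Y k)) s p) + h (P (vf_sum J x Y) s p)"
    using s_add(2)[of "P (vf_scale (x k) (Y k)) s" p "P (vf_sum J x Y) s", OF f3 f2 p(2)] by simp
  moreover have "P (vf_scale (x k) (Y k)) s p = s_scale E (x k) (P (Y k) s) p"
    using vf_linear_rules(4)[OF P V Yk s xk] p by (simp add: s_eq_def)
  ultimately show ?case
    using insert s_scale(2)[of "P (Y k) s" p V' h "x k", OF f1 p(2)] by simp
qed

text \<open>The rank of \<open>K\<close> is the size of \<open>'r\<close> and the dimension of the
  manifold that of \<open>'n\<close>. They are not identified; the frame obtained from
  \<open>\<zeta>\<close> is indexed by \<open>'n\<close> and takes over the role of a basis.\<close>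

locale primitive_frame = manifold_chart A U \<phi>
  for A :: "('m::topological_space, 'n::finite) chart set" and U and \<phi> :: "'m \<Rightarrow> complex^'n" +
  fixes K :: "('m, 'k, 'r::finite) vbundle" and C \<zeta> mul e
  assumes higgs: "higgs_bundle A K C" and prim: "primitive_section A K C \<zeta>"
    and mult: "tangent_mult A mul"
    and mul_C: "\<And>V Y Z s. open V \<Longrightarrow> Y \<in> vfs A V \<Longrightarrow> Z \<in> vfs A V \<Longrightarrow> s \<in> sects A K V \<Longrightarrow>
      s_eq V (C (mul Y Z) s) (C Y (C Z s))"
    and e: "e \<in> vfs A UNIV" and unit: "s_eq UNIV (C e \<zeta>) \<zeta>"
begin

sublocale holo_bundle A K
  using good_A higgs by unfold_locales (simp_all add: higgs_bundle_def)

lemma C_lin: "vf_linear A K C"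
  using higgs by (simp add: higgs_bundle_def)

lemmas C_rules = vf_linear_rules[OF C_lin]

lemma C_O_linear:
  "open V \<Longrightarrow> Y \<in> vfs A V \<Longrightarrow> s \<in> sects A K V \<Longrightarrow> holo_fun A V f \<Longrightarrow> s_eq V (C Y (s_scale K f s)) (s_scale K f (C Y s))"
  using higgs unfolding higgs_bundle_def by blast

lemma C_commute:
  "open V \<Longrightarrow> Y \<in> vfs A V \<Longrightarrow> Z \<in> vfs A V \<Longrightarrow> s \<in> sects A K V \<Longrightarrow> s_eq V (C Y (C Z s)) (C Z (C Y s))"
  using higgs unfolding higgs_bundle_def by blast

lemma C_linear_combination:
  assumes V: "open V" and Y: "Y \<in> vfs A V" and J: "finite J"
    and s: "\<And>k. k \<in> J \<Longrightarrow> s k \<in> sects A K V" and x: "\<And>k. k \<in> J \<Longrightarrow> holo_fun A V (x k)" and t: "t \<in> sects A K V"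
    and t_eq: "\<And>p. p \<in> V \<Longrightarrow> \<exists>V' h. triv V' h p \<and> h (t p) = (\<Sum>k\<in>J. x k p *s h (s k p))"
    and p: "p \<in> V" "triv V' h p"
  shows "h (C Y t p) = (\<Sum>k\<in>J. x k p *s h (C Y (s k) p))"
proof -
  have "h (C Y t p) = (\<Sum>k\<in>J. (\<lambda>f p. 0) (x k) p *s h (s k p) + x k p *s h (C Y (s k) p))"
  proof (rule leibniz_sum[where W = V and ?W0.0 = V and T = "C Y" and \<delta> = "\<lambda>f p. 0", OF V order_refl _ _ _ _ J s x t t_eq p])
    show "C Y s p \<in> fiber p" if "s \<in> sects A K V" "p \<in> V" for s p
      by (rule sectsD(1)[OF C_rules(1)[OF V Y that(1)] that(2)])
    show "s_eq V (C Y s) (C Y s')" if "s \<in> sects A K V" "s' \<in> sects A K V" "s_eq V s s'" for s s'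
      by (rule C_rules(2)[OF V Y that(1) Y that(2) vf_eq_refl that(3)])
    show "s_eq V (C Y (s_add K s t)) (s_add K (C Y s) (C Y t))" if "s \<in> sects A K V" "t \<in> sects A K V" for s t
      by (rule C_rules(5)[OF V Y that])
    show "h (C Y (s_scale K f s) p) = 0 *s h (s p) + f p *s h (C Y s p)"
      if "s \<in> sects A K V" "holo_fun A V f" "p \<in> V" "triv V' h p" for s f p V' h
    proof -
      have "C Y (s_scale K f s) p = s_scale K f (C Y s) p" using C_O_linear[OF V Y that(1,2)] that(3) by (simp add: s_eq_def)
      then show ?thesis
        using s_scale(2)[of "C Y s" p V' h f, OF sectsD(1)[OF C_rules(1)[OF V Y that(1)] that(3)] that(4)] by simp
    qed
  qed auto
  then show ?thesis by simp
qed

lemma zeta: "\<zeta> \<in> sects A K V"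
  using prim sects_subset[of \<zeta> UNIV V] by (simp add: primitive_section_def)

lemma X_vfs: "V \<subseteq> U \<Longrightarrow> X i \<in> vfs A V"
  by (rule vfs_subset[OF X_in_vfs])

text \<open>The coordinate frame of the tangent bundle, transported to \<open>K\<close> by the
  primitive section.\<close>

definition \<sigma> :: "'n \<Rightarrow> 'm \<Rightarrow> 'k" where "\<sigma> k = C (X k) \<zeta>"

lemma sigma: "\<sigma> k \<in> sects A K U"
  unfolding \<sigma>_def by (rule C_rules(1)[OF open_U X_in_vfs zeta])

lemma C_zeta_eq:
  assumes V: "open V" "V \<subseteq> U" and Y: "Y \<in> vfs A V" and p: "p \<in> V" "triv V' h p"
  shows "h (C Y \<zeta> p) = (\<Sum>k\<in>UNIV. coeff Y k p *s h (\<sigma> k p))"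
proof -
  have "s_eq V (C Y \<zeta>) (C (vf_sum UNIV (coeff Y) X) \<zeta>)"
    by (rule C_rules(2)[OF V(1) Y zeta vfs_sum zeta vf_expand(2)[OF Y V]])
      (use vf_expand(1)[OF Y V] X_vfs[OF V(2)] in \<open>auto simp: s_eq_def\<close>)
  then have "C Y \<zeta> p = C (vf_sum UNIV (coeff Y) X) \<zeta> p" using p by (simp add: s_eq_def)
  also have "h \<dots> = (\<Sum>k\<in>UNIV. coeff Y k p *s h (C (X k) \<zeta> p))"
    by (rule vf_linear_sum[OF C_lin V(1) zeta _ _ _ p]) (use vf_expand(1)[OF Y V] X_vfs[OF V(2)] in auto)
  finally show ?thesis by (simp add: \<sigma>_def)
qed

text \<open>Injectivity of the map given by \<open>\<zeta>\<close> is a statement about sections,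
  not about single fibers. Hence the coefficients have to be holomorphic and the relation has to
  hold on an open set.\<close>

lemma frame_independent:
  assumes V: "open V" "V \<subseteq> U" and x: "\<And>k. holo_fun A V (x k)"
    and zero: "\<And>p. p \<in> V \<Longrightarrow> \<exists>V' h. triv V' h p \<and> (\<Sum>k\<in>UNIV. x k p *s h (\<sigma> k p)) = 0"
    and p: "p \<in> V"
  shows "x k p = 0"
proof -
  let ?Y = "vf_sum UNIV x X" and ?Z = "vf_sum UNIV (\<lambda>_ _. 0) X"
  have Y: "?Y \<in> vfs A V" by (rule vfs_sum) (use x X_vfs[OF V(2)] in auto)
  have Z: "?Z \<in> vfs A V" by (rule vfs_sum) (use X_vfs[OF V(2)] in auto)
  have "s_eq V (C ?Y \<zeta>) (C ?Z \<zeta>)"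
    unfolding s_eq_def
  proof
    fix q assume q: "q \<in> V"
    then have qU: "q \<in> U" using V by auto
    obtain V' h where h: "triv V' h q" "(\<Sum>k\<in>UNIV. x k q *s h (\<sigma> k q)) = 0" using zero[OF q] by blast
    have "h (C ?Y \<zeta> q) = 0" using C_zeta_eq[OF V Y q h(1)] h(2) by (simp add: coeff_vf_sum[OF qU])
    moreover have "h (C ?Z \<zeta> q) = 0" using C_zeta_eq[OF V Z q h(1)] by (simp add: coeff_vf_sum[OF qU])
    ultimately show "C ?Y \<zeta> q = C ?Z \<zeta> q"
      by (intro triv_inj[OF h(1) sectsD(1)[OF C_rules(1)[OF V(1) Y zeta] q] sectsD(1)[OF C_rules(1)[OF V(1) Z zeta] q]]) simp
  qed
  then have "vf_eq A V ?Y ?Z" using prim V(1) Y Z unfolding primitive_section_def by blast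
  from coeff_cong[OF this p V(2), of k] show ?thesis using p V by (simp add: coeff_vf_sum subsetD)
qed

lemma frame_independent_eq:
  assumes V: "open V" "V \<subseteq> U" and x: "\<And>k. holo_fun A V (x k)" and y: "\<And>k. holo_fun A V (y k)"
    and eq: "\<And>p. p \<in> V \<Longrightarrow> \<exists>V' h. triv V' h p \<and> (\<Sum>k\<in>UNIV. x k p *s h (\<sigma> k p)) = (\<Sum>k\<in>UNIV. y k p *s h (\<sigma> k p))"
    and p: "p \<in> V"
  shows "x k p = y k p"
proof -
  have "(\<lambda>k p. x k p - y k p) k p = 0"
  proof (rule frame_independent[OF V _ _ p])
    show "holo_fun A V (\<lambda>p. x k p - y k p)" for k using x y by (rule holo_fun_diff)
    show "\<exists>V' h. triv V' h q \<and> (\<Sum>k\<in>UNIV. (x k q - y k q) *s h (\<sigma> k q)) = 0" if "q \<in> V" for q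
      using eq[OF that] by (auto simp: vector_sub_rdistrib sum_subtractf)
  qed
  then show ?thesis by simp
qed

text \<open>Surjectivity on sections provides a vector field, and its coordinates are the
  coefficients.\<close>

lemma frame_spans:
  assumes V: "open V" "V \<subseteq> U" and s: "s \<in> sects A K V"
  obtains x where "\<And>k. holo_fun A V (x k)"
    "\<And>p V' h. p \<in> V \<Longrightarrow> triv V' h p \<Longrightarrow> h (s p) = (\<Sum>k\<in>UNIV. x k p *s h (\<sigma> k p))"
proof -
  have "\<exists>Y\<in>vfs A V. s_eq V (C Y \<zeta>) s" using prim V(1) s unfolding primitive_section_def by blast
  then obtain Y where Y: "Y \<in> vfs A V" "s_eq V (C Y \<zeta>) s" by blast
  show ?thesis
  proof (rule that[of "coeff Y"])
    show "holo_fun A V (coeff Y k)" for k by (rule vf_expand(1)[OF Y(1) V])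
    show "h (s p) = (\<Sum>k\<in>UNIV. coeff Y k p *s h (\<sigma> k p))" if "p \<in> V" "triv V' h p" for p V' h
      using C_zeta_eq[OF V Y(1) that] Y(2) that(1) by (simp add: s_eq_def)
  qed
qed

section \<open>Structure constants of the multiplication in the frame\<close>

definition ac :: "'n \<Rightarrow> 'n \<Rightarrow> 'n \<Rightarrow> 'm \<Rightarrow> complex" where "ac i j k = coeff (mul (X i) (X j)) k"

lemma mul_X: "mul (X i) (X j) \<in> vfs A U"
  using mult open_U X_in_vfs unfolding tangent_mult_def by blast

lemma holo_ac: "holo_fun A U (ac i j k)"
  unfolding ac_def by (rule vf_expand(1)[OF mul_X open_U order_refl])

lemma holo_ec: "holo_fun A U (coeff e k)"
  by (rule vf_expand(1)[OF vfs_subset[OF e subset_UNIV] open_U order_refl])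

lemma C_sigma:
  assumes "p \<in> U" "triv V' h p"
  shows "h (C (X i) (\<sigma> j) p) = (\<Sum>k\<in>UNIV. ac i j k p *s h (\<sigma> k p))"
proof -
  have "C (X i) (\<sigma> j) p = C (mul (X i) (X j)) \<zeta> p"
    using mul_C[OF open_U X_in_vfs X_in_vfs zeta, of i j] assms(1) by (simp add: s_eq_def \<sigma>_def)
  then show ?thesis using C_zeta_eq[OF open_U order_refl mul_X assms] by (simp add: ac_def)
qed

text \<open>The Higgs endomorphisms of two coordinate fields commute on \<open>\<zeta>\<close>, and
  independence of the frame allows comparing coefficients.\<close>

lemma ac_sym: "p \<in> U \<Longrightarrow> ac i j k p = ac j i k p"
proof (rule frame_independent_eq[OF open_U order_refl holo_ac holo_ac])
  fix q assume q: "q \<in> U"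
  obtain V' h where h: "triv V' h q" using triv_exists by blast
  have "C (X i) (\<sigma> j) q = C (X j) (\<sigma> i) q"
    using C_commute[OF open_U X_in_vfs X_in_vfs zeta, of i j] q by (simp add: s_eq_def \<sigma>_def)
  then have "(\<Sum>k\<in>UNIV. ac i j k q *s h (\<sigma> k q)) = (\<Sum>k\<in>UNIV. ac j i k q *s h (\<sigma> k q))"
    unfolding C_sigma[OF q h, symmetric] by simp
  with h show "\<exists>V' h. triv V' h q \<and> (\<Sum>k\<in>UNIV. ac i j k q *s h (\<sigma> k q)) = (\<Sum>k\<in>UNIV. ac j i k q *s h (\<sigma> k q))"
    by (intro exI conjI)
qed

lemma sum_scaled: "(\<Sum>k\<in>UNIV. x k *s (\<Sum>m\<in>UNIV. y k m *s (v m :: complex^'r))) = (\<Sum>m\<in>UNIV. (\<Sum>k\<in>UNIV. x k * y k m) *s v m)"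
  for x :: "'n \<Rightarrow> complex"
proof -
  have "(\<Sum>k\<in>UNIV. x k *s (\<Sum>m\<in>UNIV. y k m *s v m)) = (\<Sum>k\<in>UNIV. \<Sum>m\<in>UNIV. (x k * y k m) *s v m)"
    by (simp add: vec.scale_sum_right)
  also have "\<dots> = (\<Sum>m\<in>UNIV. \<Sum>k\<in>UNIV. (x k * y k m) *s v m)" by (rule sum.swap)
  finally show ?thesis by (simp add: vec.scale_sum_left)
qed

lemma CC_sigma:
  assumes "p \<in> U" "triv V' h p"
  shows "h (C (X i) (C (X j) (\<sigma> l)) p) = (\<Sum>m\<in>UNIV. (\<Sum>k\<in>UNIV. ac j l k p * ac i k m p) *s h (\<sigma> m p))"
proof -
  have "\<exists>V' h. triv V' h q \<and> h (C (X j) (\<sigma> l) q) = (\<Sum>k\<in>UNIV. ac j l k q *s h (\<sigma> k q))" if "q \<in> U" for q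
    using C_sigma[OF that] triv_exists by blast
  then have "h (C (X i) (C (X j) (\<sigma> l)) p) = (\<Sum>k\<in>UNIV. ac j l k p *s h (C (X i) (\<sigma> k) p))"
    by (intro C_linear_combination[OF open_U X_in_vfs _ sigma holo_ac C_rules(1)[OF open_U X_in_vfs sigma] _ assms]) simp_all
  then show ?thesis by (simp add: C_sigma[OF assms] sum_scaled)
qed

lemma ac_commute:
  "p \<in> U \<Longrightarrow> (\<Sum>k\<in>UNIV. ac j l k p * ac i k m p) = (\<Sum>k\<in>UNIV. ac i l k p * ac j k m p)"
proof (rule frame_independent_eq[OF open_U order_refl, where x = "\<lambda>m p. \<Sum>k\<in>UNIV. ac j l k p * ac i k m p" and y = "\<lambda>m p. \<Sum>k\<in>UNIV. ac i l k p * ac j k m p"])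
  fix q assume q: "q \<in> U"
  obtain V' h where h: "triv V' h q" using triv_exists by blast
  have "C (X i) (C (X j) (\<sigma> l)) q = C (X j) (C (X i) (\<sigma> l)) q"
    using C_commute[OF open_U X_in_vfs X_in_vfs sigma, of i j] q by (simp add: s_eq_def)
  then show "\<exists>V' h. triv V' h q \<and> (\<Sum>m\<in>UNIV. (\<Sum>k\<in>UNIV. ac j l k q * ac i k m q) *s h (\<sigma> m q)) =
      (\<Sum>m\<in>UNIV. (\<Sum>k\<in>UNIV. ac i l k q * ac j k m q) *s h (\<sigma> m q))"
    using CC_sigma[OF q h, of i j l] CC_sigma[OF q h, of j i l] h by (intro exI[of _ V'] exI[of _ h]) simp
qed (intro holo_fun_sum holo_fun_mult holo_ac)+

text \<open>\<open>e\<close> is known to act trivially on \<open>\<zeta>\<close> only. Since the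
  Higgs endomorphisms commute, it acts trivially on the whole frame.\<close>

lemma ac_unit: "p \<in> U \<Longrightarrow> (\<Sum>k\<in>UNIV. coeff e k p * ac k l m p) = (if m = l then 1 else 0)"
proof (rule frame_independent_eq[OF open_U order_refl, where x = "\<lambda>m p. \<Sum>k\<in>UNIV. coeff e k p * ac k l m p" and y = "\<lambda>m p. if m = l then 1 else 0"])
  fix q assume q: "q \<in> U"
  obtain V' h where h: "triv V' h q" using triv_exists by blast
  have eU: "e \<in> vfs A U" by (rule vfs_subset[OF e subset_UNIV])
  have "C e (\<sigma> l) q = C (X l) (C e \<zeta>) q"
    using C_commute[OF open_U eU X_in_vfs zeta, of l] q by (simp add: s_eq_def \<sigma>_def)
  also have "\<dots> = \<sigma> l q"
  proof -
    have "s_eq U (C (X l) (C e \<zeta>)) (C (X l) \<zeta>)"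
      by (rule C_rules(2)[OF open_U X_in_vfs C_rules(1)[OF open_U eU zeta] X_in_vfs zeta vf_eq_refl])
        (use unit in \<open>simp add: s_eq_def\<close>)
    then show ?thesis using q by (simp add: s_eq_def \<sigma>_def)
  qed
  finally have 1: "C e (\<sigma> l) q = \<sigma> l q" .
  have "s_eq U (C e (\<sigma> l)) (C (vf_sum UNIV (coeff e) X) (\<sigma> l))"
    by (rule C_rules(2)[OF open_U eU sigma vfs_sum sigma vf_expand(2)[OF eU open_U order_refl]])
      (use holo_ec X_in_vfs in \<open>auto simp: s_eq_def\<close>)
  then have "h (C e (\<sigma> l) q) = h (C (vf_sum UNIV (coeff e) X) (\<sigma> l) q)" using q by (simp add: s_eq_def)
  also have "\<dots> = (\<Sum>k\<in>UNIV. coeff e k q *s h (C (X k) (\<sigma> l) q))"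
    by (rule vf_linear_sum[OF C_lin open_U sigma _ _ _ q h]) (use holo_ec X_in_vfs in auto)
  also have "\<dots> = (\<Sum>m\<in>UNIV. (\<Sum>k\<in>UNIV. coeff e k q * ac k l m q) *s h (\<sigma> m q))"
    by (simp add: C_sigma[OF q h] sum_scaled)
  finally have "(\<Sum>m\<in>UNIV. (\<Sum>k\<in>UNIV. coeff e k q * ac k l m q) *s h (\<sigma> m q)) = h (\<sigma> l q)" using 1 by simp
  moreover have "(\<Sum>m\<in>UNIV. (if m = l then 1 else 0) *s h (\<sigma> m q)) = h (\<sigma> l q)"
  proof -
    have "(\<Sum>m\<in>UNIV. (if m = l then 1 else 0) *s h (\<sigma> m q)) = (\<Sum>m\<in>UNIV. if m = l then h (\<sigma> m q) else 0)"
      by (intro sum.cong) auto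
    then show ?thesis by simp
  qed
  ultimately show "\<exists>V' h. triv V' h q \<and> (\<Sum>m\<in>UNIV. (\<Sum>k\<in>UNIV. coeff e k q * ac k l m q) *s h (\<sigma> m q)) =
      (\<Sum>m\<in>UNIV. (if m = l then 1 else 0) *s h (\<sigma> m q))" using h by (intro exI[of _ V'] exI[of _ h]) simp
next
  show "holo_fun A U (\<lambda>p. if m = l then 1 else 0)" for m by simp
qed (intro holo_fun_sum holo_fun_mult holo_ac holo_ec)+

text \<open>Column \<open>j\<close> contains the coordinates of the product with the
  \<open>j\<close>-th field, so composition of multiplications is the matrix product.\<close>

definition am :: "'m \<Rightarrow> 'n \<Rightarrow> (complex, 'n) smat" where "am p i = smat_of (\<lambda>k j. ac i j k p)"

definition dam :: "'n \<Rightarrow> 'n \<Rightarrow> 'm \<Rightarrow> (complex, 'n) smat" where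
  "dam i j p = smat_of (\<lambda>k l. X i (ac j l k) p)"

text \<open>The assumption \<open>conn\<close> is the common interface for connections and for
  \<open>(T)\<close>-structures. It is required at each point separately: the matrices
  \<open>D\<close> need not depend on the point in any regular way.\<close>

theorem radical_closed_in_chart:
  assumes conn: "\<And>p. p \<in> U \<Longrightarrow> \<exists>D. \<forall>i j. dam i j p - dam j i p =
      (am p j * D i - D i * am p j) - (am p i * D j - D j * am p i)"
    and W: "open W" "W \<subseteq> cotangent (U, \<phi>)"
    and f: "f \<in> radical_sheaf (spec_ideal (U, \<phi>) mul e) W" and g: "g \<in> radical_sheaf (spec_ideal (U, \<phi>) mul e) W"
  shows "poisson f g \<in> radical_sheaf (spec_ideal (U, \<phi>) mul e) W"
proof -
  let ?a = "\<lambda>t. am (\<phi>i t)" and ?e = "\<lambda>t k. coeff e k (\<phi>i t)"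
  have in_U: "\<phi>i t \<in> U" if "t \<in> \<phi> ` U" for t using chart_simps(5)[OF that] .
  have dm: "dmat i (\<lambda>t. ?a t j) t = dam i j (\<phi>i t)" if "t \<in> \<phi> ` U" for i j t
    by (rule smat_eqI) (simp add: am_def dam_def X_eq chart_simps(4)[OF that])
  interpret L: holo_comm_alg "\<phi> ` U" ?a ?e
  proof (rule holo_comm_alg.intro)
    show "open (\<phi> ` U)" by (rule chart_simps)
    show "holo_mat (\<lambda>t. ?a t i) (\<phi> ` U)" for i
      unfolding holo_mat_def am_def entry_smat_of
      using holo_fun_chart[OF holo_ac open_U order_refl insertI1] by blast
    show "holo_on (\<lambda>t. ?e t i) (\<phi> ` U)" for i
      by (rule holo_fun_chart[OF holo_ec open_U order_refl insertI1])
    fix t assume t: "t \<in> \<phi> ` U"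
    note p = in_U[OF t]
    show "comm_alg (?a t) (?e t)"
    proof
      show "?a t i * ?a t j = ?a t j * ?a t i" for i j
        by (rule smat_eqI) (use ac_commute[OF p] in \<open>simp add: entry_mult am_def mult.commute\<close>)
      show "entry (?a t i) k j = entry (?a t j) k i" for i j k using ac_sym[OF p] by (simp add: am_def)
      show "(\<Sum>i\<in>UNIV. sc (?e t i) (?a t i)) = 1"
        by (rule smat_eqI) (use ac_unit[OF p] in \<open>simp add: am_def\<close>)
    qed
    fix Z i j assume Z: "\<And>l. Z * ?a t l = ?a t l * Z"
    obtain D where D: "dam i j (\<phi>i t) - dam j i (\<phi>i t) =
      (?a t j * D i - D i * ?a t j) - (?a t i * D j - D j * ?a t i)" using conn[OF p] by blast
    \<comment> \<open>A commutator with \<open>a i\<close> has trace zero against everything that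
      commutes with \<open>a i\<close>, by cyclicity.\<close>
    have comm0: "tr ((?a t i * Y - Y * ?a t i) * Z) = 0" for i Y
    proof -
      have "tr (?a t i * Y * Z) = tr (Y * (Z * ?a t i))" by (metis mult.assoc tr_mult_commute)
      then show ?thesis by (simp add: Z left_diff_distrib mult.assoc)
    qed
    show "tr ((dmat i (\<lambda>t. ?a t j) t - dmat j (\<lambda>t. ?a t i) t) * Z) = 0"
      unfolding dm[OF t] D by (subst left_diff_distrib) (simp only: tr_simps comm0 diff_self)
  qed
  have vc: "vf_coeff (U, \<phi>) Y k t = coeff Y k (\<phi>i t)" for Y k t by (simp add: vf_coeff_def coeff_def)
  have "unit_gen (U, \<phi>) e = L.ug" by (simp add: fun_eq_iff unit_gen_def L.ug_def vc)
  moreover have "mult_gen (U, \<phi>) mul i j = L.mg i j" for i j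
    by (simp add: fun_eq_iff mult_gen_def L.mg_def vc am_def ac_def)
  ultimately have sp: "spec_ideal (U, \<phi>) mul e = ideal_sheaf L.gens" by (simp add: spec_ideal_def)
  show ?thesis
    using f g unfolding sp by (rule L.radical_poisson[OF W(1), rotated 1]) (use W(2) in \<open>auto simp: cotangent_def\<close>)
qed

end

section \<open>Good connections\<close>

context primitive_frame
begin

text \<open>The condition on a good connection is applied to coordinate fields and to the sections
  of the frame. Coordinate fields commute, so its right-hand side vanishes and the covariant
  derivatives are symmetric in \<open>i\<close> and \<open>j\<close>.\<close>

lemma good_connection_closed:
  assumes D: "good_connection A K C D" and p: "p \<in> U"
  shows "\<exists>D. \<forall>i j. dam i j p - dam j i p = (am p j * D i - D i * am p j) - (am p i * D j - D j * am p i)"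
proof -
  have D_lin: "vf_linear A K D" and hc: "holo_connection A K D"
    using D by (simp_all add: good_connection_def holo_connection_def)
  note D_rules = vf_linear_rules[OF D_lin open_U X_in_vfs]
  have D_leib: "s_eq U (D (X i) (s_scale K f s)) (s_add K (s_scale K (X i f) s) (s_scale K f (D (X i) s)))"
    if "s \<in> sects A K U" "holo_fun A U f" for i f s
    using hc open_U X_in_vfs that unfolding holo_connection_def by blast
  have good: "s_eq U (s_diff K (cov_deriv_end K C D (X i) (X j) s) (cov_deriv_end K C D (X j) (X i) s)) (C (lie_bracket (X i) (X j)) s)"
    if "s \<in> sects A K U" for i j s
    using D open_U X_in_vfs that unfolding good_connection_def by blast
  have D_sigma: "D (X i) (\<sigma> k) \<in> sects A K U" for i k by (rule D_rules(1)[OF sigma])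
  have C_sigma_sect: "C (X i) (\<sigma> k) \<in> sects A K U" for i k by (rule C_rules(1)[OF open_U X_in_vfs sigma])
  define w where "w i k = (SOME x. (\<forall>m. holo_fun A U (x m)) \<and>
      (\<forall>q\<in>U. \<forall>V' h. triv V' h q \<longrightarrow> h (D (X i) (\<sigma> k) q) = (\<Sum>m\<in>UNIV. x m q *s h (\<sigma> m q))))" for i k
  have "\<exists>x. (\<forall>m. holo_fun A U (x m)) \<and> (\<forall>q\<in>U. \<forall>V' h. triv V' h q \<longrightarrow> h (D (X i) (\<sigma> k) q) = (\<Sum>m\<in>UNIV. x m q *s h (\<sigma> m q)))" for i k
    by (rule frame_spans[OF open_U order_refl D_sigma[of i k]]) blast
  note wI = someI_ex[OF this, folded w_def]
  have w: "holo_fun A U (w i k m)"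
    "q \<in> U \<Longrightarrow> triv V' h q \<Longrightarrow> h (D (X i) (\<sigma> k) q) = (\<Sum>m\<in>UNIV. w i k m q *s h (\<sigma> m q))" for i k m q V' h
    using wI[of i k] by simp_all
  have DC: "h (D (X i) (C (X j) (\<sigma> l)) q) = (\<Sum>m\<in>UNIV. (X i (ac j l m) q + (\<Sum>k\<in>UNIV. ac j l k q * w i k m q)) *s h (\<sigma> m q))"
    if q: "q \<in> U" "triv V' h q" for i j l q V' h
  proof -
    have "h (D (X i) (C (X j) (\<sigma> l)) q) = (\<Sum>k\<in>UNIV. X i (ac j l k) q *s h (\<sigma> k q) + ac j l k q *s h (D (X i) (\<sigma> k) q))"
    proof (rule leibniz_sum[where W = U and ?W0.0 = U and T = "D (X i)" and \<delta> = "X i", OF open_U order_refl _ _ _ _ finite sigma holo_ac C_sigma_sect _ q])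
      show "D (X i) s p \<in> fiber p" if "s \<in> sects A K U" "p \<in> U" for s p
        by (rule sectsD(1)[OF D_rules(1)[OF that(1)] that(2)])
      show "s_eq U (D (X i) s) (D (X i) s')" if "s \<in> sects A K U" "s' \<in> sects A K U" "s_eq U s s'" for s s'
        by (rule D_rules(2)[OF that(1) X_in_vfs that(2) vf_eq_refl that(3)])
      show "s_eq U (D (X i) (s_add K s t)) (s_add K (D (X i) s) (D (X i) t))" if "s \<in> sects A K U" "t \<in> sects A K U" for s t
        by (rule D_rules(5)[OF that])
      show "h (D (X i) (s_scale K f s) p) = X i f p *s h (s p) + f p *s h (D (X i) s p)"
        if s: "s \<in> sects A K U" and f: "holo_fun A U f" and p: "p \<in> U" "triv V' h p" for s f p V' h
      proof -
        have fs: "s p \<in> fiber p" "D (X i) s p \<in> fiber p"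
          using sectsD(1)[OF s p(1)] sectsD(1)[OF D_rules(1)[OF s] p(1)] .
        have "D (X i) (s_scale K f s) p = s_add K (s_scale K (X i f) s) (s_scale K f (D (X i) s)) p"
          using D_leib[OF s f] p(1) by (simp add: s_eq_def)
        then show ?thesis
          using s_add(2)[of "s_scale K (X i f) s" p "s_scale K f (D (X i) s)", OF s_scale(1)[of s p, OF fs(1)] s_scale(1)[of "D (X i) s" p, OF fs(2)] p(2)]
            s_scale(2)[of s p, OF fs(1) p(2)] s_scale(2)[of "D (X i) s" p, OF fs(2) p(2)] by simp
      qed
      show "\<exists>V' h. triv V' h p \<and> h (C (X j) (\<sigma> l) p) = (\<Sum>k\<in>UNIV. ac j l k p *s h (\<sigma> k p))" if "p \<in> U" for p
        using C_sigma[OF that] triv_exists by blast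
    qed
    also have "\<dots> = (\<Sum>k\<in>UNIV. X i (ac j l k) q *s h (\<sigma> k q)) + (\<Sum>k\<in>UNIV. ac j l k q *s (\<Sum>m\<in>UNIV. w i k m q *s h (\<sigma> m q)))"
      by (simp add: sum.distrib w(2)[OF q])
    also have "\<dots> = (\<Sum>m\<in>UNIV. (X i (ac j l m) q + (\<Sum>k\<in>UNIV. ac j l k q * w i k m q)) *s h (\<sigma> m q))"
      by (simp add: sum_scaled vector_sadd_rdistrib sum.distrib)
    finally show ?thesis .
  qed
  have CD: "h (C (X j) (D (X i) (\<sigma> l)) q) = (\<Sum>m\<in>UNIV. (\<Sum>k\<in>UNIV. w i l k q * ac j k m q) *s h (\<sigma> m q))"
    if q: "q \<in> U" "triv V' h q" for i j l q V' h
  proof -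
    have "\<exists>V' h. triv V' h r \<and> h (D (X i) (\<sigma> l) r) = (\<Sum>k\<in>UNIV. w i l k r *s h (\<sigma> k r))" if "r \<in> U" for r
      using w(2)[OF that] triv_exists by blast
    then have "h (C (X j) (D (X i) (\<sigma> l)) q) = (\<Sum>k\<in>UNIV. w i l k q *s h (C (X j) (\<sigma> k) q))"
      by (intro C_linear_combination[OF open_U X_in_vfs _ sigma w(1) D_sigma _ q]) simp_all
    then show ?thesis by (simp add: C_sigma[OF q] sum_scaled)
  qed
  \<comment> \<open>The matrix of the covariant derivative of \<open>C (X j)\<close> along
    \<open>X i\<close>: the derivative of the structure constants plus a commutator with the
    connection matrix.\<close>
  define cv where "cv i j l m q = X i (ac j l m) q + (\<Sum>k\<in>UNIV. ac j l k q * w i k m q) - (\<Sum>k\<in>UNIV. w i l k q * ac j k m q)"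
    for i j l m q
  have cov: "cov_deriv_end K C D (X i) (X j) (\<sigma> l) q \<in> fiber q"
    "triv V' h q \<Longrightarrow> h (cov_deriv_end K C D (X i) (X j) (\<sigma> l) q) = (\<Sum>m\<in>UNIV. cv i j l m q *s h (\<sigma> m q))"
    if q: "q \<in> U" for i j l q V' h
  proof -
    have f1: "D (X i) (C (X j) (\<sigma> l)) q \<in> fiber q" by (rule sectsD(1)[OF D_rules(1)[OF C_sigma_sect] q])
    have f2: "C (X j) (D (X i) (\<sigma> l)) q \<in> fiber q" by (rule sectsD(1)[OF C_rules(1)[OF open_U X_in_vfs D_sigma] q])
    note sd = s_diff[of "D (X i) (C (X j) (\<sigma> l))" q "C (X j) (D (X i) (\<sigma> l))", OF f1 f2]
    show "cov_deriv_end K C D (X i) (X j) (\<sigma> l) q \<in> fiber q" unfolding cov_deriv_end_def by (rule sd(1))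
    assume t: "triv V' h q"
    show "h (cov_deriv_end K C D (X i) (X j) (\<sigma> l) q) = (\<Sum>m\<in>UNIV. cv i j l m q *s h (\<sigma> m q))"
      unfolding cov_deriv_end_def sd(2)[OF t] DC[OF q t] CD[OF q t]
      by (simp add: cv_def vector_sub_rdistrib sum_subtractf)
  qed
  have holo_cv: "holo_fun A U (cv i j l m)" for i j l m
    unfolding cv_def
    by (intro holo_fun_diff holo_fun_add holo_fun_sum holo_fun_mult holo_ac w(1) holo_fun_X open_U order_refl)
  have cv_eq: "cv i j l m q = cv j i l m q" if q: "q \<in> U" for i j l m q
  proof (rule frame_independent_eq[where x = "cv i j l" and y = "cv j i l", OF open_U order_refl holo_cv holo_cv _ q])
    fix r assume r: "r \<in> U"
    obtain V' h where h: "triv V' h r" using triv_exists by blast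
    note sd = s_diff(2)[of "cov_deriv_end K C D (X i) (X j) (\<sigma> l)" r "cov_deriv_end K C D (X j) (X i) (\<sigma> l)", OF cov(1)[OF r] cov(1)[OF r] h]
    have "h (C (lie_bracket (X i) (X j)) (\<sigma> l) r) = 0"
    proof -
      have v0: "vf_scale (\<lambda>_. 0) (X i) \<in> vfs A U" by (rule vfs_scale[OF X_in_vfs]) simp
      have "C (lie_bracket (X i) (X j)) (\<sigma> l) r = C (vf_scale (\<lambda>_. 0) (X i)) (\<sigma> l) r"
        using C_rules(2)[OF open_U lie_bracket_X(2) sigma v0 sigma lie_bracket_X(1), of l] r by (simp add: s_eq_def)
      also have "\<dots> = s_scale K (\<lambda>_. 0) (C (X i) (\<sigma> l)) r"
        using C_rules(4)[OF open_U X_in_vfs sigma, of "\<lambda>_. 0" i l] r by (simp add: s_eq_def)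
      also have "h \<dots> = 0"
        using s_scale(2)[of "C (X i) (\<sigma> l)" r V' h "\<lambda>_. 0", OF sectsD(1)[OF C_sigma_sect r] h] by simp
      finally show ?thesis .
    qed
    moreover have "s_diff K (cov_deriv_end K C D (X i) (X j) (\<sigma> l)) (cov_deriv_end K C D (X j) (X i) (\<sigma> l)) r = C (lie_bracket (X i) (X j)) (\<sigma> l) r"
      using good[OF sigma, of i j l] r by (simp add: s_eq_def)
    ultimately have "(\<Sum>m\<in>UNIV. cv i j l m r *s h (\<sigma> m r)) = (\<Sum>m\<in>UNIV. cv j i l m r *s h (\<sigma> m r))"
      using sd unfolding cov(2)[OF r h] by simp
    with h show "\<exists>V' h. triv V' h r \<and> (\<Sum>m\<in>UNIV. cv i j l m r *s h (\<sigma> m r)) = (\<Sum>m\<in>UNIV. cv j i l m r *s h (\<sigma> m r))"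
      by (intro exI conjI)
  qed
  \<comment> \<open>The images of frame sections are put in columns, as in \<open>am\<close>, so
    that the two sums in \<open>cv\<close> become matrix products.\<close>
  define \<Omega> where "\<Omega> i = smat_of (\<lambda>m k. w i k m p)" for i
  have "dam i j p - dam j i p = (am p j * \<Omega> i - \<Omega> i * am p j) - (am p i * \<Omega> j - \<Omega> j * am p i)" for i j
  proof (rule smat_eqI)
    fix m l
    show "entry (dam i j p - dam j i p) m l = entry ((am p j * \<Omega> i - \<Omega> i * am p j) - (am p i * \<Omega> j - \<Omega> j * am p i)) m l"
      using cv_eq[OF p, of i j l m] by (simp add: entry_mult dam_def am_def \<Omega>_def cv_def mult.commute algebra_simps)
  qed
  then show ?thesis by blast
qed

end

section \<open>The product with the complex line\<close>

definition som :: "complex^('n::finite option) \<Rightarrow> complex^'n" where "som x = (\<chi> i. x $ Some i)"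

definition lpt :: "complex \<Rightarrow> complex^'n \<Rightarrow> complex^('n::finite option)" where
  "lpt z t = (\<chi> j. case j of None \<Rightarrow> z | Some i \<Rightarrow> t $ i)"

lemma lpt_simps [simp]: "lpt z t $ None = z" "lpt z t $ Some i = t $ i" "som (lpt z t) = t"
  by (simp_all add: lpt_def som_def vec_eq_iff)

lemma lpt_som [simp]: "lpt (x $ None) (som x) = x"
  by (auto simp: lpt_def som_def vec_eq_iff split: option.split)

lemma som_axis [simp]: "som (x + axis (Some k) w) = som x + axis k w" "axis (Some k) w $ None = 0"
  by (simp_all add: som_def vec_eq_iff axis_def)

lemma line_atlasE:
  assumes "(V', \<Psi>) \<in> line_atlas A"
  obtains V \<psi> where "(V, \<psi>) \<in> A" "V' = UNIV \<times> V" "\<Psi> = (\<lambda>(z, p). lpt z (\<psi> p))"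
  using assms unfolding line_atlas_def lpt_def by auto

lemma line_atlasI: "(V, \<psi>) \<in> A \<Longrightarrow> (UNIV \<times> V, \<lambda>(z, p). lpt z (\<psi> p)) \<in> line_atlas A"
  unfolding line_atlas_def lpt_def by (auto intro!: image_eqI[of _ _ "(V, \<psi>)"])

context manifold_chart
begin

text \<open>It replaces the inverse of a product chart by an explicit formula on an explicit open
  image, which reduces holomorphy on the product to charts of \<open>A\<close>.\<close>

lemma line_chart:
  assumes V: "(V, \<psi>) \<in> A" and W: "open W"
  defines "\<Psi> \<equiv> \<lambda>(z, p). lpt z (\<psi> p)"
  defines "S \<equiv> {x. som x \<in> \<psi> ` V \<and> (x $ None, inv_into V \<psi> (som x)) \<in> W}"
  shows "inj_on \<Psi> (UNIV \<times> V)" "\<Psi> ` ((UNIV \<times> V) \<inter> W) = S" "open S"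
    "x \<in> S \<Longrightarrow> inv_into (UNIV \<times> V) \<Psi> x = (x $ None, inv_into V \<psi> (som x))"
proof -
  note v = chart_props[OF atlas V]
  show inj: "inj_on \<Psi> (UNIV \<times> V)"
  proof (rule inj_on_inverseI[of _ "\<lambda>x. (x $ None, inv_into V \<psi> (som x))"])
    fix w :: "complex \<times> 'm" assume "w \<in> UNIV \<times> V"
    then show "(\<Psi> w $ None, inv_into V \<psi> (som (\<Psi> w))) = w" by (auto simp: \<Psi>_def v(3))
  qed
  show im: "\<Psi> ` ((UNIV \<times> V) \<inter> W) = S"
  proof
    show "\<Psi> ` ((UNIV \<times> V) \<inter> W) \<subseteq> S" by (auto simp: \<Psi>_def S_def v(3))
    show "S \<subseteq> \<Psi> ` ((UNIV \<times> V) \<inter> W)"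
    proof
      fix x assume x: "x \<in> S"
      then have "\<Psi> (x $ None, inv_into V \<psi> (som x)) = x" by (simp add: \<Psi>_def S_def v(4))
      moreover have "(x $ None, inv_into V \<psi> (som x)) \<in> (UNIV \<times> V) \<inter> W" using x v(5) by (auto simp: S_def)
      ultimately show "x \<in> \<Psi> ` ((UNIV \<times> V) \<inter> W)" by (metis image_eqI)
    qed
  qed
  have cont_som: "continuous_on UNIV (som :: complex^('n option) \<Rightarrow> complex^'n)"
    unfolding som_def by (intro continuous_on_vec_lambda continuous_intros)
  have o: "open (som -` (\<psi> ` V))" using open_vimage[OF v(2) cont_som] .
  have "continuous_on (som -` (\<psi> ` V)) (\<lambda>x. (x $ None, inv_into V \<psi> (som x)))"
    by (intro continuous_on_Pair continuous_intros continuous_on_compose2[OF v(6) continuous_on_subset[OF cont_som]]) auto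
  then have "open ((\<lambda>x. (x $ None, inv_into V \<psi> (som x))) -` W \<inter> som -` (\<psi> ` V))"
    using W o continuous_on_open_vimage by blast
  moreover have "(\<lambda>x. (x $ None, inv_into V \<psi> (som x))) -` W \<inter> som -` (\<psi> ` V) = S" by (auto simp: S_def)
  ultimately show "open S" by simp
  show "inv_into (UNIV \<times> V) \<Psi> x = (x $ None, inv_into V \<psi> (som x))" if x: "x \<in> S"
    by (rule inv_into_f_eq[OF inj]) (use x v(4,5) in \<open>auto simp: S_def \<Psi>_def\<close>)
qed

lemma good_line: "good_atlas (line_atlas A)"
  unfolding good_atlas_def
proof (intro allI impI)
  fix V' \<Psi> assume "(V', \<Psi>) \<in> line_atlas A"
  then obtain V \<psi> where V: "(V, \<psi>) \<in> A" "V' = UNIV \<times> V" "\<Psi> = (\<lambda>(z, p). lpt z (\<psi> p))" by (rule line_atlasE)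
  show "inj_on \<Psi> V' \<and> (\<forall>W. open W \<longrightarrow> open (\<Psi> ` (V' \<inter> W)))"
    unfolding V(2,3) using line_chart(1)[OF V(1) open_UNIV] line_chart(2,3)[OF V(1)] by simp
qed

lemma line_holo_funI:
  assumes W: "open W" and f: "\<And>V \<psi>. (V, \<psi>) \<in> A \<Longrightarrow>
    holo_on (\<lambda>x. f (x $ None, inv_into V \<psi> (som x))) {x. som x \<in> \<psi> ` V \<and> (x $ None, inv_into V \<psi> (som x)) \<in> W}"
  shows "holo_fun (line_atlas A) W f"
proof (rule holo_funI)
  fix V' \<Psi> assume "(V', \<Psi>) \<in> line_atlas A"
  then obtain V \<psi> where V: "(V, \<psi>) \<in> A" "V' = UNIV \<times> V" "\<Psi> = (\<lambda>(z, p). lpt z (\<psi> p))" by (rule line_atlasE)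
  show "holo_on (\<lambda>x. f (inv_into V' \<Psi> x)) (\<Psi> ` (V' \<inter> W))"
    unfolding V(2,3) line_chart(2)[OF V(1) W]
    by (rule holo_on_congI[OF f[OF V(1)] line_chart(3)[OF V(1) W]]) (subst line_chart(4)[OF V(1) W], simp_all)
qed

lemma line_holo_funD:
  assumes f: "holo_fun (line_atlas A) W f" and W: "open W" and V: "(V, \<psi>) \<in> A"
  shows "holo_on (\<lambda>x. f (x $ None, inv_into V \<psi> (som x))) {x. som x \<in> \<psi> ` V \<and> (x $ None, inv_into V \<psi> (som x)) \<in> W}"
  using holo_funD[OF f line_atlasI[OF V]] unfolding line_chart(2)[OF V W]
  by (rule holo_on_congI[OF _ line_chart(3)[OF V W]]) (subst line_chart(4)[OF V W], simp_all)

lemma line_holo_fun_snd: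
  assumes g: "holo_fun A V0 g" and W: "open W" and sub: "W \<subseteq> UNIV \<times> V0"
  shows "holo_fun (line_atlas A) W (\<lambda>w. g (snd w))"
proof (rule line_holo_funI[OF W])
  fix V \<psi> assume V: "(V, \<psi>) \<in> A"
  note v = chart_props[OF atlas V]
  show "holo_on (\<lambda>x. g (snd (x $ None, inv_into V \<psi> (som x)))) {x. som x \<in> \<psi> ` V \<and> (x $ None, inv_into V \<psi> (som x)) \<in> W}"
    unfolding snd_conv
  proof (rule holo_on_compose[OF holo_funD[OF g V], of som])
    show "holo_on (\<lambda>x. som x $ i) S" for i and S :: "(complex^('n option)) set" by (simp add: som_def)
    show "som ` {x. som x \<in> \<psi> ` V \<and> (x $ None, inv_into V \<psi> (som x)) \<in> W} \<subseteq> \<psi> ` (V \<inter> V0)"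
      using sub v(3) by auto
  qed
qed

lemma line_holo_fun_inverse:
  assumes W: "open W" and ne: "\<And>w. w \<in> W \<Longrightarrow> fst w \<noteq> 0"
  shows "holo_fun (line_atlas A) W (\<lambda>(z, p). 1 / z)"
proof (rule line_holo_funI[OF W])
  fix V \<psi> assume V: "(V, \<psi>) \<in> A"
  show "holo_on (\<lambda>x. case (x $ None, inv_into V \<psi> (som x)) of (z, p) \<Rightarrow> 1 / z) {x. som x \<in> \<psi> ` V \<and> (x $ None, inv_into V \<psi> (som x)) \<in> W}"
    using ne[of "(_, _)"] by (auto simp: divide_inverse intro!: holo_on_inverse)
qed

lemma open_slice: "open W \<Longrightarrow> open {q. (z, q) \<in> W}"
  using open_vimage[of W "Pair z"] by (simp add: vimage_def continuous_on_Pair continuous_on_const continuous_on_id)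

lemma open_slice': "open W \<Longrightarrow> open {z. (z, q) \<in> W}"
  using open_vimage[of W "\<lambda>z. (z, q)"] by (simp add: vimage_def continuous_on_Pair continuous_on_const continuous_on_id)

lemma line_holo_fun_slice:
  assumes f: "holo_fun (line_atlas A) W f" and W: "open W"
  shows "holo_fun A {q. (z, q) \<in> W} (\<lambda>q. f (z, q))"
proof (rule holo_funI)
  fix V \<psi> assume V: "(V, \<psi>) \<in> A"
  note v = chart_props[OF atlas V]
  have "holo_on (\<lambda>t. f (lpt z t $ None, inv_into V \<psi> (som (lpt z t)))) (\<psi> ` (V \<inter> {q. (z, q) \<in> W}))"
  proof (rule holo_on_compose[OF line_holo_funD[OF f W V], of "lpt z"])
    show "holo_on (\<lambda>x. lpt z x $ i) S" for i and S :: "(complex^'n) set" by (cases i) auto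
    show "lpt z ` \<psi> ` (V \<inter> {q. (z, q) \<in> W}) \<subseteq> {x. som x \<in> \<psi> ` V \<and> (x $ None, inv_into V \<psi> (som x)) \<in> W}"
      using v(3) by auto
  qed
  then show "holo_on (\<lambda>x. f (z, inv_into V \<psi> x)) (\<psi> ` (V \<inter> {q. (z, q) \<in> W}))" by simp
qed

lemma line_slice_differentiable:
  assumes f: "holo_fun (line_atlas A) W f" and W: "open W" and p: "(z, p) \<in> W"
  shows "(\<lambda>z. f (z, p)) field_differentiable at z"
proof -
  obtain V \<psi> where V: "(V, \<psi>) \<in> A" "p \<in> V" by (rule atlas_cover)
  note v = chart_props[OF atlas V(1)]
  let ?S = "{x. som x \<in> \<psi> ` V \<and> (x $ None, inv_into V \<psi> (som x)) \<in> W}"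
  let ?F = "\<lambda>x. f (x $ None, inv_into V \<psi> (som x))" and ?x = "lpt 0 (\<psi> p)"
  have shift: "?x + axis None u = lpt u (\<psi> p)" for u by (auto simp: vec_eq_iff lpt_def axis_def split: option.split)
  have "(\<lambda>u. ?F (?x + axis None u)) holomorphic_on {u. ?x + axis None u \<in> ?S}"
    by (rule holo_on_line_axis[OF line_holo_funD[OF f W V(1)] line_chart(3)[OF V(1) W]])
  then have "(\<lambda>u. f (u, p)) holomorphic_on {u. (u, p) \<in> W}"
    unfolding shift using V v(3) by simp
  then show ?thesis using open_slice'[OF W] p by (intro holomorphic_on_imp_differentiable_at) auto
qed

text \<open>A derivative along the manifold is a combination of partial derivatives of a holomorphic
  function on the product, hence continuous in \<open>z\<close>. This permits passing to
  \<open>z = 0\<close> in identities that contain such derivatives.\<close>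

lemma line_slice_X_continuous:
  assumes f: "holo_fun (line_atlas A) W f" and W: "open W" and p: "(z, p) \<in> W" "p \<in> U"
  shows "continuous (at z) (\<lambda>z. X i (\<lambda>q. f (z, q)) p)"
proof -
  obtain V \<psi> where V: "(V, \<psi>) \<in> A" "p \<in> V" by (rule atlas_cover)
  note v = chart_props[OF atlas V(1)]
  let ?S = "{x. som x \<in> \<psi> ` V \<and> (x $ None, inv_into V \<psi> (som x)) \<in> W}"
  let ?F = "\<lambda>x. f (x $ None, inv_into V \<psi> (som x))"
  let ?Z = "{z. (z, p) \<in> W}"
  have "X i (\<lambda>q. f (u, q)) p = (\<Sum>k\<in>UNIV. X i (\<lambda>q. \<psi> q $ k) p * pd (Some k) ?F (lpt u (\<psi> p)))" if u: "u \<in> ?Z" for u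
  proof -
    have "holo_near A p (\<lambda>q. f (u, q))"
      using line_holo_fun_slice[OF f W, of u] open_slice[OF W, of u] u by (intro holo_near_I) auto
    then have "X i (\<lambda>q. f (u, q)) p = (\<Sum>k\<in>UNIV. X i (\<lambda>q. \<psi> q $ k) p * coord_vf (V, \<psi>) k (\<lambda>q. f (u, q)) p)"
      by (rule chart_chain_rule[OF insertI1 insertI2[OF V(1)] p(2) V(2)])
    moreover have "coord_vf (V, \<psi>) k (\<lambda>q. f (u, q)) p = pd (Some k) ?F (lpt u (\<psi> p))" for k
      by (simp add: coord_vf_eq pd_def)
    ultimately show ?thesis by simp
  qed
  moreover have "continuous_on ?Z (\<lambda>u. \<Sum>k\<in>UNIV. X i (\<lambda>q. \<psi> q $ k) p * pd (Some k) ?F (lpt u (\<psi> p)))"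
  proof (intro continuous_on_sum continuous_on_mult continuous_on_const)
    fix k
    have "continuous_on ?S (pd (Some k) ?F)"
      by (rule holo_on_imp_continuous_on[OF holo_on_pd[OF line_holo_funD[OF f W V(1)] line_chart(3)[OF V(1) W]]])
    then show "continuous_on ?Z (\<lambda>u. pd (Some k) ?F (lpt u (\<psi> p)))"
    proof (rule continuous_on_compose2)
      have "continuous_on ?Z (\<lambda>u. case j of None \<Rightarrow> u | Some i \<Rightarrow> \<psi> p $ i)" for j by (cases j) auto
      then show "continuous_on ?Z (\<lambda>u. lpt u (\<psi> p))" unfolding lpt_def by (intro continuous_on_vec_lambda)
    qed (use V v(3) in auto)
  qed
  ultimately have "continuous_on ?Z (\<lambda>u. X i (\<lambda>q. f (u, q)) p)" by (simp cong: continuous_on_cong_simp)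
  then show ?thesis using open_slice'[OF W] p(1) by (simp add: continuous_on_eq_continuous_at)
qed

end

section \<open>(T)-structures\<close>

text \<open>The values of \<open>nab\<close> at \<open>z = 0\<close> are arbitrary, so identities
  are first proved for nonzero \<open>z\<close> and then extended by continuity.\<close>

lemma isCont_zero_limit:
  fixes f :: "complex \<Rightarrow> complex"
  assumes "isCont f 0" "\<forall>\<^sub>F z in at 0. f z = 0" shows "f 0 = 0"
proof -
  have "(f \<longlongrightarrow> f 0) (at 0)" using assms(1) by (simp add: isCont_def)
  moreover have "(f \<longlongrightarrow> 0) (at 0)" using assms(2) by (rule tendsto_eventually)
  ultimately show ?thesis using tendsto_unique[OF trivial_limit_at] by blast
qed

lemma open_punct: "open W \<Longrightarrow> open (punct W)"
proof -
  assume "open W"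
  moreover have "open {w. fst w \<noteq> (0::complex)}" by (intro open_Collect_neq continuous_intros)
  moreover have "punct W = W \<inter> {w. fst w \<noteq> 0}" by (auto simp: punct_def)
  ultimately show ?thesis by auto
qed

lemma eventually_punct:
  assumes "open (W :: (complex \<times> 'm::topological_space) set)" "(0, p) \<in> W"
  shows "\<forall>\<^sub>F z in at 0. (z, p) \<in> punct W"
proof -
  have "open {z. (z, p) \<in> W}"
    using open_vimage[OF assms(1), of "\<lambda>z. (z, p)"] by (simp add: vimage_def continuous_on_Pair continuous_on_const continuous_on_id)
  then show ?thesis using assms(2) by (auto simp: eventually_at_topological punct_def)
qed

locale T_frame = primitive_frame A U \<phi> "zero_restrict H" "zero_higgs A H nab" \<zeta> mul e
  for A :: "('m::topological_space, 'n::finite) chart set" and U and \<phi> :: "'m \<Rightarrow> complex^'n"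
    and H :: "(complex \<times> 'm, 'h, 'r::finite) vbundle" and nab \<zeta> mul e +
  assumes T: "T_structure A H nab"
begin

abbreviation "LA \<equiv> line_atlas A"

abbreviation "C \<equiv> zero_higgs A H nab"

sublocale HB: holo_bundle LA H
  using good_line T by unfold_locales (simp_all add: T_structure_def)

lemma fiber_restrict: "fiber p = HB.fiber (0, p)"
  unfolding fiber_def HB.fiber_def by (auto simp: zero_restrict_def prod_eq_iff)

lemma triv_restrict: "HB.triv V h (0, p) \<Longrightarrow> triv {q. (0, q) \<in> V} h p"
  unfolding triv_def HB.triv_def by (force simp: zero_restrict_def)

lemma nab_rules:
  assumes "open V" "open W" "W \<subseteq> UNIV \<times> V" "Y \<in> vfs A V" "s \<in> sects LA H W"
  shows "\<exists>u. z_times A H W (nab Y s) u"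
    "Y' \<in> vfs A V \<Longrightarrow> s' \<in> sects LA H W \<Longrightarrow> vf_eq A V Y Y' \<Longrightarrow> s_eq W s s' \<Longrightarrow> s_eq (punct W) (nab Y s) (nab Y' s')"
    "holo_fun A V f \<Longrightarrow> s_eq (punct W) (nab (vf_scale f Y) s) (s_scale H (\<lambda>(z, p). f p) (nab Y s))"
    "t \<in> sects LA H W \<Longrightarrow> s_eq (punct W) (nab Y (s_add H s t)) (s_add H (nab Y s) (nab Y t))"
    "holo_fun LA W g \<Longrightarrow> s_eq (punct W) (nab Y (s_scale H g s)) (s_add H (s_scale H (vf_lift Y g) s) (s_scale H g (nab Y s)))"
    "Y' \<in> vfs A V \<Longrightarrow> s_eq (punct W) (s_diff H (nab Y (nab Y' s)) (nab Y' (nab Y s))) (nab (lie_bracket Y Y') s)"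
proof -
  note * = T[unfolded T_structure_def, THEN conjunct2, THEN spec, THEN spec, THEN mp, OF assms(1), THEN mp, OF assms(2),
    THEN mp, OF assms(3), THEN bspec, OF assms(4), THEN bspec, OF assms(5)]
  note r = *[THEN conjunct2] note r2 = r[THEN conjunct2, THEN conjunct2] note r3 = r2[THEN conjunct2]
  show "\<exists>u. z_times A H W (nab Y s) u" using * by (rule conjunct1)
  show "s_eq (punct W) (nab Y s) (nab Y' s')" if "Y' \<in> vfs A V" "s' \<in> sects LA H W" "vf_eq A V Y Y'" "s_eq W s s'"
    using r[THEN conjunct1] that by blast
  show "s_eq (punct W) (nab (vf_scale f Y) s) (s_scale H (\<lambda>(z, p). f p) (nab Y s))" if "holo_fun A V f"
    using r2[THEN conjunct1] that by blast
  show "s_eq (punct W) (nab Y (s_add H s t)) (s_add H (nab Y s) (nab Y t))" if "t \<in> sects LA H W"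
    using r3[THEN conjunct1] that by blast
  show "s_eq (punct W) (nab Y (s_scale H g s)) (s_add H (s_scale H (vf_lift Y g) s) (s_scale H g (nab Y s)))" if "holo_fun LA W g"
    using r3[THEN conjunct2, THEN conjunct1] that by blast
  show "s_eq (punct W) (s_diff H (nab Y (nab Y' s)) (nab Y' (nab Y s))) (nab (lie_bracket Y Y') s)" if "Y' \<in> vfs A V"
    using r3[THEN conjunct2, THEN conjunct2] that by blast
qed

lemma z_timesD:
  assumes "z_times A H W v u"
  shows "u \<in> sects LA H W" "w \<in> punct W \<Longrightarrow> v w \<in> HB.fiber w"
    "w \<in> punct W \<Longrightarrow> HB.triv V h w \<Longrightarrow> h (v w) = (1 / fst w) *s h (u w)"
proof -
  show u: "u \<in> sects LA H W" using assms by (simp add: z_times_def)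
  have v: "v w = s_scale H (\<lambda>(z, p). 1 / z) u w" "u w \<in> HB.fiber w" if "w \<in> punct W"
    using assms that HB.sectsD(1)[OF u, of w] unfolding z_times_def s_eq_def by (blast, simp add: punct_def)
  show "v w \<in> HB.fiber w" if "w \<in> punct W" unfolding v(1)[OF that] by (rule HB.s_scale(1)[of u, OF v(2)[OF that]])
  show "h (v w) = (1 / fst w) *s h (u w)" if "w \<in> punct W" "HB.triv V h w"
    unfolding v(1)[OF that(1)] using HB.s_scale(2)[of u, OF v(2)[OF that(1)] that(2)] by (simp add: case_prod_beta)
qed

lemma nab_fiber:
  assumes "open V" "open W" "W \<subseteq> UNIV \<times> V" "Y \<in> vfs A V" "s \<in> sects LA H W" "w \<in> punct W"
  shows "nab Y s w \<in> HB.fiber w"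
  using nab_rules(1)[OF assms(1-5)] z_timesD(2)[OF _ assms(6)] by blast

text \<open>Away from \<open>z = 0\<close> the pole is harmless, so over the punctured set the
  connection can be applied a second time.\<close>

lemma nab_sect:
  assumes "open V" "open W" "W \<subseteq> UNIV \<times> V" "Y \<in> vfs A V" "s \<in> sects LA H W"
  shows "nab Y s \<in> sects LA H (punct W)"
proof -
  obtain u where u: "z_times A H W (nab Y s) u" using nab_rules(1)[OF assms] by blast
  have "s_scale H (\<lambda>(z, p). 1 / z) u \<in> sects LA H (punct W)"
    by (rule HB.sects_scale[OF HB.sects_subset[OF z_timesD(1)[OF u]] line_holo_fun_inverse]) (auto simp: punct_def open_punct[OF assms(2), unfolded punct_def])
  then show ?thesis
    by (rule HB.sects_cong[OF _ open_punct[OF assms(2)]]) (use u in \<open>simp add: z_times_def s_eq_def\<close>)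
qed

lemma nab_sum:
  assumes V: "open V" "V \<subseteq> U" and W: "open W" "W \<subseteq> UNIV \<times> V"
    and s: "\<And>k. s k \<in> sects LA H W" and x: "\<And>k. holo_fun LA W (x k)" and t: "t \<in> sects LA H W"
    and t_eq: "\<And>w. w \<in> W \<Longrightarrow> \<exists>V' h. HB.triv V' h w \<and> h (t w) = (\<Sum>k\<in>UNIV. x k w *s h (s k w))"
    and w: "w \<in> punct W" "HB.triv V' h w"
  shows "h (nab (X i) t w) = (\<Sum>k\<in>(UNIV :: 'n set). vf_lift (X i) (x k) w *s h (s k w) + x k w *s h (nab (X i) (s k) w))"
proof (rule HB.leibniz_sum[where W = W and ?W0.0 = "punct W" and T = "nab (X i)" and \<delta> = "vf_lift (X i)", OF W(1) _ _ _ _ _ finite s x t t_eq w])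
  note Xi = X_vfs[OF V(2), of i]
  note rules = nab_rules[OF V(1) W Xi]
  show "punct W \<subseteq> W" by (auto simp: punct_def)
  show "nab (X i) s w \<in> HB.fiber w" if "s \<in> sects LA H W" "w \<in> punct W" for s w
    by (rule nab_fiber[OF V(1) W Xi that])
  show "s_eq (punct W) (nab (X i) s) (nab (X i) s')" if "s \<in> sects LA H W" "s' \<in> sects LA H W" "s_eq W s s'" for s s'
    by (rule rules(2)[OF that(1) Xi that(2) vf_eq_refl that(3)])
  show "s_eq (punct W) (nab (X i) (s_add H s t)) (s_add H (nab (X i) s) (nab (X i) t))" if "s \<in> sects LA H W" "t \<in> sects LA H W" for s t
    by (rule rules(4)[OF that])
  show "h (nab (X i) (s_scale H f s) w) = vf_lift (X i) f w *s h (s w) + f w *s h (nab (X i) s w)"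
    if s: "s \<in> sects LA H W" and f: "holo_fun LA W f" and p: "w \<in> punct W" "HB.triv V' h w" for s f w V' h
  proof -
    have "w \<in> W" using p by (simp add: punct_def)
    then have fs: "s w \<in> HB.fiber w" "nab (X i) s w \<in> HB.fiber w"
      using HB.sectsD(1)[OF s] nab_fiber[OF V(1) W Xi s p(1)] by blast+
    have "nab (X i) (s_scale H f s) w = s_add H (s_scale H (vf_lift (X i) f) s) (s_scale H f (nab (X i) s)) w"
      using rules(5)[OF s f] p(1) by (simp add: s_eq_def)
    then show ?thesis
      using HB.s_add(2)[of "s_scale H (vf_lift (X i) f) s" w "s_scale H f (nab (X i) s)",
          OF HB.s_scale(1)[of s w, OF fs(1)] HB.s_scale(1)[of "nab (X i) s" w, OF fs(2)] p(2)]
        HB.s_scale(2)[of s w, OF fs(1) p(2)] HB.s_scale(2)[of "nab (X i) s" w, OF fs(2) p(2)] by simp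
  qed
qed

end

text \<open>The frame \<open>\<sigma>\<close> of \<open>K\<close>, extended constantly in \<open>z\<close> with respect to a trivialization \<open>h\<close> of \<open>H\<close>;
  \<open>y\<close> is the inverse of its matrix.\<close>

locale T_frame_triv = T_frame A U \<phi> H nab \<zeta> mul e
  for A :: "('m::topological_space, 'n::finite) chart set" and U and \<phi> :: "'m \<Rightarrow> complex^'n"
    and H :: "(complex \<times> 'm, 'h, 'r::finite) vbundle" and nab \<zeta> mul e +
  fixes V0 and h :: "'h \<Rightarrow> complex^'r" and V1 and y :: "'r \<Rightarrow> 'n \<Rightarrow> 'm \<Rightarrow> complex"
  assumes V0: "(V0, h) \<in> Trivs H" and V1: "V1 = {q \<in> U. (0, q) \<in> V0}"
    and holo_y: "\<And>j l. holo_fun A V1 (y j l)"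
    and y_dual: "\<And>q k l. q \<in> V1 \<Longrightarrow> (\<Sum>j\<in>UNIV. h (\<sigma> k q) $ j * y j l q) = (if k = l then 1 else 0)"
    and y_span: "\<And>q v. q \<in> V1 \<Longrightarrow> v = (\<Sum>l\<in>UNIV. (\<Sum>j\<in>UNIV. v $ j * y j l q) *s h (\<sigma> l q))"
begin

definition W where "W = V0 \<inter> UNIV \<times> V1"

text \<open>The \<open>l\<close>-th coordinate of \<open>v\<close> with respect to the frame at
  \<open>q\<close>.\<close>

definition cf where "cf l q v = (\<Sum>j\<in>UNIV. v $ j * y j l q)"

definition s where "s k w = HB.unh h w (h (\<sigma> k (snd w)))"

definition u where "u i k = (SOME u. z_times A H W (nab (X i) (s k)) u)"

text \<open>The holomorphic matrix of \<open>z\<close> times the connection in the extended frame.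
  At \<open>z = 0\<close> it gives the structure constants, see \<open>a_0\<close>.\<close>

definition a where "a i k m w = cf m (snd w) (h (u i k w))"

lemma open_V1: "open V1"
proof -
  have "open (U \<inter> {q. (0, q) \<in> V0})" using open_U open_slice[OF HB.triv_open[OF V0]] by blast
  moreover have "U \<inter> {q. (0, q) \<in> V0} = V1" by (auto simp: V1)
  ultimately show ?thesis by simp
qed

lemma V1_U: "V1 \<subseteq> U" by (auto simp: V1)

lemma W_V1: "W \<subseteq> UNIV \<times> V1" by (auto simp: W_def)

lemma open_W: "open W"
  unfolding W_def by (intro open_Int HB.triv_open[OF V0] open_Times open_UNIV open_V1)

lemma W_triv: "w \<in> W \<Longrightarrow> HB.triv V0 h w"
  using V0 by (simp add: W_def HB.triv_def)

lemma zero_in_W: "q \<in> V1 \<Longrightarrow> (0, q) \<in> W"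
  unfolding W_def using V1 by blast

lemma V1_triv: "q \<in> V1 \<Longrightarrow> triv {q. (0, q) \<in> V0} h q"
  by (rule triv_restrict[OF W_triv[OF zero_in_W]])

lemma cf_linear: "cf l q (v + v') = cf l q v + cf l q v'" "cf l q (v - v') = cf l q v - cf l q v'"
  "cf l q (c *s v) = c * cf l q v" "cf l q 0 = 0"
  by (simp_all add: cf_def distrib_right left_diff_distrib sum.distrib sum_subtractf sum_distrib_left mult.assoc)

lemma cf_sum: "cf l q (\<Sum>k\<in>J. v k) = (\<Sum>k\<in>J. cf l q (v k))"
  by (induction J rule: infinite_finite_induct) (simp_all add: cf_linear)

lemma cf_sigma: "q \<in> V1 \<Longrightarrow> cf l q (h (\<sigma> k q)) = (if k = l then 1 else 0)"
  by (simp add: cf_def y_dual)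

lemma cf_frame: "q \<in> V1 \<Longrightarrow> cf l q (\<Sum>k\<in>UNIV. x k *s h (\<sigma> k q)) = x l"
  by (simp add: cf_sum cf_linear cf_sigma if_distrib sum.delta cong: if_cong)

lemma cf_expand: "q \<in> V1 \<Longrightarrow> v = (\<Sum>l\<in>UNIV. cf l q v *s h (\<sigma> l q))"
  unfolding cf_def by (rule y_span)

lemma holo_cf:
  assumes "t \<in> sects LA H W'" "open W'" "W' \<subseteq> W"
  shows "holo_fun LA W' (\<lambda>w. cf m (snd w) (h (t w)))"
  unfolding cf_def
proof (intro holo_fun_sum holo_fun_mult)
  fix j
  have "V0 \<inter> W' = W'" using assms(3) by (auto simp: W_def)
  then show "holo_fun LA W' (\<lambda>w. h (t w) $ j)" using HB.sectsD(2)[OF assms(1) V0, of j] by simp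
  show "holo_fun LA W' (\<lambda>w. y j m (snd w))"
    by (rule line_holo_fun_snd[OF holo_y assms(2)]) (use assms(3) W_V1 in blast)
qed

lemma s_sect: "s k \<in> sects LA H W"
  unfolding s_def
proof (rule HB.sects_unh[OF V0 open_W])
  fix j
  have "V1 = {q. (0, q) \<in> V0} \<inter> U" by (auto simp: V1)
  moreover have "({q. (0, q) \<in> V0}, h) \<in> Trivs (zero_restrict H)" using V0 by (force simp: zero_restrict_def)
  ultimately have "holo_fun A V1 (\<lambda>q. h (\<sigma> k q) $ j)" using sectsD(2)[OF sigma] by simp
  then show "holo_fun LA W (\<lambda>w. h (\<sigma> k (snd w)) $ j)" by (rule line_holo_fun_snd[OF _ open_W W_V1])
qed (auto simp: W_def)

lemma h_s: "w \<in> W \<Longrightarrow> h (s k w) = h (\<sigma> k (snd w))"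
  unfolding s_def by (rule HB.unh(2)[OF W_triv])

lemma u: "z_times A H W (nab (X i) (s k)) (u i k)"
  using someI_ex[OF nab_rules(1)[OF open_V1 open_W W_V1 X_vfs[OF V1_U] s_sect[of k]], of i] by (simp add: u_def)

lemma holo_a: "holo_fun LA W (a i k m)"
  unfolding a_def by (rule holo_cf[OF z_timesD(1)[OF u] open_W order_refl])

lemma h_nab_s:
  assumes "w \<in> punct W"
  shows "h (nab (X i) (s k) w) = (\<Sum>m\<in>UNIV. (1 / fst w * a i k m w) *s h (\<sigma> m (snd w)))"
proof -
  have w: "w \<in> W" "snd w \<in> V1" using assms W_V1 by (auto simp: punct_def)
  have "h (nab (X i) (s k) w) = (1 / fst w) *s h (u i k w)"
    by (rule z_timesD(3)[OF u assms W_triv[OF w(1)]])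
  also have "h (u i k w) = (\<Sum>m\<in>UNIV. a i k m w *s h (\<sigma> m (snd w)))"
    unfolding a_def by (rule cf_expand[OF w(2)])
  finally show ?thesis by (simp add: vec.scale_sum_right)
qed

lemma cf_nab_s: "w \<in> punct W \<Longrightarrow> cf m (snd w) (h (nab (X i) (s k) w)) = 1 / fst w * a i k m w"
  using W_V1 by (auto simp: h_nab_s punct_def cf_frame)

text \<open>The defining description ranges over all local extensions of the section. Two of them
  agree at \<open>z = 0\<close>. In the Leibniz expansion of \<open>z\<close> times the connection,
  the derivatives of the coefficients carry a factor \<open>z\<close> and disappear in the limit, so
  the value is independent of the extension.\<close>

lemma zero_higgs_eq:
  assumes q: "q \<in> V1"
  shows "C (X i) (\<sigma> k) q = u i k (0, q)"
  unfolding zero_higgs_def[of A H nab "X i" "\<sigma> k" q]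
proof (rule the_equality)
  have "s k (0, r) = \<sigma> k r" if "(0, r) \<in> W" for r
  proof (rule HB.triv_inj[OF W_triv[OF that]])
    have "r \<in> U" using that W_V1 V1_U by auto
    then show "\<sigma> k r \<in> HB.fiber (0, r)" using sectsD(1)[OF sigma] by (simp add: fiber_restrict)
  qed (use h_s[OF that] HB.sectsD(1)[OF s_sect that] in simp_all)
  then show "\<exists>V W s ua. open V \<and> X i \<in> vfs A V \<and> open W \<and> W \<subseteq> UNIV \<times> V \<and> (0, q) \<in> W \<and>
      s \<in> sects LA H W \<and> (\<forall>q. (0, q) \<in> W \<longrightarrow> s (0, q) = \<sigma> k q) \<and>
      z_times A H W (nab (X i) s) ua \<and> u i k (0, q) = ua (0, q)"
    using open_V1 X_vfs[OF V1_U] open_W W_V1 zero_in_W[OF q] s_sect u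
    by (intro exI[of _ V1] exI[of _ W] exI[of _ "s k"] exI[of _ "u i k"] conjI) auto
next
  fix c
  assume "\<exists>V W s u. open V \<and> X i \<in> vfs A V \<and> open W \<and> W \<subseteq> UNIV \<times> V \<and> (0, q) \<in> W \<and>
      s \<in> sects LA H W \<and> (\<forall>q. (0, q) \<in> W \<longrightarrow> s (0, q) = \<sigma> k q) \<and> z_times A H W (nab (X i) s) u \<and> c = u (0, q)"
  then obtain V' W' t v where V': "open V'" and W': "open W'" "W' \<subseteq> UNIV \<times> V'" "(0, q) \<in> W'"
    and t: "t \<in> sects LA H W'" "\<And>q. (0, q) \<in> W' \<Longrightarrow> t (0, q) = \<sigma> k q"
    and v: "z_times A H W' (nab (X i) t) v" and c: "c = v (0, q)"
    by (elim exE conjE) (rule that, assumption+, simp_all)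
  define W2 where "W2 = W' \<inter> W"
  have W2: "open W2" "W2 \<subseteq> UNIV \<times> V1" "W2 \<subseteq> W" "W2 \<subseteq> W'" "(0, q) \<in> W2"
    using W' open_W W_V1 zero_in_W[OF q] by (auto simp: W2_def)
  have t2: "t \<in> sects LA H W2" by (rule HB.sects_subset[OF t(1) W2(4)])
  define x where "x m w = cf m (snd w) (h (t w))" for m w
  have x: "holo_fun LA W2 (x m)" for m unfolding x_def by (rule holo_cf[OF t2 W2(1,3)])
  have x_0: "x m (0, q) = (if k = m then 1 else 0)" for m
    using t(2)[OF W'(3)] cf_sigma[OF q] by (simp add: x_def)
  have comp: "holo_fun LA W2 (\<lambda>w. h (v w) $ j)" "holo_fun LA W2 (\<lambda>w. h (u i m w) $ j)" for m j
    using HB.sectsD(2)[OF HB.sects_subset[OF z_timesD(1)[OF v] W2(4)] V0, of j]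
      HB.sectsD(2)[OF HB.sects_subset[OF z_timesD(1)[OF u] W2(3)] V0, of i m j] W2(3)
    by (simp_all add: W_def Int_absorb1)
  have cont: "isCont (\<lambda>z. f (z, q)) 0" if "holo_fun LA W2 f" for f
    using line_slice_differentiable[OF that W2(1,5)] by (rule field_differentiable_imp_continuous_at)
  have qU: "q \<in> U" using q V1_U by auto
  have main: "h (v (z, q)) = (\<Sum>m\<in>UNIV. (z * X i (\<lambda>r. x m (z, r)) q) *s h (\<sigma> m q) + x m (z, q) *s h (u i m (z, q)))"
    if z: "(z, q) \<in> punct W2" for z
  proof -
    have z0: "z \<noteq> 0" and w: "(z, q) \<in> W2" "(z, q) \<in> W" "(z, q) \<in> punct W'" "(z, q) \<in> punct W"
      using z W2 by (auto simp: punct_def)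
    have "h (nab (X i) t (z, q)) = (\<Sum>m\<in>UNIV. vf_lift (X i) (x m) (z, q) *s h (s m (z, q)) + x m (z, q) *s h (nab (X i) (s m) (z, q)))"
    proof (rule nab_sum[OF open_V1 V1_U W2(1,2) HB.sects_subset[OF s_sect W2(3)] x t2 _ z W_triv[OF w(2)]])
      fix w assume w: "w \<in> W2"
      then have "w \<in> W" "snd w \<in> V1" using W2 by auto
      then show "\<exists>V' h. HB.triv V' h w \<and> h (t w) = (\<Sum>m\<in>UNIV. x m w *s h (s m w))"
        using W_triv cf_expand[of "snd w" "h (t w)"] by (intro exI[of _ V0] exI[of _ h]) (simp add: x_def h_s)
    qed
    moreover have "h (nab (X i) t (z, q)) = (1 / z) *s h (v (z, q))"
      using z_timesD(3)[OF v w(3) W_triv[OF w(2)]] by simp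
    moreover have "h (nab (X i) (s m) (z, q)) = (1 / z) *s h (u i m (z, q))" for m
      using z_timesD(3)[OF u w(4) W_triv[OF w(2)]] by simp
    ultimately have "(1 / z) *s h (v (z, q)) = (\<Sum>m\<in>UNIV. X i (\<lambda>r. x m (z, r)) q *s h (\<sigma> m q) + x m (z, q) *s ((1 / z) *s h (u i m (z, q))))"
      by (simp add: h_s[OF w(2)] vf_lift_def)
    then have "z *s ((1 / z) *s h (v (z, q))) = z *s (\<Sum>m\<in>UNIV. X i (\<lambda>r. x m (z, r)) q *s h (\<sigma> m q) + x m (z, q) *s ((1 / z) *s h (u i m (z, q))))"
      by (rule arg_cong)
    then show ?thesis using z0 by (simp add: vec.scale_sum_right vector_add_ldistrib)
  qed
  have "h (v (0, q)) $ j = h (u i k (0, q)) $ j" for j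
  proof -
    \<comment> \<open>One component of the difference of the two sides of \<open>main\<close>. It is
      continuous in \<open>z\<close> and 0 off \<open>z = 0\<close>, hence 0 there as well, where
      the coefficients \<open>x m\<close> are those of \<open>\<sigma> k\<close>.\<close>
    define F where "F z = h (v (z, q)) $ j - (\<Sum>m\<in>UNIV. (z * X i (\<lambda>r. x m (z, r)) q) * h (\<sigma> m q) $ j + x m (z, q) * h (u i m (z, q)) $ j)" for z
    have "F 0 = 0"
    proof (rule isCont_zero_limit)
      show "isCont F 0" unfolding F_def
        by (intro continuous_diff continuous_sum continuous_add continuous_mult continuous_const continuous_ident cont comp x
            line_slice_X_continuous[OF x W2(1,5) qU])
      show "\<forall>\<^sub>F z in at 0. F z = 0"
        using eventually_punct[OF W2(1,5)] by eventually_elim (simp add: main F_def)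
    qed
    then show ?thesis by (simp add: F_def x_0 if_distrib[of "\<lambda>x. x * _"] sum.delta cong: if_cong)
  qed
  then have "h (v (0, q)) = h (u i k (0, q))" by (simp add: vec_eq_iff)
  then show "c = u i k (0, q)"
    unfolding c using HB.triv_inj[OF W_triv[OF zero_in_W[OF q]]]
      HB.sectsD(1)[OF z_timesD(1)[OF v] W'(3)] HB.sectsD(1)[OF z_timesD(1)[OF u] zero_in_W[OF q]] by blast
qed

lemma a_0: "q \<in> V1 \<Longrightarrow> a i k m (0, q) = ac i k m q"
  using C_sigma[OF _ V1_triv, of q i k] V1_U cf_frame[of q m "\<lambda>m. ac i k m q"] by (auto simp: a_def zero_higgs_eq)

text \<open>The second application differentiates the coefficients \<open>a / z\<close> along the
  manifold, with \<open>z\<close> held fixed. This gives a term of order \<open>1 / z\<close> with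
  the derivative and one of order \<open>1 / z^2\<close> with the matrix product.\<close>

lemma cf_nab_nab:
  assumes w: "(z, q) \<in> punct W"
  shows "nab (X i) (nab (X j) (s l)) (z, q) \<in> HB.fiber (z, q)"
    "cf m q (h (nab (X i) (nab (X j) (s l)) (z, q))) = 1 / z * X i (\<lambda>r. a j l m (z, r)) q
      + (1 / z)^2 * (\<Sum>k\<in>UNIV. a j l k (z, q) * a i k m (z, q))"
proof -
  let ?P = "punct W"
  have P: "open ?P" "?P \<subseteq> UNIV \<times> V1" "?P \<subseteq> W" "punct ?P = ?P"
    using open_punct[OF open_W] W_V1 by (auto simp: punct_def)
  have q: "q \<in> V1" "(z, q) \<in> W" using w W_V1 by (auto simp: punct_def)
  have S: "nab (X j) (s l) \<in> sects LA H ?P" by (rule nab_sect[OF open_V1 open_W W_V1 X_vfs[OF V1_U] s_sect])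
  show "nab (X i) (nab (X j) (s l)) (z, q) \<in> HB.fiber (z, q)"
    by (rule nab_fiber[OF open_V1 P(1,2) X_vfs[OF V1_U] S]) (simp add: P w)
  define x where "x k w = (case w of (z, r) \<Rightarrow> 1 / z) * a j l k w" for k w
  have x: "holo_fun LA ?P (x k)" for k
    unfolding x_def by (intro holo_fun_mult line_holo_fun_inverse[OF P(1)] holo_fun_subset[OF holo_a P(3)]) (simp add: punct_def)
  have "h (nab (X i) (nab (X j) (s l)) (z, q)) =
      (\<Sum>k\<in>UNIV. vf_lift (X i) (x k) (z, q) *s h (s k (z, q)) + x k (z, q) *s h (nab (X i) (s k) (z, q)))"
  proof (rule nab_sum[OF open_V1 V1_U P(1,2) HB.sects_subset[OF s_sect P(3)] x S _ _ W_triv[OF q(2)]])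
    fix w assume w: "w \<in> ?P"
    then have "w \<in> W" using P by auto
    then show "\<exists>V' h. HB.triv V' h w \<and> h (nab (X j) (s l) w) = (\<Sum>k\<in>UNIV. x k w *s h (s k w))"
      using W_triv h_nab_s[OF w, of j l] by (intro exI[of _ V0] exI[of _ h]) (simp add: x_def h_s case_prod_beta)
  qed (simp add: P w)
  then have "cf m q (h (nab (X i) (nab (X j) (s l)) (z, q))) =
      (\<Sum>k\<in>UNIV. vf_lift (X i) (x k) (z, q) * (if k = m then 1 else 0) + x k (z, q) * (1 / z * a i k m (z, q)))"
    using cf_nab_s[OF w] by (simp add: cf_sum cf_linear h_s[OF q(2)] cf_sigma[OF q(1)])
  also have "\<dots> = vf_lift (X i) (x m) (z, q) + (\<Sum>k\<in>UNIV. x k (z, q) * (1 / z * a i k m (z, q)))"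
    by (simp add: sum.distrib mult_delta_right)
  also have "vf_lift (X i) (x m) (z, q) = 1 / z * X i (\<lambda>r. a j l m (z, r)) q"
  proof -
    let ?S = "{r. (z, r) \<in> W}"
    have "X i (\<lambda>r. 1 / z * a j l m (z, r)) q = X i (\<lambda>r. 1 / z) q * a j l m (z, q) + 1 / z * X i (\<lambda>r. a j l m (z, r)) q"
      by (rule X_mult[of ?S, OF _ line_holo_fun_slice[OF holo_a open_W] open_slice[OF open_W]])
        (use q W_V1 V1_U in auto)
    then show ?thesis by (simp add: vf_lift_def x_def)
  qed
  also have "(\<Sum>k\<in>UNIV. x k (z, q) * (1 / z * a i k m (z, q))) = (1 / z)^2 * (\<Sum>k\<in>UNIV. a j l k (z, q) * a i k m (z, q))"
    by (simp add: x_def sum_distrib_left power2_eq_square mult_ac)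
  finally show "cf m q (h (nab (X i) (nab (X j) (s l)) (z, q))) = 1 / z * X i (\<lambda>r. a j l m (z, r)) q
      + (1 / z)^2 * (\<Sum>k\<in>UNIV. a j l k (z, q) * a i k m (z, q))" .
qed

text \<open>Coordinate fields commute, so flatness equates the two iterated derivatives. Clearing
  the double pole leaves the commutator of the matrices and \<open>z\<close> times the
  antisymmetrized derivative.\<close>

lemma flat:
  assumes w: "(z, q) \<in> punct W"
  shows "z * (X i (\<lambda>r. a j l m (z, r)) q - X j (\<lambda>r. a i l m (z, r)) q)
    + (\<Sum>k\<in>UNIV. a j l k (z, q) * a i k m (z, q) - a i l k (z, q) * a j k m (z, q)) = 0"
proof -
  have z: "z \<noteq> 0" and wW: "(z, q) \<in> W" using w by (auto simp: punct_def)
  note rules = nab_rules[OF open_V1 open_W W_V1]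
  have V: "X i \<in> vfs A V1" "X j \<in> vfs A V1" "lie_bracket (X i) (X j) \<in> vfs A V1" "vf_scale (\<lambda>_. 0) (X i) \<in> vfs A V1"
    using X_vfs[OF V1_U] vfs_subset[OF lie_bracket_X(2) V1_U] by (auto intro: vfs_scale)
  have "h (nab (lie_bracket (X i) (X j)) (s l) (z, q)) = h (nab (vf_scale (\<lambda>_. 0) (X i)) (s l) (z, q))"
    using rules(2)[OF V(3) s_sect[of l] V(4) s_sect[of l] vf_eq_subset[OF lie_bracket_X(1) V1_U]] w by (simp add: s_eq_def)
  also have "\<dots> = h (s_scale H (\<lambda>(z, p). 0) (nab (X i) (s l)) (z, q))"
    using rules(3)[OF V(1) s_sect, of "\<lambda>_. 0" l] w by (simp add: s_eq_def)
  also have "\<dots> = 0"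
    using HB.s_scale(2)[of "nab (X i) (s l)", OF nab_fiber[OF open_V1 open_W W_V1 V(1) s_sect w] W_triv[OF wW]] by simp
  finally have 0: "h (nab (lie_bracket (X i) (X j)) (s l) (z, q)) = 0" .
  have "s_diff H (nab (X i) (nab (X j) (s l))) (nab (X j) (nab (X i) (s l))) (z, q) = nab (lie_bracket (X i) (X j)) (s l) (z, q)"
    using rules(6)[OF V(1) s_sect V(2)] w by (simp add: s_eq_def)
  then have "h (nab (X i) (nab (X j) (s l)) (z, q)) - h (nab (X j) (nab (X i) (s l)) (z, q)) = 0"
    using HB.s_diff(2)[of "nab (X i) (nab (X j) (s l))" "(z, q)" "nab (X j) (nab (X i) (s l))",
      OF cf_nab_nab(1)[OF w] cf_nab_nab(1)[OF w] W_triv[OF wW]] 0 by simp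
  then have "cf m q (h (nab (X i) (nab (X j) (s l)) (z, q))) = cf m q (h (nab (X j) (nab (X i) (s l)) (z, q)))" by simp
  then have "z^2 * (1 / z * X i (\<lambda>r. a j l m (z, r)) q + (1 / z)^2 * (\<Sum>k\<in>UNIV. a j l k (z, q) * a i k m (z, q))) =
    z^2 * (1 / z * X j (\<lambda>r. a i l m (z, r)) q + (1 / z)^2 * (\<Sum>k\<in>UNIV. a i l k (z, q) * a j k m (z, q)))"
    unfolding cf_nab_nab(2)[OF w] by simp
  moreover have E: "z^2 * (1 / z * P + (1 / z)^2 * Q) = z * P + Q" for P Q
    using z by (simp add: field_simps power2_eq_square)
  ultimately have "z * X i (\<lambda>r. a j l m (z, r)) q + (\<Sum>k\<in>UNIV. a j l k (z, q) * a i k m (z, q)) =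
      z * X j (\<lambda>r. a i l m (z, r)) q + (\<Sum>k\<in>UNIV. a i l k (z, q) * a j k m (z, q))"
    by (simp only: E)
  then show ?thesis by (simp add: sum_subtractf algebra_simps)
qed

text \<open>The identity \<open>flat\<close> has the form \<open>z * f z + g z = 0\<close> with
  \<open>g 0 = 0\<close>, because the structure constants commute. Its first-order part in
  \<open>z\<close> says that \<open>f 0\<close> is minus the derivative of \<open>g\<close> at 0,
  and that derivative is a sum of commutators.\<close>

lemma T_structure_closed_at:
  assumes p: "p \<in> V1"
  shows "\<exists>D. \<forall>i j. dam i j p - dam j i p = (am p j * D i - D i * am p j) - (am p i * D j - D j * am p i)"
proof -
  have pU: "p \<in> U" and p0: "(0, p) \<in> W" using p V1_U zero_in_W by auto
  define a' where "a' i k m = deriv (\<lambda>z. a i k m (z, p)) 0" for i k m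
  have der: "((\<lambda>z. a i k m (z, p)) has_field_derivative a' i k m) (at 0)" for i k m
    unfolding a'_def by (rule field_differentiable_derivI[OF line_slice_differentiable[OF holo_a open_W p0]])
  \<comment> \<open>The \<open>z\<close>-linear coefficients of the matrix of \<open>z\<close> times
    the connection, placed in columns.\<close>
  define D where "D i = smat_of (\<lambda>m k. a' i k m)" for i
  have key: "X i (ac j l m) p - X j (ac i l m) p =
      - (\<Sum>k\<in>UNIV. (a' j l k * ac i k m p + ac j l k p * a' i k m) - (a' i l k * ac j k m p + ac i l k p * a' j k m))" for i j l m
  proof -
    define f where "f z = X i (\<lambda>r. a j l m (z, r)) p - X j (\<lambda>r. a i l m (z, r)) p" for z
    define g where "g z = (\<Sum>k\<in>UNIV. a j l k (z, p) * a i k m (z, p) - a i l k (z, p) * a j k m (z, p))" for z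
    have Xa: "X i (\<lambda>r. a j l m (0, r)) p = X i (ac j l m) p" for i j
      by (rule X_cong[OF open_V1 p V1_U]) (rule a_0)
    have f0: "f 0 = X i (ac j l m) p - X j (ac i l m) p" by (simp add: f_def Xa)
    have g0: "g 0 = 0" using ac_commute[OF pU, of j l i m] by (simp add: g_def a_0[OF p] sum_subtractf)
    have "(g has_field_derivative (\<Sum>k\<in>UNIV. (a' j l k * ac i k m p + ac j l k p * a' i k m) - (a' i l k * ac j k m p + ac i l k p * a' j k m))) (at 0)"
      unfolding g_def
      by (rule DERIV_sum, rule derivative_eq_intros, (rule derivative_eq_intros der refl)+) (simp add: a_0[OF p] algebra_simps)
    then have "((\<lambda>z. g z / z) \<longlongrightarrow> (\<Sum>k\<in>UNIV. (a' j l k * ac i k m p + ac j l k p * a' i k m) - (a' i l k * ac j k m p + ac i l k p * a' j k m))) (at 0)"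
      using g0 by (simp add: has_field_derivative_iff)
    \<comment> \<open>The difference quotient of \<open>g\<close> at 0 equals \<open>- f z\<close>
      for nonzero \<open>z\<close>. So its limit is also given by continuity of \<open>f\<close>,
      and no derivative of \<open>f\<close> in \<open>z\<close> enters.\<close>
    moreover have "((\<lambda>z. g z / z) \<longlongrightarrow> - f 0) (at 0)"
    proof (rule Lim_transform_eventually)
      have "isCont f 0" unfolding f_def
        by (intro continuous_diff line_slice_X_continuous[OF holo_a open_W p0 pU])
      then show "((\<lambda>z. - f z) \<longlongrightarrow> - f 0) (at 0)" unfolding isCont_def by (rule tendsto_minus)
      show "\<forall>\<^sub>F z in at 0. - f z = g z / z"
        using eventually_punct[OF open_W p0]
      proof eventually_elim
        fix z assume z: "(z, p) \<in> punct W"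
        have "z * f z + g z = 0" using flat[OF z, of i j l m] by (simp add: f_def g_def)
        moreover have "z \<noteq> 0" using z by (simp add: punct_def)
        ultimately show "- f z = g z / z" by (simp add: field_simps add_eq_0_iff)
      qed
    qed
    ultimately have "- f 0 = (\<Sum>k\<in>UNIV. (a' j l k * ac i k m p + ac j l k p * a' i k m) - (a' i l k * ac j k m p + ac i l k p * a' j k m))"
      by (intro tendsto_unique[OF trivial_limit_at])
    then show ?thesis unfolding f0[symmetric] by (metis minus_minus)
  qed
  have "dam i j p - dam j i p = (am p j * D i - D i * am p j) - (am p i * D j - D j * am p i)" for i j
  proof (rule smat_eqI)
    fix m l
    show "entry (dam i j p - dam j i p) m l = entry ((am p j * D i - D i * am p j) - (am p i * D j - D j * am p i)) m l"
      using key[of i j l m] by (simp add: entry_mult dam_def am_def D_def sum_subtractf sum.distrib mult.commute algebra_simps)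
  qed
  then show ?thesis by blast
qed

end

text \<open>The inverse frame matrix is not found by inverting: the standard sections of a
  trivialization are expanded in the frame, which gives \<open>y\<close> with holomorphic entries,
  and independence of the frame makes it a two-sided inverse.\<close>

lemma (in T_frame) T_structure_closed:
  assumes p: "p \<in> U"
  shows "\<exists>D. \<forall>i j. dam i j p - dam j i p = (am p j * D i - D i * am p j) - (am p i * D j - D j * am p i)"
proof -
  obtain V0 h where t0: "HB.triv V0 h (0, p)" using HB.triv_exists by blast
  then have V0: "(V0, h) \<in> Trivs H" by (simp add: HB.triv_def)
  define V1 where "V1 = {q \<in> U. (0, q) \<in> V0}"
  let ?V = "{q. (0, q) \<in> V0}"
  have V1_eq: "V1 = ?V \<inter> U" by (auto simp: V1_def)
  have V: "(?V, h) \<in> Trivs (zero_restrict H)" using V0 by (force simp: zero_restrict_def)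
  have t: "triv ?V h q" if "q \<in> V1" for q using V that by (simp add: triv_def V1_def)
  have V1: "open V1" "V1 \<subseteq> U" using open_U open_slice[OF HB.triv_open[OF V0]] by (auto simp: V1_eq)
  \<comment> \<open>The sections of \<open>K\<close> near \<open>p\<close> that are the standard
    basis vectors in the trivialization \<open>h\<close>.\<close>
  define \<epsilon> where "\<epsilon> j q = unh h q (axis j 1)" for j q
  have eps: "\<epsilon> j \<in> sects A (zero_restrict H) V1" for j
    unfolding \<epsilon>_def by (rule sects_unh[OF V V1(1)]) (auto simp: V1_def)
  define y where "y j = (SOME x. (\<forall>k. holo_fun A V1 (x k)) \<and>
      (\<forall>q\<in>V1. \<forall>V' h. triv V' h q \<longrightarrow> h (\<epsilon> j q) = (\<Sum>k\<in>UNIV. x k q *s h (\<sigma> k q))))" for j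
  have "\<exists>x. (\<forall>k. holo_fun A V1 (x k)) \<and>
      (\<forall>q\<in>V1. \<forall>V' h. triv V' h q \<longrightarrow> h (\<epsilon> j q) = (\<Sum>k\<in>UNIV. x k q *s h (\<sigma> k q)))" for j
    by (rule frame_spans[OF V1 eps[of j]]) blast
  note yI = someI_ex[OF this, folded y_def]
  have holo_y: "holo_fun A V1 (y j l)" for j l using yI[of j] by blast
  have eps_y: "axis j 1 = (\<Sum>k\<in>UNIV. y j k q *s h (\<sigma> k q))" if q: "q \<in> V1" for j q
    using yI[of j, THEN conjunct2, THEN bspec, OF q, THEN spec, THEN spec, THEN mp, OF t[OF q]] unh(2)[OF t[OF q]]
    by (simp add: \<epsilon>_def)
  have span: "v = (\<Sum>l\<in>UNIV. (\<Sum>j\<in>UNIV. v $ j * y j l q) *s h (\<sigma> l q))" if q: "q \<in> V1" for q v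
  proof -
    have "v = (\<Sum>j\<in>UNIV. v $ j *s axis j 1)" by (simp add: basis_expansion)
    also have "\<dots> = (\<Sum>j\<in>UNIV. \<Sum>l\<in>UNIV. (v $ j * y j l q) *s h (\<sigma> l q))"
      by (simp add: eps_y[OF q] vec.scale_sum_right)
    also have "\<dots> = (\<Sum>l\<in>UNIV. \<Sum>j\<in>UNIV. (v $ j * y j l q) *s h (\<sigma> l q))" by (rule sum.swap)
    finally show ?thesis by (simp add: vec.scale_sum_left)
  qed
  have dual: "(\<Sum>j\<in>UNIV. h (\<sigma> k q) $ j * y j l q) = (if k = l then 1 else 0)" if q: "q \<in> V1" for q k l
  proof (rule frame_independent_eq[where x = "\<lambda>l q. \<Sum>j\<in>UNIV. h (\<sigma> k q) $ j * y j l q" and y = "\<lambda>l q. if k = l then 1 else 0", OF V1 _ _ _ q])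
    show "holo_fun A V1 (\<lambda>q. \<Sum>j\<in>UNIV. h (\<sigma> k q) $ j * y j l q)" for l
      using sectsD(2)[OF sigma V] by (intro holo_fun_sum holo_fun_mult holo_y) (simp add: V1_eq)
    show "holo_fun A V1 (\<lambda>q. if k = l then 1 else 0)" for l by simp
    fix r assume r: "r \<in> V1"
    have "(\<Sum>l\<in>UNIV. (if k = l then 1 else 0) *s h (\<sigma> l r)) = (\<Sum>l\<in>UNIV. if k = l then h (\<sigma> l r) else 0)"
      by (intro sum.cong) auto
    then have "(\<Sum>l\<in>UNIV. (\<Sum>j\<in>UNIV. h (\<sigma> k r) $ j * y j l r) *s h (\<sigma> l r)) = (\<Sum>l\<in>UNIV. (if k = l then 1 else 0) *s h (\<sigma> l r))"
      using span[OF r, of "h (\<sigma> k r)"] by simp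
    with t[OF r] show "\<exists>V' h'. triv V' h' r \<and> (\<Sum>l\<in>UNIV. (\<Sum>j\<in>UNIV. h (\<sigma> k r) $ j * y j l r) *s h' (\<sigma> l r)) =
        (\<Sum>l\<in>UNIV. (if k = l then 1 else 0) *s h' (\<sigma> l r))"
      by (intro exI conjI)
  qed
  interpret T_frame_triv A U \<phi> H nab \<zeta> mul e V0 h V1 y
    by unfold_locales (fact V0 V1_def holo_y dual span)+
  show ?thesis by (rule T_structure_closed_at) (use t0 p in \<open>simp add: V1_def HB.triv_def\<close>)
qed

text \<open>The primitive section is the one provided by \<open>higgs_induces\<close>, because the
  equation for the unit field refers to that section.\<close>

lemma primitive_frame_exists:
  assumes A: "complex_atlas A" and c: "local_coordinates A (U, \<phi>)"
    and higgs: "higgs_bundle A K C" and ind: "higgs_induces A K C mul e"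
  shows "\<exists>\<zeta>. primitive_frame A U \<phi> K C \<zeta> mul e"
proof -
  note * = ind[unfolded higgs_induces_def]
  obtain \<zeta> where z: "primitive_section A K C \<zeta>" "s_eq UNIV (C e \<zeta>) \<zeta>"
    using *[THEN conjunct2, THEN conjunct2, THEN conjunct2] by (elim exE conjE)
  have 1: "manifold_chart A U \<phi>"
    by (rule manifold_chart.intro) (use A c in \<open>simp_all add: local_coordinates_def\<close>)
  have 2: "tangent_mult A mul" "e \<in> vfs A UNIV" using * by simp_all
  have 3: "s_eq V (C (mul Y Z) s) (C Y (C Z s))"
    if "open V" "Y \<in> vfs A V" "Z \<in> vfs A V" "s \<in> sects A K V" for V Y Z s
    by (rule *[THEN conjunct2, THEN conjunct1, THEN spec, THEN mp, OF that(1), THEN bspec, OF that(2), THEN bspec, OF that(3),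
      THEN bspec, OF that(4)])
  have "primitive_frame_axioms A K C \<zeta> mul e"
    by (rule primitive_frame_axioms.intro) (fact higgs z(1) 2 3 z(2))+
  with 1 have "primitive_frame A U \<phi> K C \<zeta> mul e"
    by (rule primitive_frame.intro)
  then show ?thesis by (rule exI[of _ \<zeta>])
qed

theorem theorem6p7:
  fixes A :: "('m::{t2_space,second_countable_topology}, 'n::finite) chart set"
  assumes "complex_atlas A"
  shows "(\<forall>(K :: ('m,'k,'r::finite) vbundle) C D mul e.
            primitive_higgs_bundle A K C \<longrightarrow> good_connection A K C D \<longrightarrow>
            higgs_induces A K C mul e \<longrightarrow>
            radical_poisson_closed A mul e) \<and>
         (\<forall>(H :: (complex \<times> 'm,'h,'q::finite) vbundle) nab mul e.
            F_manifold A mul e \<longrightarrow> T_structure_over A H nab mul e \<longrightarrow>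
            radical_poisson_closed A mul e)"
proof (intro conjI allI impI)
  fix K :: "('m, 'k, 'r) vbundle" and C D mul e
  assume K: "primitive_higgs_bundle A K C" "good_connection A K C D" "higgs_induces A K C mul e"
  show "radical_poisson_closed A mul e"
    unfolding radical_poisson_closed_def
  proof (intro allI impI ballI)
    fix c W f g
    assume c: "local_coordinates A c" and W: "open W" "W \<subseteq> cotangent c"
      and fg: "f \<in> radical_sheaf (spec_ideal c mul e) W" "g \<in> radical_sheaf (spec_ideal c mul e) W"
    obtain U \<phi> where c_eq: "c = (U, \<phi>)" by fastforce
    from primitive_frame_exists[OF assms c[unfolded c_eq] K(1)[unfolded primitive_higgs_bundle_def, THEN conjunct1] K(3)]
    obtain \<zeta> where "primitive_frame A U \<phi> K C \<zeta> mul e" by (elim exE)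
    then interpret primitive_frame A U \<phi> K C \<zeta> mul e .
    show "poisson f g \<in> radical_sheaf (spec_ideal c mul e) W"
      unfolding c_eq by (rule radical_closed_in_chart[OF good_connection_closed[OF K(2)] W[unfolded c_eq] fg[unfolded c_eq]])
  qed
next
  fix H :: "(complex \<times> 'm, 'h, 'q) vbundle" and nab mul e
  assume "F_manifold A mul e" and "T_structure_over A H nab mul e"
  then have T: "T_structure A H nab" and K: "primitive_higgs_bundle A (zero_restrict H) (zero_higgs A H nab)"
    "higgs_induces A (zero_restrict H) (zero_higgs A H nab) mul e" by (simp_all add: T_structure_over_def)
  show "radical_poisson_closed A mul e"
    unfolding radical_poisson_closed_def
  proof (intro allI impI ballI)
    fix c W f g
    assume c: "local_coordinates A c" and W: "open W" "W \<subseteq> cotangent c"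
      and fg: "f \<in> radical_sheaf (spec_ideal c mul e) W" "g \<in> radical_sheaf (spec_ideal c mul e) W"
    obtain U \<phi> where c_eq: "c = (U, \<phi>)" by fastforce
    from primitive_frame_exists[OF assms c[unfolded c_eq] K(1)[unfolded primitive_higgs_bundle_def, THEN conjunct1] K(2)]
    obtain \<zeta> where "primitive_frame A U \<phi> (zero_restrict H) (zero_higgs A H nab) \<zeta> mul e" by (elim exE)
    then interpret T_frame A U \<phi> H nab \<zeta> mul e
      by (rule T_frame.intro) (rule T_frame_axioms.intro[OF T])
    show "poisson f g \<in> radical_sheaf (spec_ideal c mul e) W"
      unfolding c_eq by (rule radical_closed_in_chart[OF T_structure_closed W[unfolded c_eq] fg[unfolded c_eq]])
  qed
qed

end
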